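(* Let $\mathbb Q^*_W$ be a limit point of the sequence $\{\mathbb Q^{W,N}_{\mu_N}:N\ge1\}$. The measure $\mathbb Q^*_W$ is concentrated on paths $\rho(t,x)\,dx$ with the property that for all $j=1,\dots,d$ there exists a function in $L^2_{x_j\otimes W_j}([0,T]\times\mathbb T^d)$, denoted by $d\Phi/dW_j$, such that $$\int_0^Tds\int_{\mathbb T^d}dx\,(\partial_{x_j}H)(s,x)\,\Phi(\rho(s,x))=-\int_0^Tds\int_{\mathbb T^d}d(x_j\otimes W_j)(x)\,(d\Phi/dW_j)(s,x)\,H(s,x)$$ for all functions $H$ in $C^{0,1_j}([0,T]\times\mathbb T^d)$.
   Context: Let $d>1$ be an integer. For $k=1,\dots,d$ let $W_k:\mathbb R\to\mathbb R$ be strictly increasing and càdlàg, with $W_k(0)=0$ and $W_k(u+1)-W_k(u)=W_k(1)-W_k(0)$ for all $u$; $W(x)=\sum_{k=1}^dW_k(x_k)$. $\mathbb T^d=[0,1)^d$ is the torus, $\mathbb T_N^d=\{0,\dots,N-1\}^d$ the discrete torus (sums modulo $N$), $e_1,\dots,e_d$ the canonical basis. Fix $a>-1/2$, $\Phi(\alpha)=\alpha+a\alpha^2$, and for $\eta\in\{0,1\}^{\mathbb T_N^d}$, $x\in\mathbb T_N^d$ let $$c_{x,x+e_j}(\eta)=1+a\{\eta(x-e_j)+\eta(x+2e_j)\},\qquad \xi_{x,x+e_j}=\frac1{N[W_j((x_j+1)/N)-W_j(x_j/N)]},$$ $$(L_Nf)(\eta)=\sum_{j=1}^d\sum_{x\in\mathbb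 T_N^d}\xi_{x,x+e_j}\,c_{x,x+e_j}(\eta)\{f(\sigma^{x,x+e_j}\eta)-f(\eta)\},$$ where $\sigma^{x,x+e_j}\eta$ is $\eta$ with $\eta(x)$ and $\eta(x+e_j)$ exchanged. $\{\eta_t\}$ is the Markov process with generator $N^2L_N$. Fix $T>0$, a continuous $\rho_0:\mathbb T^d\to[0,1]$ and probability measures $\mu_N$ on $\{0,1\}^{\mathbb T_N^d}$ associated to $\rho_0$, i.e. for every $\delta>0$ and continuous $H:\mathbb T^d\to\mathbb R$, $\lim_N\mu_N\{|N^{-d}\sum_xH(x/N)\eta(x)-\int H\rho_0\,du|>\delta\}=0$. Let $\mathcal M$ be the space of positive measures on $\mathbb T^d$ with total mass at most one, with the weak topology; the empirical measure is $\pi^N_t=N^{-d}\sum_{x\in\mathbb T_N^d}\eta_t(x)\delta_{x/N}$. $\mathbb Q^{W,N}_{\mu_N}$ is the law of $(\pi^N_t)_{0\le t\le T}$ on the space $D([0,T],\mathcal M)$ of càdlàg trajectories, endowed with the uniform topology, when $\eta_0$ has law $\mu_N$. Limit points are limits of subsequences for weak convergence of probability measures; limit points are known to be concentrated on trajectories $\pi_t(du)=\rho(t,u)\,du$ with $0\le\rho\le1$. $C^{0,1_j}([0,T]\times\mathbb T^d)$ is the set of continuous functions with continuous partial derivative $\partial_{x_j}$ in the $j$-th spatial coordinate. $d(x_j\otimes W_j)=dx_1\cdots dx_{j-1}\,dW_j\,dx_{j+1}\cdots dx_d$ is the product of Lebesgue measure on $\mathbb T^{d-1}$ and the measure on $\mathbb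 T$ induced by $W_j$. $L^2_{x_j\otimes W_j}([0,T]\times\mathbb T^d)$ is the Hilbert space of measurable $H:[0,T]\times\mathbb T^d\to\mathbb R$ with $\int_0^Tds\int_{\mathbb T^d}d(x_j\otimes W_j)\,H(s,u)^2<\infty$. *)

theory Defs
  imports "HOL-Probability.Probability"
begin

section \<open>The torus and its function spaces\<close>

text \<open>
  The dimension \<open>d\<close> is \<open>CARD('n)\<close>, coordinates being indexed by the finite type \<open>'n\<close>.
  Points of the continuous torus are represented in the fundamental domain, whose Borel sets are
  those of the torus; continuous (differentiable) functions on the torus are continuous
  (differentiable) functions on the whole space that are 1-periodic in every coordinate.
\<close>

definition torus :: "(real ^ 'n) set" where
  "torus = {x. \<forall>k. 0 \<le> x $ k \<and> x $ k < 1}"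

definition torus_borel :: "(real ^ 'n) measure" where
  "torus_borel = restrict_space borel torus"

definition torus_lebesgue :: "(real ^ 'n) measure" where
  "torus_lebesgue = restrict_space lborel torus"

definition periodic :: "(real ^ 'n \<Rightarrow> real) \<Rightarrow> bool" where
  "periodic H \<longleftrightarrow> (\<forall>x k. H (x + axis k 1) = H x)"

definition C_torus :: "(real ^ 'n \<Rightarrow> real) set" where
  "C_torus = {H. continuous_on UNIV H \<and> periodic H}"

definition partial_deriv :: "'n \<Rightarrow> (real ^ 'n \<Rightarrow> real) \<Rightarrow> real ^ 'n \<Rightarrow> real" where
  "partial_deriv j f x = deriv (\<lambda>h. f (x + h *\<^sub>R axis j 1)) 0"

definition C01 :: "real \<Rightarrow> 'n \<Rightarrow> (real \<Rightarrow> real ^ 'n \<Rightarrow> real) set" where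
  "C01 T j = {H. (\<forall>t\<in>{0..T}. periodic (H t)) \<and>
     continuous_on ({0..T} \<times> UNIV) (\<lambda>(t, x). H t x) \<and>
     (\<forall>t\<in>{0..T}. \<forall>x. (\<lambda>h. H t (x + h *\<^sub>R axis j 1)) field_differentiable (at 0)) \<and>
     continuous_on ({0..T} \<times> UNIV) (\<lambda>(t, x). partial_deriv j (H t) x)}"

text \<open>
  The measure \<open>d(x\<^sub>j \<otimes> W\<^sub>j)\<close>. Restricting the Stieltjes measure of \<open>W\<^sub>j\<close> to \<open>[0,1)\<close> gives the
  measure induced on the circle: by periodicity of the increments a jump of \<open>W\<^sub>j\<close> at \<open>0\<close> and the
  one at \<open>1\<close> agree, and it is charged once, to the point \<open>0\<close>.
\<close>

definition xW_measure :: "('n \<Rightarrow> real \<Rightarrow> real) \<Rightarrow> 'n \<Rightarrow> (real ^ 'n) measure" where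
  "xW_measure W j =
     distr (\<Pi>\<^sub>M k\<in>UNIV. restrict_space (if k = j then interval_measure (W j) else lborel) {0..<1})
       torus_borel (\<lambda>f. \<chi> k. f k)"

definition L2_xW :: "real \<Rightarrow> ('n \<Rightarrow> real \<Rightarrow> real) \<Rightarrow> 'n \<Rightarrow> (real \<Rightarrow> real ^ 'n \<Rightarrow> real) set" where
  "L2_xW T W j =
     {g. (\<lambda>(s, x). g s x) \<in> borel_measurable (restrict_space lborel {0..T} \<Otimes>\<^sub>M xW_measure W j) \<and>
         integrable (restrict_space lborel {0..T} \<Otimes>\<^sub>M xW_measure W j) (\<lambda>(s, x). (g s x)\<^sup>2)}"


section \<open>Cadlag functions and the space of trajectories\<close>

text \<open>At an endpoint of \<open>I\<close> the missing one-sided limit is vacuous (trivial filter).\<close>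

definition cadlag_on :: "real set \<Rightarrow> 'a topology \<Rightarrow> (real \<Rightarrow> 'a) \<Rightarrow> bool" where
  "cadlag_on I X f \<longleftrightarrow>
     (\<forall>t\<in>I. limitin X f (f t) (at t within (I \<inter> {t<..})) \<and>
            (\<exists>l. limitin X f l (at t within (I \<inter> {..<t}))))"

text \<open>
  The space \<open>\<M>\<close> of measures on the torus of total mass at most one is
  \<open>space (subprob_algebra torus_borel)\<close>. Its weak topology is the coarsest one making all
  \<open>\<mu> \<mapsto> \<integral> H d\<mu>\<close>, \<open>H\<close> continuous on the torus, continuous. It is compact metrizable, and its Borel
  \<open>\<sigma>\<close>-algebra is that of \<^const>\<open>subprob_algebra\<close>.
\<close>

definition weak_topology :: "(real ^ 'n) measure topology" where
  "weak_topology =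
     pullback_topology (space (subprob_algebra torus_borel))
       (\<lambda>\<mu>. \<lambda>H\<in>C_torus. \<integral>u. H u \<partial>\<mu>) (product_topology (\<lambda>_. euclideanreal) C_torus)"

definition D_space :: "real \<Rightarrow> (real \<Rightarrow> (real ^ 'n) measure) set" where
  "D_space T = {\<pi> \<in> extensional {0..T}. cadlag_on {0..T} weak_topology \<pi>}"

text \<open>
  The topology of uniform convergence on \<open>D([0,T], \<M>)\<close>. As \<open>\<M>\<close> is compact, it has a unique
  compatible uniformity, generated by the pseudometrics \<open>\<bar>\<integral> H d\<mu> - \<integral> H d\<nu>\<bar>\<close>; hence no choice of a metric
  on \<open>\<M>\<close> is involved.
\<close>

definition uniform_nbhd ::
  "real \<Rightarrow> (real ^ 'n \<Rightarrow> real) set \<Rightarrow> real \<Rightarrow> (real \<Rightarrow> (real ^ 'n) measure) \<Rightarrow> (real \<Rightarrow> (real ^ 'n) measure) set"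
  where
  "uniform_nbhd T \<H> \<epsilon> \<pi> =
     {\<pi>' \<in> D_space T. \<forall>H\<in>\<H>. \<forall>t\<in>{0..T}. \<bar>(\<integral>u. H u \<partial>\<pi>' t) - (\<integral>u. H u \<partial>\<pi> t)\<bar> < \<epsilon>}"

definition uniform_topology :: "real \<Rightarrow> (real \<Rightarrow> (real ^ 'n) measure) topology" where
  "uniform_topology T =
     topology (\<lambda>U. U \<subseteq> D_space T \<and>
       (\<forall>\<pi>\<in>U. \<exists>\<H> \<epsilon>. finite \<H> \<and> \<H> \<subseteq> C_torus \<and> 0 < \<epsilon> \<and> uniform_nbhd T \<H> \<epsilon> \<pi> \<subseteq> U))"

lemma topspace_weak_topology: "topspace weak_topology = space (subprob_algebra torus_borel)"
  by (auto simp: weak_topology_def topspace_pullback_topology)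

lemma openin_uniform_topology:
  "openin (uniform_topology T) U \<longleftrightarrow> U \<subseteq> D_space T \<and>
     (\<forall>\<pi>\<in>U. \<exists>\<H> \<epsilon>. finite \<H> \<and> \<H> \<subseteq> C_torus \<and> 0 < \<epsilon> \<and> uniform_nbhd T \<H> \<epsilon> \<pi> \<subseteq> U)"
proof -
  let ?O = "\<lambda>U. U \<subseteq> D_space T \<and>
     (\<forall>\<pi>\<in>U. \<exists>\<H> \<epsilon>. finite \<H> \<and> \<H> \<subseteq> C_torus \<and> 0 < \<epsilon> \<and> uniform_nbhd T \<H> \<epsilon> \<pi> \<subseteq> U)"
  have "?O (S \<inter> S')" if S: "?O S" and S': "?O S'" for S S'
  proof (intro conjI ballI)
    show "S \<inter> S' \<subseteq> D_space T" using S by auto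
    fix \<pi> assume "\<pi> \<in> S \<inter> S'"
    with S S' obtain A e B e' where
      A: "finite A" "A \<subseteq> C_torus" "0 < e" "uniform_nbhd T A e \<pi> \<subseteq> S" and
      B: "finite B" "B \<subseteq> C_torus" "0 < e'" "uniform_nbhd T B e' \<pi> \<subseteq> S'"
      by (meson IntD1 IntD2)
    have "uniform_nbhd T (A \<union> B) (min e e') \<pi> \<subseteq> S \<inter> S'"
      using A(4) B(4) unfolding uniform_nbhd_def by fastforce
    then show "\<exists>\<H> \<epsilon>. finite \<H> \<and> \<H> \<subseteq> C_torus \<and> 0 < \<epsilon> \<and> uniform_nbhd T \<H> \<epsilon> \<pi> \<subseteq> S \<inter> S'"
      using A B by (intro exI[of _ "A \<union> B"] exI[of _ "min e e'"]) auto
  qed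
  moreover have "?O (\<Union>K)" if "\<forall>S\<in>K. ?O S" for K
  proof (intro conjI ballI)
    show "\<Union>K \<subseteq> D_space T" using that by auto
    fix \<pi> assume "\<pi> \<in> \<Union>K"
    then obtain S where "S \<in> K" "\<pi> \<in> S" by auto
    with that show "\<exists>\<H> \<epsilon>. finite \<H> \<and> \<H> \<subseteq> C_torus \<and> 0 < \<epsilon> \<and> uniform_nbhd T \<H> \<epsilon> \<pi> \<subseteq> \<Union>K"
      by (meson Sup_upper order_trans)
  qed
  ultimately have "istopology ?O"
    unfolding istopology_def by blast
  then show ?thesis
    unfolding uniform_topology_def by (rule fun_cong[OF topology_inverse'])
qed

text \<open>
  \<open>D([0,T], \<M>)\<close> carries the \<open>\<sigma>\<close>-algebra generated by the evaluations \<open>\<pi> \<mapsto> \<pi>\<^sub>t\<close>. The uniform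
  topology is not separable, and a random trajectory with a jump at a diffusely distributed time need
  not be measurable for its full Borel \<open>\<sigma>\<close>-algebra.
\<close>

definition path_space :: "real \<Rightarrow> (real \<Rightarrow> (real ^ 'n) measure) measure" where
  "path_space T = restrict_space (\<Pi>\<^sub>M t\<in>{0..T}. subprob_algebra torus_borel) (D_space T)"

text \<open>
  Weak convergence with respect to the uniform topology, for probability measures on
  \<^const>\<open>path_space\<close>: test functions are the bounded measurable functionals that are continuous in the
  uniform topology.
\<close>

definition weakly_converges ::
  "real \<Rightarrow> (nat \<Rightarrow> (real \<Rightarrow> (real ^ 'n) measure) measure) \<Rightarrow> (real \<Rightarrow> (real ^ 'n) measure) measure \<Rightarrow> bool"
  where
  "weakly_converges T Q Q' \<longleftrightarrow>
     (\<forall>F. continuous_map (uniform_topology T) euclideanreal F \<and>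
          F \<in> borel_measurable (path_space T) \<and> bounded (F ` D_space T) \<longrightarrow>
          (\<lambda>n. \<integral>\<pi>. F \<pi> \<partial>Q n) \<longlonglongrightarrow> (\<integral>\<pi>. F \<pi> \<partial>Q'))"

definition limit_point ::
  "real \<Rightarrow> (nat \<Rightarrow> (real \<Rightarrow> (real ^ 'n) measure) measure) \<Rightarrow> (real \<Rightarrow> (real ^ 'n) measure) measure \<Rightarrow> bool"
  where
  "limit_point T Q Q' \<longleftrightarrow>
     prob_space Q' \<and> sets Q' = sets (path_space T) \<and>
     (\<exists>r. strict_mono r \<and> weakly_converges T (\<lambda>n. Q (r n)) Q')"


section \<open>Markov processes on a finite state space\<close>

text \<open>The semigroup \<open>exp (t G)\<close>, given by its power series.\<close>

definition semigroup_of :: "(('s \<Rightarrow> real) \<Rightarrow> 's \<Rightarrow> real) \<Rightarrow> real \<Rightarrow> ('s \<Rightarrow> real) \<Rightarrow> 's \<Rightarrow> real" where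
  "semigroup_of G t f \<eta> = (\<Sum>k. t ^ k / fact k * (G ^^ k) f \<eta>)"

definition natural_filtration ::
  "'w measure \<Rightarrow> 's set \<Rightarrow> (real \<Rightarrow> 'w \<Rightarrow> 's) \<Rightarrow> real \<Rightarrow> 'w measure" where
  "natural_filtration \<Omega> S X s =
     sigma (space \<Omega>) {X r -` A \<inter> space \<Omega> | r A. 0 \<le> r \<and> r \<le> s \<and> A \<subseteq> S}"

text \<open>\<open>X\<close>, defined on \<open>\<Omega>\<close>, is a Markov process on the finite set \<open>S\<close> with generator \<open>G\<close> and initial law \<open>\<mu>\<close>.\<close>

definition markov_process ::
  "'s set \<Rightarrow> (('s \<Rightarrow> real) \<Rightarrow> 's \<Rightarrow> real) \<Rightarrow> 's measure \<Rightarrow> 'w measure \<Rightarrow> (real \<Rightarrow> 'w \<Rightarrow> 's) \<Rightarrow> bool" where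
  "markov_process S G \<mu> \<Omega> X \<longleftrightarrow>
     prob_space \<Omega> \<and>
     (\<forall>t\<ge>0. X t \<in> \<Omega> \<rightarrow>\<^sub>M count_space S) \<and>
     (\<forall>\<omega>\<in>space \<Omega>. cadlag_on {0..} (discrete_topology S) (\<lambda>t. X t \<omega>)) \<and>
     distr \<Omega> (count_space S) (X 0) = \<mu> \<and>
     (\<forall>f s t. 0 \<le> s \<and> s \<le> t \<longrightarrow>
        (AE \<omega> in \<Omega>. real_cond_exp \<Omega> (natural_filtration \<Omega> S X s) (\<lambda>\<omega>. f (X t \<omega>)) \<omega> =
                    semigroup_of G (t - s) f (X s \<omega>)))"


section \<open>The exclusion process\<close>

type_synonym 'n site = "'n \<Rightarrow> nat"
type_synonym 'n config = "'n site \<Rightarrow> nat"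

definition sites :: "nat \<Rightarrow> 'n site set" where
  "sites N = {x. \<forall>k. x k < N}"

definition configs :: "nat \<Rightarrow> 'n config set" where
  "configs N = sites N \<rightarrow>\<^sub>E {0, 1}"

text \<open>The site \<open>x + m e\<^sub>j\<close>, with addition modulo \<open>N\<close>.\<close>

definition shift :: "nat \<Rightarrow> 'n \<Rightarrow> int \<Rightarrow> 'n site \<Rightarrow> 'n site" where
  "shift N j m x = x(j := nat ((int (x j) + m) mod int N))"

definition exchange :: "'n site \<Rightarrow> 'n site \<Rightarrow> 'n config \<Rightarrow> 'n config" where
  "exchange x y \<eta> = \<eta>(x := \<eta> y, y := \<eta> x)"

definition rate_c :: "real \<Rightarrow> nat \<Rightarrow> 'n \<Rightarrow> 'n site \<Rightarrow> 'n config \<Rightarrow> real" where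
  "rate_c a N j x \<eta> = 1 + a * (real (\<eta> (shift N j (- 1) x)) + real (\<eta> (shift N j 2 x)))"

definition conductance :: "('n \<Rightarrow> real \<Rightarrow> real) \<Rightarrow> nat \<Rightarrow> 'n \<Rightarrow> 'n site \<Rightarrow> real" where
  "conductance W N j x =
     1 / (real N * (W j ((real (x j) + 1) / real N) - W j (real (x j) / real N)))"

definition generator ::
  "('n::finite \<Rightarrow> real \<Rightarrow> real) \<Rightarrow> real \<Rightarrow> nat \<Rightarrow> ('n config \<Rightarrow> real) \<Rightarrow> 'n config \<Rightarrow> real" where
  "generator W a N f \<eta> =
     (\<Sum>j\<in>UNIV. \<Sum>x\<in>sites N. conductance W N j x * rate_c a N j x \<eta> *
        (f (exchange x (shift N j 1 x) \<eta>) - f \<eta>))"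

definition \<Phi> :: "real \<Rightarrow> real \<Rightarrow> real" where
  "\<Phi> a \<alpha> = \<alpha> + a * \<alpha>\<^sup>2"

definition scaled_site :: "nat \<Rightarrow> 'n site \<Rightarrow> real ^ 'n" where
  "scaled_site N x = (\<chi> k. real (x k) / real N)"

definition associated_to :: "(nat \<Rightarrow> 'n config measure) \<Rightarrow> (real ^ 'n::finite \<Rightarrow> real) \<Rightarrow> bool" where
  "associated_to \<mu> \<rho>\<^sub>0 \<longleftrightarrow>
     (\<forall>\<delta>>0. \<forall>H\<in>C_torus.
        (\<lambda>N. measure (\<mu> N) {\<eta> \<in> configs N.
           \<bar>(\<Sum>x\<in>sites N. H (scaled_site N x) * real (\<eta> x)) / real N ^ CARD('n)
             - (\<integral>u. H u * \<rho>\<^sub>0 u \<partial>torus_lebesgue)\<bar> > \<delta>}) \<longlonglongrightarrow> 0)"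

definition empirical_measure :: "nat \<Rightarrow> 'n::finite config \<Rightarrow> (real ^ 'n) measure" where
  "empirical_measure N \<eta> =
     distr (point_measure (sites N) (\<lambda>x. ennreal (real (\<eta> x) / real N ^ CARD('n))))
       torus_borel (scaled_site N)"

text \<open>The law \<open>\<Q>\<close> of \<open>(\<pi>\<^sup>N\<^sub>t)\<close>, \<open>0 \<le> t \<le> T\<close>, when \<open>\<eta>\<close> is the exclusion process on \<open>\<Omega>\<close>.\<close>

definition empirical_law ::
  "real \<Rightarrow> nat \<Rightarrow> 'w measure \<Rightarrow> (real \<Rightarrow> 'w \<Rightarrow> 'n::finite config) \<Rightarrow> (real \<Rightarrow> (real ^ 'n) measure) measure" where
  "empirical_law T N \<Omega> \<eta> =
     distr \<Omega> (path_space T) (\<lambda>\<omega>. \<lambda>t\<in>{0..T}. empirical_measure N (\<eta> t \<omega>))"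

lemma finite_sites: "finite (sites N :: 'n::finite site set)"
proof -
  have "sites N = (UNIV::'n set) \<rightarrow>\<^sub>E {..<N}"
    by (auto simp: sites_def PiE_def)
  then show ?thesis
    by (simp add: finite_PiE)
qed

lemma card_sites: "card (sites N :: 'n::finite site set) = N ^ CARD('n)"
proof -
  have "sites N = (UNIV::'n set) \<rightarrow>\<^sub>E {..<N}"
    by (auto simp: sites_def PiE_def)
  then show ?thesis
    by (simp add: card_PiE)
qed

lemma empirical_measure_in_subprob:
  assumes "N \<ge> 1" "\<eta> \<in> configs N"
  shows "empirical_measure N \<eta> \<in> space (subprob_algebra (torus_borel :: (real ^ 'n::finite) measure))"
proof -
  let ?p = "point_measure (sites N :: 'n site set) (\<lambda>x. ennreal (real (\<eta> x) / real N ^ CARD('n)))"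
  have m: "scaled_site N \<in> ?p \<rightarrow>\<^sub>M torus_borel"
    using assms(1)
    by (auto simp: point_measure_def scaled_site_def torus_borel_def space_restrict_space torus_def sites_def)
  have v: "\<eta> x \<le> 1" if "x \<in> sites N" for x
  proof -
    have "\<eta> x \<in> {0, 1}"
      using PiE_mem[of \<eta> "sites N" "\<lambda>_. {0,1}" x] assms(2) that by (simp add: configs_def)
    then show ?thesis by auto
  qed
  have "emeasure ?p (sites N) = (\<Sum>x\<in>sites N. ennreal (real (\<eta> x) / real N ^ CARD('n)))"
    by (rule emeasure_point_measure_finite) (auto simp: finite_sites)
  also have "\<dots> \<le> (\<Sum>x\<in>(sites N :: 'n site set). ennreal (1 / real N ^ CARD('n)))"
    by (intro sum_mono ennreal_leI divide_right_mono) (use v in auto)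
  also have "\<dots> = 1"
    using assms(1) by (simp add: card_sites ennreal_of_nat_eq_real_of_nat flip: ennreal_mult ennreal_1)
  finally have e: "emeasure ?p (sites N) \<le> 1" .
  have "subprob_space (empirical_measure N \<eta>)"
  proof (rule subprob_spaceI)
    have "scaled_site N -` space torus_borel \<inter> sites N = (sites N :: 'n site set)"
      using measurable_space[OF m] by (auto simp: space_point_measure)
    then show "emeasure (empirical_measure N \<eta>) (space (empirical_measure N \<eta>)) \<le> 1"
      using e by (simp add: empirical_measure_def emeasure_distr[OF m] space_point_measure)
    show "space (empirical_measure N \<eta>) \<noteq> {}"
      by (auto simp: empirical_measure_def torus_borel_def space_restrict_space torus_def
          intro!: exI[of _ 0])
  qed
  then show ?thesis
    by (simp add: space_subprob_algebra empirical_measure_def)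
qed

lemma empirical_trajectory_measurable:
  fixes \<eta> :: "real \<Rightarrow> 'w \<Rightarrow> 'n::finite config"
  assumes N: "N \<ge> 1" and mp: "markov_process (configs N) G \<mu> \<Omega> \<eta>"
  shows "(\<lambda>\<omega>. \<lambda>t\<in>{0..T}. empirical_measure N (\<eta> t \<omega>)) \<in> \<Omega> \<rightarrow>\<^sub>M path_space T"
  unfolding path_space_def
proof (rule measurable_restrict_space2)
  have meas: "\<And>t. 0 \<le> t \<Longrightarrow> \<eta> t \<in> \<Omega> \<rightarrow>\<^sub>M count_space (configs N)"
    and cad: "\<And>\<omega>. \<omega> \<in> space \<Omega> \<Longrightarrow> cadlag_on {0..} (discrete_topology (configs N)) (\<lambda>t. \<eta> t \<omega>)"
    using mp by (auto simp: markov_process_def)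
  show "(\<lambda>\<omega>. \<lambda>t\<in>{0..T}. empirical_measure N (\<eta> t \<omega>)) \<in> \<Omega> \<rightarrow>\<^sub>M (\<Pi>\<^sub>M t\<in>{0..T}. subprob_algebra torus_borel)"
  proof (rule measurable_restrict)
    fix t assume "t \<in> {0..T}"
    then have "\<eta> t \<in> \<Omega> \<rightarrow>\<^sub>M count_space (configs N)" using meas by auto
    moreover have "empirical_measure N \<in> count_space (configs N) \<rightarrow>\<^sub>M subprob_algebra (torus_borel :: (real ^ 'n) measure)"
      using empirical_measure_in_subprob[OF N] by auto
    ultimately show "(\<lambda>\<omega>. empirical_measure N (\<eta> t \<omega>)) \<in> \<Omega> \<rightarrow>\<^sub>M subprob_algebra torus_borel"
      by (rule measurable_compose)
  qed
  show "(\<lambda>\<omega>. \<lambda>t\<in>{0..T}. empirical_measure N (\<eta> t \<omega>)) \<in> space \<Omega> \<rightarrow> D_space T"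
  proof
    fix \<omega> assume \<omega>: "\<omega> \<in> space \<Omega>"
    let ?p = "\<lambda>t\<in>{0..T}. empirical_measure N (\<eta> t \<omega>)"
    have lim: "limitin weak_topology ?p (empirical_measure N l) (at t within ({0..T} \<inter> S))"
      if "limitin (discrete_topology (configs N)) (\<lambda>t. \<eta> t \<omega>) l (at t within ({0..} \<inter> S))" for l t S
    proof -
      have l: "l \<in> configs N" "\<forall>\<^sub>F s in at t within ({0..} \<inter> S). \<eta> s \<omega> \<in> {l}"
        using that by (auto simp: limitin_def)
      have "\<forall>\<^sub>F s in at t within ({0..T} \<inter> S). \<eta> s \<omega> \<in> {l}"
        by (rule filter_leD[OF _ l(2)]) (auto intro: at_le)
      moreover have "\<forall>\<^sub>F s in at t within ({0..T} \<inter> S). s \<in> {0..T}"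
        by (auto simp: eventually_at_filter)
      ultimately have ev: "\<forall>\<^sub>F s in at t within ({0..T} \<inter> S). ?p s = empirical_measure N l"
        by eventually_elim auto
      show ?thesis
        unfolding limitin_def
      proof (intro conjI allI impI)
        show "empirical_measure N l \<in> topspace weak_topology"
          using empirical_measure_in_subprob[OF N l(1)] by (simp add: topspace_weak_topology)
        fix U assume "openin weak_topology U \<and> empirical_measure N l \<in> U"
        then show "\<forall>\<^sub>F s in at t within ({0..T} \<inter> S). ?p s \<in> U"
          using ev by (auto elim: eventually_mono)
      qed
    qed
    have "cadlag_on {0..T} weak_topology ?p"
      unfolding cadlag_on_def
    proof (intro ballI conjI)
      fix t assume t: "t \<in> {0..T}"
      then have c: "limitin (discrete_topology (configs N)) (\<lambda>t. \<eta> t \<omega>) (\<eta> t \<omega>) (at t within ({0..} \<inter> {t<..}))"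
        "\<exists>l. limitin (discrete_topology (configs N)) (\<lambda>t. \<eta> t \<omega>) l (at t within ({0..} \<inter> {..<t}))"
        using cad[OF \<omega>] by (auto simp: cadlag_on_def)
      show "limitin weak_topology ?p (?p t) (at t within ({0..T} \<inter> {t<..}))"
        using lim[OF c(1)] t by simp
      show "\<exists>l. limitin weak_topology ?p l (at t within ({0..T} \<inter> {..<t}))"
        using lim c(2) by blast
    qed
    then show "?p \<in> D_space T"
      by (simp add: D_space_def)
  qed
qed

end

theory Submission
imports Defs
begin

text \<open>On [0,1] the function \<Phi> is Lipschitz with constant 1 + 2|a|, so the increments of
  \<Phi>(\<rho>) are dominated by those of \<rho>. The existence of the derivative of \<Phi>(\<rho>) with
  respect to W_j therefore follows from an estimate on \<rho> alone, and \<rho>, unlike \<Phi>(\<rho>), is a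
  linear function of the empirical measure: no local function of the configuration has to be replaced by a
  function of the density.

  The estimate concerns the energy E_\<epsilon>(\<rho>) = \<integral>ds\<integral>dx
  (\<rho>(s,x+\<epsilon>e_j) - \<rho>(s,x))^2 / (\<epsilon> (W_j(x_j+2\<epsilon>) - W_j(x_j)))
  (density_energy). Suppose that it stays bounded along a sequence \<epsilon> \<rightarrow> 0. For a test
  function H the integral of \<partial>_jH \<Phi>(\<rho>) is the limit of the integrals of H(x)
  (\<Phi>(\<rho>(x)) - \<Phi>(\<rho>(x+\<epsilon>e_j))) / \<epsilon> (difference_quotient_limit), and
  Young's inequality bounds these by a multiple of E_\<epsilon>(\<rho>) plus the integral of H^2
  (W_j(x_j+2\<epsilon>) - W_j(x_j)) / \<epsilon>, with constants that do not depend on \<epsilon>. Since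
  W_j(t+h) - W_j(t) is the mass of (t,t+h], Fubini's theorem compares the last integral with the square of
  the norm of H in L^2(x_j\<otimes>W_j) (stieltjes_increment_integral, weighted_torus_integral_bound). The
  resulting inequality 2L(H) \<le> C + \<parallel>H\<parallel>^2 for the linear functional L(H) =
  \<integral>\<partial>_jH \<Phi>(\<rho>) (weak_form_bound) is a form of continuity, and the Riesz
  representation produces the derivative (riesz_representation, weak_derivative_exists).

  The energy is bounded because the uniform measure on configurations is reversible. The entropy of the law
  of the process is at most of order N^d, so that the Dirichlet form accumulated up to time T is of order
  N^(d-2) (entropy_production, directional_energy_bound). Let G be the average, over the sites y in a small
  box, of \<eta>(y+le_j) - \<eta>(y), with l of order \<epsilon>N. In the expectation of G^2 one factor G is
  written as a sum of gradients over single bonds; the exchange across a bond reverses the sign of its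
  gradient and hardly changes G, so that each term is controlled by the Dirichlet form of the bond
  (bond_estimate). If the Young parameter of each bond is chosen proportional to its resistance, the
  resistances along the segment add up to N (W_j(y_j+l/N) - W_j(y_j)), which is where the weight in
  E_\<epsilon> comes from (gradient_average_estimate, microscopic_energy). The error terms are of order l
  N^(-d) and vanish because d > 1.

  At a fixed time s the square of a mollified increment of \<pi>_s is a continuous bounded function of the
  trajectory, so its expectation converges along the subsequence, and Fatou's lemma transfers the bound to
  the limit point, first for mollified boxes (limit_energy_smooth), then for boxes (limit_energy_average),
  then for the density, by Lebesgue's differentiation theorem; the constant does not depend on \<epsilon>,
  so a last application of Fatou's lemma shows that almost surely the energies are bounded along a sequence
  \<epsilon> \<rightarrow> 0 (limit_density_energy). That \<pi>_s has a density with values in [0,1] comes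
  from the exclusion rule: a box contains at most as many particles as sites (limit_box_bounded,
  box_bounded_density).\<close>

section \<open>Entropy production of reversible dynamics\<close>

text \<open>The function ln t - 2(t-1)/(t+1) vanishes at t = 1 and has derivative (t-1)^2/(t(t+1)^2). This
  comparison of the logarithmic with the arithmetic mean replaces the logarithm in the entropy production by
  a rational expression that is quadratic in the difference.\<close>

lemma log_mean_bound:
  fixes x y :: real assumes "x > 0" "y > 0"
  shows "2 * (x - y)^2 / (x + y) \<le> (x - y) * (ln x - ln y)"
proof -
  have main: "2 * (x - y)^2 / (x + y) \<le> (x - y) * (ln x - ln y)" if "x \<ge> y" "y > 0" for x y :: real
  proof -
    \<comment> \<open>By homogeneity the inequality depends on the ratio x/y only.\<close>
    define f where "f t = ln t - 2 * (t - 1) / (t + 1)" for t :: real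
    have "f 1 \<le> f (x/y)"
    proof (rule DERIV_nonneg_imp_nondecreasing[of 1 "x/y" f])
      show "1 \<le> x / y" using that by simp
      fix t :: real assume t: "1 \<le> t" "t \<le> x/y"
      have "(f has_real_derivative (1/t - (2 * (t + 1) - 2 * (t - 1)) / ((t + 1) * (t + 1)))) (at t)"
        unfolding f_def using t by (auto intro!: derivative_eq_intros)
      also have "1/t - (2 * (t + 1) - 2 * (t - 1)) / ((t + 1) * (t + 1)) = 1/t - 4/(t+1)^2"
        by (simp add: power2_eq_square)
      finally have "(f has_real_derivative (1/t - 4/(t+1)^2)) (at t)" .
      moreover have "1/t - 4/(t+1)^2 = (t-1)^2/(t*(t+1)^2)"
        using t by (simp add: divide_simps power2_eq_square) (simp add: algebra_simps)
      ultimately show "\<exists>z. (f has_real_derivative z) (at t) \<and> z \<ge> 0"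
        using t by (intro exI[of _ "(t-1)^2/(t*(t+1)^2)"]) auto
    qed
    then have "2 * (x/y - 1) / (x/y + 1) \<le> ln (x/y)" by (simp add: f_def)
    also have "ln (x/y) = ln x - ln y" using that by (simp add: ln_div)
    also have "2 * (x/y - 1) / (x/y + 1) = 2 * (x - y)/(x+y)"
      using that by (simp add: divide_simps)
    finally have "(x - y) * (2 * (x - y)/(x+y)) \<le> (x - y) * (ln x - ln y)"
      using that by (intro mult_left_mono) auto
    then show ?thesis by (simp add: power2_eq_square mult.assoc mult.left_commute)
  qed
  show ?thesis
  proof (cases "x \<ge> y")
    case True then show ?thesis using main assms by auto
  next
    case False
    then have "2 * (y - x)^2 / (y + x) \<le> (y - x) * (ln y - ln x)" using main[of x y] assms by auto
    then show ?thesis by (simp add: power2_commute add.commute algebra_simps)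
  qed
qed

text \<open>Each move is an involution whose rate is the same before and after it. This symmetry makes the
  counting measure reversible.\<close>

locale reversible_dynamics =
  fixes S :: "'s set" and I :: "'b set" and \<sigma> :: "'b \<Rightarrow> 's \<Rightarrow> 's" and r :: "'b \<Rightarrow> 's \<Rightarrow> real"
    and G :: "('s \<Rightarrow> real) \<Rightarrow> 's \<Rightarrow> real"
  assumes finS: "finite S" and neS: "S \<noteq> {}" and finI: "finite I"
    and maps: "b \<in> I \<Longrightarrow> \<eta> \<in> S \<Longrightarrow> \<sigma> b \<eta> \<in> S"
    and invol: "b \<in> I \<Longrightarrow> \<eta> \<in> S \<Longrightarrow> \<sigma> b (\<sigma> b \<eta>) = \<eta>"
    and rate_nonneg: "b \<in> I \<Longrightarrow> \<eta> \<in> S \<Longrightarrow> 0 \<le> r b \<eta>"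
    and rate_inv: "b \<in> I \<Longrightarrow> \<eta> \<in> S \<Longrightarrow> r b (\<sigma> b \<eta>) = r b \<eta>"
    and gen: "\<eta> \<in> S \<Longrightarrow> G f \<eta> = (\<Sum>b\<in>I. r b \<eta> * (f (\<sigma> b \<eta>) - f \<eta>))"
begin

lemma sum_move: "b \<in> I \<Longrightarrow> (\<Sum>\<eta>\<in>S. F (\<sigma> b \<eta>)) = (\<Sum>\<eta>\<in>S. F \<eta>)"
  by (rule sum.reindex_bij_witness[where i = "\<sigma> b" and j = "\<sigma> b"]) (auto simp: maps invol)

text \<open>Substituting \<sigma> b \<eta> for \<eta> keeps the rate and reverses the sign of the difference
  of f; the identity is the mean of the sum and of its image under this substitution.\<close>

lemma dirichlet_form:
  "(\<Sum>\<eta>\<in>S. g \<eta> * G f \<eta>) =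
     - (1/2) * (\<Sum>b\<in>I. \<Sum>\<eta>\<in>S. r b \<eta> * (g (\<sigma> b \<eta>) - g \<eta>) * (f (\<sigma> b \<eta>) - f \<eta>))"
proof -
  have 1: "(\<Sum>\<eta>\<in>S. g \<eta> * (r b \<eta> * (f (\<sigma> b \<eta>) - f \<eta>))) =
     - (1/2) * (\<Sum>\<eta>\<in>S. r b \<eta> * (g (\<sigma> b \<eta>) - g \<eta>) * (f (\<sigma> b \<eta>) - f \<eta>))" if b: "b \<in> I" for b
  proof -
    have "(\<Sum>\<eta>\<in>S. g \<eta> * (r b \<eta> * (f (\<sigma> b \<eta>) - f \<eta>))) =
      (\<Sum>\<eta>\<in>S. g (\<sigma> b \<eta>) * (r b (\<sigma> b \<eta>) * (f (\<sigma> b (\<sigma> b \<eta>)) - f (\<sigma> b \<eta>))))"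
      by (rule sum_move[OF b, symmetric])
    also have "\<dots> = (\<Sum>\<eta>\<in>S. - (g (\<sigma> b \<eta>) * (r b \<eta> * (f (\<sigma> b \<eta>) - f \<eta>))))"
      by (intro sum.cong) (auto simp: b rate_inv invol algebra_simps)
    finally have "2 * (\<Sum>\<eta>\<in>S. g \<eta> * (r b \<eta> * (f (\<sigma> b \<eta>) - f \<eta>))) =
      (\<Sum>\<eta>\<in>S. g \<eta> * (r b \<eta> * (f (\<sigma> b \<eta>) - f \<eta>))) + (\<Sum>\<eta>\<in>S. - (g (\<sigma> b \<eta>) * (r b \<eta> * (f (\<sigma> b \<eta>) - f \<eta>))))"
      by simp
    also have "\<dots> = - (\<Sum>\<eta>\<in>S. r b \<eta> * (g (\<sigma> b \<eta>) - g \<eta>) * (f (\<sigma> b \<eta>) - f \<eta>))"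
      by (simp add: sum.distrib[symmetric] sum_negf[symmetric] del: sum_negf) (intro sum.cong, auto simp: algebra_simps)
    finally show ?thesis by simp
  qed
  have "(\<Sum>\<eta>\<in>S. g \<eta> * G f \<eta>) = (\<Sum>\<eta>\<in>S. \<Sum>b\<in>I. g \<eta> * (r b \<eta> * (f (\<sigma> b \<eta>) - f \<eta>)))"
    by (intro sum.cong) (auto simp: gen sum_distrib_left)
  also have "\<dots> = (\<Sum>b\<in>I. \<Sum>\<eta>\<in>S. g \<eta> * (r b \<eta> * (f (\<sigma> b \<eta>) - f \<eta>)))"
    by (rule sum.swap)
  also have "\<dots> = (\<Sum>b\<in>I. - (1/2) * (\<Sum>\<eta>\<in>S. r b \<eta> * (g (\<sigma> b \<eta>) - g \<eta>) * (f (\<sigma> b \<eta>) - f \<eta>)))"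
    by (intro sum.cong 1) auto
  finally show ?thesis by (simp only: sum_distrib_left)
qed

lemma generator_symmetric: "(\<Sum>\<eta>\<in>S. g \<eta> * G f \<eta>) = (\<Sum>\<eta>\<in>S. f \<eta> * G g \<eta>)"
  unfolding dirichlet_form by (simp add: mult.commute mult.left_commute)

text \<open>On a finite state space the generator is a bounded operator for the maximum norm, so its
  exponential series converges for every time.\<close>

lemma generator_power_bound:
  obtains C where "C \<ge> 0" "\<And>f B k \<eta>. (\<And>\<zeta>. \<zeta> \<in> S \<Longrightarrow> \<bar>f \<zeta>\<bar> \<le> B) \<Longrightarrow> \<eta> \<in> S \<Longrightarrow> \<bar>(G ^^ k) f \<eta>\<bar> \<le> C ^ k * B"
proof -
  define C where "C = (\<Sum>\<zeta>\<in>S. \<Sum>b\<in>I. 2 * r b \<zeta>)"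
  have C0: "C \<ge> 0" unfolding C_def by (intro sum_nonneg) (auto simp: rate_nonneg)
  have 1: "\<bar>G f \<eta>\<bar> \<le> C * B" if f: "\<And>\<zeta>. \<zeta> \<in> S \<Longrightarrow> \<bar>f \<zeta>\<bar> \<le> B" and \<eta>: "\<eta> \<in> S" for f B \<eta>
  proof -
    have B: "B \<ge> 0" using f[OF \<eta>] by linarith
    have "\<bar>G f \<eta>\<bar> \<le> (\<Sum>b\<in>I. \<bar>r b \<eta> * (f (\<sigma> b \<eta>) - f \<eta>)\<bar>)"
      unfolding gen[OF \<eta>] by (rule sum_abs)
    also have "\<dots> \<le> (\<Sum>b\<in>I. 2 * r b \<eta> * B)"
    proof (rule sum_mono)
      fix b assume b: "b \<in> I"
      have "\<bar>f (\<sigma> b \<eta>) - f \<eta>\<bar> \<le> 2 * B" using f[OF \<eta>] f[OF maps[OF b \<eta>]] by linarith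
      then have "r b \<eta> * \<bar>f (\<sigma> b \<eta>) - f \<eta>\<bar> \<le> r b \<eta> * (2 * B)"
        by (intro mult_left_mono rate_nonneg b \<eta>)
      then show "\<bar>r b \<eta> * (f (\<sigma> b \<eta>) - f \<eta>)\<bar> \<le> 2 * r b \<eta> * B"
        by (simp add: abs_mult rate_nonneg b \<eta>)
    qed
    also have "\<dots> = (\<Sum>b\<in>I. 2 * r b \<eta>) * B" by (simp add: sum_distrib_right)
    also have "\<dots> \<le> C * B"
      unfolding C_def
      by (intro mult_right_mono B member_le_sum[of \<eta> S "\<lambda>\<zeta>. \<Sum>b\<in>I. 2 * r b \<zeta>"] \<eta> finS)
         (auto intro!: sum_nonneg rate_nonneg)
    finally show ?thesis .
  qed
  have "\<bar>(G ^^ k) f \<eta>\<bar> \<le> C ^ k * B" if f: "\<And>\<zeta>. \<zeta> \<in> S \<Longrightarrow> \<bar>f \<zeta>\<bar> \<le> B" and "\<eta> \<in> S" for f B k \<eta>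
    using that(2)
  proof (induction k arbitrary: \<eta>)
    case 0 then show ?case using f by simp
  next
    case (Suc k)
    show ?case using 1[of "(G ^^ k) f" "C ^ k * B", OF Suc.IH Suc.prems] by (simp add: mult.assoc)
  qed
  then show thesis using that C0 by blast
qed

text \<open>A power series in t that converges everywhere may be differentiated term by term.\<close>

lemma semigroup_derivative:
  assumes \<eta>: "\<eta> \<in> S"
  shows "((\<lambda>t. semigroup_of G t f \<eta>) has_real_derivative semigroup_of G t (G f) \<eta>) (at t)"
proof -
  obtain C where C: "C \<ge> 0" "\<And>f B k \<eta>. (\<And>\<zeta>. \<zeta> \<in> S \<Longrightarrow> \<bar>f \<zeta>\<bar> \<le> B) \<Longrightarrow> \<eta> \<in> S \<Longrightarrow> \<bar>(G ^^ k) f \<eta>\<bar> \<le> C ^ k * B"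
    using generator_power_bound by blast
  \<comment> \<open>The sum over the finite state space serves as a bound for the maximum.\<close>
  define B where "B = (\<Sum>\<zeta>\<in>S. \<bar>f \<zeta>\<bar>)"
  have B: "\<bar>f \<zeta>\<bar> \<le> B" if "\<zeta> \<in> S" for \<zeta>
    unfolding B_def by (intro member_le_sum that finS) auto
  define c where "c k = (G ^^ k) f \<eta> / fact k" for k
  have "summable (\<lambda>k. c k * y ^ k)" for y :: real
  proof (rule summable_comparison_test')
    have "summable (\<lambda>k. inverse (fact k) * (C * \<bar>y\<bar>) ^ k)" by (rule summable_exp)
    then show "summable (\<lambda>k. B * (inverse (fact k) * (C * \<bar>y\<bar>) ^ k))" by (rule summable_mult)
    fix k :: nat
    have "\<bar>(G ^^ k) f \<eta>\<bar> * \<bar>y\<bar> ^ k / fact k \<le> (C ^ k * B) * \<bar>y\<bar> ^ k / fact k"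
      by (intro divide_right_mono mult_right_mono C(2) B \<eta>) auto
    then show "norm (c k * y ^ k) \<le> B * (inverse (fact k) * (C * \<bar>y\<bar>) ^ k)"
      by (simp add: c_def abs_mult power_abs power_mult_distrib field_simps)
  qed
  then have "((\<lambda>x. \<Sum>k. c k * x ^ k) has_field_derivative (\<Sum>k. diffs c k * t ^ k)) (at t)"
    by (rule termdiffs_strong_converges_everywhere)
  moreover have "(\<lambda>x. \<Sum>k. c k * x ^ k) = (\<lambda>t. semigroup_of G t f \<eta>)"
    by (simp add: semigroup_of_def c_def mult.commute)
  moreover have "(\<Sum>k. diffs c k * t ^ k) = semigroup_of G t (G f) \<eta>"
  proof -
    have "diffs c k * t ^ k = t ^ k / fact k * (G ^^ k) (G f) \<eta>" for k
      by (simp add: diffs_def c_def funpow_swap1[symmetric] field_simps del: of_nat_Suc)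
    then show ?thesis by (simp add: semigroup_of_def)
  qed
  ultimately show ?thesis by simp
qed

text \<open>The sum of q ln q decreases at the rate given by the Dirichlet form of q against ln q, which
  log_mean_bound bounds from below. Adding the uniform law to p keeps the logarithms finite and is invisible
  to the generator, which annihilates constants. As q has mass 2 and values between 1/|S| and 2, its entropy
  is at most 2 ln 2 initially and at least -2 ln |S| finally.\<close>

lemma entropy_production:
  fixes p :: "real \<Rightarrow> 's \<Rightarrow> real" and T :: real
  assumes T: "T \<ge> 0"
    and p0: "\<And>t \<eta>. t \<in> {0..T} \<Longrightarrow> \<eta> \<in> S \<Longrightarrow> 0 \<le> p t \<eta>"
    and p1: "\<And>t. t \<in> {0..T} \<Longrightarrow> (\<Sum>\<eta>\<in>S. p t \<eta>) = 1"
    and dp: "\<And>t \<zeta>. t \<in> {0..T} \<Longrightarrow> \<zeta> \<in> S \<Longrightarrow>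
        ((\<lambda>t. p t \<zeta>) has_real_derivative G (p t) \<zeta>) (at t within {0..T})"
  defines "q \<equiv> \<lambda>t \<eta>. p t \<eta> + 1 / real (card S)"
  shows "continuous_on {0..T} (\<lambda>t. \<Sum>b\<in>I. \<Sum>\<eta>\<in>S. r b \<eta> * ((q t (\<sigma> b \<eta>) - q t \<eta>)\<^sup>2 / (q t (\<sigma> b \<eta>) + q t \<eta>)))"
    and "integral {0..T} (\<lambda>t. \<Sum>b\<in>I. \<Sum>\<eta>\<in>S. r b \<eta> * ((q t (\<sigma> b \<eta>) - q t \<eta>)\<^sup>2 / (q t (\<sigma> b \<eta>) + q t \<eta>)))
       \<le> 2 * ln 2 + 2 * ln (card S)"
proof -
  let ?D = "\<lambda>t. \<Sum>b\<in>I. \<Sum>\<eta>\<in>S. r b \<eta> * ((q t (\<sigma> b \<eta>) - q t \<eta>)\<^sup>2 / (q t (\<sigma> b \<eta>) + q t \<eta>))"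
  define u where "u = 1 / real (card S)"
  have cS: "card S > 0" using finS neS by (simp add: card_gt_0_iff)
  have u: "u > 0" "u \<le> 1" using cS by (auto simp: u_def)
  have q: "q t \<eta> = p t \<eta> + u" for t \<eta> by (simp add: q_def u_def)
  have qu: "q t \<eta> \<ge> u" "q t \<eta> > 0" if "t \<in> {0..T}" "\<eta> \<in> S" for t \<eta>
    using p0[OF that] u by (auto simp: q)
  have q2: "q t \<eta> \<le> 2" if t: "t \<in> {0..T}" "\<eta> \<in> S" for t \<eta>
  proof -
    have "p t \<eta> \<le> (\<Sum>\<eta>\<in>S. p t \<eta>)" using t p0 finS by (intro member_le_sum) auto
    then show ?thesis using p1 t u by (auto simp: q)
  qed
  have qs: "(\<Sum>\<eta>\<in>S. q t \<eta>) = 2" if "t \<in> {0..T}" for t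
    using p1[OF that] cS by (simp add: q sum.distrib u_def)
  have Gq: "G (q t) \<zeta> = G (p t) \<zeta>" if "\<zeta> \<in> S" for t \<zeta>
    using that by (simp add: gen q)
  have dq: "((\<lambda>t. q t \<zeta>) has_real_derivative G (q t) \<zeta>) (at t within {0..T})" if "t \<in> {0..T}" "\<zeta> \<in> S" for t \<zeta>
    unfolding Gq[OF that(2)] unfolding q using dp[OF that] by (auto intro!: derivative_eq_intros)
  have cq: "continuous_on {0..T} (\<lambda>t. q t \<zeta>)" if "\<zeta> \<in> S" for \<zeta>
    using dq that by (meson DERIV_continuous continuous_on_eq_continuous_within)
  have qq: "q t (\<sigma> b \<eta>) + q t \<eta> \<noteq> 0" if "t \<in> {0..T}" "b \<in> I" "\<eta> \<in> S" for t b \<eta>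
    using qu(2)[OF that(1) maps[OF that(2,3)]] qu(2)[OF that(1,3)] by auto
  show cD: "continuous_on {0..T} ?D"
    by (intro continuous_intros cq maps) (auto simp: qq)
  define h where "h t = (\<Sum>\<eta>\<in>S. q t \<eta> * ln (q t \<eta>))" for t
  define h' where "h' t = (\<Sum>\<eta>\<in>S. G (q t) \<eta> * (ln (q t \<eta>) + 1))" for t
  have dh: "(h has_vector_derivative h' t) (at t within {0..T})" if t: "t \<in> {0..T}" for t
  proof -
    have "((\<lambda>t. q t \<eta> * ln (q t \<eta>)) has_real_derivative G (q t) \<eta> * (ln (q t \<eta>) + 1)) (at t within {0..T})"
      if "\<eta> \<in> S" for \<eta>
      using qu(2)[OF t that] by (auto intro!: derivative_eq_intros dq[OF t that] simp: field_simps)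
    then show ?thesis unfolding h_def h'_def
      by (auto intro!: has_vector_derivative_sum simp: has_real_derivative_iff_has_vector_derivative)
  qed
  have hi: "(h' has_integral (h T - h 0)) {0..T}"
    by (rule fundamental_theorem_of_calculus[OF T dh])
  have h'D: "h' t \<le> - ?D t" if t: "t \<in> {0..T}" for t
  proof -
    have "h' t = (\<Sum>\<eta>\<in>S. ln (q t \<eta>) * G (q t) \<eta>) + (\<Sum>\<eta>\<in>S. (\<lambda>_. 1) \<eta> * G (q t) \<eta>)"
      by (simp add: h'_def sum.distrib[symmetric] algebra_simps)
    also have "(\<Sum>\<eta>\<in>S. (\<lambda>_. 1) \<eta> * G (q t) \<eta>) = 0" by (subst dirichlet_form) simp
    finally have "h' t = - (1/2) * (\<Sum>b\<in>I. \<Sum>\<eta>\<in>S. r b \<eta> * (ln (q t (\<sigma> b \<eta>)) - ln (q t \<eta>)) * (q t (\<sigma> b \<eta>) - q t \<eta>))"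
      by (simp add: dirichlet_form[of "\<lambda>\<eta>. ln (q t \<eta>)"])
    moreover have "2 * ?D t \<le> (\<Sum>b\<in>I. \<Sum>\<eta>\<in>S. r b \<eta> * (ln (q t (\<sigma> b \<eta>)) - ln (q t \<eta>)) * (q t (\<sigma> b \<eta>) - q t \<eta>))"
      unfolding sum_distrib_left
    proof (intro sum_mono)
      fix b \<eta> assume b: "b \<in> I" "\<eta> \<in> S"
      have "r b \<eta> * (2 * (q t (\<sigma> b \<eta>) - q t \<eta>)\<^sup>2 / (q t (\<sigma> b \<eta>) + q t \<eta>))
         \<le> r b \<eta> * ((q t (\<sigma> b \<eta>) - q t \<eta>) * (ln (q t (\<sigma> b \<eta>)) - ln (q t \<eta>)))"
        by (intro mult_left_mono log_mean_bound rate_nonneg qu(2) t b maps)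
      then show "2 * (r b \<eta> * ((q t (\<sigma> b \<eta>) - q t \<eta>)\<^sup>2 / (q t (\<sigma> b \<eta>) + q t \<eta>)))
         \<le> r b \<eta> * (ln (q t (\<sigma> b \<eta>)) - ln (q t \<eta>)) * (q t (\<sigma> b \<eta>) - q t \<eta>)"
        by (simp add: mult.commute mult.left_commute)
    qed
    ultimately show ?thesis by linarith
  qed
  have Di: "?D integrable_on {0..T}" by (rule integrable_continuous_real[OF cD])
  have "h T - h 0 \<le> - integral {0..T} ?D"
    using has_integral_le[OF hi has_integral_neg[OF integrable_integral[OF Di]]] h'D by auto
  moreover have "h 0 \<le> 2 * ln 2"
  proof -
    have "h 0 \<le> (\<Sum>\<eta>\<in>S. q 0 \<eta> * ln 2)"
      unfolding h_def using T qu[of 0] q2[of 0] by (intro sum_mono mult_left_mono) (auto simp: less_imp_le)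
    also have "\<dots> = 2 * ln 2" using qs[of 0] T by (simp add: sum_distrib_right[symmetric])
    finally show ?thesis .
  qed
  moreover have "h T \<ge> - 2 * ln (card S)"
  proof -
    have "(\<Sum>\<eta>\<in>S. q T \<eta> * ln u) \<le> h T"
      unfolding h_def
    proof (intro sum_mono mult_left_mono)
      fix \<eta> assume "\<eta> \<in> S"
      then show "ln u \<le> ln (q T \<eta>)" "0 \<le> q T \<eta>" using T qu[of T \<eta>] u by auto
    qed
    moreover have "(\<Sum>\<eta>\<in>S. q T \<eta> * ln u) = 2 * ln u" using qs[of T] T by (simp add: sum_distrib_right[symmetric])
    moreover have "ln u = - ln (card S)" using cS by (simp add: u_def ln_div)
    ultimately show ?thesis by simp
  qed
  ultimately show "integral {0..T} ?D \<le> 2 * ln 2 + 2 * ln (card S)" by simp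
qed

end

lemma finite_expectation:
  fixes f :: "'s \<Rightarrow> real"
  assumes P: "prob_space \<Omega>" and X: "X \<in> \<Omega> \<rightarrow>\<^sub>M count_space S" and fin: "finite S"
  shows "(\<integral>\<omega>. f (X \<omega>) \<partial>\<Omega>) = (\<Sum>\<eta>\<in>S. measure \<Omega> (X -` {\<eta>} \<inter> space \<Omega>) * f \<eta>)"
proof -
  interpret prob_space \<Omega> by fact
  have s: "X -` {\<eta>} \<inter> space \<Omega> \<in> sets \<Omega>" if "\<eta> \<in> S" for \<eta>
    using that by (intro measurable_sets[OF X]) auto
  have "(\<integral>\<omega>. f (X \<omega>) \<partial>\<Omega>) = (\<integral>\<omega>. (\<Sum>\<eta>\<in>S. indicator (X -` {\<eta>} \<inter> space \<Omega>) \<omega> * f \<eta>) \<partial>\<Omega>)"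
  proof (intro Bochner_Integration.integral_cong refl)
    fix \<omega> assume w: "\<omega> \<in> space \<Omega>"
    have "(\<Sum>\<eta>\<in>S. indicator (X -` {\<eta>} \<inter> space \<Omega>) \<omega> * f \<eta>) = (\<Sum>\<eta>\<in>S. if \<eta> = X \<omega> then f \<eta> else 0)"
      using w by (intro sum.cong) (auto simp: indicator_def)
    then show "f (X \<omega>) = (\<Sum>\<eta>\<in>S. indicator (X -` {\<eta>} \<inter> space \<Omega>) \<omega> * f \<eta>)"
      using fin measurable_space[OF X w] by simp
  qed
  also have "\<dots> = (\<Sum>\<eta>\<in>S. measure \<Omega> (X -` {\<eta>} \<inter> space \<Omega>) * f \<eta>)"
    using s by (subst Bochner_Integration.integral_sum) (auto simp: less_top[symmetric])
  finally show ?thesis .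
qed

text \<open>Taking expectations in the Markov property between the times 0 and t.\<close>

lemma markov_process_semigroup:
  fixes f :: "'s \<Rightarrow> real"
  assumes mp: "markov_process S G \<mu> \<Omega> X" and fin: "finite S" and t: "t \<ge> 0"
  shows "(\<integral>\<omega>. f (X t \<omega>) \<partial>\<Omega>) = (\<Sum>\<eta>\<in>S. measure \<mu> {\<eta>} * semigroup_of G t f \<eta>)"
proof -
  have "\<forall>f s t. 0 \<le> s \<and> s \<le> t \<longrightarrow>
        (AE \<omega> in \<Omega>. real_cond_exp \<Omega> (natural_filtration \<Omega> S X s) (\<lambda>\<omega>. f (X t \<omega>)) \<omega> =
                    semigroup_of G (t - s) f (X s \<omega>))"
    using mp unfolding markov_process_def by blast
  from this[rule_format, of 0 t f] t
  have ce: "AE \<omega> in \<Omega>. real_cond_exp \<Omega> (natural_filtration \<Omega> S X 0) (\<lambda>\<omega>. f (X t \<omega>)) \<omega> =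
                    semigroup_of G t f (X 0 \<omega>)"
    by simp
  have P: "prob_space \<Omega>" and XM: "\<And>t. t \<ge> 0 \<Longrightarrow> X t \<in> \<Omega> \<rightarrow>\<^sub>M count_space S"
    and d: "distr \<Omega> (count_space S) (X 0) = \<mu>"
    using mp unfolding markov_process_def by auto
  interpret prob_space \<Omega> by fact
  let ?F = "natural_filtration \<Omega> S X 0"
  have sub: "subalgebra \<Omega> ?F"
  proof -
    have "sets ?F \<subseteq> sets \<Omega>"
      unfolding natural_filtration_def
      by (subst sets_measure_of) (auto intro!: sets.sigma_sets_subset measurable_sets[OF XM])
    then show ?thesis by (auto simp: subalgebra_def natural_filtration_def space_measure_of_conv)
  qed
  interpret finite_measure_subalgebra \<Omega> ?F by standard (rule sub)
  have int: "integrable \<Omega> (\<lambda>\<omega>. g (X s \<omega>))" if "s \<ge> 0" for s and g :: "'s \<Rightarrow> real"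
  proof (rule integrable_const_bound[where B = "\<Sum>\<eta>\<in>S. \<bar>g \<eta>\<bar>"])
    show "(\<lambda>\<omega>. g (X s \<omega>)) \<in> borel_measurable \<Omega>"
      using XM[OF that] by (rule measurable_compose) simp
    show "AE \<omega> in \<Omega>. norm (g (X s \<omega>)) \<le> (\<Sum>\<eta>\<in>S. \<bar>g \<eta>\<bar>)"
      using measurable_space[OF XM[OF that]] fin
      by (intro AE_I2) (auto intro!: member_le_sum[of _ S "\<lambda>\<eta>. \<bar>g \<eta>\<bar>"])
  qed
  have "(\<integral>\<omega>. f (X t \<omega>) \<partial>\<Omega>) = (\<integral>\<omega>. real_cond_exp \<Omega> ?F (\<lambda>\<omega>. f (X t \<omega>)) \<omega> \<partial>\<Omega>)"
    using real_cond_exp_int(2)[OF int[OF t]] by simp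
  also have "\<dots> = (\<integral>\<omega>. semigroup_of G t f (X 0 \<omega>) \<partial>\<Omega>)"
    using ce int[of 0 "semigroup_of G t f"] by (intro integral_cong_AE) auto
  also have "\<dots> = (\<Sum>\<eta>\<in>S. measure \<Omega> (X 0 -` {\<eta>} \<inter> space \<Omega>) * semigroup_of G t f \<eta>)"
    by (rule finite_expectation[OF P XM fin]) simp
  also have "\<dots> = (\<Sum>\<eta>\<in>S. measure \<mu> {\<eta>} * semigroup_of G t f \<eta>)"
    unfolding d[symmetric] by (intro sum.cong refl arg_cong2[where f = "(*)"]) (auto simp: measure_distr[OF XM])
  finally show ?thesis .
qed

text \<open>The forward equation for the one-time marginals. The semigroup formula, applied to the indicator
  of \<zeta>, is differentiated in t, and the symmetry of the generator moves it from the indicator to the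
  law.\<close>

lemma (in reversible_dynamics) law_derivative:
  assumes mp: "markov_process S G \<mu> \<Omega> X" and t: "t \<in> {0..T}" and \<zeta>: "\<zeta> \<in> S"
  defines "p \<equiv> \<lambda>t \<zeta>. measure \<Omega> (X t -` {\<zeta>} \<inter> space \<Omega>)"
  shows "((\<lambda>t. p t \<zeta>) has_real_derivative G (p t) \<zeta>) (at t within {0..T})"
proof -
  have P: "prob_space \<Omega>" and XM: "\<And>t. t \<ge> 0 \<Longrightarrow> X t \<in> \<Omega> \<rightarrow>\<^sub>M count_space S"
    using mp unfolding markov_process_def by auto
  have E: "(\<Sum>\<eta>\<in>S. p t \<eta> * f \<eta>) = (\<Sum>\<eta>\<in>S. measure \<mu> {\<eta>} * semigroup_of G t f \<eta>)" if "t \<ge> 0" for t f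
    using finite_expectation[OF P XM finS, OF that, of f] markov_process_semigroup[OF mp finS that, of f]
    by (simp add: p_def)
  define e where "e = (\<lambda>\<eta>. if \<eta> = \<zeta> then 1 else 0 :: real)"
  have e: "(\<Sum>\<eta>\<in>S. f \<eta> * e \<eta>) = f \<zeta>" for f
    using finS \<zeta> by (simp add: e_def if_distrib cong: if_cong)
  have "((\<lambda>t. \<Sum>\<eta>\<in>S. measure \<mu> {\<eta>} * semigroup_of G t e \<eta>) has_real_derivative
        (\<Sum>\<eta>\<in>S. measure \<mu> {\<eta>} * semigroup_of G t (G e) \<eta>)) (at t within {0..T})"
    by (intro DERIV_sum DERIV_cmult has_field_derivative_at_within[OF semigroup_derivative])
  also have "(\<Sum>\<eta>\<in>S. measure \<mu> {\<eta>} * semigroup_of G t (G e) \<eta>) = (\<Sum>\<eta>\<in>S. p t \<eta> * G e \<eta>)"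
    using E t by simp
  also have "\<dots> = (\<Sum>\<eta>\<in>S. e \<eta> * G (p t) \<eta>)" by (rule generator_symmetric)
  also have "\<dots> = G (p t) \<zeta>" using e[of "G (p t)"] by (simp add: mult.commute)
  finally show ?thesis
    by (rule has_field_derivative_transform_within[OF _ zero_less_one t])
       (use E[where f = e] e in \<open>auto\<close>)
qed

section \<open>The exclusion process\<close>

lemma shift_in_sites: "N \<ge> 1 \<Longrightarrow> x \<in> sites N \<Longrightarrow> shift N j m x \<in> sites N"
  by (auto simp: sites_def shift_def nat_less_iff)

lemma shift_shift:
  assumes "N \<ge> 1" shows "shift N j m (shift N j m' x) = shift N j (m + m') x"
  using assms mod_add_right_eq[of m "int (x j) + m'" "int N"]
  by (auto simp: shift_def fun_eq_iff add_ac)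

lemma shift_0: "x \<in> sites N \<Longrightarrow> shift N j 0 x = x"
  by (auto simp: shift_def sites_def)

lemma shift_neq:
  assumes x: "x \<in> sites N" and m: "\<not> int N dvd m - m'"
  shows "shift N j m x \<noteq> shift N j m' x"
proof
  assume "shift N j m x = shift N j m' x"
  then have "shift N j m x j = shift N j m' x j" by simp
  moreover have "N \<noteq> 0" using x by (auto simp: sites_def)
  ultimately have "(int (x j) + m) mod int N = (int (x j) + m') mod int N"
    by (simp add: shift_def nat_eq_iff)
  then have "int N dvd (int (x j) + m) - (int (x j) + m')" by (simp add: mod_eq_dvd_iff)
  with m show False by simp
qed

lemma finite_configs: "finite (configs N :: 'n::finite config set)"
  by (auto simp: configs_def intro!: finite_PiE finite_sites)

lemma card_configs: "card (configs N :: 'n::finite config set) = 2 ^ (N ^ CARD('n))"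
  unfolding configs_def by (subst card_PiE) (auto simp: finite_sites card_sites numeral_2_eq_2)

lemma configs_ne: "configs N \<noteq> {}"
  by (simp add: configs_def PiE_eq_empty_iff)

lemma config_value: "\<eta> \<in> configs N \<Longrightarrow> x \<in> sites N \<Longrightarrow> \<eta> x = 0 \<or> \<eta> x = 1"
  using PiE_mem[of \<eta> "sites N" "\<lambda>_. {0,1}" x] by (simp add: configs_def)

lemma exchange_in_configs:
  "\<eta> \<in> configs N \<Longrightarrow> x \<in> sites N \<Longrightarrow> y \<in> sites N \<Longrightarrow> exchange x y \<eta> \<in> configs N"
  by (auto simp: configs_def exchange_def PiE_iff extensional_def)

lemma exchange_exchange: "exchange x y (exchange x y \<eta>) = \<eta>"
  by (rule ext) (simp add: exchange_def)

lemma not_dvd_small: "N \<ge> 3 \<Longrightarrow> m \<in> {-2,-1,1,2} \<Longrightarrow> \<not> int N dvd m"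
  using zdvd_imp_le[of "int N" "\<bar>m\<bar>"] by auto

text \<open>The rate of a bond depends on the two sites next to the bond only. On fewer than three sites per
  direction these could be end points of the bond.\<close>

lemma rate_c_exchange:
  assumes N: "N \<ge> 3" and x: "x \<in> sites N"
  shows "rate_c a N j x (exchange x (shift N j 1 x) \<eta>) = rate_c a N j x \<eta>"
proof -
  have "shift N j m x \<noteq> x" "shift N j m x \<noteq> shift N j 1 x" if "m \<in> {-1,2}" for m
  proof -
    have "m \<in> {-2,-1,1,2}" "m - 1 \<in> {-2,-1,1,2}" using that by auto
    then show "shift N j m x \<noteq> x" "shift N j m x \<noteq> shift N j 1 x"
      using shift_neq[OF x, of m 0 j] shift_neq[OF x, of m 1 j] not_dvd_small[OF N] by (auto simp: shift_0[OF x])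
  qed
  then show ?thesis by (simp add: rate_c_def exchange_def)
qed

text \<open>The rate is affine in the number of occupied sites among the two neighbours of the bond, so its
  extreme values are attained when both are empty or both occupied.\<close>

lemma rate_c_bound:
  assumes N: "N \<ge> 1" and x: "x \<in> sites N" and \<eta>: "\<eta> \<in> configs N"
  shows "min 1 (1 + 2 * a) \<le> rate_c a N j x \<eta>"
  using config_value[OF \<eta> shift_in_sites[OF N x, of j "-1"]] config_value[OF \<eta> shift_in_sites[OF N x, of j 2]]
  by (auto simp: rate_c_def min_def)

lemma conductance_pos:
  fixes W :: "'n \<Rightarrow> real \<Rightarrow> real" and x :: "'n site"
  assumes "\<And>k. strict_mono (W k)" "N \<ge> 1" shows "0 < conductance W N j x"
proof -
  have "W j (real (x j) / real N) < W j ((real (x j) + 1) / real N)"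
    using assms by (intro strict_monoD[of "W j"]) (auto simp: divide_strict_right_mono)
  then show ?thesis using assms by (simp add: conductance_def)
qed

text \<open>The part of the Dirichlet form carried by one bond. Dividing by the sum of the two values
  instead of working with square roots makes it quadratic in the difference.\<close>

definition bond_energy :: "nat \<Rightarrow> 'n \<Rightarrow> 'n site \<Rightarrow> ('n config \<Rightarrow> real) \<Rightarrow> real" where
  "bond_energy N j x q = (\<Sum>\<eta>\<in>configs N. (q (exchange x (shift N j 1 x) \<eta>) - q \<eta>)\<^sup>2
      / (q (exchange x (shift N j 1 x) \<eta>) + q \<eta>))"

definition directional_energy :: "('n \<Rightarrow> real \<Rightarrow> real) \<Rightarrow> nat \<Rightarrow> 'n \<Rightarrow> ('n config \<Rightarrow> real) \<Rightarrow> real" where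
  "directional_energy W N j q = (\<Sum>x\<in>sites N. conductance W N j x * bond_energy N j x q)"

definition law_at :: "'w measure \<Rightarrow> (real \<Rightarrow> 'w \<Rightarrow> 's) \<Rightarrow> real \<Rightarrow> 's \<Rightarrow> real" where
  "law_at \<Omega> X t \<zeta> = measure \<Omega> (X t -` {\<zeta>} \<inter> space \<Omega>)"

text \<open>Adding the uniform law makes the law of the process strictly positive, so that it may appear in
  a logarithm or in a denominator; expectations of nonnegative functions only become larger.\<close>

definition mixed_law :: "nat \<Rightarrow> 'w measure \<Rightarrow> (real \<Rightarrow> 'w \<Rightarrow> 'n::finite config) \<Rightarrow> real \<Rightarrow> 'n config \<Rightarrow> real" where
  "mixed_law N \<Omega> X t \<zeta> = law_at \<Omega> X t \<zeta> + 1 / real (card (configs N :: 'n config set))"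

lemma bond_energy_nonneg:
  fixes x :: "'n::finite site"
  assumes "N \<ge> 1" "x \<in> sites N" "\<And>\<eta>. \<eta> \<in> configs N \<Longrightarrow> 0 < q \<eta>"
  shows "0 \<le> bond_energy N j x q"
  unfolding bond_energy_def using exchange_in_configs[OF _ assms(2) shift_in_sites[OF assms(1,2)]]
  by (intro sum_nonneg divide_nonneg_nonneg add_nonneg_nonneg) (auto intro!: less_imp_le assms(3))

locale exclusion =
  fixes W :: "'n::finite \<Rightarrow> real \<Rightarrow> real" and a T :: real and N :: nat
    and \<mu> :: "'n config measure" and \<Omega> :: "'w measure" and X :: "real \<Rightarrow> 'w \<Rightarrow> 'n config"
  assumes N3: "N \<ge> 3" and W_mono: "\<And>k. strict_mono (W k)" and a_half: "a > - 1 / 2" and T0: "T \<ge> 0"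
    and mp: "markov_process (configs N) (\<lambda>f \<zeta>. (real N)\<^sup>2 * generator W a N f \<zeta>) \<mu> \<Omega> X"
begin

lemma cond_pos: "0 < conductance W N j x"
  by (rule conductance_pos) (use W_mono N3 in auto)

sublocale reversible_dynamics "configs N" "(UNIV :: 'n set) \<times> sites N"
   "\<lambda>(j, x). exchange x (shift N j 1 x)" "\<lambda>(j, x) \<eta>. (real N)\<^sup>2 * conductance W N j x * rate_c a N j x \<eta>"
   "\<lambda>f \<zeta>. (real N)\<^sup>2 * generator W a N f \<zeta>"
proof
  show "finite (configs N :: 'n config set)" by (rule finite_configs)
  show "configs N \<noteq> ({} :: 'n config set)" by (rule configs_ne)
  show "finite ((UNIV :: 'n set) \<times> (sites N :: 'n site set))" by (simp add: finite_sites)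
next
  fix b :: "'n \<times> 'n site" and \<eta> :: "'n config"
  assume b: "b \<in> UNIV \<times> sites N" and \<eta>: "\<eta> \<in> configs N"
  obtain j x where bb: "b = (j, x)" and x: "x \<in> sites N" using b by auto
  have sx: "shift N j 1 x \<in> sites N" using N3 x by (intro shift_in_sites) auto
  have "0 \<le> rate_c a N j x \<eta>"
    using rate_c_bound[OF _ x \<eta>, of a j] N3 a_half by (auto simp: min_def split: if_splits)
  then show "0 \<le> (case b of (j, x) \<Rightarrow> \<lambda>\<eta>. (real N)\<^sup>2 * conductance W N j x * rate_c a N j x \<eta>) \<eta>"
    using cond_pos[of j x] by (simp add: bb)
  show "(case b of (j, x) \<Rightarrow> \<lambda>\<eta>. (real N)\<^sup>2 * conductance W N j x * rate_c a N j x \<eta>)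
      ((case b of (j, x) \<Rightarrow> exchange x (shift N j 1 x)) \<eta>) =
    (case b of (j, x) \<Rightarrow> \<lambda>\<eta>. (real N)\<^sup>2 * conductance W N j x * rate_c a N j x \<eta>) \<eta>"
    using rate_c_exchange[OF N3 x] by (simp add: bb)
  show "(case b of (j, x) \<Rightarrow> exchange x (shift N j 1 x)) \<eta> \<in> configs N"
    using exchange_in_configs[OF \<eta> x sx] by (simp add: bb)
  show "(case b of (j, x) \<Rightarrow> exchange x (shift N j 1 x)) ((case b of (j, x) \<Rightarrow> exchange x (shift N j 1 x)) \<eta>) = \<eta>"
    by (simp add: bb exchange_exchange)
next
  fix \<eta> :: "'n config" and f :: "'n config \<Rightarrow> real"
  show "(real N)\<^sup>2 * generator W a N f \<eta> = (\<Sum>b\<in>UNIV \<times> sites N.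
      (case b of (j, x) \<Rightarrow> \<lambda>\<eta>. (real N)\<^sup>2 * conductance W N j x * rate_c a N j x \<eta>) \<eta> *
      (f ((case b of (j, x) \<Rightarrow> exchange x (shift N j 1 x)) \<eta>) - f \<eta>))"
    unfolding generator_def
    by (simp add: sum.cartesian_product sum_distrib_left split_beta mult.assoc)
qed

lemma prob: "prob_space \<Omega>" and X_measurable: "t \<ge> 0 \<Longrightarrow> X t \<in> \<Omega> \<rightarrow>\<^sub>M count_space (configs N)"
  using mp unfolding markov_process_def by auto

lemma law_sum: "t \<ge> 0 \<Longrightarrow> (\<Sum>\<zeta>\<in>configs N. law_at \<Omega> X t \<zeta>) = 1"
  using finite_expectation[OF prob X_measurable finS, of t "\<lambda>_. 1"] prob_space.prob_space[OF prob]
  by (simp add: law_at_def)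

lemma mixed_law_pos: "0 < mixed_law N \<Omega> X t \<zeta>"
  by (simp add: mixed_law_def law_at_def card_configs add_nonneg_pos)

lemma mixed_law_sum: "t \<ge> 0 \<Longrightarrow> (\<Sum>\<zeta>\<in>configs N. mixed_law N \<Omega> X t \<zeta>) = 2"
  by (simp add: mixed_law_def sum.distrib law_sum card_configs)

lemma law_continuous:
  assumes "\<zeta> \<in> configs N" shows "continuous_on {0..T} (\<lambda>t. law_at \<Omega> X t \<zeta>)"
  unfolding law_at_def using law_derivative[OF mp _ assms, of _ T]
  by (meson DERIV_continuous continuous_on_eq_continuous_within)

lemma directional_energy_continuous: "continuous_on {0..T} (\<lambda>t. directional_energy W N j (mixed_law N \<Omega> X t))"
proof -
  have nz: "mixed_law N \<Omega> X t \<zeta> + mixed_law N \<Omega> X t \<xi> \<noteq> 0" for t \<zeta> \<xi>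
    using mixed_law_pos[of t \<zeta>] mixed_law_pos[of t \<xi>] by linarith
  have c: "continuous_on {0..T} (\<lambda>t. mixed_law N \<Omega> X t \<zeta>)" if "\<zeta> \<in> configs N" for \<zeta>
    unfolding mixed_law_def by (intro continuous_intros law_continuous that)
  show ?thesis
    unfolding directional_energy_def bond_energy_def
    by (intro continuous_intros ballI nz c) (use N3 in \<open>auto intro!: exchange_in_configs shift_in_sites\<close>)
qed

lemma directional_energy_nonneg: "0 \<le> directional_energy W N j (mixed_law N \<Omega> X t)"
  unfolding directional_energy_def
  using N3
  by (intro sum_nonneg less_imp_le[OF cond_pos] mult_nonneg_nonneg bond_energy_nonneg mixed_law_pos) (auto simp: less_imp_le)

text \<open>There are 2^(N^d) configurations, so the entropy is of order N^d, and the generator carries a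
  factor N^2. The bonds in the directions other than j contribute nonnegative terms, and the jump rates are
  bounded away from zero because a > -1/2.\<close>

lemma directional_energy_bound:
  "integral {0..T} (\<lambda>t. directional_energy W N j (mixed_law N \<Omega> X t))
     \<le> 4 * ln 2 / min 1 (1 + 2 * a) * (real N ^ CARD('n) / (real N)\<^sup>2)"
proof -
  let ?q = "mixed_law N \<Omega> X"
  let ?s = "\<lambda>j x. exchange x (shift N j 1 x)"
  define c where "c = min 1 (1 + 2 * a)"
  have c: "c > 0" using a_half by (auto simp: c_def)
  let ?D = "\<lambda>t. \<Sum>b\<in>UNIV \<times> sites N. \<Sum>\<eta>\<in>configs N.
     (case b of (j, x) \<Rightarrow> \<lambda>\<eta>. (real N)\<^sup>2 * conductance W N j x * rate_c a N j x \<eta>) \<eta> *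
     ((?q t ((case b of (j, x) \<Rightarrow> ?s j x) \<eta>) - ?q t \<eta>)\<^sup>2 / (?q t ((case b of (j, x) \<Rightarrow> ?s j x) \<eta>) + ?q t \<eta>))"
  have dp: "((\<lambda>t. law_at \<Omega> X t \<zeta>) has_real_derivative (real N)\<^sup>2 * generator W a N (law_at \<Omega> X t) \<zeta>) (at t within {0..T})"
    if "t \<in> {0..T}" "\<zeta> \<in> configs N" for t \<zeta>
    using law_derivative[OF mp that] unfolding law_at_def[abs_def] .
  note E = entropy_production[of T "law_at \<Omega> X", OF T0 _ law_sum dp, folded mixed_law_def]
  have cD: "continuous_on {0..T} ?D" by (rule E) (auto simp: law_at_def)
  have I: "integral {0..T} ?D \<le> 2 * ln 2 + 2 * ln (real (card (configs N :: 'n config set)))"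
    by (rule E) (auto simp: law_at_def)
  have le: "(real N)\<^sup>2 * c * directional_energy W N j (?q t) \<le> ?D t" for t
  proof -
    have nn: "0 \<le> (?q t (?s k x \<eta>) - ?q t \<eta>)\<^sup>2 / (?q t (?s k x \<eta>) + ?q t \<eta>)" for k x \<eta>
      by (intro divide_nonneg_nonneg add_nonneg_nonneg less_imp_le[OF mixed_law_pos] zero_le_power2)
    note cp = cond_pos
    have rc: "c \<le> rate_c a N k x \<eta>" if "x \<in> sites N" "\<eta> \<in> configs N" for k x \<eta>
      unfolding c_def by (rule rate_c_bound) (use N3 that in auto)
    have "(real N)\<^sup>2 * c * directional_energy W N j (?q t) = (\<Sum>x\<in>sites N. \<Sum>\<eta>\<in>configs N.
       (real N)\<^sup>2 * conductance W N j x * c * ((?q t (?s j x \<eta>) - ?q t \<eta>)\<^sup>2 / (?q t (?s j x \<eta>) + ?q t \<eta>)))"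
      by (simp add: directional_energy_def bond_energy_def sum_distrib_left mult_ac)
    also have "\<dots> \<le> (\<Sum>x\<in>sites N. \<Sum>\<eta>\<in>configs N.
       (real N)\<^sup>2 * conductance W N j x * rate_c a N j x \<eta> * ((?q t (?s j x \<eta>) - ?q t \<eta>)\<^sup>2 / (?q t (?s j x \<eta>) + ?q t \<eta>)))"
      by (intro sum_mono mult_right_mono mult_left_mono rc nn) (use cp in \<open>auto simp: less_imp_le\<close>)
    also have "\<dots> \<le> (\<Sum>k\<in>UNIV. \<Sum>x\<in>sites N. \<Sum>\<eta>\<in>configs N.
       (real N)\<^sup>2 * conductance W N k x * rate_c a N k x \<eta> * ((?q t (?s k x \<eta>) - ?q t \<eta>)\<^sup>2 / (?q t (?s k x \<eta>) + ?q t \<eta>)))"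
    proof (rule member_le_sum)
      fix k assume "k \<in> UNIV - {j}"
      have "0 \<le> rate_c a N k x \<eta>" if "x \<in> sites N" "\<eta> \<in> configs N" for x \<eta>
        using rc[OF that, of k] c by linarith
      then show "0 \<le> (\<Sum>x\<in>sites N. \<Sum>\<eta>\<in>configs N.
       (real N)\<^sup>2 * conductance W N k x * rate_c a N k x \<eta> * ((?q t (?s k x \<eta>) - ?q t \<eta>)\<^sup>2 / (?q t (?s k x \<eta>) + ?q t \<eta>)))"
        by (intro sum_nonneg mult_nonneg_nonneg nn) (use cp in \<open>auto simp: less_imp_le\<close>)
    qed auto
    also have "\<dots> = ?D t" by (subst sum.cartesian_product) (simp add: split_beta)
    finally show ?thesis .
  qed
  have "integral {0..T} (\<lambda>t. (real N)\<^sup>2 * c * directional_energy W N j (?q t)) \<le> integral {0..T} ?D"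
    by (intro integral_le le integrable_continuous_real cD continuous_intros directional_energy_continuous)
  also have "\<dots> \<le> 2 * ln 2 + 2 * ln (real (card (configs N :: 'n config set)))" by (rule I)
  also have "\<dots> = 2 * ln 2 * (1 + real N ^ CARD('n))"
    by (simp add: card_configs ln_realpow algebra_simps)
  also have "\<dots> \<le> 4 * ln 2 * real N ^ CARD('n)"
    using N3 one_le_power[of "real N" "CARD('n)"] by (simp add: algebra_simps)
  finally have "(real N)\<^sup>2 * c * integral {0..T} (\<lambda>t. directional_energy W N j (?q t)) \<le> 4 * ln 2 * real N ^ CARD('n)"
    by simp
  then show ?thesis unfolding c_def[symmetric] using c N3 by (simp add: field_simps)
qed

end

section \<open>Translations and boxes on the torus\<close>

lemma vec_nth_measurable [measurable]: "(\<lambda>x::real^'n::finite. x $ k) \<in> borel_measurable borel"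
  by (intro borel_measurable_continuous_onI continuous_intros)

lemma torus_borel_set [measurable]: "(torus :: (real^'n::finite) set) \<in> sets borel"
proof -
  have "torus = (\<Inter>k\<in>UNIV. {x::real^'n. 0 \<le> x $ k \<and> x $ k < 1})" by (auto simp: torus_def)
  also have "\<dots> \<in> sets borel" by (intro sets.finite_INT) auto
  finally show ?thesis .
qed

lemma One_vec_nth: "(One :: real^'n::finite) $ k = 1"
proof -
  have "(One :: real^'n) $ k = One \<bullet> axis k (1 :: real)"
    by (subst inner_axis) (simp only: inner_real_def mult_1_right)
  also have "\<dots> = 1" by (intro inner_sum_Basis axis_in_Basis_iff[THEN iffD2]) simp
  finally show ?thesis .
qed

lemma sum_Basis_vec_nth [simp]: "(\<Sum>x\<in>(Basis :: (real^'n::finite) set). x $ k) = 1"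
  using One_vec_nth[of k] by simp

lemma emeasure_lborel_cube: "c \<ge> 0 \<Longrightarrow> emeasure lborel (box x (x + c *\<^sub>R One) :: (real^'n::finite) set) = ennreal (c ^ CARD('n))"
  and emeasure_lborel_ccube: "c \<ge> 0 \<Longrightarrow> emeasure lborel (cbox x (x + c *\<^sub>R One) :: (real^'n::finite) set) = ennreal (c ^ CARD('n))"
  by (simp_all add: emeasure_lborel_box_eq emeasure_lborel_cbox_eq inner_add_left)

lemma emeasure_torus_le: "emeasure lborel (torus :: (real^'n::finite) set) \<le> 1"
proof -
  have "emeasure lborel (torus :: (real^'n) set) \<le> emeasure lborel (cbox 0 (0 + 1 *\<^sub>R One) :: (real^'n) set)"
    by (intro emeasure_mono) (auto simp: torus_def mem_box_cart One_vec_nth less_imp_le)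
  also have "\<dots> = 1" by (subst emeasure_lborel_ccube) auto
  finally show ?thesis .
qed

lemma space_torus_lebesgue [simp]: "space torus_lebesgue = torus"
  and space_torus_borel [simp]: "space torus_borel = torus"
  by (auto simp: torus_lebesgue_def torus_borel_def space_restrict_space)

lemma sets_torus_lebesgue [simp, measurable_cong]: "sets torus_lebesgue = sets torus_borel"
  by (auto simp: torus_lebesgue_def torus_borel_def sets_restrict_space)

lemma torus_borel_measurable: "f \<in> borel_measurable borel \<Longrightarrow> f \<in> borel_measurable torus_borel"
  unfolding torus_borel_def by (rule measurable_restrict_space1)

lemma nn_integral_torus: "(\<integral>\<^sup>+x. f x \<partial>torus_lebesgue) = (\<integral>\<^sup>+x. f x * indicator torus x \<partial>lborel)"
  unfolding torus_lebesgue_def by (subst nn_integral_restrict_space) auto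

lemma finite_measure_torus_lebesgue: "finite_measure (torus_lebesgue :: (real^'a::finite) measure)"
proof
  have "emeasure torus_lebesgue (torus :: (real^'a::finite) set) = emeasure lborel (torus :: (real^'a::finite) set)"
    unfolding torus_lebesgue_def by (subst emeasure_restrict_space) auto
  then show "emeasure torus_lebesgue (space torus_lebesgue :: (real^'a::finite) set) \<noteq> \<infinity>"
    using emeasure_torus_le[where 'n='a] by (auto simp: top_unique)
qed

lemma nn_integral_translate:
  fixes f :: "real^'n::finite \<Rightarrow> ennreal"
  assumes [measurable]: "f \<in> borel_measurable borel"
  shows "(\<integral>\<^sup>+x. f (c + x) \<partial>lborel) = (\<integral>\<^sup>+x. f x \<partial>lborel)"
proof -
  have "(\<integral>\<^sup>+x. f x \<partial>lborel) = (\<integral>\<^sup>+x. f x \<partial>distr lborel borel ((+) c))" by (simp add: lborel_distr_plus)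
  also have "\<dots> = (\<integral>\<^sup>+x. f (c + x) \<partial>lborel)" by (subst nn_integral_distr) auto
  finally show ?thesis by simp
qed

lemma periodic_int_axis:
  assumes per: "\<And>x k. f (x + axis k 1) = f (x :: real^'n)"
  shows "f (x + of_int z *\<^sub>R axis k 1) = f x"
proof -
  have nat: "f (x + real n *\<^sub>R axis k 1) = f x" for n x
  proof (induction n)
    case (Suc n)
    have "x + real (Suc n) *\<^sub>R axis k 1 = (x + real n *\<^sub>R axis k 1) + axis k 1" by (simp add: algebra_simps)
    then show ?case using per[of "x + real n *\<^sub>R axis k 1" k] Suc by (simp only:)
  qed simp
  show ?thesis
  proof (cases "z \<ge> 0")
    case True then show ?thesis using nat[of x "nat z"] by simp
  next
    case False
    then have "f (x + of_int z *\<^sub>R axis k 1 + real (nat (- z)) *\<^sub>R axis k 1) = f (x + of_int z *\<^sub>R axis k 1)" by (intro nat)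
    then show ?thesis using False by (simp add: algebra_simps)
  qed
qed

text \<open>By periodicity only the fractional part of the translation matters. The translated unit cube
  protrudes from the original one on one side, and the protruding slab is moved back by one period.\<close>

lemma nn_integral_torus_translate_axis:
  fixes f :: "real^'n::finite \<Rightarrow> ennreal"
  assumes [measurable]: "f \<in> borel_measurable borel" and per: "\<And>x k. f (x + axis k 1) = f x"
  shows "(\<integral>\<^sup>+x. f (x + h *\<^sub>R axis k 1) \<partial>torus_lebesgue) = (\<integral>\<^sup>+x. f x \<partial>torus_lebesgue)"
proof -
  define s where "s = frac h"
  let ?e = "axis k 1 :: real^'n"
  have s: "0 \<le> s" "s < 1" by (auto simp: s_def frac_lt_1)
  have fs: "f (x + h *\<^sub>R ?e) = f (x + s *\<^sub>R ?e)" for x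
    using periodic_int_axis[of f "x + s *\<^sub>R ?e" "\<lfloor>h\<rfloor>" k, OF per] by (simp add: s_def frac_def algebra_simps)
  have [measurable]: "(\<lambda>x::real^'n. x + c) \<in> borel_measurable borel" "(\<lambda>x::real^'n. x - c) \<in> borel_measurable borel" for c
    by (intro borel_measurable_continuous_onI continuous_intros)+
  have m1: "(\<lambda>x. indicator torus (x - c) :: ennreal) \<in> borel_measurable borel" for c :: "real^'n"
    by measurable
  note [measurable] = m1
  \<comment> \<open>The translated cube consists of a part of the unit cube and of a part of its neighbour
    in direction k.\<close>
  have T: "indicator torus (x - s *\<^sub>R ?e) =
     indicator torus x * indicator {x. s \<le> x $ k} x + indicator torus (x - ?e) * (indicator {x. x $ k < s} (x - ?e) :: ennreal)" for x
  proof -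
    have c: "(x - t *\<^sub>R ?e) $ i = (if i = k then x $ k - t else x $ i)" for t i by (auto simp: axis_def)
    have c1: "(x - ?e) $ i = (if i = k then x $ k - 1 else x $ i)" for i by (auto simp: axis_def)
    define P where "P = (\<forall>i. i \<noteq> k \<longrightarrow> 0 \<le> x $ i \<and> x $ i < 1)"
    have split: "(\<forall>i. Q i) \<longleftrightarrow> (\<forall>i. i \<noteq> k \<longrightarrow> Q i) \<and> Q k" for Q by metis
    have "x - s *\<^sub>R ?e \<in> torus \<longleftrightarrow> P \<and> s \<le> x $ k \<and> x $ k < 1 + s"
      unfolding torus_def P_def mem_Collect_eq by (subst split) (simp only: c if_True, auto)
    moreover have "x \<in> torus \<longleftrightarrow> P \<and> 0 \<le> x $ k \<and> x $ k < 1"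
      unfolding torus_def P_def mem_Collect_eq by (rule split)
    moreover have "x - ?e \<in> torus \<longleftrightarrow> P \<and> 1 \<le> x $ k \<and> x $ k < 2"
      unfolding torus_def P_def mem_Collect_eq by (subst split) (simp only: c1 if_True, auto)
    moreover have "x - ?e \<in> {x. x $ k < s} \<longleftrightarrow> x $ k < 1 + s" by (auto simp: c1)
    ultimately show ?thesis using s by (cases P) (auto simp: indicator_def)
  qed
  have "(\<integral>\<^sup>+x. f (x + h *\<^sub>R ?e) \<partial>torus_lebesgue) = (\<integral>\<^sup>+x. f (s *\<^sub>R ?e + x) * indicator torus ((s *\<^sub>R ?e + x) - s *\<^sub>R ?e) \<partial>lborel)"
    by (simp add: nn_integral_torus fs add.commute)
  also have "\<dots> = (\<integral>\<^sup>+x. f x * indicator torus (x - s *\<^sub>R ?e) \<partial>lborel)"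
    by (rule nn_integral_translate) measurable
  also have "\<dots> = (\<integral>\<^sup>+x. f x * indicator torus x * indicator {x. s \<le> x $ k} x + f x * indicator torus (x - ?e) * indicator {x. x $ k < s} (x - ?e) \<partial>lborel)"
    unfolding T by (simp add: distrib_left mult.assoc)
  also have "\<dots> = (\<integral>\<^sup>+x. f x * indicator torus x * indicator {x. s \<le> x $ k} x \<partial>lborel) + (\<integral>\<^sup>+x. f x * indicator torus (x - ?e) * indicator {x. x $ k < s} (x - ?e) \<partial>lborel)"
    by (rule nn_integral_add) measurable
  also have "(\<integral>\<^sup>+x. f x * indicator torus (x - ?e) * indicator {x. x $ k < s} (x - ?e) \<partial>lborel) =
     (\<integral>\<^sup>+x. f (?e + x) * indicator torus ((?e + x) - ?e) * indicator {x. x $ k < s} ((?e + x) - ?e) \<partial>lborel)"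
    by (rule nn_integral_translate[symmetric]) measurable
  also have "\<dots> = (\<integral>\<^sup>+x. f x * indicator torus x * indicator {x. x $ k < s} x \<partial>lborel)"
    using per by (simp add: add.commute)
  also have "(\<integral>\<^sup>+x. f x * indicator torus x * indicator {x. s \<le> x $ k} x \<partial>lborel) + \<dots> = (\<integral>\<^sup>+x. f x * indicator torus x * indicator {x. s \<le> x $ k} x + f x * indicator torus x * indicator {x. x $ k < s} x \<partial>lborel)"
    by (rule nn_integral_add[symmetric]) measurable
  also have "\<dots> = (\<integral>\<^sup>+x. f x * indicator torus x \<partial>lborel)"
    by (intro nn_integral_cong) (auto simp: indicator_def)
  finally show ?thesis by (simp add: nn_integral_torus)
qed

lemma vec_sum_axis: "(\<Sum>k\<in>UNIV. (v $ k) *\<^sub>R axis k 1) = (v :: real^'n::finite)"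
  using basis_expansion[of v] by (simp add: scalar_mult_eq_scaleR)

lemma nn_integral_torus_translate:
  fixes f :: "real^'n::finite \<Rightarrow> ennreal"
  assumes f: "f \<in> borel_measurable borel" and per: "\<And>x k. f (x + axis k 1) = f x"
  shows "(\<integral>\<^sup>+x. f (x + v) \<partial>torus_lebesgue) = (\<integral>\<^sup>+x. f x \<partial>torus_lebesgue)"
proof -
  have "(\<integral>\<^sup>+x. f (x + (\<Sum>k\<in>A. (v $ k) *\<^sub>R axis k 1)) \<partial>torus_lebesgue) = (\<integral>\<^sup>+x. f x \<partial>torus_lebesgue)" for A
  proof (induction A rule: infinite_finite_induct)
    case (insert i A)
    let ?w = "\<Sum>k\<in>A. (v $ k) *\<^sub>R axis k 1 :: real^'n"
    have [measurable]: "(\<lambda>x. x + ?w) \<in> borel_measurable borel"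
      by (intro borel_measurable_continuous_onI continuous_intros)
    have "(\<integral>\<^sup>+x. f (x + (\<Sum>k\<in>insert i A. (v $ k) *\<^sub>R axis k 1)) \<partial>torus_lebesgue) =
      (\<integral>\<^sup>+x. (\<lambda>x. f (x + ?w)) (x + (v $ i) *\<^sub>R axis i 1) \<partial>torus_lebesgue)"
      using insert by (simp add: algebra_simps)
    also have "\<dots> = (\<integral>\<^sup>+x. f (x + ?w) \<partial>torus_lebesgue)"
    proof (rule nn_integral_torus_translate_axis)
      show "(\<lambda>x. f (x + ?w)) \<in> borel_measurable borel" using f by measurable
      show "f (x + axis k 1 + ?w) = f (x + ?w)" for x k
        using per[of "x + ?w" k] by (simp add: add_ac)
    qed
    finally show ?case using insert by simp
  qed simp_all
  from this[of UNIV] show ?thesis by (simp add: vec_sum_axis)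
qed

text \<open>The open cube with side \<delta>, repeated along the integer lattice. Subsets of the torus are
  handled as periodic subsets of the whole space, where the topology and Lebesgue measure of the euclidean
  space apply.\<close>

definition periodic_box :: "real \<Rightarrow> (real^'n) set" where
  "periodic_box \<delta> = {x. \<forall>k. 0 < frac (x $ k) \<and> frac (x $ k) < \<delta>}"

lemma frac_between:
  assumes "\<delta> \<le> 1" "of_int z < t" "t < of_int z + \<delta>" shows "frac t = t - of_int z"
proof -
  have "\<lfloor>t\<rfloor> = z" using assms by (intro floor_unique) auto
  then show ?thesis by (simp add: frac_def)
qed

lemma open_periodic_box:
  assumes "\<delta> \<le> 1" shows "open (periodic_box \<delta> :: (real^'n::finite) set)"
proof -
  have "{t::real. 0 < frac t \<and> frac t < \<delta>} = (\<Union>z::int. {of_int z<..<of_int z + \<delta>})"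
  proof (intro set_eqI iffI)
    fix t :: real assume "t \<in> {t. 0 < frac t \<and> frac t < \<delta>}"
    then have "t \<in> {of_int \<lfloor>t\<rfloor><..<of_int \<lfloor>t\<rfloor> + \<delta>}" by (auto simp: frac_def)
    then show "t \<in> (\<Union>z::int. {of_int z<..<of_int z + \<delta>})" by blast
  next
    fix t :: real assume "t \<in> (\<Union>z::int. {of_int z<..<of_int z + \<delta>})"
    then show "t \<in> {t. 0 < frac t \<and> frac t < \<delta>}" using frac_between[OF assms] by (auto simp del: frac_gt_0_iff)
  qed
  then have 1: "open {t::real. 0 < frac t \<and> frac t < \<delta>}" by auto
  have "periodic_box \<delta> = (\<Inter>k\<in>UNIV. (\<lambda>x::real^'n. x $ k) -` {t. 0 < frac t \<and> frac t < \<delta>})"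
    by (auto simp: periodic_box_def)
  moreover have "open \<dots>"
    by (intro open_INT ballI open_vimage 1 continuous_intros) auto
  ultimately show ?thesis by simp
qed

lemma frac_add_1: "frac (t + 1) = frac (t :: real)"
  by (simp add: frac_def)

lemma periodic_box_shift: "x + axis k 1 \<in> periodic_box \<delta> \<longleftrightarrow> x \<in> (periodic_box \<delta> :: (real^'n::finite) set)"
proof -
  have "frac ((x + axis k 1) $ i) = frac (x $ i)" for i by (simp add: axis_def frac_add_1)
  then show ?thesis unfolding periodic_box_def mem_Collect_eq by (simp only:)
qed

text \<open>A Lipschitz minorant of the indicator of the periodic box. It is a continuous function on the
  torus, so its integrals are continuous for the weak topology, and it increases to the indicator with m.\<close>

definition bump :: "real \<Rightarrow> nat \<Rightarrow> real^'n \<Rightarrow> real" where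
  "bump \<delta> m x = min 1 (real m * infdist x (- periodic_box \<delta>))"

lemma zero_notin_periodic_box: "0 \<notin> (periodic_box \<delta> :: (real^'n::finite) set)"
  by (simp add: periodic_box_def)

lemma bump_range: "0 \<le> bump \<delta> m x" "bump \<delta> m x \<le> 1"
  by (auto simp: bump_def infdist_nonneg)

lemma bump_le_indicator: "bump \<delta> m x \<le> indicator (periodic_box \<delta>) x"
  using bump_range[of \<delta> m x] by (cases "x \<in> periodic_box \<delta>") (auto simp: bump_def)

lemma infdist_translate_le:
  fixes S :: "'a::real_normed_vector set"
  assumes "\<And>a. a \<in> S \<Longrightarrow> a + v \<in> S" shows "infdist (x + v) S \<le> infdist x S"
proof (cases "S = {}")
  case False
  show ?thesis unfolding infdist_notempty[OF False, of x]
  proof (rule cINF_greatest[OF False])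
    fix a assume "a \<in> S"
    then have "infdist (x + v) S \<le> dist (x + v) (a + v)" by (intro infdist_le assms)
    then show "infdist (x + v) S \<le> dist x a" by simp
  qed
qed (simp add: infdist_def)

lemma bump_periodic: "bump \<delta> m (x + axis k 1) = bump \<delta> m (x :: real^'n::finite)"
proof -
  let ?S = "- periodic_box \<delta> :: (real^'n) set"
  have "infdist (x + axis k 1) ?S \<le> infdist x ?S"
    by (rule infdist_translate_le) (simp add: periodic_box_shift)
  moreover have "infdist ((x + axis k 1) + - axis k 1) ?S \<le> infdist (x + axis k 1) ?S"
    using periodic_box_shift[of "_ - axis k 1" k \<delta>] by (intro infdist_translate_le) simp
  ultimately show ?thesis by (simp add: bump_def)
qed

lemma bump_lipschitz: "\<bar>bump \<delta> m x - bump \<delta> m y\<bar> \<le> real m * dist x y"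
proof -
  let ?S = "- periodic_box \<delta>"
  have "\<bar>infdist x ?S - infdist y ?S\<bar> \<le> dist x y"
    using infdist_triangle[of x ?S y] infdist_triangle[of y ?S x] by (simp add: dist_commute abs_le_iff)
  then have "real m * \<bar>infdist x ?S - infdist y ?S\<bar> \<le> real m * dist x y" by (intro mult_left_mono) auto
  then have "\<bar>real m * infdist x ?S - real m * infdist y ?S\<bar> \<le> real m * dist x y"
    by (simp add: right_diff_distrib[symmetric] abs_mult)
  then show ?thesis unfolding bump_def by linarith
qed

lemma bump_continuous: "continuous_on A (bump \<delta> m)"
  unfolding bump_def by (intro continuous_intros)

lemma bump_C_torus: "(\<lambda>u. bump \<delta> m (u - x)) \<in> C_torus"
proof -
  have "continuous_on UNIV (\<lambda>u. bump \<delta> m (u - x))"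
    by (rule continuous_on_compose2[OF bump_continuous[of UNIV]]) (auto intro!: continuous_intros)
  moreover have "bump \<delta> m (u + axis k 1 - x) = bump \<delta> m (u - x)" for u k
    using bump_periodic[of \<delta> m "u - x" k] by (simp add: algebra_simps)
  ultimately show ?thesis by (simp add: C_torus_def periodic_def)
qed

text \<open>The box is open, so each of its points has a positive distance to the complement.\<close>

lemma bump_limit:
  assumes "\<delta> \<le> 1" shows "(\<lambda>m. bump \<delta> m (x :: real^'n::finite)) \<longlonglongrightarrow> indicator (periodic_box \<delta>) x"
proof (cases "x \<in> periodic_box \<delta>")
  case True
  have c: "closed (- periodic_box \<delta> :: (real^'n) set)" using open_periodic_box[OF assms] by (rule closed_Compl)
  have ne: "- periodic_box \<delta> \<noteq> ({} :: (real^'n) set)" using zero_notin_periodic_box by auto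
  let ?d = "infdist x (- periodic_box \<delta>)"
  have d: "?d > 0" using infdist_pos_not_in_closed[OF c ne] True by auto
  obtain M where M: "real M * ?d > 1" using reals_Archimedean3[OF d] by blast
  have "bump \<delta> m x = 1" if "m \<ge> M" for m
  proof -
    have "real M * ?d \<le> real m * ?d" using that d by (intro mult_right_mono) auto
    then show ?thesis using M by (simp add: bump_def)
  qed
  then show ?thesis using True by (intro tendsto_eventually) (auto simp: eventually_sequentially)
next
  case False
  then have "bump \<delta> m x = 0" for m using bump_le_indicator[of \<delta> m x] bump_range[of \<delta> m x] by auto
  then show ?thesis using False by simp
qed

text \<open>By translation invariance v may be taken to be 0; the reflected box meets the unit cube in a
  cube with side \<delta>.\<close>

lemma bump_integral:
  assumes "0 < \<delta>" "\<delta> \<le> 1"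
  shows "(\<integral>\<^sup>+x. ennreal (bump \<delta> m (v - x)) \<partial>(torus_lebesgue :: (real^'n::finite) measure)) \<le> ennreal (\<delta> ^ CARD('n))"
proof -
  let ?f = "\<lambda>x::real^'n. ennreal (bump \<delta> m (- x))"
  have f: "?f \<in> borel_measurable borel"
  proof -
    have "(\<lambda>x. bump \<delta> m (- x)) \<in> borel_measurable (borel :: (real^'n) measure)"
      by (intro borel_measurable_continuous_onI continuous_on_compose2[OF bump_continuous[of UNIV]] continuous_intros) auto
    then show ?thesis by measurable
  qed
  have per: "?f (x + axis k 1) = ?f x" for x k
    using bump_periodic[of \<delta> m "- x - axis k 1" k] by (simp add: algebra_simps)
  have "(\<integral>\<^sup>+x. ennreal (bump \<delta> m (v - x)) \<partial>torus_lebesgue) = (\<integral>\<^sup>+x. ?f (x + (- v)) \<partial>torus_lebesgue)" by simp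
  also have "\<dots> = (\<integral>\<^sup>+x. ?f x \<partial>torus_lebesgue)" by (rule nn_integral_torus_translate[OF f per])
  also have "\<dots> \<le> (\<integral>\<^sup>+x. indicator (box ((1 - \<delta>) *\<^sub>R One) ((1 - \<delta>) *\<^sub>R One + \<delta> *\<^sub>R One)) x \<partial>(lborel :: (real^'n) measure))"
    unfolding nn_integral_torus
  proof (rule nn_integral_mono)
    fix x :: "real^'n"
    show "ennreal (bump \<delta> m (- x)) * indicator torus x \<le> indicator (box ((1 - \<delta>) *\<^sub>R One) ((1 - \<delta>) *\<^sub>R One + \<delta> *\<^sub>R One)) x"
    proof (cases "x \<in> torus \<and> - x \<in> periodic_box \<delta>")
      case True
      have "1 - \<delta> < x $ k \<and> x $ k < 1" for k
      proof -
        have t: "0 \<le> x $ k" "x $ k < 1" using True by (auto simp: torus_def)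
        have fr: "0 < frac (- x $ k)" "frac (- x $ k) < \<delta>" using True by (auto simp: periodic_box_def)
        have "x $ k \<noteq> 0" using fr by auto
        then have "\<lfloor>- x $ k\<rfloor> = -1" using t by (intro floor_unique) auto
        then show ?thesis using fr t by (simp add: frac_def)
      qed
      then have "x \<in> box ((1 - \<delta>) *\<^sub>R One) ((1 - \<delta>) *\<^sub>R One + \<delta> *\<^sub>R One)"
        by (auto simp: mem_box_cart One_vec_nth)
      then show ?thesis using bump_range[of \<delta> m "-x"] by (auto simp: indicator_def)
    next
      case False
      then show ?thesis using bump_le_indicator[of \<delta> m "- x"] by (auto simp: indicator_def ennreal_eq_0_iff)
    qed
  qed
  also have "\<dots> = ennreal (\<delta> ^ CARD('n))" using assms emeasure_lborel_cube[of \<delta> "(1 - \<delta>) *\<^sub>R One :: real^'n"] by simp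
  finally show ?thesis .
qed

text \<open>The map i \<mapsto> \<lfloor>N frac(i/N - x)\<rfloor> is injective on {0,...,N-1}, and on the
  points that are counted its values are at most \<lfloor>\<delta>N\<rfloor>.\<close>

lemma lattice_count_line:
  assumes N: "N \<ge> 1" and \<delta>: "\<delta> > 0"
  shows "real (card {i. i < N \<and> 0 < frac (real i / real N - x) \<and> frac (real i / real N - x) < \<delta>}) \<le> \<delta> * real N + 1"
    (is "real (card ?A) \<le> _")
proof -
  let ?f = "\<lambda>i::nat. nat \<lfloor>real N * frac (real i / real N - x)\<rfloor>"
  have "inj_on ?f ?A"
  proof (rule inj_onI)
    fix i i' assume i: "i \<in> ?A" "i' \<in> ?A" and eq: "?f i = ?f i'"
    have e: "real N * frac (real i / real N - x) = real i - real N * x - of_int (int N * \<lfloor>real i / real N - x\<rfloor>)" for i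
      using N by (simp add: frac_def right_diff_distrib)
    define z where "z = (int i - int N * \<lfloor>real i / real N - x\<rfloor>) - (int i' - int N * \<lfloor>real i' / real N - x\<rfloor>)"
    have "real N * frac (real i / real N - x) - real N * frac (real i' / real N - x) = of_int z"
      unfolding e z_def by simp
    moreover have "\<lfloor>real N * frac (real i / real N - x)\<rfloor> = \<lfloor>real N * frac (real i' / real N - x)\<rfloor>"
      using eq by (simp add: nat_eq_iff split: if_splits)
    ultimately have "\<bar>of_int z :: real\<bar> < 1" by linarith
    then have "z = 0" by linarith
    then have "int i - int i' = int N * (\<lfloor>real i / real N - x\<rfloor> - \<lfloor>real i' / real N - x\<rfloor>)"
      by (simp add: z_def algebra_simps)
    then have "int N dvd int i - int i'" by simp
    moreover have "\<bar>int i - int i'\<bar> < int N" using i by auto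
    ultimately have "int i - int i' = 0" using zdvd_imp_le[of "int N" "\<bar>int i - int i'\<bar>"] by (cases "i = i'") auto
    then show "i = i'" by simp
  qed
  moreover have "?f ` ?A \<subseteq> {..nat \<lfloor>\<delta> * real N\<rfloor>}"
  proof
    fix z assume "z \<in> ?f ` ?A"
    then obtain i where i: "i \<in> ?A" "z = ?f i" by blast
    have "real N * frac (real i / real N - x) \<le> \<delta> * real N"
      using i mult_right_mono[of "frac (real i / real N - x)" \<delta> "real N"] by (simp add: mult.commute)
    then have "?f i \<le> nat \<lfloor>\<delta> * real N\<rfloor>" by (intro nat_mono floor_mono)
    then show "z \<in> {..nat \<lfloor>\<delta> * real N\<rfloor>}" using i(2) by (simp only: atMost_iff)
  qed
  ultimately have "card ?A \<le> card {..nat \<lfloor>\<delta> * real N\<rfloor>}" by (intro card_inj_on_le) auto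
  then have "real (card ?A) \<le> real (nat \<lfloor>\<delta> * real N\<rfloor>) + 1" by simp
  also have "real (nat \<lfloor>\<delta> * real N\<rfloor>) \<le> \<delta> * real N" using \<delta> by (intro of_nat_floor) auto
  finally show ?thesis by simp
qed

lemma lattice_count:
  assumes N: "N \<ge> 1" and \<delta>: "\<delta> > 0"
  shows "real (card {y \<in> sites N. scaled_site N y - x \<in> (periodic_box \<delta> :: (real^'n::finite) set)}) \<le> (\<delta> * real N + 1) ^ CARD('n)"
proof -
  let ?A = "\<lambda>k. {i. i < N \<and> 0 < frac (real i / real N - x $ k) \<and> frac (real i / real N - x $ k) < \<delta>}"
  have eq: "{y \<in> sites N. scaled_site N y - x \<in> periodic_box \<delta>} = Pi\<^sub>E (UNIV :: 'n set) ?A"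
    by (auto simp: sites_def periodic_box_def scaled_site_def PiE_def Pi_def)
  have "real (card {y \<in> sites N. scaled_site N y - x \<in> periodic_box \<delta>}) = (\<Prod>k\<in>UNIV. real (card (?A k)))"
    unfolding eq by (simp add: card_PiE)
  also have "\<dots> \<le> (\<Prod>k\<in>(UNIV::'n set). \<delta> * real N + 1)"
    by (intro prod_mono conjI lattice_count_line[OF N \<delta>]) auto
  finally show ?thesis by simp
qed

section \<open>Mesoscopic gradients and the Dirichlet form\<close>

text \<open>Integration by parts over a single bond: \<sigma> is the exchange, g the gradient across the
  bond, which \<sigma> reverses, and G an observable that \<sigma> changes by at most r. The mean of the sum
  and of its image under \<sigma> contains the difference of q across the bond, and Young's inequality with
  parameter \<alpha> splits it from G.\<close>

lemma bond_estimate: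
  fixes G g q :: "'s \<Rightarrow> real"
  assumes maps: "\<And>\<eta>. \<eta> \<in> S \<Longrightarrow> \<sigma> \<eta> \<in> S" and invol: "\<And>\<eta>. \<eta> \<in> S \<Longrightarrow> \<sigma> (\<sigma> \<eta>) = \<eta>"
    and q: "\<And>\<eta>. \<eta> \<in> S \<Longrightarrow> 0 < q \<eta>" and g1: "\<And>\<eta>. \<eta> \<in> S \<Longrightarrow> \<bar>g \<eta>\<bar> \<le> 1"
    and anti: "\<And>\<eta>. \<eta> \<in> S \<Longrightarrow> g (\<sigma> \<eta>) = - g \<eta>"
    and G: "\<And>\<eta>. \<eta> \<in> S \<Longrightarrow> \<bar>G (\<sigma> \<eta>) - G \<eta>\<bar> \<le> r" and \<alpha>: "\<alpha> > 0"
  shows "(\<Sum>\<eta>\<in>S. G \<eta> * g \<eta> * q \<eta>) \<le>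
    (\<alpha> * (3 * (\<Sum>\<eta>\<in>S. (G \<eta>)\<^sup>2 * q \<eta>) + 2 * r\<^sup>2 * (\<Sum>\<eta>\<in>S. q \<eta>))
      + (\<Sum>\<eta>\<in>S. (q (\<sigma> \<eta>) - q \<eta>)\<^sup>2 / (q (\<sigma> \<eta>) + q \<eta>)) / (4 * \<alpha>) + r * (\<Sum>\<eta>\<in>S. q \<eta>)) / 2"
proof -
  have move: "(\<Sum>\<eta>\<in>S. F (\<sigma> \<eta>)) = (\<Sum>\<eta>\<in>S. F \<eta>)" for F :: "'s \<Rightarrow> real"
    by (rule sum.reindex_bij_witness[where i = \<sigma> and j = \<sigma>]) (auto simp: maps invol)
  let ?A = "\<Sum>\<eta>\<in>S. G \<eta> * g \<eta> * q \<eta>"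
  have "?A = (\<Sum>\<eta>\<in>S. G (\<sigma> \<eta>) * g (\<sigma> \<eta>) * q (\<sigma> \<eta>))" by (rule move[symmetric])
  also have "\<dots> = - (\<Sum>\<eta>\<in>S. G (\<sigma> \<eta>) * g \<eta> * q (\<sigma> \<eta>))"
    unfolding sum_negf[symmetric] by (intro sum.cong) (auto simp: anti)
  finally have "2 * ?A = (\<Sum>\<eta>\<in>S. g \<eta> * (G \<eta> * q \<eta> - G (\<sigma> \<eta>) * q (\<sigma> \<eta>)))"
    by (simp add: algebra_simps sum_subtractf)
  also have "\<dots> \<le> (\<Sum>\<eta>\<in>S. \<alpha> * ((G \<eta>)\<^sup>2 * q \<eta> + (2 * (G (\<sigma> \<eta>))\<^sup>2 + 2 * r\<^sup>2) * q (\<sigma> \<eta>))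
      + (q (\<sigma> \<eta>) - q \<eta>)\<^sup>2 / (q (\<sigma> \<eta>) + q \<eta>) / (4 * \<alpha>) + r * q (\<sigma> \<eta>))"
  proof (rule sum_mono)
    fix \<eta> assume \<eta>: "\<eta> \<in> S"
    let ?p = "q (\<sigma> \<eta>)" and ?q = "q \<eta>" and ?H = "G (\<sigma> \<eta>)" and ?G = "G \<eta>"
    have pos: "?p > 0" "?q > 0" using q maps \<eta> by auto
    have r: "\<bar>?G - ?H\<bar> \<le> r" using G[OF \<eta>] by linarith
    have "g \<eta> * (?G * ?q - ?H * ?p) \<le> \<bar>g \<eta>\<bar> * \<bar>?G * ?q - ?H * ?p\<bar>" by (metis abs_ge_self abs_mult)
    also have "\<dots> \<le> 1 * \<bar>?G * ?q - ?H * ?p\<bar>" by (intro mult_right_mono g1 \<eta>) auto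
    also have "1 * \<bar>?G * ?q - ?H * ?p\<bar> = \<bar>?G * (?q - ?p) + (?G - ?H) * ?p\<bar>" by (simp add: algebra_simps)
    also have "\<dots> \<le> \<bar>?G\<bar> * \<bar>?p - ?q\<bar> + r * ?p"
    proof -
      have 1: "\<bar>?G - ?H\<bar> * ?p \<le> r * ?p" using r pos by (intro mult_right_mono) auto
      have 2: "\<bar>?G * (?q - ?p)\<bar> = \<bar>?G\<bar> * \<bar>?p - ?q\<bar>" "\<bar>(?G - ?H) * ?p\<bar> = \<bar>?G - ?H\<bar> * ?p"
        using pos by (simp_all add: abs_mult abs_minus_commute)
      show ?thesis using abs_triangle_ineq[of "?G * (?q - ?p)" "(?G - ?H) * ?p"] 1 unfolding 2 by linarith
    qed
    also have "\<bar>?G\<bar> * \<bar>?p - ?q\<bar> \<le> \<alpha> * ?G\<^sup>2 * (?p + ?q) + (?p - ?q)\<^sup>2 / (?p + ?q) / (4 * \<alpha>)"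
    proof -
      have "0 \<le> (2 * \<alpha> * \<bar>?G\<bar> * (?p + ?q) - \<bar>?p - ?q\<bar>)\<^sup>2" by simp
      also have "\<dots> = 4 * \<alpha>\<^sup>2 * ?G\<^sup>2 * (?p + ?q)\<^sup>2 + (?p - ?q)\<^sup>2 - 4 * \<alpha> * (?p + ?q) * (\<bar>?G\<bar> * \<bar>?p - ?q\<bar>)"
        by (simp add: power2_diff power_mult_distrib mult_ac) (simp add: power2_eq_square algebra_simps)
      finally have "\<bar>?G\<bar> * \<bar>?p - ?q\<bar> \<le> (4 * \<alpha>\<^sup>2 * ?G\<^sup>2 * (?p + ?q)\<^sup>2 + (?p - ?q)\<^sup>2) / (4 * \<alpha> * (?p + ?q))"
        using \<alpha> pos by (subst pos_le_divide_eq) (auto simp: mult_ac)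
      also have "\<dots> = \<alpha> * ?G\<^sup>2 * (?p + ?q) + (?p - ?q)\<^sup>2 / (?p + ?q) / (4 * \<alpha>)"
        using \<alpha> pos by (simp add: add_divide_distrib power2_eq_square)
      finally show ?thesis .
    qed
    also have "\<alpha> * ?G\<^sup>2 * (?p + ?q) \<le> \<alpha> * (?G\<^sup>2 * ?q + (2 * ?H\<^sup>2 + 2 * r\<^sup>2) * ?p)"
    proof -
      have "?G\<^sup>2 \<le> 2 * ?H\<^sup>2 + 2 * (?G - ?H)\<^sup>2"
        using zero_le_power2[of "2 * ?H - ?G"] by (simp add: power2_eq_square algebra_simps)
      also have "(?G - ?H)\<^sup>2 \<le> r\<^sup>2" using r by (metis abs_ge_zero power2_abs power_mono)
      finally have "?G\<^sup>2 * ?p \<le> (2 * ?H\<^sup>2 + 2 * r\<^sup>2) * ?p" using pos by (intro mult_right_mono) auto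
      then have "\<alpha> * (?G\<^sup>2 * ?p) \<le> \<alpha> * ((2 * ?H\<^sup>2 + 2 * r\<^sup>2) * ?p)" using \<alpha> by (intro mult_left_mono) auto
      then show ?thesis by (simp add: algebra_simps)
    qed
    finally show "g \<eta> * (?G * ?q - ?H * ?p) \<le> \<alpha> * (?G\<^sup>2 * ?q + (2 * ?H\<^sup>2 + 2 * r\<^sup>2) * ?p)
      + (?p - ?q)\<^sup>2 / (?p + ?q) / (4 * \<alpha>) + r * ?p" by simp
  qed
  also have "\<dots> = \<alpha> * ((\<Sum>\<eta>\<in>S. (G \<eta>)\<^sup>2 * q \<eta>) + (\<Sum>\<eta>\<in>S. (2 * (G (\<sigma> \<eta>))\<^sup>2 + 2 * r\<^sup>2) * q (\<sigma> \<eta>)))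
      + (\<Sum>\<eta>\<in>S. (q (\<sigma> \<eta>) - q \<eta>)\<^sup>2 / (q (\<sigma> \<eta>) + q \<eta>)) / (4 * \<alpha>) + r * (\<Sum>\<eta>\<in>S. q (\<sigma> \<eta>))"
    by (simp only: sum.distrib sum_distrib_left[symmetric] sum_divide_distrib[symmetric])
  also have "(\<Sum>\<eta>\<in>S. (2 * (G (\<sigma> \<eta>))\<^sup>2 + 2 * r\<^sup>2) * q (\<sigma> \<eta>)) = (\<Sum>\<eta>\<in>S. (2 * (G \<eta>)\<^sup>2 + 2 * r\<^sup>2) * q \<eta>)"
    by (rule move)
  also have "\<dots> = 2 * (\<Sum>\<eta>\<in>S. (G \<eta>)\<^sup>2 * q \<eta>) + 2 * r\<^sup>2 * (\<Sum>\<eta>\<in>S. q \<eta>)"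
    by (simp add: algebra_simps sum.distrib sum_distrib_left sum_distrib_right)
  also have "(\<Sum>\<eta>\<in>S. q (\<sigma> \<eta>)) = (\<Sum>\<eta>\<in>S. q \<eta>)" by (rule move)
  finally show ?thesis by (simp add: algebra_simps)
qed

lemma sum_shift:
  assumes N: "N \<ge> 1" shows "(\<Sum>y\<in>sites N. f (shift N j m y)) = (\<Sum>y\<in>sites N. f y)"
  by (rule sum.reindex_bij_witness[where i = "shift N j (-m)" and j = "shift N j m"])
     (auto simp: shift_shift[OF N] shift_0 shift_in_sites[OF N])

text \<open>The normalisation is the number of sites and not the sum of the weights \<kappa>, so that
  gradient_average is close to the integral of a test function against the empirical measure
  (shift_difference_approx).\<close>

definition gradient_average :: "nat \<Rightarrow> 'n::finite \<Rightarrow> nat \<Rightarrow> ('n site \<Rightarrow> real) \<Rightarrow> 'n config \<Rightarrow> real" where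
  "gradient_average N j l \<kappa> \<eta> =
     (\<Sum>y\<in>sites N. \<kappa> y * (real (\<eta> (shift N j (int l) y)) - real (\<eta> y))) / real N ^ CARD('n)"

text \<open>An exchange modifies the configuration at two sites, and each site occurs in two terms of the
  sum.\<close>

lemma gradient_average_exchange:
  fixes \<kappa> :: "'n::finite site \<Rightarrow> real"
  assumes N: "N \<ge> 1" and \<kappa>: "\<And>y. y \<in> sites N \<Longrightarrow> 0 \<le> \<kappa> y \<and> \<kappa> y \<le> 1" and \<eta>: "\<eta> \<in> configs N"
    and u: "u \<in> sites N" and v: "v \<in> sites N"
  shows "\<bar>gradient_average N j l \<kappa> (exchange u v \<eta>) - gradient_average N j l \<kappa> \<eta>\<bar> \<le> 4 / real N ^ CARD('n)"
proof -
  let ?e = "exchange u v \<eta>"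
  let ?b = "\<lambda>y. (if y = u then 1 else 0) + (if y = v then 1 else 0) :: real"
  have d: "\<bar>real (?e y) - real (\<eta> y)\<bar> \<le> ?b y" if "y \<in> sites N" for y
    using config_value[OF \<eta> u] config_value[OF \<eta> v] by (auto simp: exchange_def)
  have "\<bar>\<Sum>y\<in>sites N. \<kappa> y * ((real (?e (shift N j (int l) y)) - real (\<eta> (shift N j (int l) y))) - (real (?e y) - real (\<eta> y)))\<bar>
     \<le> (\<Sum>y\<in>sites N. 1 * (?b (shift N j (int l) y) + ?b y))"
  proof (rule order_trans[OF sum_abs], rule sum_mono)
    fix y :: "'n site" assume y: "y \<in> sites N"
    have "\<bar>\<kappa> y * ((real (?e (shift N j (int l) y)) - real (\<eta> (shift N j (int l) y))) - (real (?e y) - real (\<eta> y)))\<bar>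
      = \<kappa> y * \<bar>(real (?e (shift N j (int l) y)) - real (\<eta> (shift N j (int l) y))) - (real (?e y) - real (\<eta> y))\<bar>"
      using \<kappa>[OF y] by (simp add: abs_mult)
    also have "\<dots> \<le> 1 * (?b (shift N j (int l) y) + ?b y)"
      using d[OF y] d[OF shift_in_sites[OF N y, of j "int l"]] \<kappa>[OF y]
      by (intro mult_mono) auto
    finally show "\<bar>\<kappa> y * ((real (?e (shift N j (int l) y)) - real (\<eta> (shift N j (int l) y))) - (real (?e y) - real (\<eta> y)))\<bar> \<le> \<dots>" .
  qed
  also have "\<dots> = 4"
    using u v by (simp add: sum.distrib sum_shift[OF N, of ?b] sum_shift[OF N, of "\<lambda>y. if y = u then 1 else 0"]
        sum_shift[OF N, of "\<lambda>y. if y = v then 1 else 0"] finite_sites)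
  finally have "\<bar>\<Sum>y\<in>sites N. \<kappa> y * ((real (?e (shift N j (int l) y)) - real (\<eta> (shift N j (int l) y))) - (real (?e y) - real (\<eta> y)))\<bar> \<le> 4" .
  moreover have "gradient_average N j l \<kappa> ?e - gradient_average N j l \<kappa> \<eta> =
    (\<Sum>y\<in>sites N. \<kappa> y * ((real (?e (shift N j (int l) y)) - real (\<eta> (shift N j (int l) y))) - (real (?e y) - real (\<eta> y)))) / real N ^ CARD('n)"
    unfolding gradient_average_def diff_divide_distrib[symmetric] sum_subtractf[symmetric]
    by (simp add: algebra_simps)
  ultimately show ?thesis by (simp add: divide_right_mono)
qed

text \<open>One factor of the square is written as a telescoping sum over the l bonds between y and y + l
  e_j, and bond_estimate is applied to every bond with a Young parameter \<alpha> proportional to its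
  resistance 1/\<xi>. The resistances add up to at most N S, so that the second moment reappears on the
  right with the coefficient 1/2 and can be absorbed into the left-hand side.\<close>

lemma gradient_average_estimate:
  fixes \<kappa> :: "'n::finite site \<Rightarrow> real" and q :: "'n config \<Rightarrow> real"
  assumes N: "N \<ge> 1" and q: "\<And>\<eta>. \<eta> \<in> configs N \<Longrightarrow> 0 < q \<eta>" and q2: "(\<Sum>\<eta>\<in>configs N. q \<eta>) = 2"
    and \<kappa>: "\<And>y. y \<in> sites N \<Longrightarrow> 0 \<le> \<kappa> y \<and> \<kappa> y \<le> 1"
    and K: "K > 0" "(\<Sum>y\<in>sites N. \<kappa> y) / real N ^ CARD('n) \<le> K"
    and \<xi>: "\<And>y. 0 < conductance W N j y" and S: "S > 0"
    and res: "\<And>y. y \<in> sites N \<Longrightarrow> \<kappa> y \<noteq> 0 \<Longrightarrow> (\<Sum>i<l. 1 / conductance W N j (shift N j (int i) y)) \<le> real N * S"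
  defines "r \<equiv> 4 / real N ^ CARD('n)"
  shows "(\<Sum>\<eta>\<in>configs N. (gradient_average N j l \<kappa> \<eta>)\<^sup>2 * q \<eta>) \<le> 4/3 * r\<^sup>2 + 2 * K * real l * r + 3/4 * K * real N * S *
    ((\<Sum>y\<in>sites N. \<kappa> y * (\<Sum>i<l. conductance W N j (shift N j (int i) y) * bond_energy N j (shift N j (int i) y) q)) / real N ^ CARD('n))"
proof -
  let ?G = "gradient_average N j l \<kappa>" and ?s = "\<lambda>i y. shift N j (int i) y" and ?n = "real N ^ CARD('n)"
  let ?\<xi> = "\<lambda>i y. conductance W N j (?s i y)" and ?D = "\<lambda>i y. bond_energy N j (?s i y) q"
  define E where "E = (\<Sum>\<eta>\<in>configs N. (?G \<eta>)\<^sup>2 * q \<eta>)"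
  have E0: "E \<ge> 0" unfolding E_def using q by (intro sum_nonneg mult_nonneg_nonneg) (auto simp: less_imp_le)
  have r0: "r > 0" using N by (simp add: r_def)
  have n0: "?n > 0" using N by simp
  have sites: "?s i y \<in> sites N" if "y \<in> sites N" for i y using shift_in_sites[OF N that] .
  have suc: "?s (Suc i) y = shift N j 1 (?s i y)" for i y
    by (simp add: shift_shift[OF N] add.commute)
  have tele: "?G \<eta> = (\<Sum>y\<in>sites N. \<Sum>i<l. \<kappa> y / ?n * (real (\<eta> (?s (Suc i) y)) - real (\<eta> (?s i y))))" for \<eta>
    unfolding gradient_average_def sum_divide_distrib sum_distrib_left[symmetric] sum_lessThan_telescope[of "\<lambda>i. real (\<eta> (?s i _))"]
    by (intro sum.cong) (auto simp: shift_0)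
  have "E = (\<Sum>\<eta>\<in>configs N. ?G \<eta> * (\<Sum>y\<in>sites N. \<Sum>i<l. \<kappa> y / ?n * (real (\<eta> (?s (Suc i) y)) - real (\<eta> (?s i y)))) * q \<eta>)"
    unfolding E_def by (intro sum.cong refl) (simp only: power2_eq_square tele[symmetric])
  also have "\<dots> = (\<Sum>y\<in>sites N. \<Sum>i<l. \<kappa> y / ?n * (\<Sum>\<eta>\<in>configs N. ?G \<eta> * (real (\<eta> (?s (Suc i) y)) - real (\<eta> (?s i y))) * q \<eta>))"
    unfolding sum_distrib_left sum_distrib_right
    by (subst sum.swap, intro sum.cong refl, subst sum.swap, intro sum.cong refl) (simp add: mult_ac)
  also have "\<dots> \<le> (\<Sum>y\<in>sites N. \<Sum>i<l. \<kappa> y / ?n * ((1 / (3 * K * ?\<xi> i y * real N * S) * (3 * E + 4 * r\<^sup>2)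
        + 3 * K * ?\<xi> i y * real N * S * ?D i y / 4) / 2 + r))"
  proof (intro sum_mono mult_left_mono)
    fix y :: "'n site" and i assume y: "y \<in> sites N"
    \<comment> \<open>The coefficient 3 of the second moment in bond_estimate, the total weight K and the
      total resistance N S are compensated by this choice, up to the factor 1/2.\<close>
    let ?\<alpha> = "1 / (3 * K * ?\<xi> i y * real N * S)"
    have \<alpha>: "?\<alpha> > 0" using K \<xi> N S by simp
    have "(\<Sum>\<eta>\<in>configs N. ?G \<eta> * (real (\<eta> (?s (Suc i) y)) - real (\<eta> (?s i y))) * q \<eta>) \<le>
     (?\<alpha> * (3 * (\<Sum>\<eta>\<in>configs N. (?G \<eta>)\<^sup>2 * q \<eta>) + 2 * r\<^sup>2 * (\<Sum>\<eta>\<in>configs N. q \<eta>))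
      + (\<Sum>\<eta>\<in>configs N. (q (exchange (?s i y) (?s (Suc i) y) \<eta>) - q \<eta>)\<^sup>2 / (q (exchange (?s i y) (?s (Suc i) y) \<eta>) + q \<eta>)) / (4 * ?\<alpha>)
      + r * (\<Sum>\<eta>\<in>configs N. q \<eta>)) / 2"
    proof (rule bond_estimate[OF _ _ _ _ _ _ \<alpha>])
      fix \<eta> :: "'n config" assume \<eta>: "\<eta> \<in> configs N"
      show "exchange (?s i y) (?s (Suc i) y) \<eta> \<in> configs N" by (intro exchange_in_configs \<eta> sites y)
      show "\<bar>real (\<eta> (?s (Suc i) y)) - real (\<eta> (?s i y))\<bar> \<le> 1"
        using config_value[OF \<eta> sites[OF y, of i]] config_value[OF \<eta> sites[OF y, of "Suc i"]] by auto
      show "\<bar>?G (exchange (?s i y) (?s (Suc i) y) \<eta>) - ?G \<eta>\<bar> \<le> r"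
        unfolding r_def by (intro gradient_average_exchange N \<kappa> \<eta> sites y)
    qed (auto simp: exchange_exchange q, auto simp: exchange_def)
    also have "\<dots> = (?\<alpha> * (3 * E + 4 * r\<^sup>2) + 3 * K * ?\<xi> i y * real N * S * ?D i y / 4) / 2 + r"
      unfolding q2 E_def[symmetric] suc bond_energy_def by simp
    finally show "(\<Sum>\<eta>\<in>configs N. ?G \<eta> * (real (\<eta> (?s (Suc i) y)) - real (\<eta> (?s i y))) * q \<eta>) \<le> \<dots>" .
    show "0 \<le> \<kappa> y / ?n" using \<kappa>[OF y] n0 by simp
  qed
  also have "\<dots> \<le> (\<Sum>y\<in>sites N. \<kappa> y / ?n * ((3 * E + 4 * r\<^sup>2) / (6 * K) + real l * r
        + 3/8 * K * real N * S * (\<Sum>i<l. ?\<xi> i y * ?D i y)))"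
  proof (rule sum_mono)
    fix y :: "'n site" assume y: "y \<in> sites N"
    show "(\<Sum>i<l. \<kappa> y / ?n * ((1 / (3 * K * ?\<xi> i y * real N * S) * (3 * E + 4 * r\<^sup>2)
        + 3 * K * ?\<xi> i y * real N * S * ?D i y / 4) / 2 + r)) \<le>
      \<kappa> y / ?n * ((3 * E + 4 * r\<^sup>2) / (6 * K) + real l * r + 3/8 * K * real N * S * (\<Sum>i<l. ?\<xi> i y * ?D i y))"
    proof (cases "\<kappa> y = 0")
      case False
      have "(\<Sum>i<l. (1 / (3 * K * ?\<xi> i y * real N * S) * (3 * E + 4 * r\<^sup>2)
          + 3 * K * ?\<xi> i y * real N * S * ?D i y / 4) / 2 + r)
        = (\<Sum>i<l. 1 / ?\<xi> i y) * ((3 * E + 4 * r\<^sup>2) / (6 * K * real N * S)) + real l * r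
           + 3/8 * K * real N * S * (\<Sum>i<l. ?\<xi> i y * ?D i y)"
        by (simp add: sum.distrib sum_distrib_left sum_distrib_right add_divide_distrib mult_ac)
      also have "(\<Sum>i<l. 1 / ?\<xi> i y) * ((3 * E + 4 * r\<^sup>2) / (6 * K * real N * S)) \<le>
        (real N * S) * ((3 * E + 4 * r\<^sup>2) / (6 * K * real N * S))"
        using E0 K N S by (intro mult_right_mono res y False) auto
      also have "\<dots> = (3 * E + 4 * r\<^sup>2) / (6 * K)" using N S K by (simp add: field_simps)
      finally show ?thesis
        unfolding sum_distrib_left[symmetric] using \<kappa>[OF y] n0 by (intro mult_left_mono) auto
    qed simp
  qed
  also have "\<dots> = (\<Sum>y\<in>sites N. \<kappa> y) / ?n * ((3 * E + 4 * r\<^sup>2) / (6 * K) + real l * r)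
      + 3/8 * K * real N * S * ((\<Sum>y\<in>sites N. \<kappa> y * (\<Sum>i<l. ?\<xi> i y * ?D i y)) / ?n)"
  proof -
    have "(\<Sum>y\<in>sites N. \<kappa> y / ?n * (c + d * F y)) = (\<Sum>y\<in>sites N. \<kappa> y) / ?n * c + d * ((\<Sum>y\<in>sites N. \<kappa> y * F y) / ?n)"
      for c d and F :: "'n site \<Rightarrow> real"
      by (simp add: distrib_left add_divide_distrib sum.distrib sum_distrib_left sum_distrib_right sum_divide_distrib mult_ac)
    then show ?thesis .
  qed
  also have "(\<Sum>y\<in>sites N. \<kappa> y) / ?n * ((3 * E + 4 * r\<^sup>2) / (6 * K) + real l * r)
      \<le> K * ((3 * E + 4 * r\<^sup>2) / (6 * K) + real l * r)"
    using E0 K r0 by (intro mult_right_mono) auto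
  also have "\<dots> = E / 2 + 2/3 * r\<^sup>2 + K * real l * r" using K by (simp add: field_simps)
  finally show ?thesis unfolding E_def[symmetric] by simp
qed

text \<open>A function with periodic increments is a periodic function plus a linear one.\<close>

lemma increment_periodic:
  fixes W :: "real \<Rightarrow> real"
  assumes per: "\<And>u. W (u + 1) - W u = W 1 - W 0"
  shows "W (u + of_int z + h) - W (u + of_int z) = W (u + h) - W u"
proof -
  have 1: "W (u + 1) = W u + (W 1 - W 0)" for u using per[of u] by linarith
  have nat: "W (u + real n) = W u + real n * (W 1 - W 0)" for u n
  proof (induction n)
    case (Suc n)
    have "W (u + real (Suc n)) = W ((u + real n) + 1)" by (simp add: algebra_simps)
    also have "\<dots> = W (u + real n) + (W 1 - W 0)" by (rule 1)
    finally show ?case using Suc by (simp add: algebra_simps)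
  qed simp
  have int: "W (u + of_int z) = W u + of_int z * (W 1 - W 0)" for u
  proof (cases "z \<ge> 0")
    case True then show ?thesis using nat[of u "nat z"] by simp
  next
    case False then show ?thesis using nat[of "u + of_int z" "nat (- z)"] by simp
  qed
  have "W (u + of_int z + h) = W ((u + h) + of_int z)" by (simp add: algebra_simps)
  then show ?thesis by (simp add: int)
qed

lemma real_nat_mod:
  assumes "N \<ge> 1" shows "real (nat (k mod int N)) = of_int k - real N * of_int (k div int N)"
proof -
  have 1: "real (nat (k mod int N)) = of_int (k mod int N)" using assms by (subst of_nat_nat) auto
  have "real_of_int (int N * (k div int N) + k mod int N) = of_int k" by (simp only: mult_div_mod_eq)
  then show ?thesis unfolding 1 of_int_add of_int_mult of_int_of_nat_eq by linarith
qed

text \<open>Each resistance is N times an increment of W_j. The increments telescope, also across the seam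
  of the discrete torus, because they are periodic.\<close>

lemma resistance_sum:
  fixes W :: "'n \<Rightarrow> real \<Rightarrow> real" and y :: "'n site"
  assumes N: "N \<ge> 1" and per: "\<And>u. W j (u + 1) - W j u = W j 1 - W j 0"
  shows "(\<Sum>i<l. 1 / conductance W N j (shift N j (int i) y)) =
     real N * (W j (real (y j) / real N + real l / real N) - W j (real (y j) / real N))"
proof -
  have "1 / conductance W N j (shift N j (int i) y) = real N * W j (real (y j) / real N + real (Suc i) / real N)
     - real N * W j (real (y j) / real N + real i / real N)" for i
  proof -
    let ?z = "(int (y j) + int i) div int N"
    have m: "real (nat ((int (y j) + int i) mod int N)) = real (y j) + real i - real N * of_int ?z"
      using real_nat_mod[OF N, of "int (y j) + int i"] by simp
    have d: "real (nat ((int (y j) + int i) mod int N)) / real N = (real (y j) / real N + real i / real N) + of_int (- ?z)"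
      unfolding m using N by (simp add: field_simps)
    have "1 / conductance W N j (shift N j (int i) y) =
      real N * (W j ((real (nat ((int (y j) + int i) mod int N))) / real N + 1 / real N) - W j (real (nat ((int (y j) + int i) mod int N)) / real N))"
      by (simp add: conductance_def shift_def add_divide_distrib)
    also have "\<dots> = real N * (W j ((real (y j) / real N + real i / real N) + 1 / real N) - W j (real (y j) / real N + real i / real N))"
      unfolding d using increment_periodic[of "W j" "real (y j) / real N + real i / real N" "- ?z" "1 / real N", OF per]
      by (simp only:)
    finally show ?thesis by (simp add: right_diff_distrib add_divide_distrib add_ac)
  qed
  then show ?thesis
    using sum_lessThan_telescope[of "\<lambda>i. real N * W j (real (y j) / real N + real i / real N)" l]
    by (simp add: right_diff_distrib)
qed

text \<open>Modulo 1, the segment starts within distance \<delta> \<le> \<epsilon> to the right of x_j and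
  is at most \<epsilon> long, so it is contained in the interval from x_j to x_j + 2\<epsilon>. This is the
  reason for the length 2\<epsilon> in the weight of the energy.\<close>

lemma resistance_bound:
  fixes W :: "'n::finite \<Rightarrow> real \<Rightarrow> real" and y :: "'n site"
  assumes N: "N \<ge> 1" and per: "\<And>u. W j (u + 1) - W j u = W j 1 - W j 0" and mono: "strict_mono (W j)"
    and y: "scaled_site N y - x \<in> periodic_box \<delta>" and \<delta>: "\<delta> \<le> \<epsilon>" and l: "real l \<le> \<epsilon> * real N"
  shows "(\<Sum>i<l. 1 / conductance W N j (shift N j (int i) y)) \<le> real N * (W j (x $ j + 2 * \<epsilon>) - W j (x $ j))"
proof -
  let ?u = "real (y j) / real N"
  define t where "t = ?u - of_int \<lfloor>?u - x $ j\<rfloor>"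
  have fr: "0 < frac (?u - x $ j)" "frac (?u - x $ j) < \<delta>" using y by (auto simp: periodic_box_def scaled_site_def)
  have t: "x $ j \<le> t" "t \<le> x $ j + \<delta>" using fr by (auto simp: t_def frac_def)
  have lN: "real l / real N \<le> \<epsilon>" using l N by (simp add: field_simps)
  have u: "?u = t + of_int \<lfloor>?u - x $ j\<rfloor>" by (simp add: t_def)
  have "W j (?u + real l / real N) - W j ?u = W j (t + real l / real N) - W j t"
    using increment_periodic[of "W j" t "\<lfloor>?u - x $ j\<rfloor>" "real l / real N", OF per] u by simp
  also have "\<dots> \<le> W j (x $ j + 2 * \<epsilon>) - W j (x $ j)"
    using t lN \<delta> by (intro diff_mono strict_mono_mono[OF mono, THEN monoD]) auto
  finally show ?thesis unfolding resistance_sum[OF N, of W j, OF per] by (intro mult_left_mono) auto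
qed

lemma scaled_site_torus: "N \<ge> 1 \<Longrightarrow> y \<in> sites N \<Longrightarrow> scaled_site N y \<in> torus"
  by (auto simp: scaled_site_def torus_def sites_def)

lemma empirical_integral:
  fixes \<eta> :: "'n::finite config"
  assumes N: "N \<ge> 1" and H: "H \<in> borel_measurable borel"
  shows "(\<integral>u. H u \<partial>empirical_measure N \<eta>) = (\<Sum>y\<in>sites N. real (\<eta> y) * H (scaled_site N y)) / real N ^ CARD('n)"
proof -
  have m: "scaled_site N \<in> point_measure (sites N) (\<lambda>x. ennreal (real (\<eta> x) / real N ^ CARD('n))) \<rightarrow>\<^sub>M torus_borel"
    using scaled_site_torus[OF N]
    by (auto simp: point_measure_def torus_borel_def space_restrict_space measurable_def)
  have "(\<integral>u. H u \<partial>empirical_measure N \<eta>) =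
    (\<integral>y. H (scaled_site N y) \<partial>point_measure (sites N) (\<lambda>x. ennreal (real (\<eta> x) / real N ^ CARD('n))))"
    unfolding empirical_measure_def by (rule integral_distr[OF m torus_borel_measurable[OF H]])
  also have "\<dots> = (\<Sum>y\<in>sites N. (real (\<eta> y) / real N ^ CARD('n)) * H (scaled_site N y))"
    by (subst lebesgue_integral_point_measure_finite) (auto simp: finite_sites)
  finally show ?thesis by (simp add: sum_divide_distrib)
qed

lemma scaled_site_shift:
  fixes y :: "'n::finite site"
  assumes N: "N \<ge> 1"
  obtains z :: int where "scaled_site N (shift N j m y) = scaled_site N y + (of_int m / real N) *\<^sub>R axis j 1 + of_int z *\<^sub>R axis j 1"
proof -
  let ?z = "(int (y j) + m) div int N"
  have e: "real (nat ((int (y j) + m) mod int N)) = real (y j) + of_int m - real N * of_int ?z"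
    using real_nat_mod[OF N, of "int (y j) + m"] by simp
  have "scaled_site N (shift N j m y) = scaled_site N y + (of_int m / real N) *\<^sub>R axis j 1 + of_int (- ?z) *\<^sub>R axis j 1"
    unfolding vec_eq_iff
  proof
    fix i
    show "scaled_site N (shift N j m y) $ i = (scaled_site N y + (of_int m / real N) *\<^sub>R axis j 1 + of_int (- ?z) *\<^sub>R axis j 1) $ i"
      using N e by (simp add: scaled_site_def shift_def axis_def field_simps)
  qed
  then show thesis using that by blast
qed

text \<open>Integrated against a measure, this is the difference between its mollified masses of two boxes
  whose corners are x + \<epsilon> e_j and x.\<close>

definition shift_difference :: "real \<Rightarrow> nat \<Rightarrow> 'n \<Rightarrow> real \<Rightarrow> real^'n \<Rightarrow> real^'n \<Rightarrow> real" where
  "shift_difference \<delta> m j \<epsilon> x u = bump \<delta> m (u - x - \<epsilon> *\<^sub>R axis j 1) - bump \<delta> m (u - x)"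

lemma bump_measurable [measurable]: "bump \<delta> m \<in> borel_measurable (borel :: (real^'n::finite) measure)"
  by (intro borel_measurable_continuous_onI bump_continuous)

lemma shift_difference_measurable [measurable]:
  "(\<lambda>(x, u). shift_difference \<delta> m j \<epsilon> x u) \<in> borel_measurable (borel \<Otimes>\<^sub>M (borel :: (real^'n::finite) measure))"
  unfolding shift_difference_def by measurable

text \<open>Summation by parts turns the translation of the configuration into one of the test function. On
  the lattice the translation by \<epsilon> becomes one by l = \<lfloor>\<epsilon>N\<rfloor> sites; the
  rounding error is less than 1/N, and bumps have Lipschitz constant m.\<close>

lemma shift_difference_approx:
  fixes \<eta> :: "'n::finite config"
  assumes N: "N \<ge> 1" and \<eta>: "\<eta> \<in> configs N" and \<epsilon>: "\<epsilon> \<ge> 0" and l: "l = nat \<lfloor>\<epsilon> * real N\<rfloor>"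
  shows "\<bar>(\<integral>u. shift_difference \<delta> m j \<epsilon> x u \<partial>empirical_measure N \<eta>)
     - gradient_average N j l (\<lambda>y. bump \<delta> m (scaled_site N y - x)) \<eta>\<bar> \<le> real m / real N"
proof -
  let ?n = "real N ^ CARD('n)" and ?b = "\<lambda>y. bump \<delta> m (scaled_site N y - x)"
  let ?e = "axis j 1 :: real^'n"
  have moved: "?b (shift N j (- int l) y) = bump \<delta> m (scaled_site N y - x - (real l / real N) *\<^sub>R ?e)" for y
  proof -
    obtain z where z: "scaled_site N (shift N j (- int l) y) = scaled_site N y + (of_int (- int l) / real N) *\<^sub>R ?e + of_int z *\<^sub>R ?e"
      using scaled_site_shift[OF N] by blast
    have "scaled_site N (shift N j (- int l) y) - x = (scaled_site N y - x - (real l / real N) *\<^sub>R ?e) + of_int z *\<^sub>R ?e"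
      unfolding z by (simp add: algebra_simps)
    then show ?thesis using periodic_int_axis[of "bump \<delta> m", OF bump_periodic] by (metis)
  qed
  have "(\<Sum>y\<in>sites N. ?b y * real (\<eta> (shift N j (int l) y))) =
      (\<Sum>y\<in>sites N. ?b (shift N j (- int l) (shift N j (int l) y)) * real (\<eta> (shift N j (int l) y)))"
    by (intro sum.cong) (auto simp: shift_shift[OF N] shift_0)
  also have "\<dots> = (\<Sum>y\<in>sites N. ?b (shift N j (- int l) y) * real (\<eta> y))"
    by (rule sum_shift[OF N])
  finally have G: "gradient_average N j l ?b \<eta> = (\<Sum>y\<in>sites N. real (\<eta> y) * (?b (shift N j (- int l) y) - ?b y)) / ?n"
    by (simp add: gradient_average_def right_diff_distrib sum_subtractf mult.commute)
  have I: "(\<integral>u. shift_difference \<delta> m j \<epsilon> x u \<partial>empirical_measure N \<eta>) = (\<Sum>y\<in>sites N. real (\<eta> y) * shift_difference \<delta> m j \<epsilon> x (scaled_site N y)) / ?n"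
    by (rule empirical_integral[OF N]) measurable
  have "\<bar>(\<Sum>y\<in>sites N. real (\<eta> y) * (bump \<delta> m (scaled_site N y - x - \<epsilon> *\<^sub>R ?e) - bump \<delta> m (scaled_site N y - x - (real l / real N) *\<^sub>R ?e)))\<bar>
     \<le> (\<Sum>y\<in>(sites N :: 'n site set). real m / real N)"
  proof (rule order_trans[OF sum_abs], rule sum_mono)
    fix y :: "'n site" assume y: "y \<in> sites N"
    have fl: "real l \<le> \<epsilon> * real N" unfolding l using \<epsilon> by (intro of_nat_floor) auto
    have fl': "\<epsilon> * real N < real l + 1" unfolding l by linarith
    have "\<bar>\<epsilon> - real l / real N\<bar> = (\<epsilon> * real N - real l) / real N" using N fl by (simp add: field_simps)
    also have "\<dots> \<le> 1 / real N" using fl' by (intro divide_right_mono) auto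
    finally have d: "\<bar>\<epsilon> - real l / real N\<bar> \<le> 1 / real N" .
    have "dist (scaled_site N y - x - \<epsilon> *\<^sub>R ?e) (scaled_site N y - x - (real l / real N) *\<^sub>R ?e) = norm ((real l / real N - \<epsilon>) *\<^sub>R ?e)"
      by (simp add: dist_norm scaleR_left_diff_distrib)
    also have "\<dots> = \<bar>\<epsilon> - real l / real N\<bar>" by (simp add: norm_axis_1 abs_minus_commute)
    finally have "\<bar>bump \<delta> m (scaled_site N y - x - \<epsilon> *\<^sub>R ?e) - bump \<delta> m (scaled_site N y - x - (real l / real N) *\<^sub>R ?e)\<bar> \<le> real m * \<bar>\<epsilon> - real l / real N\<bar>"
      using bump_lipschitz[of \<delta> m "scaled_site N y - x - \<epsilon> *\<^sub>R ?e" "scaled_site N y - x - (real l / real N) *\<^sub>R ?e"] by simp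
    also have "\<dots> \<le> real m * (1 / real N)" by (intro mult_left_mono d) auto
    finally have b: "\<bar>bump \<delta> m (scaled_site N y - x - \<epsilon> *\<^sub>R ?e) - bump \<delta> m (scaled_site N y - x - (real l / real N) *\<^sub>R ?e)\<bar> \<le> real m / real N" by simp
    show "\<bar>real (\<eta> y) * (bump \<delta> m (scaled_site N y - x - \<epsilon> *\<^sub>R ?e) - bump \<delta> m (scaled_site N y - x - (real l / real N) *\<^sub>R ?e))\<bar> \<le> real m / real N"
      using config_value[OF \<eta> y] b by auto
  qed
  also have "\<dots> = ?n * (real m / real N)" by (simp add: card_sites)
  finally have "\<bar>(\<Sum>y\<in>sites N. real (\<eta> y) * (bump \<delta> m (scaled_site N y - x - \<epsilon> *\<^sub>R ?e) - bump \<delta> m (scaled_site N y - x - (real l / real N) *\<^sub>R ?e)))\<bar> / ?n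
     \<le> real m / real N"
    using N by (simp add: pos_divide_le_eq mult.commute)
  moreover have "(\<integral>u. shift_difference \<delta> m j \<epsilon> x u \<partial>empirical_measure N \<eta>) - gradient_average N j l ?b \<eta> =
    (\<Sum>y\<in>sites N. real (\<eta> y) * (bump \<delta> m (scaled_site N y - x - \<epsilon> *\<^sub>R ?e) - bump \<delta> m (scaled_site N y - x - (real l / real N) *\<^sub>R ?e))) / ?n"
    unfolding I G diff_divide_distrib[symmetric] sum_subtractf[symmetric] moved
    by (simp add: shift_difference_def algebra_simps)
  ultimately show ?thesis by simp
qed

context exclusion
begin

definition increment_energy :: "real \<Rightarrow> nat \<Rightarrow> 'n \<Rightarrow> real \<Rightarrow> real \<Rightarrow> real^'n \<Rightarrow> real" where
  "increment_energy \<delta> m j \<epsilon> t x =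
     (\<Sum>\<eta>\<in>configs N. law_at \<Omega> X t \<eta> * (\<integral>u. shift_difference \<delta> m j \<epsilon> x u \<partial>empirical_measure N \<eta>)\<^sup>2)
       / (\<epsilon> * (W j (x $ j + 2 * \<epsilon>) - W j (x $ j)))"

text \<open>In gradient_average_estimate the lattice count gives K = (2\<delta>)^d, and the resistance bound
  S cancels against the weight of the energy. All error terms are of order 1/N because r is of order N^(-d)
  and d \<ge> 2.\<close>

lemma microscopic_pointwise:
  assumes d2: "CARD('n) > 1" and per: "\<And>u. W j (u + 1) - W j u = W j 1 - W j 0"
    and \<delta>: "0 < \<delta>" "\<delta> \<le> \<epsilon>" "\<epsilon> \<le> 1" and N\<delta>: "real N * \<delta> \<ge> 1" and t: "t \<ge> 0"
    and s0: "s0 > 0" "\<And>v. s0 \<le> W j (v + 2 * \<epsilon>) - W j v"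
    and l: "l = nat \<lfloor>\<epsilon> * real N\<rfloor>"
  shows "increment_energy \<delta> m j \<epsilon> t x \<le>
    (43 + 16 * (2 * \<delta>) ^ CARD('n) + 4 * (real m)\<^sup>2) / (\<epsilon> * s0) / real N +
    3/2 * (2 * \<delta>) ^ CARD('n) * real N / \<epsilon> *
    ((\<Sum>y\<in>sites N. bump \<delta> m (scaled_site N y - x) * (\<Sum>i<l. conductance W N j (shift N j (int i) y)
        * bond_energy N j (shift N j (int i) y) (mixed_law N \<Omega> X t))) / real N ^ CARD('n))"
proof -
  have N: "N \<ge> 1" using N3 by simp
  have \<epsilon>: "\<epsilon> > 0" using \<delta> by simp
  let ?n = "real N ^ CARD('n)" and ?\<kappa> = "\<lambda>y. bump \<delta> m (scaled_site N y - x)" and ?q = "mixed_law N \<Omega> X t"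
  let ?G = "gradient_average N j l ?\<kappa>"
  let ?I = "\<lambda>\<eta>. \<integral>u. shift_difference \<delta> m j \<epsilon> x u \<partial>empirical_measure N \<eta>"
  define S where "S = W j (x $ j + 2 * \<epsilon>) - W j (x $ j)"
  define A where "A = (\<Sum>y\<in>sites N. ?\<kappa> y * (\<Sum>i<l. conductance W N j (shift N j (int i) y) * bond_energy N j (shift N j (int i) y) ?q)) / ?n"
  define K where "K = (2 * \<delta>) ^ CARD('n)"
  define r where "r = 4 / ?n"
  have K0: "K > 0" using \<delta> by (simp add: K_def)
  have S0: "S > 0" "S \<ge> s0" using s0(1) s0(2)[of "x $ j"] by (auto simp: S_def)
  have n0: "?n > 0" using N by simp
  have lN: "real l \<le> \<epsilon> * real N" unfolding l using \<epsilon> by (intro of_nat_floor) auto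
  have \<kappa>K: "(\<Sum>y\<in>sites N. ?\<kappa> y) / ?n \<le> K"
  proof -
    have "(\<Sum>y\<in>sites N. ?\<kappa> y) \<le> (\<Sum>y\<in>(sites N :: 'n site set). indicator (periodic_box \<delta>) (scaled_site N y - x))"
      by (intro sum_mono bump_le_indicator)
    also have "\<dots> = real (card {y \<in> sites N. scaled_site N y - x \<in> periodic_box \<delta>})"
      by (simp add: indicator_def sum.If_cases finite_sites Int_def)
    also have "\<dots> \<le> (\<delta> * real N + 1) ^ CARD('n)" by (rule lattice_count[OF N \<delta>(1)])
    also have "\<dots> \<le> (2 * \<delta> * real N) ^ CARD('n)" using N\<delta> \<delta> by (intro power_mono) (auto simp: mult_ac)
    also have "\<dots> = K * ?n" by (simp add: K_def power_mult_distrib)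
    finally show ?thesis using n0 by (simp add: pos_divide_le_eq)
  qed
  have E: "(\<Sum>\<eta>\<in>configs N. (?G \<eta>)\<^sup>2 * ?q \<eta>) \<le> 4/3 * r\<^sup>2 + 2 * K * real l * r + 3/4 * K * real N * S * A"
    unfolding r_def A_def
  proof (rule gradient_average_estimate[OF N mixed_law_pos mixed_law_sum[OF t] _ K0 \<kappa>K cond_pos S0(1)])
    show "0 \<le> ?\<kappa> y \<and> ?\<kappa> y \<le> 1" for y by (simp add: bump_range)
    fix y :: "'n site" assume y: "y \<in> sites N" "?\<kappa> y \<noteq> 0"
    have "scaled_site N y - x \<in> periodic_box \<delta>"
      using y(2) bump_le_indicator[of \<delta> m "scaled_site N y - x"] bump_range(1)[of \<delta> m "scaled_site N y - x"]
      by (cases "scaled_site N y - x \<in> periodic_box \<delta>") auto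
    then show "(\<Sum>i<l. 1 / conductance W N j (shift N j (int i) y)) \<le> real N * S"
      unfolding S_def by (intro resistance_bound[where W = W and j = j and \<delta> = \<delta>] N per W_mono \<delta>(2) lN)
  qed
  have sq: "(?I \<eta>)\<^sup>2 \<le> 2 * (?G \<eta>)\<^sup>2 + 2 * (real m / real N)\<^sup>2" if \<eta>: "\<eta> \<in> configs N" for \<eta>
  proof -
    have "\<bar>?I \<eta> - ?G \<eta>\<bar>\<^sup>2 \<le> (real m / real N)\<^sup>2"
      using shift_difference_approx[OF N \<eta> _ l] \<epsilon> by (intro power_mono) auto
    moreover have "(?I \<eta>)\<^sup>2 \<le> 2 * (?G \<eta>)\<^sup>2 + 2 * (?I \<eta> - ?G \<eta>)\<^sup>2"
      using zero_le_power2[of "2 * ?G \<eta> - ?I \<eta>"] by (simp add: power2_eq_square algebra_simps)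
    ultimately show ?thesis by simp
  qed
  have "(\<Sum>\<eta>\<in>configs N. law_at \<Omega> X t \<eta> * (?I \<eta>)\<^sup>2) \<le> (\<Sum>\<eta>\<in>configs N. ?q \<eta> * (2 * (?G \<eta>)\<^sup>2 + 2 * (real m / real N)\<^sup>2))"
  proof (rule sum_mono)
    fix \<eta> :: "'n config" assume \<eta>: "\<eta> \<in> configs N"
    have "law_at \<Omega> X t \<eta> * (?I \<eta>)\<^sup>2 \<le> ?q \<eta> * (?I \<eta>)\<^sup>2"
      by (intro mult_right_mono) (auto simp: mixed_law_def)
    also have "\<dots> \<le> ?q \<eta> * (2 * (?G \<eta>)\<^sup>2 + 2 * (real m / real N)\<^sup>2)"
      by (intro mult_left_mono sq \<eta> less_imp_le[OF mixed_law_pos])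
    finally show "law_at \<Omega> X t \<eta> * (?I \<eta>)\<^sup>2 \<le> \<dots>" .
  qed
  also have "\<dots> = 2 * (\<Sum>\<eta>\<in>configs N. (?G \<eta>)\<^sup>2 * ?q \<eta>) + 4 * (real m / real N)\<^sup>2"
    using mixed_law_sum[OF t]
    by (simp add: distrib_left sum.distrib sum_distrib_left[symmetric] sum_distrib_right[symmetric] mult_ac)
  also have "\<dots> \<le> 2 * (4/3 * r\<^sup>2 + 2 * K * real l * r + 3/4 * K * real N * S * A) + 4 * (real m / real N)\<^sup>2"
    using E by (intro add_right_mono mult_left_mono) simp_all
  also have "\<dots> \<le> (43 + 16 * K + 4 * (real m)\<^sup>2) / real N + 3/2 * K * real N * S * A"
  proof -
    \<comment> \<open>With at least two dimensions r is at most 4/N^2; the number 43 in the bound exceeds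
      2(4/3)16.\<close>
    have n2: "(real N)\<^sup>2 \<le> ?n" using N d2 by (intro power_increasing) auto
    have r: "r \<le> 4 / (real N)\<^sup>2" unfolding r_def using n2 N by (intro divide_left_mono) auto
    have r0: "r \<ge> 0" using n0 by (simp add: r_def)
    have "real N \<ge> 1" using N by simp
    then have N2: "real N \<le> (real N)\<^sup>2" by (simp add: power2_eq_square)
    have "real l * r \<le> real N * (4 / (real N)\<^sup>2)"
      using lN \<delta> mult_right_mono[of \<epsilon> 1 "real N"] r r0 by (intro mult_mono) auto
    also have "\<dots> = 4 / real N" using N by (simp add: power2_eq_square)
    finally have lr: "real l * r \<le> 4 / real N" .
    have "r\<^sup>2 \<le> (4 / (real N)\<^sup>2)\<^sup>2" using r r0 by (intro power_mono)
    also have "\<dots> = 16 / ((real N)\<^sup>2 * (real N)\<^sup>2)" by (simp add: power2_eq_square)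
    also have "\<dots> \<le> 16 / (real N * 1)" using N N2 by (intro divide_left_mono mult_mono) auto
    finally have r2: "r\<^sup>2 \<le> 16 / real N" by simp
    have m2: "(real m / real N)\<^sup>2 \<le> (real m)\<^sup>2 / real N"
      unfolding power_divide using N N2 by (intro divide_left_mono) auto
    have "2 * K * (real l * r) \<le> 2 * K * (4 / real N)" using lr K0 by (intro mult_left_mono) auto
    then have "2 * (4/3 * r\<^sup>2 + 2 * K * real l * r + 3/4 * K * real N * S * A) + 4 * (real m / real N)\<^sup>2
      \<le> 2 * (4/3 * (16 / real N) + 2 * K * (4 / real N) + 3/4 * K * real N * S * A) + 4 * ((real m)\<^sup>2 / real N)"
      using r2 m2 by (simp add: mult.assoc)
    also have "\<dots> \<le> (43 + 16 * K + 4 * (real m)\<^sup>2) / real N + 3/2 * K * real N * S * A"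
      using N by (simp add: add_divide_distrib) (simp add: field_simps)
    finally show ?thesis .
  qed
  finally have "increment_energy \<delta> m j \<epsilon> t x \<le> ((43 + 16 * K + 4 * (real m)\<^sup>2) / real N + 3/2 * K * real N * S * A) / (\<epsilon> * S)"
    unfolding increment_energy_def S_def[symmetric] using S0 \<epsilon> by (intro divide_right_mono) auto
  also have "\<dots> = (43 + 16 * K + 4 * (real m)\<^sup>2) / real N / (\<epsilon> * S) + 3/2 * K * real N / \<epsilon> * A"
    using S0 \<epsilon> by (simp add: add_divide_distrib)
  also have "(43 + 16 * K + 4 * (real m)\<^sup>2) / real N / (\<epsilon> * S) \<le> (43 + 16 * K + 4 * (real m)\<^sup>2) / real N / (\<epsilon> * s0)"
    using S0 s0 \<epsilon> K0 by (intro divide_left_mono mult_left_mono) auto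
  also have "\<dots> = (43 + 16 * K + 4 * (real m)\<^sup>2) / (\<epsilon> * s0) / real N" by simp
  finally show ?thesis unfolding K_def A_def by simp
qed

text \<open>When microscopic_pointwise is integrated over x, every bump contributes the volume \<delta>^d,
  and every bond is seen from l \<le> \<epsilon>N sites, so that the bond energies add up to l times the
  directional energy. The powers of N cancel by directional_energy_bound, and what remains is proportional
  to \<delta>^(2d), the square of the volume of the box.\<close>

lemma microscopic_energy:
  assumes d2: "CARD('n) > 1" and per: "\<And>u. W j (u + 1) - W j u = W j 1 - W j 0"
    and \<delta>: "0 < \<delta>" "\<delta> \<le> \<epsilon>" "\<epsilon> \<le> 1" and N\<delta>: "real N * \<delta> \<ge> 1"
    and s0: "s0 > 0" "\<And>v. s0 \<le> W j (v + 2 * \<epsilon>) - W j v"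
  shows "(\<integral>\<^sup>+t. (\<integral>\<^sup>+x. ennreal (increment_energy \<delta> m j \<epsilon> t x) \<partial>torus_lebesgue) \<partial>restrict_space lborel {0..T}) \<le>
    ennreal (T * (43 + 16 * (2 * \<delta>) ^ CARD('n) + 4 * (real m)\<^sup>2) / (\<epsilon> * s0) / real N
      + 6 * ln 2 / min 1 (1 + 2 * a) * 2 ^ CARD('n) * (\<delta> ^ CARD('n))\<^sup>2)"
proof -
  have N: "N \<ge> 1" using N3 by simp
  have \<epsilon>: "\<epsilon> > 0" using \<delta> by simp
  let ?n = "real N ^ CARD('n)"
  define l where "l = nat \<lfloor>\<epsilon> * real N\<rfloor>"
  have lN: "real l \<le> \<epsilon> * real N" unfolding l_def using \<epsilon> by (intro of_nat_floor) auto
  define K where "K = (2 * \<delta>) ^ CARD('n)"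
  have K0: "K > 0" using \<delta> by (simp add: K_def)
  define C where "C = (43 + 16 * K + 4 * (real m)\<^sup>2) / (\<epsilon> * s0) / real N"
  have C0: "C \<ge> 0" using K0 \<epsilon> s0 by (simp add: C_def)
  define B where "B t y = (\<Sum>i<l. conductance W N j (shift N j (int i) y) * bond_energy N j (shift N j (int i) y) (mixed_law N \<Omega> X t))" for t y
  let ?DE = "\<lambda>t. directional_energy W N j (mixed_law N \<Omega> X t)"
  have B0: "0 \<le> B t y" if "y \<in> sites N" for t y
    unfolding B_def using that
    by (intro sum_nonneg mult_nonneg_nonneg less_imp_le[OF cond_pos] bond_energy_nonneg N shift_in_sites mixed_law_pos)
  have Bs: "(\<Sum>y\<in>sites N. B t y) = real l * ?DE t" for t
  proof -
    have "(\<Sum>y\<in>sites N. B t y) = (\<Sum>i<l. \<Sum>y\<in>sites N. conductance W N j (shift N j (int i) y) * bond_energy N j (shift N j (int i) y) (mixed_law N \<Omega> X t))"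
      unfolding B_def by (rule sum.swap)
    also have "\<dots> = (\<Sum>i<l. ?DE t)"
      unfolding directional_energy_def
      by (intro sum.cong refl sum_shift[OF N, where f = "\<lambda>y. conductance W N j y * bond_energy N j y (mixed_law N \<Omega> X t)"])
    finally show ?thesis by simp
  qed
  define c where "c = 3/2 * K * real N / \<epsilon> / ?n"
  have c0: "c \<ge> 0" using K0 \<epsilon> by (simp add: c_def)
  have x_bound: "(\<integral>\<^sup>+x. ennreal (increment_energy \<delta> m j \<epsilon> t x) \<partial>torus_lebesgue) \<le> ennreal (C + 3/2 * K * \<delta> ^ CARD('n) * (real N)\<^sup>2 / ?n * ?DE t)"
    if t: "t \<in> {0..T}" for t
  proof -
    have [measurable]: "(\<lambda>x. bump \<delta> m (v - x)) \<in> borel_measurable torus_lebesgue" for v :: "real^'n"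
    proof -
      have "(\<lambda>x. bump \<delta> m (v - x)) \<in> borel_measurable borel" by measurable
      then have "(\<lambda>x. bump \<delta> m (v - x)) \<in> borel_measurable torus_borel" by (rule torus_borel_measurable)
      then show ?thesis by (simp cong: measurable_cong_sets)
    qed
    have "(\<integral>\<^sup>+x. ennreal (increment_energy \<delta> m j \<epsilon> t x) \<partial>torus_lebesgue)
      \<le> (\<integral>\<^sup>+x. ennreal C + (\<Sum>y\<in>sites N. ennreal (c * B t y) * ennreal (bump \<delta> m (scaled_site N y - x))) \<partial>torus_lebesgue)"
    proof (rule nn_integral_mono)
      fix x :: "real^'n"
      have e: "(\<Sum>y\<in>sites N. (c * B t y) * bump \<delta> m (scaled_site N y - x)) =
          3/2 * K * real N / \<epsilon> * ((\<Sum>y\<in>sites N. bump \<delta> m (scaled_site N y - x) * B t y) / ?n)"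
        unfolding sum_distrib_left sum_divide_distrib c_def by (intro sum.cong) auto
      have "increment_energy \<delta> m j \<epsilon> t x \<le> C + (\<Sum>y\<in>sites N. (c * B t y) * bump \<delta> m (scaled_site N y - x))"
        unfolding e unfolding C_def K_def B_def using t by (intro microscopic_pointwise[OF d2 per \<delta> N\<delta> _ s0 l_def]) auto
      then have "ennreal (increment_energy \<delta> m j \<epsilon> t x) \<le> ennreal (C + (\<Sum>y\<in>sites N. (c * B t y) * bump \<delta> m (scaled_site N y - x)))"
        by (rule ennreal_leI)
      also have "\<dots> = ennreal C + ennreal (\<Sum>y\<in>sites N. (c * B t y) * bump \<delta> m (scaled_site N y - x))"
        using C0 c0 B0 bump_range(1) by (intro ennreal_plus sum_nonneg mult_nonneg_nonneg) auto
      also have "ennreal (\<Sum>y\<in>sites N. (c * B t y) * bump \<delta> m (scaled_site N y - x)) = (\<Sum>y\<in>sites N. ennreal (c * B t y) * ennreal (bump \<delta> m (scaled_site N y - x)))"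
        using c0 B0 bump_range(1)
        by (subst sum_ennreal[symmetric]) (auto intro!: mult_nonneg_nonneg sum.cong ennreal_mult)
      finally show "ennreal (increment_energy \<delta> m j \<epsilon> t x) \<le> ennreal C + (\<Sum>y\<in>sites N. ennreal (c * B t y) * ennreal (bump \<delta> m (scaled_site N y - x)))" .
    qed
    also have "\<dots> = ennreal C * emeasure torus_lebesgue (torus :: (real^'n) set) + (\<Sum>y\<in>sites N. ennreal (c * B t y) * (\<integral>\<^sup>+x. ennreal (bump \<delta> m (scaled_site N y - x)) \<partial>(torus_lebesgue :: (real^'n) measure)))"
      by (subst nn_integral_add) (auto simp: nn_integral_sum nn_integral_cmult)
    also have "\<dots> \<le> ennreal C * 1 + (\<Sum>y\<in>(sites N :: 'n site set). ennreal (c * B t y) * ennreal (\<delta> ^ CARD('n)))"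
    proof (intro add_mono mult_left_mono sum_mono bump_integral)
      have "emeasure torus_lebesgue (torus :: (real^'n) set) = emeasure lborel (torus :: (real^'n) set)"
        unfolding torus_lebesgue_def by (subst emeasure_restrict_space) auto
      then show "emeasure torus_lebesgue (torus :: (real^'n) set) \<le> 1" using emeasure_torus_le by simp
    qed (use \<delta> in auto)
    also have "\<dots> = ennreal (C + (\<Sum>y\<in>sites N. c * B t y * \<delta> ^ CARD('n)))"
      using C0 c0 B0 \<delta>
      by (subst ennreal_plus) (auto intro!: sum_nonneg mult_nonneg_nonneg simp: ennreal_mult[symmetric] sum_ennreal)
    also have "(\<Sum>y\<in>sites N. c * B t y * \<delta> ^ CARD('n)) = c * \<delta> ^ CARD('n) * (real l * ?DE t)"
      unfolding Bs[symmetric] by (simp add: sum_distrib_left mult_ac)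
    also have "ennreal (C + c * \<delta> ^ CARD('n) * (real l * ?DE t)) \<le> ennreal (C + c * \<delta> ^ CARD('n) * ((\<epsilon> * real N) * ?DE t))"
      using c0 \<delta> lN directional_energy_nonneg
      by (intro ennreal_leI add_left_mono mult_left_mono mult_right_mono) auto
    also have "c * \<delta> ^ CARD('n) * ((\<epsilon> * real N) * ?DE t) = 3/2 * K * \<delta> ^ CARD('n) * (real N)\<^sup>2 / ?n * ?DE t"
      using \<epsilon> by (simp add: c_def power2_eq_square)
    finally show ?thesis .
  qed
  define k where "k = 3/2 * K * \<delta> ^ CARD('n) * (real N)\<^sup>2 / ?n"
  have k0: "k \<ge> 0" using K0 \<delta> by (simp add: k_def)
  have "(\<integral>\<^sup>+t. (\<integral>\<^sup>+x. ennreal (increment_energy \<delta> m j \<epsilon> t x) \<partial>torus_lebesgue) \<partial>restrict_space lborel {0..T})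
     \<le> (\<integral>\<^sup>+t. ennreal (C + k * ?DE t) \<partial>restrict_space lborel {0..T})"
    unfolding k_def by (intro nn_integral_mono x_bound) (auto simp: space_restrict_space)
  also have "\<dots> = (\<integral>\<^sup>+t. ennreal (indicator {0..T} t * (C + k * ?DE t)) \<partial>lborel)"
    by (subst nn_integral_restrict_space) (auto intro!: nn_integral_cong simp: indicator_def)
  also have "\<dots> = ennreal (integral {0..T} (\<lambda>t. C + k * ?DE t))"
  proof -
    have c: "continuous_on {0..T} (\<lambda>t. C + k * ?DE t)" by (intro continuous_intros directional_energy_continuous)
    have si: "set_integrable lborel {0..T} (\<lambda>t. C + k * ?DE t)"
      by (rule borel_integrable_atLeastAtMost'[OF c])
    have "(\<integral>\<^sup>+t. ennreal (indicator {0..T} t * (C + k * ?DE t)) \<partial>lborel) = ennreal (\<integral>t. indicator {0..T} t * (C + k * ?DE t) \<partial>lborel)"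
      using si C0 k0 directional_energy_nonneg unfolding set_integrable_def
      by (intro nn_integral_eq_integral) (auto intro!: AE_I2 mult_nonneg_nonneg add_nonneg_nonneg)
    also have "(\<integral>t. indicator {0..T} t * (C + k * ?DE t) \<partial>lborel) = integral {0..T} (\<lambda>t. C + k * ?DE t)"
      using set_borel_integral_eq_integral(2)[OF si] by (simp add: set_lebesgue_integral_def)
    finally show ?thesis .
  qed
  also have "integral {0..T} (\<lambda>t. C + k * ?DE t) = T * C + k * integral {0..T} ?DE"
    using T0 by (subst integral_add) (auto intro!: integrable_continuous_real continuous_intros directional_energy_continuous)
  also have "ennreal (T * C + k * integral {0..T} ?DE) \<le> ennreal (T * C + k * (4 * ln 2 / min 1 (1 + 2 * a) * (?n / (real N)\<^sup>2)))"
    using k0 directional_energy_bound[of j] by (intro ennreal_leI add_left_mono mult_left_mono)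
  also have "k * (4 * ln 2 / min 1 (1 + 2 * a) * (?n / (real N)\<^sup>2)) = 6 * ln 2 / min 1 (1 + 2 * a) * 2 ^ CARD('n) * (\<delta> ^ CARD('n))\<^sup>2"
    using N by (simp add: k_def K_def power_mult_distrib power2_eq_square)
  also have "T * C = T * (43 + 16 * (2 * \<delta>) ^ CARD('n) + 4 * (real m)\<^sup>2) / (\<epsilon> * s0) / real N"
    by (simp add: C_def K_def)
  finally show ?thesis .
qed

end

section \<open>Weak limits of the empirical trajectories\<close>

lemma C_torus_measurable: "H \<in> C_torus \<Longrightarrow> H \<in> borel_measurable borel"
  by (auto simp: C_torus_def intro: borel_measurable_continuous_onI)

lemma D_space_value:
  assumes "\<pi> \<in> D_space T" "s \<in> {0..T}" shows "\<pi> s \<in> space (subprob_algebra torus_borel)"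
  using assms by (auto simp: D_space_def cadlag_on_def limitin_def topspace_weak_topology)

lemma openin_weak_topology_functional:
  assumes H: "H \<in> C_torus" and U: "open U"
  shows "openin weak_topology {\<mu> \<in> space (subprob_algebra torus_borel). (\<integral>u. H u \<partial>\<mu>) \<in> U}"
proof -
  let ?P = "product_topology (\<lambda>_. euclideanreal) (C_torus :: (real^'n \<Rightarrow> real) set)"
  have "continuous_map ?P euclideanreal (\<lambda>f. f H)"
    using H by (rule continuous_map_product_projection)
  then have "openin ?P {f \<in> topspace ?P. f H \<in> U}"
    by (rule openin_continuous_map_preimage) (use U in simp)
  moreover have "{\<mu> \<in> space (subprob_algebra torus_borel). (\<integral>u. H u \<partial>\<mu>) \<in> U} =
     (\<lambda>\<mu>. \<lambda>H\<in>C_torus. \<integral>u. H u \<partial>\<mu>) -` {f \<in> topspace ?P. f H \<in> U} \<inter> space (subprob_algebra torus_borel)"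
    using H by auto
  ultimately show ?thesis
    unfolding weak_topology_def openin_pullback_topology by blast
qed

lemma D_space_right_limit:
  assumes \<pi>: "\<pi> \<in> D_space T" and t: "t \<in> {0..T}" and H: "H \<in> C_torus"
  shows "((\<lambda>s. \<integral>u. H u \<partial>\<pi> s) \<longlongrightarrow> (\<integral>u. H u \<partial>\<pi> t)) (at t within ({0..T} \<inter> {t<..}))"
proof (rule topological_tendstoI)
  fix U :: "real set" assume U: "open U" "(\<integral>u. H u \<partial>\<pi> t) \<in> U"
  have "limitin weak_topology \<pi> (\<pi> t) (at t within ({0..T} \<inter> {t<..}))"
    using \<pi> t by (auto simp: D_space_def cadlag_on_def)
  moreover have "\<pi> t \<in> {\<mu> \<in> space (subprob_algebra torus_borel). (\<integral>u. H u \<partial>\<mu>) \<in> U}"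
    using D_space_value[OF \<pi> t] U by simp
  ultimately have "\<forall>\<^sub>F s in at t within ({0..T} \<inter> {t<..}). \<pi> s \<in> {\<mu> \<in> space (subprob_algebra torus_borel). (\<integral>u. H u \<partial>\<mu>) \<in> U}"
    using openin_weak_topology_functional[OF H U(1)] unfolding limitin_def by blast
  then show "\<forall>\<^sub>F s in at t within ({0..T} \<inter> {t<..}). (\<integral>u. H u \<partial>\<pi> s) \<in> U"
    by (rule eventually_mono) auto
qed

lemma topspace_uniform_topology: "topspace (uniform_topology T) = D_space T"
proof
  show "topspace (uniform_topology T) \<subseteq> D_space T"
    using openin_uniform_topology[of T "topspace (uniform_topology T)"] by auto
  have "openin (uniform_topology T) (D_space T)"
    unfolding openin_uniform_topology uniform_nbhd_def
    by (auto intro!: exI[of _ "{}"] exI[of _ "1::real"])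
  then show "D_space T \<subseteq> topspace (uniform_topology T)" by (rule openin_subset)
qed

text \<open>A uniform neighbourhood controls the integral of H at all times at once, in particular at the
  time s.\<close>

lemma evaluation_continuous:
  assumes H: "H \<in> C_torus" and g: "continuous_on UNIV g" and s: "s \<in> {0..T}"
  shows "continuous_map (uniform_topology T) euclideanreal (\<lambda>\<pi>. g (\<integral>u. H u \<partial>\<pi> s))"
  unfolding continuous_map topspace_uniform_topology
proof (intro conjI allI impI)
  fix U :: "real set" assume "openin euclideanreal U"
  then have U: "open (g -` U)" using g by (simp add: continuous_on_open_vimage)
  show "openin (uniform_topology T) {\<pi> \<in> D_space T. g (\<integral>u. H u \<partial>\<pi> s) \<in> U}"
    unfolding openin_uniform_topology
  proof (intro conjI ballI)
    fix \<pi> assume "\<pi> \<in> {\<pi> \<in> D_space T. g (\<integral>u. H u \<partial>\<pi> s) \<in> U}"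
    then have "(\<integral>u. H u \<partial>\<pi> s) \<in> g -` U" by simp
    then obtain e where e: "e > 0" "ball (\<integral>u. H u \<partial>\<pi> s) e \<subseteq> g -` U" using U open_contains_ball by blast
    have "uniform_nbhd T {H} e \<pi> \<subseteq> {\<pi> \<in> D_space T. g (\<integral>u. H u \<partial>\<pi> s) \<in> U}"
    proof
      fix \<pi>' assume "\<pi>' \<in> uniform_nbhd T {H} e \<pi>"
      then have "\<pi>' \<in> D_space T" "(\<integral>u. H u \<partial>\<pi>' s) \<in> ball (\<integral>u. H u \<partial>\<pi> s) e"
        using s by (auto simp: uniform_nbhd_def dist_real_def abs_minus_commute)
      then show "\<pi>' \<in> {\<pi> \<in> D_space T. g (\<integral>u. H u \<partial>\<pi> s) \<in> U}" using e by auto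
    qed
    then show "\<exists>\<H> \<epsilon>. finite \<H> \<and> \<H> \<subseteq> C_torus \<and> 0 < \<epsilon> \<and> uniform_nbhd T \<H> \<epsilon> \<pi> \<subseteq> {\<pi> \<in> D_space T. g (\<integral>u. H u \<partial>\<pi> s) \<in> U}"
      using e H by (intro exI[of _ "{H}"] exI[of _ e]) auto
  qed auto
qed auto

lemma evaluation_measurable [measurable]:
  assumes "s \<in> {0..T}" shows "(\<lambda>\<pi>. \<pi> s) \<in> path_space T \<rightarrow>\<^sub>M subprob_algebra torus_borel"
  unfolding path_space_def using assms by (intro measurable_restrict_space1 measurable_component_singleton)

lemma space_path_space: "space (path_space T) = (D_space T :: (real \<Rightarrow> (real ^ 'a::finite) measure) set)"
proof -
  have "(D_space T :: (real \<Rightarrow> (real ^ 'a) measure) set) \<subseteq> (\<Pi>\<^sub>E t\<in>{0..T}. space (subprob_algebra torus_borel))"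
  proof
    fix \<pi> :: "real \<Rightarrow> (real ^ 'a) measure" assume \<pi>: "\<pi> \<in> D_space T"
    then show "\<pi> \<in> (\<Pi>\<^sub>E t\<in>{0..T}. space (subprob_algebra torus_borel))"
      by (intro PiE_I D_space_value[OF \<pi>]) (auto simp: D_space_def extensional_def)
  qed
  then show ?thesis unfolding path_space_def space_restrict_space space_PiM by blast
qed

lemma subprob_integral_bound:
  fixes H :: "real ^ 'n::finite \<Rightarrow> real"
  assumes \<mu>: "\<mu> \<in> space (subprob_algebra torus_borel)" and H: "H \<in> borel_measurable torus_borel"
    and B: "\<And>u. u \<in> torus \<Longrightarrow> \<bar>H u\<bar> \<le> B"
  shows "integrable \<mu> H" "\<bar>\<integral>u. H u \<partial>\<mu>\<bar> \<le> B"
proof -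
  have sm: "subprob_space \<mu>" "sets \<mu> = sets torus_borel" using \<mu> by (auto simp: space_subprob_algebra)
  interpret subprob_space \<mu> by fact
  have sp: "space \<mu> = torus" using sets_eq_imp_space_eq[OF sm(2)] by simp
  have "\<bar>H 0\<bar> \<le> B" by (rule B) (simp add: torus_def)
  then have B0: "B \<ge> 0" by linarith
  have Hm: "H \<in> borel_measurable \<mu>" using H sm(2) by (simp cong: measurable_cong_sets)
  show i: "integrable \<mu> H"
    by (rule integrable_const_bound[where B = B]) (use B sp Hm in auto)
  have "\<bar>\<integral>u. H u \<partial>\<mu>\<bar> \<le> (\<integral>u. \<bar>H u\<bar> \<partial>\<mu>)" using integral_norm_bound[of \<mu> H] by simp
  also have "\<dots> \<le> (\<integral>u. B \<partial>\<mu>)" using i B sp by (intro integral_mono) auto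
  also have "\<dots> \<le> B" using B0 subprob_measure_le_1[of "space \<mu>"] by (simp add: mult_left_le_one_le)
  finally show "\<bar>\<integral>u. H u \<partial>\<mu>\<bar> \<le> B" .
qed

text \<open>Evaluation at a fixed time is continuous for the uniform topology, so the weak convergence of
  the laws of the trajectories implies that of the one-time marginals; the left-hand side is the expectation
  under the law of the N-th empirical trajectory, written as a sum over configurations.\<close>

lemma limit_evaluation:
  fixes \<Omega> :: "nat \<Rightarrow> 'w measure" and \<eta> :: "nat \<Rightarrow> real \<Rightarrow> 'w \<Rightarrow> 'n::finite config"
  assumes mp: "\<And>N. N \<ge> 1 \<Longrightarrow> markov_process (configs N) (G N) (\<mu> N) (\<Omega> N) (\<eta> N)"
    and r: "strict_mono r" and wc: "weakly_converges T (\<lambda>n. empirical_law T (r n) (\<Omega> (r n)) (\<eta> (r n))) Q"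
    and H: "H \<in> C_torus" and B: "\<And>u. \<bar>H u\<bar> \<le> B" and g: "continuous_on UNIV g" and s: "s \<in> {0..T}"
  shows "(\<lambda>n. \<Sum>\<zeta>\<in>configs (r n). law_at (\<Omega> (r n)) (\<eta> (r n)) s \<zeta> * g (\<integral>u. H u \<partial>empirical_measure (r n) \<zeta>))
    \<longlonglongrightarrow> (\<integral>\<pi>. g (\<integral>u. H u \<partial>\<pi> s) \<partial>Q)"
proof -
  let ?F = "\<lambda>\<pi>. g (\<integral>u. H u \<partial>\<pi> s)"
  have Hb: "H \<in> borel_measurable borel" by (rule C_torus_measurable[OF H])
  have Ht: "H \<in> borel_measurable torus_borel" by (rule torus_borel_measurable[OF Hb])
  have gm [measurable]: "g \<in> borel_measurable borel" by (rule borel_measurable_continuous_onI[OF g])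
  have Fm: "?F \<in> borel_measurable (path_space T)"
  proof -
    have "(\<lambda>\<mu>. \<integral>u. H u \<partial>\<mu>) \<in> borel_measurable (subprob_algebra torus_borel)"
      using Ht by (rule integral_measurable_subprob_algebra)
    from measurable_compose[OF measurable_compose[OF evaluation_measurable[OF s] this] gm] show ?thesis .
  qed
  have bd: "bounded (?F ` D_space T)"
  proof (rule bounded_subset)
    have "compact (g ` {-B..B})" by (intro compact_continuous_image continuous_on_subset[OF g]) auto
    then show "bounded (g ` {-B..B})" by (rule compact_imp_bounded)
    show "?F ` D_space T \<subseteq> g ` {-B..B}"
    proof safe
      fix \<pi> :: "real \<Rightarrow> (real ^ 'n) measure" assume "\<pi> \<in> D_space T"
      from subprob_integral_bound(2)[OF D_space_value[OF this s] Ht, of B] B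
      show "?F \<pi> \<in> g ` {-B..B}" by (intro imageI) (auto simp: abs_le_iff)
    qed
  qed
  have lim: "(\<lambda>n. \<integral>\<pi>. ?F \<pi> \<partial>empirical_law T (r n) (\<Omega> (r n)) (\<eta> (r n))) \<longlonglongrightarrow> (\<integral>\<pi>. ?F \<pi> \<partial>Q)"
    using wc evaluation_continuous[OF H g s] Fm bd unfolding weakly_converges_def by blast
  have eq: "(\<integral>\<pi>. ?F \<pi> \<partial>empirical_law T N (\<Omega> N) (\<eta> N)) =
     (\<Sum>\<zeta>\<in>configs N. law_at (\<Omega> N) (\<eta> N) s \<zeta> * g (\<integral>u. H u \<partial>empirical_measure N \<zeta>))" if N: "N \<ge> 1" for N
  proof -
    have P: "prob_space (\<Omega> N)" and X: "\<eta> N s \<in> \<Omega> N \<rightarrow>\<^sub>M count_space (configs N)"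
      using mp[OF N] s by (auto simp: markov_process_def)
    have "(\<integral>\<pi>. ?F \<pi> \<partial>empirical_law T N (\<Omega> N) (\<eta> N)) = (\<integral>\<omega>. ?F (\<lambda>t\<in>{0..T}. empirical_measure N (\<eta> N t \<omega>)) \<partial>\<Omega> N)"
      unfolding empirical_law_def by (rule integral_distr[OF empirical_trajectory_measurable[OF N mp[OF N]] Fm])
    also have "\<dots> = (\<integral>\<omega>. g (\<integral>u. H u \<partial>empirical_measure N (\<eta> N s \<omega>)) \<partial>\<Omega> N)" using s by simp
    also have "\<dots> = (\<Sum>\<zeta>\<in>configs N. law_at (\<Omega> N) (\<eta> N) s \<zeta> * g (\<integral>u. H u \<partial>empirical_measure N \<zeta>))"
      unfolding law_at_def by (rule finite_expectation[OF P X finite_configs])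
    finally show ?thesis .
  qed
  have "\<forall>\<^sub>F n in sequentially. r n \<ge> 1"
    using strict_mono_imp_increasing[OF r] seq_suble[OF r] by (auto intro!: eventually_sequentiallyI[of 1] intro: order_trans)
  then have "\<forall>\<^sub>F n in sequentially. (\<integral>\<pi>. ?F \<pi> \<partial>empirical_law T (r n) (\<Omega> (r n)) (\<eta> (r n))) =
     (\<Sum>\<zeta>\<in>configs (r n). law_at (\<Omega> (r n)) (\<eta> (r n)) s \<zeta> * g (\<integral>u. H u \<partial>empirical_measure (r n) \<zeta>))"
    by eventually_elim (rule eq)
  then show ?thesis using lim by (rule Lim_transform_eventually[rotated])
qed

definition box_mass :: "real \<Rightarrow> (real^'n) measure \<Rightarrow> real^'n \<Rightarrow> real" where
  "box_mass \<delta> \<mu> x = measure \<mu> {u \<in> torus. u - x \<in> periodic_box \<delta>}"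

lemma bump_integral_limit:
  assumes \<mu>: "\<mu> \<in> space (subprob_algebra (torus_borel :: (real^'n::finite) measure))" and \<delta>: "\<delta> \<le> 1"
  shows "(\<lambda>m. \<integral>u. bump \<delta> m (u - x) \<partial>\<mu>) \<longlonglongrightarrow> box_mass \<delta> \<mu> x"
proof -
  have sm: "subprob_space \<mu>" "sets \<mu> = sets torus_borel" using \<mu> by (auto simp: space_subprob_algebra)
  interpret subprob_space \<mu> by fact
  have sp: "space \<mu> = torus" using sets_eq_imp_space_eq[OF sm(2)] by simp
  have pb [measurable]: "periodic_box \<delta> \<in> sets (borel :: (real^'n) measure)" using open_periodic_box[OF \<delta>] by (rule borel_open)
  have "(\<lambda>u. indicator (periodic_box \<delta>) (u - x) :: real) \<in> borel_measurable borel" by measurable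
  from torus_borel_measurable[OF this] have im: "(\<lambda>u. indicator (periodic_box \<delta>) (u - x) :: real) \<in> borel_measurable \<mu>"
    using sm(2) by (simp cong: measurable_cong_sets)
  have bm: "(\<lambda>u. bump \<delta> m (u - x)) \<in> borel_measurable \<mu>" for m
  proof -
    have "(\<lambda>u. bump \<delta> m (u - x)) \<in> borel_measurable borel" by measurable
    from torus_borel_measurable[OF this] show ?thesis using sm(2) by (simp cong: measurable_cong_sets)
  qed
  have "(\<lambda>m. \<integral>u. bump \<delta> m (u - x) \<partial>\<mu>) \<longlonglongrightarrow> (\<integral>u. indicator (periodic_box \<delta>) (u - x) \<partial>\<mu>)"
    by (rule integral_dominated_convergence[where w = "\<lambda>_. 1"])
       (auto intro!: im bm AE_I2 bump_limit[OF \<delta>] simp: bump_range)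
  also have "(\<integral>u. indicator (periodic_box \<delta>) (u - x) \<partial>\<mu>) = (\<integral>u. indicator {u \<in> torus. u - x \<in> periodic_box \<delta>} u \<partial>\<mu>)"
    by (intro Bochner_Integration.integral_cong) (auto simp: sp indicator_def)
  also have "\<dots> = box_mass \<delta> \<mu> x"
    unfolding box_mass_def Bochner_Integration.integral_indicator
    by (rule arg_cong[where f = "measure \<mu>"]) (auto simp: sp)
  finally show ?thesis .
qed

text \<open>Joint measurability in the time, the position and the trajectory. By right-continuity the value
  at the time s is the limit of the values at c n s, the first multiple of 1/(n+1) after s, and for fixed n
  the function c n takes only countably many values.\<close>

lemma bump_integral_measurable:
  assumes T: "T \<ge> 0"
  shows "(\<lambda>((s, x), \<pi>). \<integral>u. bump \<delta> m (u - x) \<partial>\<pi> s) \<in>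
    borel_measurable ((restrict_space borel {0..T} \<Otimes>\<^sub>M (borel :: (real^'n::finite) measure)) \<Otimes>\<^sub>M path_space T)" (is "_ \<in> borel_measurable ?M")
proof -
  define f where "f t z = (case z of ((s, x), \<pi>) \<Rightarrow> \<integral>u. bump \<delta> m (u - x) \<partial>\<pi> t)" for t :: real and z :: "(real \<times> (real^'n)) \<times> (real \<Rightarrow> (real^'n) measure)"
  have fm: "f t \<in> borel_measurable ?M" if t: "t \<in> {0..T}" for t
  proof -
    have [measurable]: "(\<lambda>z. snd z t) \<in> ?M \<rightarrow>\<^sub>M subprob_algebra torus_borel"
      using measurable_compose[OF measurable_snd evaluation_measurable[OF t]] .
    have e: "f t z = enn2real (\<integral>\<^sup>+u. ennreal (bump \<delta> m (u - snd (fst z))) \<partial>snd z t)" if "z \<in> space ?M" for z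
    proof -
      have "snd z \<in> D_space T" using that by (auto simp: space_pair_measure space_path_space)
      note v = D_space_value[OF this t]
      have "(\<lambda>u. bump \<delta> m (u - snd (fst z))) \<in> borel_measurable borel" by measurable
      from subprob_integral_bound(1)[OF v torus_borel_measurable[OF this], of 1]
      have "integrable (snd z t) (\<lambda>u. bump \<delta> m (u - snd (fst z)))" by (simp add: bump_range)
      then show ?thesis by (simp add: f_def split_beta integral_eq_nn_integral bump_range)
    qed
    have [measurable]: "(\<lambda>u. u) \<in> torus_borel \<rightarrow>\<^sub>M (borel :: (real^'n) measure)"
      unfolding torus_borel_def by (rule measurable_restrict_space1) simp
    have "(\<lambda>(z, u). ennreal (bump \<delta> m (u - snd (fst z)))) \<in> borel_measurable (?M \<Otimes>\<^sub>M torus_borel)"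
      by measurable
    then have "(\<lambda>z. \<integral>\<^sup>+u. ennreal (bump \<delta> m (u - snd (fst z))) \<partial>snd z t) \<in> borel_measurable ?M"
      by (rule nn_integral_measurable_subprob_algebra2) measurable
    then have "(\<lambda>z. enn2real (\<integral>\<^sup>+u. ennreal (bump \<delta> m (u - snd (fst z))) \<partial>snd z t)) \<in> borel_measurable ?M" by measurable
    then show ?thesis by (rule measurable_cong[THEN iffD2, rotated]) (rule e)
  qed
  define c where "c n s = min T (real_of_int (\<lfloor>real (Suc n) * s\<rfloor> + 1) / real (Suc n))" for n s
  have cm: "(\<lambda>z. f (c n (fst (fst z))) z) \<in> borel_measurable ?M" for n
  proof -
    define g where "g i z = (if i \<ge> 0 then f (min T (real_of_int (i + 1) / real (Suc n))) z else 0)" for i :: int and z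
    have gm: "g i \<in> borel_measurable ?M" for i
    proof (cases "i \<ge> 0")
      case True
      then have "min T (real_of_int (i + 1) / real (Suc n)) \<in> {0..T}" using T by auto
      from fm[OF this] True show ?thesis by (simp add: g_def[abs_def])
    qed (simp add: g_def[abs_def])
    have [measurable]: "(\<lambda>s. s) \<in> restrict_space borel {0..T} \<rightarrow>\<^sub>M borel" by (rule measurable_restrict_space1) simp
    have fl: "(\<lambda>z. \<lfloor>real (Suc n) * fst (fst z)\<rfloor>) \<in> ?M \<rightarrow>\<^sub>M count_space UNIV" by measurable
    have "(\<lambda>z. g \<lfloor>real (Suc n) * fst (fst z)\<rfloor> z) \<in> borel_measurable ?M"
      using gm fl by (rule measurable_compose_countable)
    moreover have "g \<lfloor>real (Suc n) * fst (fst z)\<rfloor> z = f (c n (fst (fst z))) z" if "z \<in> space ?M" for z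
    proof -
      have "0 \<le> fst (fst z)" using that by (auto simp: space_pair_measure space_restrict_space)
      then show ?thesis by (auto simp: g_def c_def)
    qed
    ultimately show ?thesis by (subst measurable_cong[symmetric]) auto
  qed
  have "(\<lambda>z. case z of ((s, x), \<pi>) \<Rightarrow> \<integral>u. bump \<delta> m (u - x) \<partial>\<pi> s) \<in> borel_measurable ?M"
  proof (rule borel_measurable_LIMSEQ_real[OF _ cm])
    fix z :: "(real \<times> (real^'n)) \<times> (real \<Rightarrow> (real^'n) measure)" assume z: "z \<in> space ?M"
    obtain s x \<pi> where zz: "z = ((s, x), \<pi>)" by (cases z) auto
    have s: "s \<in> {0..T}" and \<pi>: "\<pi> \<in> D_space T"
      using z by (auto simp: zz space_pair_measure space_path_space space_restrict_space)
    have "(\<lambda>n. \<integral>u. bump \<delta> m (u - x) \<partial>\<pi> (c n s)) \<longlonglongrightarrow> (\<integral>u. bump \<delta> m (u - x) \<partial>\<pi> s)"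
    proof (cases "s = T")
      case True
      have "c n s = s" for n
      proof -
        have "real (Suc n) * T \<le> real_of_int (\<lfloor>real (Suc n) * T\<rfloor> + 1)" by linarith
        then have "T \<le> real_of_int (\<lfloor>real (Suc n) * T\<rfloor> + 1) / real (Suc n)" by (simp add: pos_le_divide_eq mult.commute)
        then show ?thesis unfolding c_def True by simp
      qed
      then show ?thesis by simp
    next
      case False
      have lim: "((\<lambda>t. \<integral>u. bump \<delta> m (u - x) \<partial>\<pi> t) \<longlongrightarrow> (\<integral>u. bump \<delta> m (u - x) \<partial>\<pi> s)) (at s within ({0..T} \<inter> {s<..}))"
        by (rule D_space_right_limit[OF \<pi> s bump_C_torus])
      have gt: "s < c n s" for n
      proof -
        have "real (Suc n) * s < real_of_int (\<lfloor>real (Suc n) * s\<rfloor> + 1)" by linarith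
        then have "s < real_of_int (\<lfloor>real (Suc n) * s\<rfloor> + 1) / real (Suc n)" by (simp add: pos_less_divide_eq mult.commute)
        then show ?thesis unfolding c_def using False s by simp
      qed
      have up: "c n s \<le> s + 1 / real (Suc n)" for n
      proof -
        have "real_of_int (\<lfloor>real (Suc n) * s\<rfloor> + 1) \<le> real (Suc n) * s + 1" by linarith
        then have "real_of_int (\<lfloor>real (Suc n) * s\<rfloor> + 1) / real (Suc n) \<le> (real (Suc n) * s + 1) / real (Suc n)" by (intro divide_right_mono) auto
        also have "\<dots> = s + 1 / real (Suc n)" by (simp add: field_simps del: of_nat_Suc)
        finally show ?thesis unfolding c_def by linarith
      qed
      have "(\<lambda>n. c n s) \<longlonglongrightarrow> s"
      proof (rule real_tendsto_sandwich[OF _ _ tendsto_const])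
        show "(\<lambda>n. s + 1 / real (Suc n)) \<longlonglongrightarrow> s"
          using tendsto_add[OF tendsto_const LIMSEQ_inverse_real_of_nat, of s] by (simp add: inverse_eq_divide)
      qed (use gt up in \<open>auto simp: less_imp_le\<close>)
      moreover have "\<forall>\<^sub>F n in sequentially. c n s \<in> {0..T} \<inter> {s<..} \<and> c n s \<noteq> s"
      proof (intro always_eventually allI conjI IntI)
        fix n show "c n s \<in> {0..T}" using gt[of n] s by (auto simp: c_def)
        show "c n s \<in> {s<..}" "c n s \<noteq> s" using gt[of n] by auto
      qed
      ultimately have "filterlim (\<lambda>n. c n s) (at s within ({0..T} \<inter> {s<..})) sequentially"
        by (simp add: filterlim_at)
      from filterlim_compose[OF lim this] show ?thesis .
    qed
    then show "(\<lambda>n. f (c n (fst (fst z))) z) \<longlonglongrightarrow> (case z of ((s, x), \<pi>) \<Rightarrow> \<integral>u. bump \<delta> m (u - x) \<partial>\<pi> s)"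
      by (simp add: zz f_def)
  qed
  then show ?thesis by (simp add: split_beta')
qed

lemma box_mass_measurable:
  assumes T: "T \<ge> 0" and \<delta>: "\<delta> \<le> 1"
  shows "(\<lambda>((s, x), \<pi>). box_mass \<delta> (\<pi> s) x) \<in>
    borel_measurable ((restrict_space borel {0..T} \<Otimes>\<^sub>M (borel :: (real^'n::finite) measure)) \<Otimes>\<^sub>M path_space T)"
proof (rule borel_measurable_LIMSEQ_real[where u = "\<lambda>m ((s, x), \<pi>). \<integral>u. bump \<delta> m (u - x) \<partial>\<pi> s", OF _ bump_integral_measurable[OF T]])
  fix z :: "(real \<times> (real^'n)) \<times> (real \<Rightarrow> (real^'n) measure)"
  assume z: "z \<in> space ((restrict_space borel {0..T} \<Otimes>\<^sub>M (borel :: (real^'n) measure)) \<Otimes>\<^sub>M path_space T)"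
  obtain s x \<pi> where zz: "z = ((s, x), \<pi>)" by (cases z) auto
  have "s \<in> {0..T}" "\<pi> \<in> D_space T"
    using z by (auto simp: zz space_pair_measure space_path_space space_restrict_space)
  then show "(\<lambda>m. (\<lambda>((s, x), \<pi>). \<integral>u. bump \<delta> m (u - x) \<partial>\<pi> s) z) \<longlonglongrightarrow> (\<lambda>((s, x), \<pi>). box_mass \<delta> (\<pi> s) x) z"
    unfolding zz by (simp add: bump_integral_limit[OF D_space_value \<delta>])
qed

section \<open>Absolute continuity of the limit\<close>

text \<open>Boxes with rational corners suffice to bound a measure, and there are only countably many of
  them, so that the exceptional null sets can be united.\<close>

definition rational_points :: "(real^'n) set" where "rational_points = {x. \<forall>k. x $ k \<in> \<rat>}"

lemma countable_rational_points: "countable (rational_points :: (real^'n::finite) set)"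
proof -
  have "(rational_points :: (real^'n) set) \<subseteq> (\<lambda>f. \<chi> k. f k) ` (UNIV \<rightarrow>\<^sub>E \<rat>)"
  proof
    fix x :: "real^'n" assume "x \<in> rational_points"
    then show "x \<in> (\<lambda>f. \<chi> k. f k) ` (UNIV \<rightarrow>\<^sub>E \<rat>)"
      by (intro image_eqI[of _ _ "\<lambda>k. x $ k"]) (auto simp: rational_points_def)
  qed
  moreover have "countable ((UNIV :: 'n set) \<rightarrow>\<^sub>E (\<rat> :: real set))"
    by (intro countable_PiE) (auto simp: countable_rat)
  ultimately show ?thesis by (meson countable_image countable_subset)
qed

text \<open>By the exclusion rule the number of particles in a box is at most the number of its lattice
  points.\<close>

lemma empirical_bump_bound:
  fixes \<zeta> :: "'n::finite config"
  assumes N: "N \<ge> 1" and \<zeta>: "\<zeta> \<in> configs N" and \<delta>: "\<delta> > 0"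
  shows "(\<integral>u. bump \<delta> m (u - x) \<partial>empirical_measure N \<zeta>) \<le> (\<delta> + 1 / real N) ^ CARD('n)"
proof -
  have "(\<integral>u. bump \<delta> m (u - x) \<partial>empirical_measure N \<zeta>) = (\<Sum>y\<in>sites N. real (\<zeta> y) * bump \<delta> m (scaled_site N y - x)) / real N ^ CARD('n)"
    by (rule empirical_integral[OF N]) measurable
  also have "\<dots> \<le> (\<Sum>y\<in>(sites N :: 'n site set). indicator (periodic_box \<delta>) (scaled_site N y - x)) / real N ^ CARD('n)"
  proof (intro divide_right_mono sum_mono)
    fix y :: "'n site" assume y: "y \<in> sites N"
    have "real (\<zeta> y) * bump \<delta> m (scaled_site N y - x) \<le> bump \<delta> m (scaled_site N y - x)"
      using config_value[OF \<zeta> y] bump_range(1)[of \<delta> m "scaled_site N y - x"] by auto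
    also have "\<dots> \<le> indicator (periodic_box \<delta>) (scaled_site N y - x)" by (rule bump_le_indicator)
    finally show "real (\<zeta> y) * bump \<delta> m (scaled_site N y - x) \<le> indicator (periodic_box \<delta>) (scaled_site N y - x)" .
  qed simp
  also have "(\<Sum>y\<in>(sites N :: 'n site set). indicator (periodic_box \<delta>) (scaled_site N y - x)) = real (card {y \<in> sites N. scaled_site N y - x \<in> periodic_box \<delta>})"
    by (simp add: indicator_def sum.If_cases finite_sites Int_def)
  also have "\<dots> / real N ^ CARD('n) \<le> (\<delta> * real N + 1) ^ CARD('n) / real N ^ CARD('n)"
    by (intro divide_right_mono lattice_count[OF N \<delta>]) simp
  also have "\<dots> = (\<delta> + 1 / real N) ^ CARD('n)" using N by (simp add: power_divide[symmetric] add_divide_distrib)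
  finally show ?thesis .
qed

text \<open>The expectation of the positive part of the excess is a limit of expectations under the
  empirical laws, where the excess is at most (\<delta> + 1/N)^d - \<delta>^d.\<close>

lemma limit_bump_bound:
  fixes \<Omega> :: "nat \<Rightarrow> 'w measure" and \<eta> :: "nat \<Rightarrow> real \<Rightarrow> 'w \<Rightarrow> 'n::finite config"
  assumes mp: "\<And>N. N \<ge> 1 \<Longrightarrow> markov_process (configs N) (G N) (\<mu> N) (\<Omega> N) (\<eta> N)"
    and lp: "limit_point T (\<lambda>N. empirical_law T N (\<Omega> N) (\<eta> N)) Q"
    and s: "s \<in> {0..T}" and \<delta>: "0 < \<delta>"
  shows "AE \<pi> in Q. (\<integral>u. bump \<delta> m (u - x) \<partial>\<pi> s) \<le> \<delta> ^ CARD('n)"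
proof -
  obtain r where r: "strict_mono r" and wc: "weakly_converges T (\<lambda>n. empirical_law T (r n) (\<Omega> (r n)) (\<eta> (r n))) Q"
    using lp by (auto simp: limit_point_def)
  have Q: "prob_space Q" "sets Q = sets (path_space T)" using lp by (auto simp: limit_point_def)
  interpret prob_space Q by fact
  have spQ: "space Q = D_space T" using sets_eq_imp_space_eq[OF Q(2)] by (simp add: space_path_space)
  let ?d = "\<delta> ^ CARD('n)"
  define g where "g y = max 0 (y - ?d)" for y
  have g: "continuous_on UNIV g" unfolding g_def by (intro continuous_intros)
  let ?H = "\<lambda>u. bump \<delta> m (u - x)"
  note lim = limit_evaluation[OF mp r wc bump_C_torus[of \<delta> m x] _ g s, of 1]
  have "(\<integral>\<pi>. g (\<integral>u. ?H u \<partial>\<pi> s) \<partial>Q) \<le> 0"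
  proof (rule LIMSEQ_le[OF lim])
    show "\<bar>?H u\<bar> \<le> 1" for u by (simp add: bump_range)
    have "(\<lambda>n. (\<delta> + 1 / real (r n)) ^ CARD('n) - ?d) \<longlonglongrightarrow> (\<delta> + 0) ^ CARD('n) - ?d"
      using filterlim_compose[OF lim_1_over_n filterlim_subseq[OF r]] by (intro tendsto_intros)
    then show "(\<lambda>n. (\<delta> + 1 / real (r n)) ^ CARD('n) - ?d) \<longlonglongrightarrow> 0" by simp
    have "(\<Sum>\<zeta>\<in>configs (r n). law_at (\<Omega> (r n)) (\<eta> (r n)) s \<zeta> * g (\<integral>u. ?H u \<partial>empirical_measure (r n) \<zeta>))
       \<le> (\<delta> + 1 / real (r n)) ^ CARD('n) - ?d" if n: "n \<ge> 1" for n
    proof -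
      have N: "r n \<ge> 1" using seq_suble[OF r, of n] n by linarith
      have P: "prob_space (\<Omega> (r n))" and X: "\<eta> (r n) s \<in> \<Omega> (r n) \<rightarrow>\<^sub>M count_space (configs (r n))"
        using mp[OF N] s by (auto simp: markov_process_def)
      have one: "(\<Sum>\<zeta>\<in>configs (r n). law_at (\<Omega> (r n)) (\<eta> (r n)) s \<zeta>) = 1"
        using finite_expectation[OF P X finite_configs, of "\<lambda>_. 1"] prob_space.prob_space[OF P] by (simp add: law_at_def)
      have "(\<Sum>\<zeta>\<in>configs (r n). law_at (\<Omega> (r n)) (\<eta> (r n)) s \<zeta> * g (\<integral>u. ?H u \<partial>empirical_measure (r n) \<zeta>))
         \<le> (\<Sum>\<zeta>\<in>configs (r n). law_at (\<Omega> (r n)) (\<eta> (r n)) s \<zeta> * ((\<delta> + 1 / real (r n)) ^ CARD('n) - ?d))"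
      proof (intro sum_mono mult_left_mono)
        fix \<zeta> :: "'n config" assume \<zeta>: "\<zeta> \<in> configs (r n)"
        have "?d \<le> (\<delta> + 1 / real (r n)) ^ CARD('n)" using \<delta> by (intro power_mono) auto
        then show "g (\<integral>u. ?H u \<partial>empirical_measure (r n) \<zeta>) \<le> (\<delta> + 1 / real (r n)) ^ CARD('n) - ?d"
          using empirical_bump_bound[OF N \<zeta> \<delta>, of m x] by (simp add: g_def)
      qed (simp add: law_at_def)
      also have "\<dots> = (\<delta> + 1 / real (r n)) ^ CARD('n) - ?d" by (simp add: sum_distrib_right[symmetric] one)
      finally show ?thesis .
    qed
    then show "\<exists>M. \<forall>n\<ge>M. (\<Sum>\<zeta>\<in>configs (r n). law_at (\<Omega> (r n)) (\<eta> (r n)) s \<zeta> * g (\<integral>u. ?H u \<partial>empirical_measure (r n) \<zeta>))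
       \<le> (\<delta> + 1 / real (r n)) ^ CARD('n) - ?d" by blast
  qed
  moreover have g0: "g y \<ge> 0" for y by (simp add: g_def)
  ultimately have I0: "(\<integral>\<pi>. g (\<integral>u. ?H u \<partial>\<pi> s) \<partial>Q) = 0"
    by (intro antisym integral_nonneg_AE) auto
  have Hm: "?H \<in> borel_measurable torus_borel" by (rule torus_borel_measurable) measurable
  have "integrable Q (\<lambda>\<pi>. g (\<integral>u. ?H u \<partial>\<pi> s))"
  proof (rule integrable_const_bound[where B = 1])
    have [measurable]: "(\<lambda>\<pi>. \<integral>u. ?H u \<partial>\<pi> s) \<in> borel_measurable (path_space T)"
      using measurable_compose[OF evaluation_measurable[OF s] integral_measurable_subprob_algebra[OF Hm]] .
    have "(\<lambda>\<pi>. g (\<integral>u. ?H u \<partial>\<pi> s)) \<in> borel_measurable (path_space T)" unfolding g_def by measurable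
    then show "(\<lambda>\<pi>. g (\<integral>u. ?H u \<partial>\<pi> s)) \<in> borel_measurable Q" using Q(2) by (simp cong: measurable_cong_sets)
    show "AE \<pi> in Q. norm (g (\<integral>u. ?H u \<partial>\<pi> s)) \<le> 1"
    proof (rule AE_I2)
      fix \<pi> :: "real \<Rightarrow> (real^'n) measure" assume "\<pi> \<in> space Q"
      then have "\<pi> \<in> D_space T" using spQ by simp
      from subprob_integral_bound(2)[OF D_space_value[OF this s] Hm, of 1]
      have "\<bar>\<integral>u. ?H u \<partial>\<pi> s\<bar> \<le> 1" by (simp add: bump_range)
      moreover have "?d > 0" using \<delta> by simp
      ultimately show "norm (g (\<integral>u. ?H u \<partial>\<pi> s)) \<le> 1" by (simp add: g_def)
    qed
  qed
  then have "AE \<pi> in Q. g (\<integral>u. ?H u \<partial>\<pi> s) = 0"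
    using I0 g0 by (subst (asm) integral_nonneg_eq_0_iff_AE) auto
  then show ?thesis by eventually_elim (simp add: g_def)
qed

definition box_bounded :: "(real^'n::finite) measure \<Rightarrow> bool" where
  "box_bounded \<mu> \<longleftrightarrow> (\<forall>x\<in>rational_points. \<forall>\<delta>\<in>\<rat> \<inter> {0<..1}. box_mass \<delta> \<mu> x \<le> \<delta> ^ CARD('n))"

text \<open>It suffices to consider countably many times, because a strict violation of the bound at some
  time persists on its right.\<close>

lemma limit_box_bounded:
  fixes \<Omega> :: "nat \<Rightarrow> 'w measure" and \<eta> :: "nat \<Rightarrow> real \<Rightarrow> 'w \<Rightarrow> 'n::finite config"
  assumes mp: "\<And>N. N \<ge> 1 \<Longrightarrow> markov_process (configs N) (G N) (\<mu> N) (\<Omega> N) (\<eta> N)"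
    and lp: "limit_point T (\<lambda>N. empirical_law T N (\<Omega> N) (\<eta> N)) Q" and T: "T \<ge> 0"
  shows "AE \<pi> in Q. \<forall>s\<in>{0..T}. box_bounded (\<pi> s)"
proof -
  have Q: "prob_space Q" "sets Q = sets (path_space T)" using lp by (auto simp: limit_point_def)
  have spQ: "space Q = D_space T" using sets_eq_imp_space_eq[OF Q(2)] by (simp add: space_path_space)
  \<comment> \<open>The time T has no times to its right, so right-continuity gives no information there.\<close>
  define S where "S = insert T (\<rat> \<inter> {0..T})"
  have S: "countable S" "S \<subseteq> {0..T}" using T by (auto simp: S_def countable_rat)
  have cd: "countable (\<rat> \<inter> {0<..1::real})" by (simp add: countable_rat countable_Int1)
  have "AE \<pi> in Q. \<forall>s\<in>S. \<forall>x\<in>rational_points. \<forall>\<delta>\<in>\<rat> \<inter> {0<..1}. \<forall>m\<in>UNIV. (\<integral>u. bump \<delta> m (u - x) \<partial>\<pi> s) \<le> \<delta> ^ CARD('n)"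
    by (intro AE_ball_countable' S(1) countable_rational_points cd countableI_type limit_bump_bound[OF mp lp]) (use S(2) in auto)
  then show ?thesis
  proof (rule AE_mp, intro AE_I2 impI ballI)
    fix \<pi> :: "real \<Rightarrow> (real^'n) measure" and s
    assume "\<pi> \<in> space Q" and s: "s \<in> {0..T}"
      and b: "\<forall>s\<in>S. \<forall>x\<in>rational_points. \<forall>\<delta>\<in>\<rat> \<inter> {0<..1}. \<forall>m\<in>UNIV. (\<integral>u. bump \<delta> m (u - x) \<partial>\<pi> s) \<le> \<delta> ^ CARD('n)"
    then have \<pi>: "\<pi> \<in> D_space T" using spQ by simp
    show "box_bounded (\<pi> s)" unfolding box_bounded_def
    proof (intro ballI)
      fix x :: "real^'n" and \<delta> :: real assume x: "x \<in> rational_points" and \<delta>: "\<delta> \<in> \<rat> \<inter> {0<..1}"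
      have le: "(\<integral>u. bump \<delta> m (u - x) \<partial>\<pi> s) \<le> \<delta> ^ CARD('n)" for m
      proof (rule ccontr)
        assume gt: "\<not> (\<integral>u. bump \<delta> m (u - x) \<partial>\<pi> s) \<le> \<delta> ^ CARD('n)"
        then have "s \<notin> S" using b x \<delta> by auto
        then have sT: "s < T" using s by (auto simp: S_def)
        have "\<forall>\<^sub>F t in at s within ({0..T} \<inter> {s<..}). \<delta> ^ CARD('n) < (\<integral>u. bump \<delta> m (u - x) \<partial>\<pi> t)"
          using gt by (intro order_tendstoD(1)[OF D_space_right_limit[OF \<pi> s bump_C_torus]]) simp
        then obtain e where e: "e > 0" "\<And>t. t \<in> {0..T} \<inter> {s<..} \<Longrightarrow> t \<noteq> s \<Longrightarrow> dist t s < e \<Longrightarrow> \<delta> ^ CARD('n) < (\<integral>u. bump \<delta> m (u - x) \<partial>\<pi> t)"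
          unfolding eventually_at by auto
        obtain t where t: "t \<in> \<rat>" "s < t" "t < min T (s + e)"
          using Rats_dense_in_real[of s "min T (s + e)"] sT e(1) by auto
        then have "t \<in> S" using s by (auto simp: S_def)
        with b x \<delta> have "(\<integral>u. bump \<delta> m (u - x) \<partial>\<pi> t) \<le> \<delta> ^ CARD('n)" by auto
        moreover have "\<delta> ^ CARD('n) < (\<integral>u. bump \<delta> m (u - x) \<partial>\<pi> t)"
          using t s by (intro e(2)) (auto simp: dist_real_def)
        ultimately show False by simp
      qed
      show "box_mass \<delta> (\<pi> s) x \<le> \<delta> ^ CARD('n)"
        using \<delta> le by (intro LIMSEQ_le_const2[OF bump_integral_limit[OF D_space_value[OF \<pi> s]]]) auto
    qed
  qed
qed

definition cell :: "nat \<Rightarrow> 'n site \<Rightarrow> (real^'n) set" where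
  "cell n i = {u. \<forall>k. real (i k) / real n \<le> u $ k \<and> u $ k < (real (i k) + 1) / real n}"

lemma cell_measurable [measurable]: "cell n (i :: 'n::finite site) \<in> sets borel"
proof -
  have "cell n i = (\<Inter>k\<in>UNIV. {u. real (i k) / real n \<le> u $ k \<and> u $ k < (real (i k) + 1) / real n})"
    by (auto simp: cell_def)
  also have "\<dots> \<in> sets borel" by (intro sets.finite_INT) auto
  finally show ?thesis .
qed

lemma cell_subset_torus:
  fixes i :: "'n::finite site"
  assumes "n \<ge> 1" "i \<in> sites n" shows "cell n i \<subseteq> torus"
proof
  fix u :: "real^'n" assume u: "u \<in> cell n i"
  show "u \<in> torus" unfolding torus_def
  proof (intro CollectI allI)
    fix k
    have "i k + 1 \<le> n" using assms(2) by (auto simp: sites_def Suc_le_eq)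
    then have "real (i k) + 1 \<le> real n" by linarith
    then have "(real (i k) + 1) / real n \<le> 1" using assms(1) by simp
    moreover have "0 \<le> real (i k) / real n" by simp
    ultimately show "0 \<le> u $ k \<and> u $ k < 1" using u unfolding cell_def mem_Collect_eq by (meson order_trans less_le_trans)
  qed
qed

lemma cell_cover:
  fixes u :: "real^'n::finite"
  assumes "n \<ge> 1" "u \<in> torus" obtains i where "i \<in> sites n" "u \<in> cell n i"
proof
  let ?i = "\<lambda>k. nat \<lfloor>real n * u $ k\<rfloor>"
  have f: "real (?i k) = of_int \<lfloor>real n * u $ k\<rfloor>" for k using assms by (auto simp: torus_def)
  show "?i \<in> sites n"
  proof -
    have "?i k < n" for k
    proof -
      have "real n * u $ k < real n" using assms by (auto simp: torus_def)
      then have "real (?i k) < real n" unfolding f by linarith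
      then show ?thesis by simp
    qed
    then show ?thesis by (simp add: sites_def)
  qed
  show "u \<in> cell n ?i" unfolding cell_def
  proof (intro CollectI allI conjI)
    fix k
    show "real (?i k) / real n \<le> u $ k" unfolding f using assms by (simp add: pos_divide_le_eq mult.commute)
    have "real n * u $ k < of_int \<lfloor>real n * u $ k\<rfloor> + 1" by linarith
    then show "u $ k < (real (?i k) + 1) / real n" unfolding f using assms by (simp add: pos_less_divide_eq mult.commute)
  qed
qed

lemma cell_disjoint:
  fixes i i' :: "'n::finite site"
  assumes "n \<ge> 1" "u \<in> cell n i" "u \<in> cell n i'" shows "i = i'"
proof
  fix k
  have "real (i k) / real n < (real (i' k) + 1) / real n" "real (i' k) / real n < (real (i k) + 1) / real n"
    using assms(2,3) unfolding cell_def mem_Collect_eq by (meson le_less_trans)+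
  then have "real (i k) < real (i' k) + 1" "real (i' k) < real (i k) + 1"
    using assms(1) by (auto simp: divide_less_cancel)
  then show "i k = i' k" by linarith
qed

lemma cell_lebesgue:
  fixes i :: "'n::finite site"
  assumes "n \<ge> 1" shows "ennreal ((1 / real n) ^ CARD('n)) \<le> emeasure lborel (cell n i :: (real^'n) set)"
proof -
  let ?c = "(\<chi> k. real (i k) / real n) :: real^'n"
  have "box ?c (?c + (1 / real n) *\<^sub>R One) \<subseteq> cell n i"
    by (auto simp: mem_box_cart cell_def One_vec_nth add_divide_distrib less_imp_le)
  then have "emeasure lborel (box ?c (?c + (1 / real n) *\<^sub>R One)) \<le> emeasure lborel (cell n i)"
    by (intro emeasure_mono) auto
  then show ?thesis by (simp add: emeasure_lborel_cube)
qed

lemma cell_diameter: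
  fixes u v :: "real^'n::finite"
  assumes "n \<ge> 1" "u \<in> cell n i" "v \<in> cell n i" shows "dist u v \<le> real CARD('n) / real n"
proof -
  have "norm (u - v) \<le> (\<Sum>k\<in>UNIV. \<bar>(u - v) $ k\<bar>)" by (rule norm_le_l1_cart)
  also have "\<dots> \<le> (\<Sum>k\<in>(UNIV :: 'n set). 1 / real n)"
  proof (rule sum_mono)
    fix k
    have "real (i k) / real n \<le> u $ k" "u $ k < real (i k) / real n + 1 / real n"
      "real (i k) / real n \<le> v $ k" "v $ k < real (i k) / real n + 1 / real n"
      using assms(2,3) by (auto simp: cell_def add_divide_distrib)
    then show "\<bar>(u - v) $ k\<bar> \<le> 1 / real n" by simp
  qed
  finally show ?thesis by (simp add: dist_norm)
qed

text \<open>Cells are half-open and boxes are open, so a cell is covered by slightly larger boxes, with side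
  1/n + 1/p and p \<rightarrow> \<infinity>. The side is at most 1 because n and p are at least 2.\<close>

lemma box_bounded_cell:
  fixes \<mu> :: "(real^'n::finite) measure"
  assumes \<mu>: "\<mu> \<in> space (subprob_algebra torus_borel)" and b: "box_bounded \<mu>" and n: "n \<ge> 2" and i: "i \<in> sites n"
  shows "measure \<mu> (cell n i) \<le> (1 / real n) ^ CARD('n)"
proof -
  have sm: "subprob_space \<mu>" "sets \<mu> = sets torus_borel" using \<mu> by (auto simp: space_subprob_algebra)
  interpret subprob_space \<mu> by fact
  have le: "measure \<mu> (cell n i) \<le> (1 / real n + 1 / real p) ^ CARD('n)" if p: "p \<ge> 2" for p
  proof -
    \<comment> \<open>The corner is shifted by 1/p to the left, so that the closed faces of the cell lie
      inside the open box.\<close>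
    define \<delta> where "\<delta> = 1 / real n + 1 / real p"
    define x where "x = ((\<chi> k. real (i k) / real n - 1 / real p) :: real^'n)"
    have "1 / real n \<le> 1 / 2" "1 / real p \<le> 1 / 2" using n p by (auto intro!: divide_left_mono)
    moreover have pos: "1 / real n > 0" "1 / real p > 0" using n p by auto
    ultimately have "0 < \<delta>" "\<delta> \<le> 1" unfolding \<delta>_def by linarith+
    then have \<delta>: "\<delta> \<in> \<rat> \<inter> {0<..1}" by (auto simp: \<delta>_def)
    have x: "x \<in> rational_points" by (auto simp: rational_points_def x_def)
    have sub: "cell n i \<subseteq> {u \<in> torus. u - x \<in> periodic_box \<delta>}"
    proof
      fix u :: "real^'n" assume u: "u \<in> cell n i"
      have "u \<in> torus" using cell_subset_torus[OF _ i] n u by auto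
      moreover have "0 < frac ((u - x) $ k) \<and> frac ((u - x) $ k) < \<delta>" for k
      proof -
        have "real (i k) / real n \<le> u $ k" "u $ k < real (i k) / real n + 1 / real n"
          using u by (auto simp: cell_def add_divide_distrib)
        then have "0 < (u - x) $ k" "(u - x) $ k < \<delta>" using pos(2) unfolding x_def \<delta>_def vector_minus_component vec_lambda_beta by linarith+
        moreover from this have "frac ((u - x) $ k) = (u - x) $ k" using \<delta> by (subst frac_eq) auto
        ultimately show ?thesis by simp
      qed
      ultimately show "u \<in> {u \<in> torus. u - x \<in> periodic_box \<delta>}" by (simp add: periodic_box_def)
    qed
    have "(\<lambda>u. u - x) -` periodic_box \<delta> \<in> sets borel"
      using open_periodic_box[of \<delta>, where 'n = 'n] \<delta> by (intro borel_open open_vimage continuous_intros) auto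
    then have "{u \<in> torus. u - x \<in> periodic_box \<delta>} \<in> sets \<mu>"
      unfolding sm(2) torus_borel_def sets_restrict_space
      by (intro image_eqI[of _ _ "(\<lambda>u. u - x) -` periodic_box \<delta>"]) auto
    then have "measure \<mu> (cell n i) \<le> box_mass \<delta> \<mu> x"
      unfolding box_mass_def by (intro finite_measure_mono sub)
    also have "\<dots> \<le> \<delta> ^ CARD('n)" using b x \<delta> by (auto simp: box_bounded_def)
    finally show ?thesis by (simp add: \<delta>_def)
  qed
  have "(\<lambda>p. (1 / real n + 1 / real p) ^ CARD('n)) \<longlonglongrightarrow> (1 / real n + 0) ^ CARD('n)"
    by (intro tendsto_intros lim_1_over_n)
  then show ?thesis using le by (intro LIMSEQ_le_const[where x = "(1 / real n) ^ CARD('n)"]) auto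
qed

text \<open>The compact set is covered by the cells that it meets. If the mesh is small they all lie in an
  open neighbourhood with almost the same volume.\<close>

lemma box_bounded_compact:
  fixes \<mu> :: "(real^'n::finite) measure"
  assumes \<mu>: "\<mu> \<in> space (subprob_algebra torus_borel)" and b: "box_bounded \<mu>" and K: "compact K" "K \<subseteq> torus"
  shows "emeasure \<mu> K \<le> emeasure lborel K"
proof (rule ennreal_le_epsilon)
  fix e :: real assume e: "e > 0"
  have sm: "subprob_space \<mu>" "sets \<mu> = sets torus_borel" using \<mu> by (auto simp: space_subprob_algebra)
  interpret subprob_space \<mu> by fact
  have Kb: "K \<in> sets borel" using K by (intro borel_closed compact_imp_closed)
  obtain U where U: "open U" "K \<subseteq> U" "emeasure lborel (U - K) < e" using outer_regular_lborel[OF Kb e] .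
  obtain d where d: "d > 0" "(\<Union>x\<in>K. ball x d) \<subseteq> U" using compact_subset_open_imp_ball_epsilon_subset[OF K(1) U(1,2)] .
  \<comment> \<open>A cell has diameter at most 1/n times the dimension, which is to be smaller than the
    distance from K to the complement of U.\<close>
  obtain n0 where n0: "real CARD('n) / d < real n0" using reals_Archimedean2 by blast
  define n where "n = max 2 n0"
  have n: "n \<ge> 2" "n \<ge> 1" by (auto simp: n_def)
  have "real CARD('n) / d < real n" using n0 by (simp add: n_def)
  then have nd: "real CARD('n) / real n < d" using d n by (simp add: field_simps)
  define I where "I = {i \<in> sites n. cell n i \<inter> K \<noteq> {}}"
  have I: "finite I" "I \<subseteq> sites n" using finite_sites[of n] by (auto simp: I_def)
  have cs: "cell n i \<in> sets \<mu>" if "i \<in> I" for i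
    unfolding sm(2) torus_borel_def using cell_subset_torus[OF n(2)] that I by (subst sets_restrict_space_iff) auto
  have "K \<subseteq> (\<Union>i\<in>I. cell n i)"
  proof
    fix u assume u: "u \<in> K"
    then obtain i where "i \<in> sites n" "u \<in> cell n i" using cell_cover[OF n(2)] K(2) by blast
    then show "u \<in> (\<Union>i\<in>I. cell n i)" using u by (auto simp: I_def)
  qed
  then have "emeasure \<mu> K \<le> emeasure \<mu> (\<Union>i\<in>I. cell n i)"
    using I cs by (intro emeasure_mono) auto
  also have "\<dots> \<le> (\<Sum>i\<in>I. emeasure \<mu> (cell n i))"
    using I cs by (intro emeasure_subadditive_finite) auto
  also have "\<dots> \<le> (\<Sum>i\<in>I. emeasure lborel (cell n i :: (real^'n) set))"
  proof (rule sum_mono)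
    fix i assume i: "i \<in> I"
    have "emeasure \<mu> (cell n i) = ennreal (measure \<mu> (cell n i))" by (rule emeasure_eq_measure)
    also have "\<dots> \<le> ennreal ((1 / real n) ^ CARD('n))" using box_bounded_cell[OF \<mu> b n(1)] i I by (intro ennreal_leI) auto
    also have "\<dots> \<le> emeasure lborel (cell n i :: (real^'n) set)" by (rule cell_lebesgue[OF n(2)])
    finally show "emeasure \<mu> (cell n i) \<le> emeasure lborel (cell n i :: (real^'n) set)" .
  qed
  also have "\<dots> = emeasure lborel (\<Union>i\<in>I. cell n i :: (real^'n) set)"
    using I cell_disjoint[OF n(2)] by (intro sum_emeasure) (auto simp: disjoint_family_on_def)
  also have "\<dots> \<le> emeasure lborel U"
  proof (rule emeasure_mono)
    show "(\<Union>i\<in>I. cell n i) \<subseteq> U"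
    proof safe
      fix i :: "'n site" and u :: "real^'n" assume i: "i \<in> I" and u: "u \<in> cell n i"
      then obtain v where v: "v \<in> K" "v \<in> cell n i" by (auto simp: I_def)
      have "dist v u < d" using cell_diameter[OF n(2) v(2) u] nd by simp
      then have "u \<in> (\<Union>x\<in>K. ball x d)" using v(1) by auto
      then show "u \<in> U" using d(2) by blast
    qed
  qed (use U in auto)
  also have "\<dots> = emeasure lborel (K \<union> (U - K))" using U by (intro arg_cong[where f = "emeasure lborel"]) auto
  also have "\<dots> \<le> emeasure lborel K + emeasure lborel (U - K)"
    using U Kb by (intro emeasure_subadditive) auto
  also have "\<dots> \<le> emeasure lborel K + ennreal e" using U by (intro add_left_mono) auto
  finally show "emeasure \<mu> K \<le> emeasure lborel K + ennreal e" .
qed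

text \<open>Inner regularity reduces the comparison to compact sets.\<close>

lemma box_bounded_le_lebesgue:
  fixes \<mu> :: "(real^'n::finite) measure"
  assumes \<mu>: "\<mu> \<in> space (subprob_algebra torus_borel)" and b: "box_bounded \<mu>" and A: "A \<in> sets torus_borel"
  shows "emeasure \<mu> A \<le> emeasure torus_lebesgue A"
proof -
  have sm: "subprob_space \<mu>" "sets \<mu> = sets torus_borel" using \<mu> by (auto simp: space_subprob_algebra)
  interpret subprob_space \<mu> by fact
  have A': "A \<in> sets borel" "A \<subseteq> torus" using A by (auto simp: torus_borel_def sets_restrict_space_iff)
  have sp: "space \<mu> = torus" using sets_eq_imp_space_eq[OF sm(2)] by simp
  have m: "(\<lambda>x. x) \<in> \<mu> \<rightarrow>\<^sub>M borel"
  proof -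
    have "(\<lambda>x. x) \<in> torus_borel \<rightarrow>\<^sub>M (borel :: (real^'n) measure)"
      unfolding torus_borel_def by (rule measurable_restrict_space1) simp
    then show ?thesis using sm(2) by (simp cong: measurable_cong_sets)
  qed
  let ?M = "distr \<mu> borel (\<lambda>x. x)"
  have e: "emeasure ?M B = emeasure \<mu> (B \<inter> torus)" if "B \<in> sets borel" for B
    using that by (simp add: emeasure_distr[OF m] sp)
  have "emeasure \<mu> A = emeasure ?M A" using A' by (simp add: e Int_absorb2)
  also have "\<dots> = (SUP K \<in> {K. K \<subseteq> A \<and> compact K}. emeasure ?M K)"
    using emeasure_finite[of torus] A' by (intro inner_regular) (auto simp: e)
  also have "\<dots> \<le> emeasure lborel A"
  proof (rule SUP_least)
    fix K assume K: "K \<in> {K. K \<subseteq> A \<and> compact K}"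
    then have Kb: "K \<in> sets borel" by (auto intro: borel_closed compact_imp_closed)
    have KT: "K \<subseteq> torus" using K A' by auto
    have "emeasure ?M K = emeasure \<mu> K" using KT by (simp add: e[OF Kb] Int_absorb2)
    also have "\<dots> \<le> emeasure lborel K" using K KT by (intro box_bounded_compact[OF \<mu> b]) auto
    also have "\<dots> \<le> emeasure lborel A" using K A' by (intro emeasure_mono) auto
    finally show "emeasure ?M K \<le> emeasure lborel A" .
  qed
  also have "\<dots> = emeasure torus_lebesgue A"
    unfolding torus_lebesgue_def using A' by (subst emeasure_restrict_space) auto
  finally show ?thesis .
qed

section \<open>A canonical version of the density\<close>

text \<open>On the set where the Radon-Nikodym density exceeds 1, the measure N would be larger than M.\<close>

lemma density_le_one:
  assumes M: "sigma_finite_measure M" "finite_measure M" and sets: "sets N = sets M"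
    and le: "\<And>A. A \<in> sets M \<Longrightarrow> emeasure N A \<le> emeasure M A"
  obtains f where "f \<in> borel_measurable M" "N = density M f" "AE x in M. f x \<le> (1 :: ennreal)"
proof -
  interpret sigma_finite_measure M by fact
  interpret finite_measure M by fact
  have "absolutely_continuous M N"
    unfolding absolutely_continuous_def
  proof
    fix A assume A: "A \<in> null_sets M"
    then have "emeasure N A \<le> emeasure M A" by (intro le) auto
    then have "emeasure N A \<le> 0" using A by auto
    then show "A \<in> null_sets N" using A sets by (intro null_setsI) auto
  qed
  from Radon_Nikodym[OF this sets] obtain f where f [measurable]: "f \<in> borel_measurable M" and N: "density M f = N" by auto
  define A where "A = {x \<in> space M. 1 < f x}"
  have A [measurable]: "A \<in> sets M" unfolding A_def by measurable
  have "(\<integral>\<^sup>+x. f x * indicator A x - indicator A x \<partial>M) = (\<integral>\<^sup>+x. f x * indicator A x \<partial>M) - (\<integral>\<^sup>+x. indicator A x \<partial>M)"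
  proof (rule nn_integral_diff)
    show "(\<integral>\<^sup>+x. indicator A x \<partial>M) \<noteq> \<infinity>" using emeasure_finite[of A] by simp
    show "AE x in M. indicator A x \<le> f x * indicator A x"
      by (intro AE_I2) (auto simp: A_def indicator_def less_imp_le)
  qed measurable
  also have "(\<integral>\<^sup>+x. f x * indicator A x \<partial>M) = emeasure N A" by (simp add: N[symmetric] emeasure_density)
  also have "emeasure N A - (\<integral>\<^sup>+x. indicator A x \<partial>M) = 0" using le[OF A] emeasure_finite[of A] by (auto simp: diff_eq_0_iff_ennreal less_top[symmetric] top_unique)
  finally have "AE x in M. f x * indicator A x - indicator A x = 0"
    by (subst (asm) nn_integral_0_iff_AE) auto
  then have "AE x in M. f x \<le> 1"
  proof (rule AE_mp, intro AE_I2 impI)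
    fix x assume "x \<in> space M" "f x * indicator A x - indicator A x = 0"
    then show "f x \<le> 1"
      by (cases "x \<in> A") (auto simp: A_def diff_eq_0_iff_ennreal not_less split: if_splits)
  qed
  then show thesis using that f N by blast
qed

definition box_average :: "nat \<Rightarrow> (real^'n) measure \<Rightarrow> real^'n \<Rightarrow> real" where
  "box_average n \<mu> x = real (Suc n) ^ CARD('n) * box_mass (1 / real (Suc n)) \<mu> x"

text \<open>Lebesgue's differentiation theorem for cubes that have x as a corner. As the coordinates of x
  are strictly less than 1, small cubes of this kind do not leave the unit cube, and the periodic box
  coincides with an ordinary one.\<close>

lemma box_average_density:
  fixes g :: "real^'n::finite \<Rightarrow> real"
  assumes g [measurable]: "g \<in> borel_measurable borel" and g01: "\<And>x. 0 \<le> g x" "\<And>x. g x \<le> indicator torus x"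
    and \<mu>: "\<mu> = density torus_lebesgue (\<lambda>x. ennreal (g x))"
  shows "AE x in torus_lebesgue. (\<lambda>n. box_average n \<mu> x) \<longlonglongrightarrow> g x"
proof -
  have ti: "integrable lborel (indicator torus :: real^'n \<Rightarrow> real)"
    using emeasure_torus_le[where 'n = 'n] by (intro integrable_real_indicator) (auto intro: le_less_trans[OF _ ennreal_one_less_top])
  have gi: "integrable lborel g"
    by (rule Bochner_Integration.integrable_bound[OF ti]) (use g01 in \<open>auto intro!: AE_I2 simp: abs_of_nonneg\<close>)
  have "g integrable_on cbox a b" for a b
    using integrable_on_subcbox[OF integrable_on_lborel[OF gi]] by simp
  from integrable_ccontinuous_explicit[OF this]
  obtain N where N: "negligible N" and L: "\<And>x e. x \<notin> N \<Longrightarrow> 0 < e \<Longrightarrow>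
       \<exists>d>0. \<forall>h. 0 < h \<and> h < d \<longrightarrow> norm (integral (cbox x (x + h *\<^sub>R One)) g /\<^sub>R h ^ DIM(real^'n) - g x) < e" by blast
  have key: "(\<lambda>n. box_average n \<mu> x) \<longlonglongrightarrow> g x" if x: "x \<in> torus" "x \<notin> N" for x
  proof -
    have mass: "box_mass h \<mu> x = integral (cbox x (x + h *\<^sub>R One)) g" if h: "0 < h" "\<And>k. x $ k + h < 1" for h
    proof -
      let ?B = "box x (x + h *\<^sub>R One)"
      have BT: "?B \<subseteq> torus"
      proof
        fix u assume u: "u \<in> ?B"
        show "u \<in> torus" unfolding torus_def
        proof (intro CollectI allI)
          fix k
          have "x $ k < u $ k" "u $ k < x $ k + h" using u by (auto simp: mem_box_cart One_vec_nth)
          then show "0 \<le> u $ k \<and> u $ k < 1" using x(1) h(2)[of k] by (auto simp: torus_def intro: order_trans less_imp_le)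
        qed
      qed
      have "{u \<in> torus. u - x \<in> periodic_box h} = ?B"
      proof (intro set_eqI iffI)
        fix u assume u: "u \<in> {u \<in> torus. u - x \<in> periodic_box h}"
        have "x $ k < u $ k \<and> u $ k < x $ k + h" for k
        proof -
          have r: "0 \<le> u $ k" "u $ k < 1" "0 \<le> x $ k" "x $ k < 1" using u x(1) by (auto simp: torus_def)
          have fr: "0 < frac (u $ k - x $ k)" "frac (u $ k - x $ k) < h" using u by (auto simp: periodic_box_def)
          have "u $ k \<ge> x $ k"
          proof (rule ccontr)
            assume "\<not> ?thesis"
            then have "\<lfloor>u $ k - x $ k\<rfloor> = -1" using r by (intro floor_unique) auto
            then show False using fr r h(2)[of k] by (simp add: frac_def)
          qed
          then have "\<lfloor>u $ k - x $ k\<rfloor> = 0" using r by (intro floor_unique) auto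
          then show ?thesis using fr by (simp add: frac_def)
        qed
        then show "u \<in> ?B" by (auto simp: mem_box_cart One_vec_nth)
      next
        fix u assume u: "u \<in> ?B"
        have "0 < frac ((u - x) $ k) \<and> frac ((u - x) $ k) < h" for k
        proof -
          have "x $ k < u $ k" "u $ k < x $ k + h" using u by (auto simp: mem_box_cart One_vec_nth)
          then have b: "0 < (u - x) $ k" "(u - x) $ k < h" unfolding vector_minus_component by linarith+
          moreover have "0 \<le> x $ k" using x(1) by (auto simp: torus_def)
          ultimately have "frac ((u - x) $ k) = (u - x) $ k" using h(2)[of k] by (subst frac_eq) auto
          then show ?thesis using b by simp
        qed
        then show "u \<in> {u \<in> torus. u - x \<in> periodic_box h}" using BT u by (auto simp: periodic_box_def)
      qed
      then have "box_mass h \<mu> x = measure \<mu> ?B" by (simp add: box_mass_def)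
      also have "\<dots> = integral ?B g"
      proof -
        have si: "set_integrable lborel ?B g" unfolding set_integrable_def
          by (rule Bochner_Integration.integrable_bound[OF gi]) (auto intro!: AE_I2 simp: indicator_def)
        have gm: "(\<lambda>x. ennreal (g x)) \<in> borel_measurable torus_lebesgue"
        proof -
          have "(\<lambda>x. ennreal (g x)) \<in> borel_measurable borel" by measurable
          from torus_borel_measurable[OF this] show ?thesis by (simp cong: measurable_cong_sets)
        qed
        have Bs: "?B \<in> sets torus_lebesgue" using BT by (auto simp: torus_borel_def sets_restrict_space_iff)
        have "emeasure \<mu> ?B = (\<integral>\<^sup>+x. ennreal (g x) * indicator ?B x \<partial>torus_lebesgue)"
          unfolding \<mu> by (rule emeasure_density[OF gm Bs])
        also have "\<dots> = (\<integral>\<^sup>+x. ennreal (indicator ?B x * g x) \<partial>lborel)"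
          unfolding nn_integral_torus using BT by (intro nn_integral_cong) (auto simp: indicator_def)
        also have "\<dots> = ennreal (\<integral>x. indicator ?B x * g x \<partial>lborel)"
          using si g01 by (intro nn_integral_eq_integral) (auto simp: set_integrable_def)
        also have "(\<integral>x. indicator ?B x * g x \<partial>lborel) = integral ?B g"
          using set_borel_integral_eq_integral(2)[OF si] by (simp add: set_lebesgue_integral_def)
        finally have "emeasure \<mu> ?B = ennreal (integral ?B g)" .
        moreover have "0 \<le> integral ?B g"
          using set_borel_integral_eq_integral(1)[OF si] g01 by (intro integral_nonneg) auto
        ultimately show ?thesis by (simp add: measure_def)
      qed
      finally show ?thesis by (simp add: integral_open_interval)
    qed
    define d0 where "d0 = Min (range (\<lambda>k. 1 - x $ k))"
    have d0: "d0 > 0" "\<And>k. d0 \<le> 1 - x $ k" using x(1) by (auto simp: d0_def torus_def)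
    show ?thesis
    proof (rule LIMSEQ_I)
      fix e :: real assume "e > 0"
      from L[OF x(2) this] obtain d where d: "d > 0"
        "\<And>h. 0 < h \<Longrightarrow> h < d \<Longrightarrow> norm (integral (cbox x (x + h *\<^sub>R One)) g /\<^sub>R h ^ DIM(real^'n) - g x) < e" by blast
      obtain n0 where n0: "1 / real (Suc n0) < min d d0" using d d0 nat_approx_posE[of "min d d0"] by (auto simp: inverse_eq_divide)
      show "\<exists>n0. \<forall>n\<ge>n0. norm (box_average n \<mu> x - g x) < e"
      proof (intro exI allI impI)
        fix n assume n: "n \<ge> n0"
        let ?h = "1 / real (Suc n)"
        have "?h \<le> 1 / real (Suc n0)" using n by (intro divide_left_mono) auto
        then have h: "0 < ?h" "?h < d" "?h < d0" using n0 by auto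
        have "box_mass ?h \<mu> x = integral (cbox x (x + ?h *\<^sub>R One)) g"
        proof (rule mass[OF h(1)])
          show "x $ k + ?h < 1" for k using h(3) d0(2)[of k] by linarith
        qed
        then have "box_average n \<mu> x = integral (cbox x (x + ?h *\<^sub>R One)) g /\<^sub>R ?h ^ DIM(real^'n)"
          by (simp add: box_average_def power_divide)
        then show "norm (box_average n \<mu> x - g x) < e" using d(2)[OF h(1,2)] by simp
      qed
    qed
  qed
  have "N \<in> null_sets lebesgue" using N by (simp add: negligible_iff_null_sets)
  then obtain N' where N': "N' \<in> null_sets lborel" "N \<subseteq> N'" by (auto simp: null_sets_completion_iff2)
  have "AE x in lborel. x \<notin> N'" using N'(1) by (rule AE_not_in)
  then have "AE x in lborel. x \<in> torus \<longrightarrow> (\<lambda>n. box_average n \<mu> x) \<longlonglongrightarrow> g x"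
    by (rule AE_mp) (use key N' in \<open>auto intro!: AE_I2\<close>)
  then show ?thesis unfolding torus_lebesgue_def by (subst AE_restrict_space_iff) auto
qed

text \<open>Convergence to a value in [0,1] is expressed through Cauchy sequences and lim, so that the set
  of good points is measurable.\<close>

definition good_point :: "(real^'n) measure \<Rightarrow> real^'n \<Rightarrow> bool" where
  "good_point \<mu> x \<longleftrightarrow> Cauchy (\<lambda>n. box_average n \<mu> x) \<and> 0 \<le> lim (\<lambda>n. box_average n \<mu> x) \<and> lim (\<lambda>n. box_average n \<mu> x) \<le> 1"

text \<open>A version of the density that is computed from the measure at every point, hence jointly
  measurable in the trajectory, the time and the position, and periodic. The truncation to [0,1] matters
  only where the averages do not converge to a value in this interval.\<close>

definition box_density :: "(real^'n) measure \<Rightarrow> real^'n \<Rightarrow> real" where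
  "box_density \<mu> x = max 0 (min 1 (lim (\<lambda>n. box_average n \<mu> x)))"

lemma box_density_range: "0 \<le> box_density \<mu> x" "box_density \<mu> x \<le> 1"
  by (auto simp: box_density_def)

lemma good_point_limit: "good_point \<mu> x \<Longrightarrow> (\<lambda>n. box_average n \<mu> x) \<longlonglongrightarrow> box_density \<mu> x"
  by (auto simp: good_point_def box_density_def Cauchy_convergent_iff convergent_LIMSEQ_iff)

text \<open>The Radon-Nikodym density g of a box bounded measure has values in [0,1], and almost everywhere
  the box averages converge to it.\<close>

lemma box_bounded_density:
  fixes \<mu> :: "(real^'n::finite) measure"
  assumes \<mu>: "\<mu> \<in> space (subprob_algebra torus_borel)" and b: "box_bounded \<mu>"
  shows "AE x in torus_lebesgue. good_point \<mu> x"
    and "\<mu> = density torus_lebesgue (\<lambda>x. ennreal (box_density \<mu> x))"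
proof -
  have sm: "subprob_space \<mu>" "sets \<mu> = sets torus_borel" using \<mu> by (auto simp: space_subprob_algebra)
  interpret T: finite_measure "torus_lebesgue :: (real^'n) measure" by (rule finite_measure_torus_lebesgue)
  obtain f where f: "f \<in> borel_measurable torus_lebesgue" "\<mu> = density torus_lebesgue f" "AE x in torus_lebesgue. f x \<le> (1::ennreal)"
  proof (rule density_le_one[of torus_lebesgue \<mu>])
    show "sets \<mu> = sets torus_lebesgue" using sm(2) by simp
    show "emeasure \<mu> A \<le> emeasure torus_lebesgue A" if "A \<in> sets torus_lebesgue" for A
      using that by (intro box_bounded_le_lebesgue[OF \<mu> b]) simp
  qed (use T.sigma_finite_measure_axioms T.finite_measure_axioms in auto)
  have fm: "(\<lambda>x. f x * indicator torus x) \<in> borel_measurable borel"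
    using f(1) unfolding torus_lebesgue_def by (subst (asm) borel_measurable_restrict_space_iff_ennreal) auto
  define g where "g x = enn2real (min 1 (f x * indicator torus x))" for x
  have gm: "g \<in> borel_measurable borel" unfolding g_def using fm by measurable
  have g1: "g x \<le> indicator torus x" for x
    unfolding g_def by (cases "x \<in> torus") (auto intro: enn2real_leI)
  have g0: "0 \<le> g x" for x by (simp add: g_def)
  have fg: "AE x in torus_lebesgue. f x = ennreal (g x)"
    using f(3)
  proof (rule AE_mp, intro AE_I2 impI)
    fix x assume "x \<in> space torus_lebesgue" "f x \<le> 1"
    then show "f x = ennreal (g x)" by (auto simp: g_def min_absorb2 ennreal_enn2real_if top_unique)
  qed
  have meas: "h \<in> borel_measurable torus_lebesgue" if "h \<in> borel_measurable borel" for h :: "real^'n \<Rightarrow> ennreal"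
    using torus_borel_measurable[OF that] by (simp cong: measurable_cong_sets)
  have gm': "(\<lambda>x. ennreal (g x)) \<in> borel_measurable torus_lebesgue" using gm by (intro meas) measurable
  have \<mu>g: "\<mu> = density torus_lebesgue (\<lambda>x. ennreal (g x))"
    unfolding f(2) by (rule density_cong[OF f(1) gm' fg])
  have lim: "AE x in torus_lebesgue. (\<lambda>n. box_average n \<mu> x) \<longlonglongrightarrow> g x"
    by (rule box_average_density[OF gm g0 g1 \<mu>g])
  have g01: "g x \<le> 1" for x using g1[of x] by (cases "x \<in> torus") auto
  have l: "good_point \<mu> x \<and> box_density \<mu> x = g x" if "(\<lambda>n. box_average n \<mu> x) \<longlonglongrightarrow> g x" for x
  proof -
    have "lim (\<lambda>n. box_average n \<mu> x) = g x" using that by (rule limI)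
    moreover have "Cauchy (\<lambda>n. box_average n \<mu> x)" using that by (auto simp: Cauchy_convergent_iff convergent_def)
    ultimately show ?thesis using g0[of x] g01[of x] by (auto simp: good_point_def box_density_def)
  qed
  show "AE x in torus_lebesgue. good_point \<mu> x" using lim by eventually_elim (use l in blast)
  have gd: "AE x in torus_lebesgue. ennreal (g x) = ennreal (box_density \<mu> x)" using lim by eventually_elim (use l in auto)
  show "\<mu> = density torus_lebesgue (\<lambda>x. ennreal (box_density \<mu> x))"
  proof -
    have "box_mass \<delta> \<mu> \<in> borel_measurable borel" if \<delta>: "\<delta> \<le> 1" for \<delta>
    proof (rule borel_measurable_LIMSEQ_real[OF bump_integral_limit[OF \<mu> \<delta>]])
      fix m
      have [measurable]: "(\<lambda>u. u) \<in> \<mu> \<rightarrow>\<^sub>M (borel :: (real^'n) measure)"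
      proof -
        have "(\<lambda>u. u) \<in> torus_borel \<rightarrow>\<^sub>M (borel :: (real^'n) measure)"
          unfolding torus_borel_def by (rule measurable_restrict_space1) simp
        then show ?thesis using sm(2) by (simp cong: measurable_cong_sets)
      qed
      interpret subprob_space \<mu> by fact
      show "(\<lambda>x. \<integral>u. bump \<delta> m (u - x) \<partial>\<mu>) \<in> borel_measurable borel" by measurable
    qed
    then have "box_average n \<mu> \<in> borel_measurable borel" for n
      unfolding box_average_def[abs_def] by (intro borel_measurable_times) auto
    then have "box_density \<mu> \<in> borel_measurable borel"
      unfolding box_density_def[abs_def] by measurable
    then have "(\<lambda>x. ennreal (box_density \<mu> x)) \<in> borel_measurable torus_lebesgue" by (intro meas) measurable
    from density_cong[OF gm' this gd] \<mu>g show ?thesis by simp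
  qed
qed

lemma box_mass_periodic: "box_mass \<delta> \<mu> (x + axis k 1) = box_mass \<delta> (\<mu> :: (real^'n::finite) measure) x"
proof -
  have "u - (x + axis k 1) \<in> periodic_box \<delta> \<longleftrightarrow> u - x \<in> periodic_box \<delta>" for u
    using periodic_box_shift[of "u - (x + axis k 1)" k \<delta>] by (simp add: algebra_simps)
  then show ?thesis by (simp add: box_mass_def)
qed

lemma box_average_periodic: "box_average n \<mu> (x + axis k 1) = box_average n (\<mu> :: (real^'n::finite) measure) x"
  by (simp add: box_average_def box_mass_periodic)

lemma box_density_periodic: "box_density \<mu> (x + axis k 1) = box_density (\<mu> :: (real^'n::finite) measure) x"
  by (simp add: box_density_def box_average_periodic)

lemma AE_torus_translate:
  fixes P :: "real^'n::finite \<Rightarrow> bool"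
  assumes P: "AE x in torus_lebesgue. P x" and m: "{x. P x} \<in> sets borel" and per: "\<And>x k. P (x + axis k 1) = P x"
  shows "AE x in torus_lebesgue. P (x + v)"
proof -
  let ?f = "\<lambda>x. indicator {x. \<not> P x} x :: ennreal"
  have f: "?f \<in> borel_measurable borel"
  proof -
    have "- {x. P x} \<in> sets borel" using m by auto
    then have "{x. \<not> P x} \<in> sets borel" by (simp add: Collect_neg_eq)
    then show ?thesis by simp
  qed
  have fv: "(\<lambda>x. ?f (x + v)) \<in> borel_measurable borel"
    using f by (rule measurable_compose[rotated]) (intro borel_measurable_continuous_onI continuous_intros)
  have meas: "h \<in> borel_measurable torus_lebesgue" if "h \<in> borel_measurable borel" for h :: "real^'n \<Rightarrow> ennreal"
    using torus_borel_measurable[OF that] by (simp cong: measurable_cong_sets)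
  have "(\<integral>\<^sup>+x. ?f (x + v) \<partial>torus_lebesgue) = (\<integral>\<^sup>+x. ?f x \<partial>torus_lebesgue)"
    by (rule nn_integral_torus_translate[OF f]) (simp add: per indicator_def)
  also have "\<dots> = 0" using P by (subst nn_integral_0_iff_AE[OF meas[OF f]]) auto
  finally have "AE x in torus_lebesgue. ?f (x + v) = 0" by (subst (asm) nn_integral_0_iff_AE[OF meas[OF fv]])
  then show ?thesis by eventually_elim (simp add: indicator_def split: if_splits)
qed

lemma box_average_measurable:
  assumes T: "T \<ge> 0"
  shows "(\<lambda>((s, x), \<pi>). box_average n (\<pi> s) x) \<in>
    borel_measurable ((restrict_space borel {0..T} \<Otimes>\<^sub>M (borel :: (real^'n::finite) measure)) \<Otimes>\<^sub>M path_space T)"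
proof -
  have "(\<lambda>z. real (Suc n) ^ CARD('n) * (\<lambda>((s, x), \<pi>). box_mass (1 / real (Suc n)) (\<pi> s) x) z) \<in>
    borel_measurable ((restrict_space borel {0..T} \<Otimes>\<^sub>M (borel :: (real^'n) measure)) \<Otimes>\<^sub>M path_space T)"
    by (intro borel_measurable_times box_mass_measurable T) auto
  then show ?thesis by (simp add: box_average_def split_beta')
qed

section \<open>Energy of the limiting density\<close>

text \<open>Modulo 1, every interval of length 2\<epsilon> contains one of the finitely many intervals
  [(k+1)\<epsilon>, (k+2)\<epsilon>] with k \<le> 1/\<epsilon>, and W increases strictly on each of these.\<close>

lemma increment_lower_bound:
  fixes W :: "real \<Rightarrow> real"
  assumes mono: "strict_mono W" and per: "\<And>u. W (u + 1) - W u = W 1 - W 0" and \<epsilon>: "\<epsilon> > 0"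
  obtains s0 where "s0 > 0" "\<And>v. s0 \<le> W (v + 2 * \<epsilon>) - W v"
proof -
  define g where "g k = W (real k * \<epsilon> + 2 * \<epsilon>) - W (real k * \<epsilon> + \<epsilon>)" for k :: nat
  \<comment> \<open>For t in [0,1) the index k with k\<epsilon> \<le> t < (k+1)\<epsilon> is at most
    1/\<epsilon>.\<close>
  define K where "K = nat \<lfloor>1 / \<epsilon>\<rfloor>"
  define s0 where "s0 = Min (g ` {..K})"
  have g: "g k > 0" for k unfolding g_def using strict_monoD[OF mono, of "real k * \<epsilon> + \<epsilon>" "real k * \<epsilon> + 2 * \<epsilon>"] \<epsilon> by simp
  have s0: "s0 > 0" unfolding s0_def using g by (subst Min_gr_iff) auto
  have "s0 \<le> W (v + 2 * \<epsilon>) - W v" for v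
  proof -
    define t where "t = frac v"
    have t: "0 \<le> t" "t < 1" by (auto simp: t_def frac_lt_1)
    have v: "v = t + of_int \<lfloor>v\<rfloor>" by (simp add: t_def frac_def)
    define k where "k = nat \<lfloor>t / \<epsilon>\<rfloor>"
    have kr: "real k = of_int \<lfloor>t / \<epsilon>\<rfloor>" using t \<epsilon> by (simp add: k_def)
    have "k \<le> K" unfolding k_def K_def using t \<epsilon> by (intro nat_mono floor_mono divide_right_mono) auto
    then have "s0 \<le> g k" unfolding s0_def by (intro Min_le) auto
    also have "g k \<le> W (t + 2 * \<epsilon>) - W t"
    proof -
      have a: "real k \<le> t / \<epsilon>" "t / \<epsilon> < real k + 1" unfolding kr by linarith+
      have "real k * \<epsilon> \<le> t" using a(1) \<epsilon> by (simp add: pos_le_divide_eq)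
      moreover have "t \<le> real k * \<epsilon> + \<epsilon>" using a(2) \<epsilon> by (simp add: pos_divide_less_eq algebra_simps less_imp_le)
      ultimately show ?thesis unfolding g_def
        by (intro diff_mono strict_mono_mono[OF mono, THEN monoD]) auto
    qed
    also have "\<dots> = W (v + 2 * \<epsilon>) - W v"
      using increment_periodic[of W t "\<lfloor>v\<rfloor>" "2 * \<epsilon>", OF per] v by simp
    finally show ?thesis .
  qed
  then show thesis using that s0 by blast
qed

abbreviation space_time :: "real \<Rightarrow> (real \<times> (real^'n::finite)) measure" where
  "space_time T \<equiv> restrict_space lborel {0..T} \<Otimes>\<^sub>M torus_lebesgue"

lemma finite_measure_time: "finite_measure (restrict_space lborel {0..T::real})"
proof
  have "emeasure (restrict_space lborel {0..T}) {0..T} = emeasure lborel {0..T}"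
    by (subst emeasure_restrict_space) auto
  then show "emeasure (restrict_space lborel {0..T}) (space (restrict_space lborel {0..T})) \<noteq> \<infinity>"
    by (simp add: space_restrict_space emeasure_lborel_Icc_eq)
qed

lemma finite_measure_space_time: "finite_measure (space_time T :: (real \<times> (real^'n::finite)) measure)"
  by (rule finite_measure_pair_measure[OF finite_measure_torus_lebesgue finite_measure_time])

lemma torus_lebesgue_id: "(\<lambda>x. x) \<in> torus_lebesgue \<rightarrow>\<^sub>M (borel :: (real^'n::finite) measure)"
  unfolding torus_lebesgue_def by (rule measurable_restrict_space1) simp

lemma torus_lebesgue_measurable: "f \<in> M \<rightarrow>\<^sub>M torus_lebesgue \<Longrightarrow> f \<in> M \<rightarrow>\<^sub>M (borel :: (real^'n::finite) measure)"
  using measurable_compose[OF _ torus_lebesgue_id] by blast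

lemma time_id: "(\<lambda>s. s) \<in> restrict_space lborel {0..T} \<rightarrow>\<^sub>M restrict_space borel {0..T::real}"
  by (rule measurable_ident_sets) (simp add: sets_restrict_space)

lemma space_time_translate:
  assumes Q: "sets Q = sets (path_space T)"
  shows "(\<lambda>(z, \<pi>). ((fst z, snd z + v), \<pi>)) \<in> space_time T \<Otimes>\<^sub>M Q \<rightarrow>\<^sub>M
    (restrict_space borel {0..T} \<Otimes>\<^sub>M (borel :: (real^'n::finite) measure)) \<Otimes>\<^sub>M path_space T"
proof -
  have q: "(\<lambda>x. x) \<in> Q \<rightarrow>\<^sub>M path_space T" by (rule measurable_ident_sets[OF Q])
  have 1: "(\<lambda>p. fst (fst p)) \<in> space_time T \<Otimes>\<^sub>M Q \<rightarrow>\<^sub>M restrict_space borel {0..T}"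
    by (rule measurable_compose[OF _ time_id]) measurable
  have 2: "(\<lambda>p. snd (fst p)) \<in> space_time T \<Otimes>\<^sub>M Q \<rightarrow>\<^sub>M (borel :: (real^'n) measure)"
    by (rule measurable_compose[OF _ torus_lebesgue_id]) measurable
  have 3: "snd \<in> space_time T \<Otimes>\<^sub>M Q \<rightarrow>\<^sub>M path_space T" by (rule measurable_compose[OF measurable_snd q])
  have "(\<lambda>p. ((fst (fst p), snd (fst p) + v), snd p)) \<in> space_time T \<Otimes>\<^sub>M Q \<rightarrow>\<^sub>M
    (restrict_space borel {0..T} \<Otimes>\<^sub>M (borel :: (real^'n) measure)) \<Otimes>\<^sub>M path_space T"
    by (intro measurable_Pair 1 3 borel_measurable_add 2) auto
  then show ?thesis by (simp add: split_beta')
qed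

lemma weight_measurable:
  assumes "strict_mono (W j)"
  shows "(\<lambda>x. \<epsilon> * (W j (x $ j + 2 * \<epsilon>) - W j (x $ j))) \<in> borel_measurable (borel :: (real^'n::finite) measure)"
proof -
  have [measurable]: "W j \<in> borel_measurable borel" using assms by (intro borel_measurable_mono strict_mono_mono)
  show ?thesis by measurable
qed

lemma shift_difference_C_torus: "shift_difference \<delta> m j \<epsilon> x \<in> C_torus"
  and shift_difference_bound: "\<bar>shift_difference \<delta> m j \<epsilon> x u\<bar> \<le> 1"
proof -
  have e: "shift_difference \<delta> m j \<epsilon> x = (\<lambda>u. bump \<delta> m (u - (x + \<epsilon> *\<^sub>R axis j 1)) - bump \<delta> m (u - x))"
    by (simp add: shift_difference_def fun_eq_iff algebra_simps)
  show "shift_difference \<delta> m j \<epsilon> x \<in> C_torus"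
    unfolding e using bump_C_torus[of \<delta> m "x + \<epsilon> *\<^sub>R axis j 1"] bump_C_torus[of \<delta> m x]
    by (auto simp: C_torus_def periodic_def intro!: continuous_intros)
  show "\<bar>shift_difference \<delta> m j \<epsilon> x u\<bar> \<le> 1"
    unfolding e using bump_range[of \<delta> m "u - (x + \<epsilon> *\<^sub>R axis j 1)"] bump_range[of \<delta> m "u - x"] by linarith
qed

lemma shift_difference_integral:
  assumes \<mu>: "\<mu> \<in> space (subprob_algebra torus_borel)"
  shows "(\<integral>u. shift_difference \<delta> m j \<epsilon> x u \<partial>\<mu>) = (\<integral>u. bump \<delta> m (u - (x + \<epsilon> *\<^sub>R axis j 1)) \<partial>\<mu>) - (\<integral>u. bump \<delta> m (u - x) \<partial>\<mu>)"
proof -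
  have i: "integrable \<mu> (\<lambda>u. bump \<delta> m (u - x))" for x
    by (rule subprob_integral_bound(1)[OF \<mu> torus_borel_measurable[OF C_torus_measurable[OF bump_C_torus]], of _ _ _ 1])
       (simp add: bump_range)
  have "shift_difference \<delta> m j \<epsilon> x u = bump \<delta> m (u - (x + \<epsilon> *\<^sub>R axis j 1)) - bump \<delta> m (u - x)" for u
    by (simp add: shift_difference_def algebra_simps)
  then show ?thesis by (simp add: Bochner_Integration.integral_diff[OF i i])
qed

lemma liminf_le_const:
  assumes "\<forall>\<^sub>F n in sequentially. f n \<le> (C :: ennreal)" shows "liminf f \<le> C"
  using Liminf_mono[OF assms] by (simp add: Liminf_const)

locale hydrodynamic_limit =
  fixes W :: "'n::finite \<Rightarrow> real \<Rightarrow> real"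
    and a T :: real
    and \<mu> :: "nat \<Rightarrow> 'n config measure"
    and \<Omega> :: "nat \<Rightarrow> 'w measure"
    and \<eta> :: "nat \<Rightarrow> real \<Rightarrow> 'w \<Rightarrow> 'n config"
    and Q :: "(real \<Rightarrow> (real ^ 'n) measure) measure"
  assumes d2: "CARD('n) > 1"
    and W_mono: "\<And>k. strict_mono (W k)"
    and W_per: "\<And>k u. W k (u + 1) - W k u = W k 1 - W k 0"
    and a_half: "a > - 1 / 2"
    and T0: "T > 0"
    and mp: "\<And>N. N \<ge> 1 \<Longrightarrow>
           markov_process (configs N) (\<lambda>f \<zeta>. (real N)\<^sup>2 * generator W a N f \<zeta>) (\<mu> N) (\<Omega> N) (\<eta> N)"
    and lp: "limit_point T (\<lambda>N. empirical_law T N (\<Omega> N) (\<eta> N)) Q"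
begin

lemma Q: "prob_space Q" "sets Q = sets (path_space T)" using lp by (auto simp: limit_point_def)

lemma space_Q: "space Q = D_space T"
  using sets_eq_imp_space_eq[OF Q(2)] by (simp add: space_path_space)

definition energy_constant :: real where
  "energy_constant = 6 * ln 2 / min 1 (1 + 2 * a) * 2 ^ CARD('n)"

lemma shift_difference_integral_measurable:
  "(\<lambda>(z, \<pi>). \<integral>u. shift_difference \<delta> m j \<epsilon> (snd z) u \<partial>\<pi> (fst z)) \<in> borel_measurable (space_time T \<Otimes>\<^sub>M Q)"
proof -
  have m: "(\<lambda>(z, \<pi>). \<integral>u. bump \<delta> m (u - (snd z + v)) \<partial>\<pi> (fst z)) \<in> borel_measurable (space_time T \<Otimes>\<^sub>M Q)" for v :: "real^'n"
    using measurable_compose[OF space_time_translate[OF Q(2), of v] bump_integral_measurable[of T \<delta> m]] T0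
    by (simp add: split_beta')
  have "(\<lambda>p. (\<lambda>(z, \<pi>). \<integral>u. bump \<delta> m (u - (snd z + \<epsilon> *\<^sub>R axis j 1)) \<partial>\<pi> (fst z)) p - (\<lambda>(z, \<pi>). \<integral>u. bump \<delta> m (u - (snd z + 0)) \<partial>\<pi> (fst z)) p)
     \<in> borel_measurable (space_time T \<Otimes>\<^sub>M Q)"
    by (intro borel_measurable_diff m)
  then show ?thesis
  proof (rule measurable_cong[THEN iffD1, rotated])
    fix p :: "(real \<times> (real^'n)) \<times> (real \<Rightarrow> (real^'n) measure)" assume p: "p \<in> space (space_time T \<Otimes>\<^sub>M Q)"
    obtain s x \<pi> where pp: "p = ((s, x), \<pi>)" by (cases p) auto
    have "\<pi> s \<in> space (subprob_algebra torus_borel)"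
      using p by (intro D_space_value) (auto simp: pp space_pair_measure space_Q space_restrict_space)
    then show "(\<lambda>(z, \<pi>). \<integral>u. bump \<delta> m (u - (snd z + \<epsilon> *\<^sub>R axis j 1)) \<partial>\<pi> (fst z)) p - (\<lambda>(z, \<pi>). \<integral>u. bump \<delta> m (u - (snd z + 0)) \<partial>\<pi> (fst z)) p
      = (\<lambda>(z, \<pi>). \<integral>u. shift_difference \<delta> m j \<epsilon> (snd z) u \<partial>\<pi> (fst z)) p"
      by (simp add: pp shift_difference_integral)
  qed
qed

lemma space_time_weight_measurable:
  "(\<lambda>z. \<epsilon> * (W j (snd z $ j + 2 * \<epsilon>) - W j (snd z $ j))) \<in> borel_measurable (space_time T)"
  by (rule measurable_compose[OF _ weight_measurable[OF W_mono]])
     (rule torus_lebesgue_measurable, measurable)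

text \<open>For fixed s and x the expected squared increment converges along the subsequence, by
  limit_evaluation, and Fatou's lemma in (s,x) carries microscopic_energy over to the limit. The integral
  over trajectories is the innermost one, so that only the laws at single times enter.\<close>

lemma limit_energy_smooth:
  assumes \<delta>: "0 < \<delta>" "\<delta> \<le> \<epsilon>" "\<epsilon> \<le> 1"
  shows "(\<integral>\<^sup>+p. ennreal ((\<integral>u. shift_difference \<delta> m j \<epsilon> (snd (fst p)) u \<partial>snd p (fst (fst p)))\<^sup>2
       / (\<epsilon> * (W j (snd (fst p) $ j + 2 * \<epsilon>) - W j (snd (fst p) $ j)))) \<partial>(space_time T \<Otimes>\<^sub>M Q))
     \<le> ennreal (energy_constant * (\<delta> ^ CARD('n))\<^sup>2)"
proof -
  interpret Q: prob_space Q by (rule Q)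
  interpret ST: finite_measure "space_time T :: (real \<times> (real^'n)) measure" by (rule finite_measure_space_time)
  interpret TL: finite_measure "torus_lebesgue :: (real^'n) measure" by (rule finite_measure_torus_lebesgue)
  let ?Z = "\<lambda>z \<pi>. \<integral>u. shift_difference \<delta> m j \<epsilon> (snd z) u \<partial>\<pi> (fst z)"
  let ?w = "\<lambda>z. \<epsilon> * (W j (snd z $ j + 2 * \<epsilon>) - W j (snd z $ j))"
  have \<epsilon>: "\<epsilon> > 0" using \<delta> by simp
  obtain s0 where s0: "s0 > 0" "\<And>v. s0 \<le> W j (v + 2 * \<epsilon>) - W j v"
    using increment_lower_bound[OF W_mono W_per \<epsilon>] by blast
  have w0: "?w z > 0" for z using s0(1) s0(2)[of "snd z $ j"] \<epsilon> by (intro mult_pos_pos) auto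
  obtain r0 where r0: "strict_mono r0" and wc0: "weakly_converges T (\<lambda>n. empirical_law T (r0 n) (\<Omega> (r0 n)) (\<eta> (r0 n))) Q"
    using lp by (auto simp: limit_point_def)
  obtain n0 :: nat where n0: "1 / \<delta> < real n0" using reals_Archimedean2 by blast
  \<comment> \<open>Without an initial segment of the subsequence there are at least three sites in each
    direction, and a box with side \<delta> contains lattice points.\<close>
  define r where "r n = r0 (n + (n0 + 3))" for n
  have r: "strict_mono r" using r0 by (auto simp: r_def strict_mono_def)
  have wc: "weakly_converges T (\<lambda>n. empirical_law T (r n) (\<Omega> (r n)) (\<eta> (r n))) Q"
    unfolding weakly_converges_def
  proof (intro allI impI)
    fix F :: "(real \<Rightarrow> (real^'n) measure) \<Rightarrow> real"
    assume F: "continuous_map (uniform_topology T) euclideanreal F \<and> F \<in> borel_measurable (path_space T) \<and> bounded (F ` D_space T)"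
    have "(\<lambda>n. \<integral>\<pi>. F \<pi> \<partial>empirical_law T (r0 n) (\<Omega> (r0 n)) (\<eta> (r0 n))) \<longlonglongrightarrow> (\<integral>\<pi>. F \<pi> \<partial>Q)"
      using wc0[unfolded weakly_converges_def, rule_format, OF F] .
    from LIMSEQ_ignore_initial_segment[OF this, of "n0 + 3"]
    show "(\<lambda>n. \<integral>\<pi>. F \<pi> \<partial>empirical_law T (r n) (\<Omega> (r n)) (\<eta> (r n))) \<longlonglongrightarrow> (\<integral>\<pi>. F \<pi> \<partial>Q)"
      unfolding r_def .
  qed
  have rn: "r n \<ge> n + n0 + 3" for n using seq_suble[OF r0, of "n + (n0 + 3)"] by (simp add: r_def)
  have r3: "r n \<ge> 3" and r1: "r n \<ge> 1" and r\<delta>: "real (r n) * \<delta> \<ge> 1" for n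
  proof -
    show "r n \<ge> 3" "r n \<ge> 1" using rn[of n] by auto
    have "1 / \<delta> < real (r n)" using rn[of n] n0 by linarith
    then show "real (r n) * \<delta> \<ge> 1" using \<delta> by (simp add: pos_divide_less_eq less_imp_le)
  qed
  have ex: "exclusion W a T (r n) (\<mu> (r n)) (\<Omega> (r n)) (\<eta> (r n))" for n
    by (intro exclusion.intro r3 W_mono a_half less_imp_le[OF T0] mp r1)
  let ?E = "\<lambda>n t x. exclusion.increment_energy W (r n) (\<Omega> (r n)) (\<eta> (r n)) \<delta> m j \<epsilon> t x"
  have conv: "(\<lambda>n. ennreal (?E n (fst z) (snd z))) \<longlonglongrightarrow> (\<integral>\<^sup>+\<pi>. ennreal ((?Z z \<pi>)\<^sup>2 / ?w z) \<partial>Q)" if z: "z \<in> space (space_time T)" for z :: "real \<times> (real^'n)"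
  proof -
    have s: "fst z \<in> {0..T}" using z by (auto simp: space_pair_measure space_restrict_space)
    have "continuous_on UNIV (\<lambda>y::real. y\<^sup>2)" by (intro continuous_intros)
    from limit_evaluation[OF mp r wc shift_difference_C_torus shift_difference_bound this s, of \<delta> m j \<epsilon> "snd z"]
    have "(\<lambda>n. (\<Sum>\<zeta>\<in>configs (r n). law_at (\<Omega> (r n)) (\<eta> (r n)) (fst z) \<zeta> * (\<integral>u. shift_difference \<delta> m j \<epsilon> (snd z) u \<partial>empirical_measure (r n) \<zeta>)\<^sup>2) / ?w z)
       \<longlonglongrightarrow> (\<integral>\<pi>. (?Z z \<pi>)\<^sup>2 \<partial>Q) / ?w z"
      by (intro tendsto_divide tendsto_const) (use w0[of z] in auto)
    then have "(\<lambda>n. ?E n (fst z) (snd z)) \<longlonglongrightarrow> (\<integral>\<pi>. (?Z z \<pi>)\<^sup>2 \<partial>Q) / ?w z"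
      by (simp add: exclusion.increment_energy_def[OF ex])
    moreover have "(\<integral>\<^sup>+\<pi>. ennreal ((?Z z \<pi>)\<^sup>2 / ?w z) \<partial>Q) = ennreal ((\<integral>\<pi>. (?Z z \<pi>)\<^sup>2 \<partial>Q) / ?w z)"
    proof -
      have zm: "?Z z \<in> borel_measurable Q"
        using measurable_compose[OF measurable_Pair1'[OF z] shift_difference_integral_measurable[of \<delta> m j \<epsilon>]] by simp
      have zb: "\<bar>?Z z \<pi>\<bar> \<le> 1" if "\<pi> \<in> space Q" for \<pi>
      proof (rule subprob_integral_bound(2))
        show "\<pi> (fst z) \<in> space (subprob_algebra torus_borel)" using that s by (intro D_space_value) (auto simp: space_Q)
        show "shift_difference \<delta> m j \<epsilon> (snd z) \<in> borel_measurable torus_borel"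
          by (intro torus_borel_measurable C_torus_measurable shift_difference_C_torus)
      qed (rule shift_difference_bound)
      have "integrable Q (\<lambda>\<pi>. (?Z z \<pi>)\<^sup>2)"
        by (rule Q.integrable_const_bound[where B = 1]) (use zb zm in \<open>auto intro!: AE_I2 simp: abs_square_le_1\<close>)
      then have i: "integrable Q (\<lambda>\<pi>. (?Z z \<pi>)\<^sup>2 / ?w z)" by simp
      have "(\<integral>\<^sup>+\<pi>. ennreal ((?Z z \<pi>)\<^sup>2 / ?w z) \<partial>Q) = ennreal (\<integral>\<pi>. (?Z z \<pi>)\<^sup>2 / ?w z \<partial>Q)"
        using w0[of z] by (intro nn_integral_eq_integral i AE_I2) (auto intro!: divide_nonneg_nonneg simp: less_imp_le)
      then show ?thesis by simp
    qed
    ultimately show ?thesis by (simp add: tendsto_ennrealI)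
  qed
  have Em: "(\<lambda>z. ennreal (?E n (fst z) (snd z))) \<in> borel_measurable (space_time T)" for n
  proof -
    interpret e: exclusion W a T "r n" "\<mu> (r n)" "\<Omega> (r n)" "\<eta> (r n)" by (rule ex)
    have l: "(\<lambda>z. law_at (\<Omega> (r n)) (\<eta> (r n)) (fst z) \<zeta>) \<in> borel_measurable (space_time T :: (real \<times> (real^'n)) measure)" if "\<zeta> \<in> configs (r n)" for \<zeta>
    proof -
      have "(\<lambda>t. law_at (\<Omega> (r n)) (\<eta> (r n)) t \<zeta>) \<in> borel_measurable (restrict_space borel {0..T})"
        by (rule borel_measurable_continuous_on_restrict[OF e.law_continuous[OF that]])
      from measurable_compose[OF measurable_compose[OF measurable_fst time_id] this] show ?thesis .
    qed
    have i: "(\<lambda>z. \<integral>u. shift_difference \<delta> m j \<epsilon> (snd z) u \<partial>empirical_measure (r n) \<zeta>) \<in> borel_measurable (space_time T)" for \<zeta>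
    proof -
      have "(\<lambda>x. (\<Sum>y\<in>sites (r n). real (\<zeta> y) * shift_difference \<delta> m j \<epsilon> x (scaled_site (r n) y)) / real (r n) ^ CARD('n)) \<in> borel_measurable borel"
        unfolding shift_difference_def by measurable
      moreover have "(\<integral>u. shift_difference \<delta> m j \<epsilon> x u \<partial>empirical_measure (r n) \<zeta>) = (\<Sum>y\<in>sites (r n). real (\<zeta> y) * shift_difference \<delta> m j \<epsilon> x (scaled_site (r n) y)) / real (r n) ^ CARD('n)" for x
        by (rule empirical_integral[OF r1 C_torus_measurable[OF shift_difference_C_torus]])
      ultimately have "(\<lambda>x. \<integral>u. shift_difference \<delta> m j \<epsilon> x u \<partial>empirical_measure (r n) \<zeta>) \<in> borel_measurable borel" by simp
      from measurable_compose[OF torus_lebesgue_measurable[OF measurable_snd] this] show ?thesis .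
    qed
    show ?thesis unfolding e.increment_energy_def
      by (intro measurable_compose[OF _ measurable_ennreal] borel_measurable_divide borel_measurable_sum borel_measurable_times borel_measurable_power l i space_time_weight_measurable)
  qed
  define A where "A = T * (43 + 16 * (2 * \<delta>) ^ CARD('n) + 4 * (real m)\<^sup>2) / (\<epsilon> * s0)"
  have micro: "(\<integral>\<^sup>+z. ennreal (?E n (fst z) (snd z)) \<partial>space_time T) \<le> ennreal (A / real (r n) + energy_constant * (\<delta> ^ CARD('n))\<^sup>2)" for n
  proof -
    have "(\<integral>\<^sup>+z. ennreal (?E n (fst z) (snd z)) \<partial>space_time T) = (\<integral>\<^sup>+t. (\<integral>\<^sup>+x. ennreal (?E n t x) \<partial>torus_lebesgue) \<partial>restrict_space lborel {0..T})"
      using TL.nn_integral_fst[OF Em[of n]] by simp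
    also have "\<dots> \<le> ennreal (A / real (r n) + energy_constant * (\<delta> ^ CARD('n))\<^sup>2)"
      unfolding A_def energy_constant_def by (rule exclusion.microscopic_energy[OF ex d2 W_per \<delta> r\<delta> s0])
    finally show ?thesis .
  qed
  have "(\<integral>\<^sup>+p. ennreal ((?Z (fst p) (snd p))\<^sup>2 / ?w (fst p)) \<partial>(space_time T \<Otimes>\<^sub>M Q)) = (\<integral>\<^sup>+z. (\<integral>\<^sup>+\<pi>. ennreal ((?Z z \<pi>)\<^sup>2 / ?w z) \<partial>Q) \<partial>space_time T)"
  proof -
    have "(\<lambda>p. ennreal ((?Z (fst p) (snd p))\<^sup>2 / ?w (fst p))) \<in> borel_measurable (space_time T \<Otimes>\<^sub>M Q)"
      using shift_difference_integral_measurable[of \<delta> m j \<epsilon>] measurable_compose[OF measurable_fst space_time_weight_measurable[of \<epsilon> j], of Q]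
      by (intro measurable_compose[OF _ measurable_ennreal] borel_measurable_divide borel_measurable_power) (simp_all add: split_beta')
    from Q.nn_integral_fst[OF this] show ?thesis by simp
  qed
  also have "\<dots> = (\<integral>\<^sup>+z. liminf (\<lambda>n. ennreal (?E n (fst z) (snd z))) \<partial>space_time T)"
    by (intro nn_integral_cong lim_imp_Liminf[symmetric, OF _ conv]) auto
  also have "\<dots> \<le> liminf (\<lambda>n. \<integral>\<^sup>+z. ennreal (?E n (fst z) (snd z)) \<partial>space_time T)"
    by (intro nn_integral_liminf Em)
  also have "\<dots> \<le> liminf (\<lambda>n. ennreal (A / real (r n) + energy_constant * (\<delta> ^ CARD('n))\<^sup>2))"
    by (intro Liminf_mono always_eventually allI micro)
  also have "\<dots> = ennreal (energy_constant * (\<delta> ^ CARD('n))\<^sup>2)"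
  proof (rule lim_imp_Liminf)
    have "(\<lambda>n. A * (1 / real (r n)) + energy_constant * (\<delta> ^ CARD('n))\<^sup>2) \<longlonglongrightarrow> A * 0 + energy_constant * (\<delta> ^ CARD('n))\<^sup>2"
      using filterlim_compose[OF lim_1_over_n filterlim_subseq[OF r]] by (intro tendsto_intros)
    then show "(\<lambda>n. ennreal (A / real (r n) + energy_constant * (\<delta> ^ CARD('n))\<^sup>2)) \<longlonglongrightarrow> ennreal (energy_constant * (\<delta> ^ CARD('n))\<^sup>2)"
      by (intro tendsto_ennrealI) simp
  qed simp
  finally show ?thesis .
qed

text \<open>The integrand of the energy with box averages at scale 1/(n+1) in place of the density, as a
  function on the product of space-time and path space.\<close>

definition average_increment :: "nat \<Rightarrow> 'n \<Rightarrow> real \<Rightarrow> (real \<times> (real^'n)) \<times> (real \<Rightarrow> (real^'n) measure) \<Rightarrow> ennreal" where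
  "average_increment n j \<epsilon> p = ennreal ((box_average n (snd p (fst (fst p))) (snd (fst p) + \<epsilon> *\<^sub>R axis j 1) - box_average n (snd p (fst (fst p))) (snd (fst p)))\<^sup>2
       / (\<epsilon> * (W j (snd (fst p) $ j + 2 * \<epsilon>) - W j (snd (fst p) $ j))))"

lemma average_increment_measurable: "average_increment n j \<epsilon> \<in> borel_measurable (space_time T \<Otimes>\<^sub>M Q)"
proof -
  have m: "(\<lambda>p. box_average n (snd p (fst (fst p))) (snd (fst p) + v)) \<in> borel_measurable (space_time T \<Otimes>\<^sub>M Q)" for v :: "real^'n"
    using measurable_compose[OF space_time_translate[OF Q(2), of v] box_average_measurable[of T n]] T0
    by (simp add: split_beta')
  have w: "(\<lambda>p. \<epsilon> * (W j (snd (fst p) $ j + 2 * \<epsilon>) - W j (snd (fst p) $ j))) \<in> borel_measurable (space_time T \<Otimes>\<^sub>M Q)"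
    using measurable_compose[OF measurable_fst space_time_weight_measurable[of \<epsilon> j], of Q] .
  show ?thesis unfolding average_increment_def[abs_def]
    using m[of 0] by (intro measurable_compose[OF _ measurable_ennreal] borel_measurable_divide borel_measurable_power borel_measurable_diff m w) simp
qed

text \<open>Fatou's lemma for m \<rightarrow> \<infinity> in limit_energy_smooth. For \<delta> = 1/(n+1) the
  square of the normalisation (n+1)^d of the box averages cancels the factor \<delta>^(2d).\<close>

lemma limit_energy_average:
  assumes \<epsilon>: "0 < \<epsilon>" "\<epsilon> \<le> 1" and n: "1 / real (Suc n) \<le> \<epsilon>"
  shows "(\<integral>\<^sup>+p. average_increment n j \<epsilon> p \<partial>(space_time T \<Otimes>\<^sub>M Q)) \<le> ennreal energy_constant"
proof -
  let ?d = "1 / real (Suc n)"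
  let ?Z = "\<lambda>m p. \<integral>u. shift_difference ?d m j \<epsilon> (snd (fst p)) u \<partial>snd p (fst (fst p))"
  let ?w = "\<lambda>p. \<epsilon> * (W j (snd (fst p) $ j + 2 * \<epsilon>) - W j (snd (fst p) $ j))"
  define c where "c = (real (Suc n) ^ CARD('n))\<^sup>2"
  have c0: "c \<ge> 0" by (simp add: c_def)
  have w0: "?w p > 0" for p
    using \<epsilon> strict_monoD[OF W_mono[of j], of "snd (fst p) $ j" "snd (fst p) $ j + 2 * \<epsilon>"] by simp
  have zm: "(\<lambda>p. ennreal ((?Z m p)\<^sup>2 / ?w p)) \<in> borel_measurable (space_time T \<Otimes>\<^sub>M Q)" for m
    using shift_difference_integral_measurable[of ?d m j \<epsilon>] measurable_compose[OF measurable_fst space_time_weight_measurable[of \<epsilon> j], of Q]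
    by (intro measurable_compose[OF _ measurable_ennreal] borel_measurable_divide borel_measurable_power) (simp_all add: split_beta')
  have conv: "(\<lambda>m. ennreal c * ennreal ((?Z m p)\<^sup>2 / ?w p)) \<longlonglongrightarrow> average_increment n j \<epsilon> p" if p: "p \<in> space (space_time T \<Otimes>\<^sub>M Q)" for p :: "(real \<times> (real^'n)) \<times> (real \<Rightarrow> (real^'n) measure)"
  proof -
    obtain s x \<pi> where pp: "p = ((s, x), \<pi>)" by (cases p) auto
    have v: "\<pi> s \<in> space (subprob_algebra torus_borel)"
      using p by (intro D_space_value) (auto simp: pp space_pair_measure space_Q space_restrict_space)
    have "(\<lambda>m. c * ((?Z m p)\<^sup>2 / ?w p)) \<longlonglongrightarrow> c * ((box_mass ?d (\<pi> s) (x + \<epsilon> *\<^sub>R axis j 1) - box_mass ?d (\<pi> s) x)\<^sup>2 / ?w p)"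
      unfolding pp fst_conv snd_conv shift_difference_integral[OF v]
      using w0[of p] by (intro tendsto_mult tendsto_divide tendsto_power tendsto_diff tendsto_const bump_integral_limit[OF v]) (auto simp: pp)
    then have "(\<lambda>m. ennreal (c * ((?Z m p)\<^sup>2 / ?w p))) \<longlonglongrightarrow> ennreal (c * ((box_mass ?d (\<pi> s) (x + \<epsilon> *\<^sub>R axis j 1) - box_mass ?d (\<pi> s) x)\<^sup>2 / ?w p))"
      by (rule tendsto_ennrealI)
    also have "c * ((box_mass ?d (\<pi> s) (x + \<epsilon> *\<^sub>R axis j 1) - box_mass ?d (\<pi> s) x)\<^sup>2 / ?w p) =
       (box_average n (\<pi> s) (x + \<epsilon> *\<^sub>R axis j 1) - box_average n (\<pi> s) x)\<^sup>2 / ?w p"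
      unfolding c_def box_average_def right_diff_distrib[symmetric] power_mult_distrib by simp
    also have "ennreal \<dots> = average_increment n j \<epsilon> p" by (simp add: average_increment_def pp)
    finally show ?thesis
      using c0 w0[of p] by (subst ennreal_mult[symmetric]) (auto intro!: divide_nonneg_nonneg simp: less_imp_le)
  qed
  have "(\<integral>\<^sup>+p. average_increment n j \<epsilon> p \<partial>(space_time T \<Otimes>\<^sub>M Q)) = (\<integral>\<^sup>+p. liminf (\<lambda>m. ennreal c * ennreal ((?Z m p)\<^sup>2 / ?w p)) \<partial>(space_time T \<Otimes>\<^sub>M Q))"
    by (intro nn_integral_cong lim_imp_Liminf[symmetric, OF _ conv]) auto
  also have "\<dots> \<le> liminf (\<lambda>m. \<integral>\<^sup>+p. ennreal c * ennreal ((?Z m p)\<^sup>2 / ?w p) \<partial>(space_time T \<Otimes>\<^sub>M Q))"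
    by (intro nn_integral_liminf borel_measurable_times_ennreal zm borel_measurable_const)
  also have "\<dots> \<le> ennreal energy_constant"
  proof (intro liminf_le_const always_eventually allI)
    fix m
    have "(\<integral>\<^sup>+p. ennreal c * ennreal ((?Z m p)\<^sup>2 / ?w p) \<partial>(space_time T \<Otimes>\<^sub>M Q)) = ennreal c * (\<integral>\<^sup>+p. ennreal ((?Z m p)\<^sup>2 / ?w p) \<partial>(space_time T \<Otimes>\<^sub>M Q))"
      by (rule nn_integral_cmult[OF zm])
    also have "\<dots> \<le> ennreal c * ennreal (energy_constant * (?d ^ CARD('n))\<^sup>2)"
      by (intro mult_left_mono limit_energy_smooth n \<epsilon>) auto
    also have "\<dots> = ennreal (c * (energy_constant * (?d ^ CARD('n))\<^sup>2))" using c0 by (simp add: ennreal_mult')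
    also have "c * (energy_constant * (?d ^ CARD('n))\<^sup>2) = energy_constant * ((real (Suc n) * ?d) ^ CARD('n))\<^sup>2"
      by (simp only: c_def power_mult_distrib mult_ac)
    also have "\<dots> = energy_constant" by simp
    finally show "(\<integral>\<^sup>+p. ennreal c * ennreal ((?Z m p)\<^sup>2 / ?w p) \<partial>(space_time T \<Otimes>\<^sub>M Q)) \<le> ennreal energy_constant" .
  qed
  finally show ?thesis .
qed

definition density_energy :: "'n \<Rightarrow> real \<Rightarrow> (real \<Rightarrow> (real^'n) measure) \<Rightarrow> ennreal" where
  "density_energy j \<epsilon> \<pi> = (\<integral>\<^sup>+s. (\<integral>\<^sup>+x. ennreal ((box_density (\<pi> s) (x + \<epsilon> *\<^sub>R axis j 1) - box_density (\<pi> s) x)\<^sup>2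
       / (\<epsilon> * (W j (x $ j + 2 * \<epsilon>) - W j (x $ j)))) \<partial>torus_lebesgue) \<partial>restrict_space lborel {0..T})"

text \<open>Translations preserve null sets, so for almost every x both x and x + \<epsilon> e_j are points
  where the box averages converge to the density.\<close>

lemma density_energy_eq:
  assumes \<pi>: "\<pi> \<in> space Q" and b: "\<And>s. s \<in> {0..T} \<Longrightarrow> box_bounded (\<pi> s)" and \<epsilon>: "0 < \<epsilon>"
  shows "(\<integral>\<^sup>+z. liminf (\<lambda>n. average_increment n j \<epsilon> (z, \<pi>)) \<partial>space_time T) = density_energy j \<epsilon> \<pi>"
proof -
  interpret TL: finite_measure "torus_lebesgue :: (real^'n) measure" by (rule finite_measure_torus_lebesgue)
  have m: "(\<lambda>z. liminf (\<lambda>n. average_increment n j \<epsilon> (z, \<pi>))) \<in> borel_measurable (space_time T)"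
    using average_increment_measurable measurable_compose[OF measurable_Pair2'[OF \<pi>]]
    by (intro borel_measurable_liminf) blast
  have "(\<integral>\<^sup>+z. liminf (\<lambda>n. average_increment n j \<epsilon> (z, \<pi>)) \<partial>space_time T) =
    (\<integral>\<^sup>+s. (\<integral>\<^sup>+x. liminf (\<lambda>n. average_increment n j \<epsilon> ((s, x), \<pi>)) \<partial>torus_lebesgue) \<partial>restrict_space lborel {0..T})"
    by (rule TL.nn_integral_fst[OF m, symmetric])
  also have "\<dots> = density_energy j \<epsilon> \<pi>"
    unfolding density_energy_def
  proof (rule nn_integral_cong, rule nn_integral_cong_AE)
    fix s assume "s \<in> space (restrict_space lborel {0..T})"
    then have s: "s \<in> {0..T}" by (simp add: space_restrict_space)
    have \<pi>D: "\<pi> \<in> D_space T" using \<pi> by (simp add: space_Q)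
    have g: "AE x in torus_lebesgue. good_point (\<pi> s) x"
      by (rule box_bounded_density(1)[OF D_space_value[OF \<pi>D s] b[OF s]])
    have avm [measurable]: "box_average n (\<pi> s) \<in> borel_measurable borel" for n
    proof -
      have "(\<lambda>x. ((s, x), \<pi>)) \<in> borel \<rightarrow>\<^sub>M (restrict_space borel {0..T} \<Otimes>\<^sub>M (borel :: (real^'n) measure)) \<Otimes>\<^sub>M path_space T"
        using s \<pi>D by (intro measurable_Pair measurable_const) (auto simp: space_restrict_space space_path_space)
      from measurable_compose[OF this box_average_measurable[of T n]] T0 show ?thesis by simp
    qed
    have gm: "{x. good_point (\<pi> s) x} \<in> sets borel"
    proof -
      have 1: "{x \<in> space borel. Cauchy (\<lambda>n. box_average n (\<pi> s) x)} \<in> sets borel" by (rule sets_Collect_Cauchy) measurable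
      have 2: "{x \<in> space borel. 0 \<le> lim (\<lambda>n. box_average n (\<pi> s) x) \<and> lim (\<lambda>n. box_average n (\<pi> s) x) \<le> 1} \<in> sets borel" by measurable
      have "{x. good_point (\<pi> s) x} = {x \<in> space borel. Cauchy (\<lambda>n. box_average n (\<pi> s) x)} \<inter> {x \<in> space borel. 0 \<le> lim (\<lambda>n. box_average n (\<pi> s) x) \<and> lim (\<lambda>n. box_average n (\<pi> s) x) \<le> 1}"
        by (auto simp: good_point_def)
      then show ?thesis using 1 2 by simp
    qed
    have g': "AE x in torus_lebesgue. good_point (\<pi> s) (x + \<epsilon> *\<^sub>R axis j 1)"
      by (rule AE_torus_translate[OF g gm]) (simp add: good_point_def box_average_periodic)
    show "AE x in torus_lebesgue. liminf (\<lambda>n. average_increment n j \<epsilon> ((s, x), \<pi>)) =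
       ennreal ((box_density (\<pi> s) (x + \<epsilon> *\<^sub>R axis j 1) - box_density (\<pi> s) x)\<^sup>2 / (\<epsilon> * (W j (x $ j + 2 * \<epsilon>) - W j (x $ j))))"
      using g g'
    proof eventually_elim
      fix x :: "real^'n" assume x: "good_point (\<pi> s) x" "good_point (\<pi> s) (x + \<epsilon> *\<^sub>R axis j 1)"
      have "\<epsilon> * (W j (x $ j + 2 * \<epsilon>) - W j (x $ j)) \<noteq> 0"
        using \<epsilon> strict_monoD[OF W_mono[of j], of "x $ j" "x $ j + 2 * \<epsilon>"] by simp
      then show "liminf (\<lambda>n. average_increment n j \<epsilon> ((s, x), \<pi>)) =
         ennreal ((box_density (\<pi> s) (x + \<epsilon> *\<^sub>R axis j 1) - box_density (\<pi> s) x)\<^sup>2 / (\<epsilon> * (W j (x $ j + 2 * \<epsilon>) - W j (x $ j))))"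
        unfolding average_increment_def fst_conv snd_conv
        by (intro lim_imp_Liminf tendsto_ennrealI tendsto_divide tendsto_power tendsto_diff tendsto_const good_point_limit x) auto
    qed
  qed
  finally show ?thesis .
qed

text \<open>Fatou's lemma is applied twice: for n \<rightarrow> \<infinity> with \<epsilon> fixed, and then
  for \<epsilon> = 1/(k+1) \<rightarrow> 0, which is possible because energy_constant does not depend on
  \<epsilon>. A nonnegative function with finite integral is finite almost everywhere.\<close>

lemma limit_density_energy:
  "AE \<pi> in Q. (\<forall>s\<in>{0..T}. box_bounded (\<pi> s)) \<and> (\<forall>j. liminf (\<lambda>k. density_energy j (1 / real (Suc k)) \<pi>) < \<infinity>)"
proof -
  interpret Q: prob_space Q by (rule Q)
  interpret ST: finite_measure "space_time T :: (real \<times> (real^'n)) measure" by (rule finite_measure_space_time)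
  interpret P: pair_sigma_finite "space_time T :: (real \<times> (real^'n)) measure" Q ..
  have bb: "AE \<pi> in Q. \<forall>s\<in>{0..T}. box_bounded (\<pi> s)"
    by (rule limit_box_bounded[OF mp lp less_imp_le[OF T0]])
  have fin: "AE \<pi> in Q. liminf (\<lambda>k. \<integral>\<^sup>+z. liminf (\<lambda>n. average_increment n j (1 / real (Suc k)) (z, \<pi>)) \<partial>space_time T) \<noteq> \<infinity>" for j
  proof -
    let ?L = "\<lambda>k p. liminf (\<lambda>n. average_increment n j (1 / real (Suc k)) p)"
    have Lm: "?L k \<in> borel_measurable (space_time T \<Otimes>\<^sub>M Q)" for k
      by (intro borel_measurable_liminf average_increment_measurable)
    have Vm: "(\<lambda>\<pi>. \<integral>\<^sup>+z. ?L k (z, \<pi>) \<partial>space_time T) \<in> borel_measurable Q" for k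
      by (rule ST.borel_measurable_nn_integral) (use measurable_compose[OF measurable_pair_swap' Lm[of k]] in \<open>simp add: split_beta'\<close>)
    have V: "(\<integral>\<^sup>+\<pi>. (\<integral>\<^sup>+z. ?L k (z, \<pi>) \<partial>space_time T) \<partial>Q) \<le> ennreal energy_constant" for k
    proof -
      have "(\<integral>\<^sup>+\<pi>. (\<integral>\<^sup>+z. ?L k (z, \<pi>) \<partial>space_time T) \<partial>Q) = (\<integral>\<^sup>+p. ?L k p \<partial>(space_time T \<Otimes>\<^sub>M Q))"
        by (rule P.nn_integral_snd[OF Lm])
      also have "\<dots> \<le> liminf (\<lambda>n. \<integral>\<^sup>+p. average_increment n j (1 / real (Suc k)) p \<partial>(space_time T \<Otimes>\<^sub>M Q))"
        by (intro nn_integral_liminf average_increment_measurable)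
      also have "\<dots> \<le> ennreal energy_constant"
      proof (rule liminf_le_const, rule eventually_sequentiallyI[of k])
        fix n assume "k \<le> n"
        then show "(\<integral>\<^sup>+p. average_increment n j (1 / real (Suc k)) p \<partial>(space_time T \<Otimes>\<^sub>M Q)) \<le> ennreal energy_constant"
          by (intro limit_energy_average) (auto intro!: divide_left_mono)
      qed
      finally show ?thesis .
    qed
    have "(\<integral>\<^sup>+\<pi>. liminf (\<lambda>k. \<integral>\<^sup>+z. ?L k (z, \<pi>) \<partial>space_time T) \<partial>Q) \<le> liminf (\<lambda>k. \<integral>\<^sup>+\<pi>. (\<integral>\<^sup>+z. ?L k (z, \<pi>) \<partial>space_time T) \<partial>Q)"
      by (intro nn_integral_liminf Vm)
    also have "\<dots> \<le> ennreal energy_constant" by (intro liminf_le_const always_eventually allI V)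
    finally have "(\<integral>\<^sup>+\<pi>. liminf (\<lambda>k. \<integral>\<^sup>+z. ?L k (z, \<pi>) \<partial>space_time T) \<partial>Q) \<noteq> \<infinity>" by (auto simp: top_unique)
    then show ?thesis by (intro nn_integral_noteq_infinite borel_measurable_liminf Vm)
  qed
  have "AE \<pi> in Q. \<forall>j\<in>UNIV. liminf (\<lambda>k. \<integral>\<^sup>+z. liminf (\<lambda>n. average_increment n j (1 / real (Suc k)) (z, \<pi>)) \<partial>space_time T) \<noteq> \<infinity>"
    by (intro AE_ball_countable' fin) (simp add: countable_finite)
  with bb AE_space show ?thesis
  proof eventually_elim
    fix \<pi> assume \<pi>: "\<pi> \<in> space Q" and b: "\<forall>s\<in>{0..T}. box_bounded (\<pi> s)"
      and f: "\<forall>j\<in>UNIV. liminf (\<lambda>k. \<integral>\<^sup>+z. liminf (\<lambda>n. average_increment n j (1 / real (Suc k)) (z, \<pi>)) \<partial>space_time T) \<noteq> \<infinity>"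
    have "(\<lambda>k. \<integral>\<^sup>+z. liminf (\<lambda>n. average_increment n j (1 / real (Suc k)) (z, \<pi>)) \<partial>space_time T) = (\<lambda>k. density_energy j (1 / real (Suc k)) \<pi>)" for j
      using density_energy_eq[OF \<pi>] b by (intro ext) auto
    then show "(\<forall>s\<in>{0..T}. box_bounded (\<pi> s)) \<and> (\<forall>j. liminf (\<lambda>k. density_energy j (1 / real (Suc k)) \<pi>) < \<infinity>)"
      using b f by (simp add: less_top)
  qed
qed

end

section \<open>Riesz representation\<close>

text \<open>Completeness of L^2 for sequences that converge geometrically fast. Since |d| \<le> 2^(-n) + 2^n
  d^2, the increments are summable in L^1, so the sequence converges almost everywhere, and Fatou's lemma
  bounds the distance to the limit.\<close>

lemma L2_limit:
  fixes f :: "nat \<Rightarrow> 'a \<Rightarrow> real"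
  assumes M: "finite_measure M" and f [measurable]: "\<And>n. f n \<in> borel_measurable M"
    and c: "\<And>m n. (\<integral>\<^sup>+x. ennreal ((f m x - f n x)\<^sup>2) \<partial>M) \<le> ennreal (2 * ((1/4)^m + (1/4)^n))"
  obtains g where "g \<in> borel_measurable M" "\<And>n. (\<integral>\<^sup>+x. ennreal ((g x - f n x)\<^sup>2) \<partial>M) \<le> ennreal (2 * (1/4)^n)"
proof -
  interpret finite_measure M by fact
  define K where "K = measure M (space M)"
  have K: "emeasure M (space M) = ennreal K" "K \<ge> 0" by (auto simp: K_def emeasure_eq_measure)
  have step: "(\<integral>\<^sup>+x. ennreal \<bar>f (Suc n) x - f n x\<bar> \<partial>M) \<le> ennreal ((K + 4) * (1/2)^n)" for n
  proof -
    have "(\<integral>\<^sup>+x. ennreal \<bar>f (Suc n) x - f n x\<bar> \<partial>M) \<le> (\<integral>\<^sup>+x. ennreal ((1/2)^n) + ennreal (2^n) * ennreal ((f (Suc n) x - f n x)\<^sup>2) \<partial>M)"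
    proof (rule nn_integral_mono)
      fix x
      let ?d = "\<bar>f (Suc n) x - f n x\<bar>"
      have "?d \<le> (1/2)^n + 2^n * ?d\<^sup>2"
      proof -
        have "0 \<le> ((1/2)^n - ?d / 2)\<^sup>2 * 2^n" by simp
        also have "\<dots> = ((1/2)^n * 2^n) * (1/2)^n - ((1/2)^n * 2^n) * ?d + 2^n * ?d\<^sup>2 / 4"
          by (simp add: power2_eq_square algebra_simps)
        also have "(1/2::real)^n * 2^n = 1" by (simp add: power_mult_distrib[symmetric])
        finally have "0 \<le> 1 * (1/2)^n - 1 * ?d + 2^n * ?d\<^sup>2 / 4" .
        moreover have "0 \<le> 2^n * ?d\<^sup>2" by simp
        moreover have "d \<le> e + X" if "0 \<le> 1 * e - 1 * d + X / 4" "0 \<le> X" for d e X :: real using that by linarith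
        ultimately show ?thesis by blast
      qed
      then have "ennreal ?d \<le> ennreal ((1/2)^n + 2^n * (f (Suc n) x - f n x)\<^sup>2)" by (intro ennreal_leI) simp
      then show "ennreal ?d \<le> ennreal ((1/2)^n) + ennreal (2^n) * ennreal ((f (Suc n) x - f n x)\<^sup>2)"
        by (simp add: ennreal_mult[symmetric] ennreal_plus[symmetric] del: ennreal_plus)
    qed
    also have "\<dots> = ennreal ((1/2)^n) * ennreal K + ennreal (2^n) * (\<integral>\<^sup>+x. ennreal ((f (Suc n) x - f n x)\<^sup>2) \<partial>M)"
      by (subst nn_integral_add) (auto simp: nn_integral_cmult K)
    also have "\<dots> \<le> ennreal ((1/2)^n) * ennreal K + ennreal (2^n) * ennreal (2 * ((1/4)^(Suc n) + (1/4)^n))"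
      by (intro add_left_mono mult_left_mono c) auto
    also have "\<dots> = ennreal ((1/2)^n * K + 2^n * (2 * ((1/4)^(Suc n) + (1/4)^n)))"
      using K by (simp add: ennreal_mult[symmetric] ennreal_plus[symmetric] del: ennreal_plus)
    also have "\<dots> \<le> ennreal ((K + 4) * (1/2)^n)"
    proof (rule ennreal_leI)
      have "(2::real)^n * (1/4)^n = (1/2)^n" by (simp add: power_mult_distrib[symmetric])
      then have "(2::real)^n * (2 * ((1/4)^(Suc n) + (1/4)^n)) = 5/2 * (1/2)^n" by (simp add: algebra_simps)
      then show "(1/2)^n * K + 2^n * (2 * ((1/4)^(Suc n) + (1/4)^n)) \<le> (K + 4) * (1/2)^n" by (simp add: algebra_simps)
    qed
    finally show ?thesis .
  qed
  have "(\<integral>\<^sup>+x. (\<Sum>n. ennreal \<bar>f (Suc n) x - f n x\<bar>) \<partial>M) = (\<Sum>n. \<integral>\<^sup>+x. ennreal \<bar>f (Suc n) x - f n x\<bar> \<partial>M)"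
    by (rule nn_integral_suminf) measurable
  also have "\<dots> \<le> (\<Sum>n. ennreal ((K + 4) * (1/2)^n))" by (intro suminf_le step summableI)
  also have "\<dots> = ennreal (\<Sum>n. (K + 4) * (1/2)^n)"
    using K by (intro suminf_ennreal2 summable_mult summable_geometric) auto
  also have "\<dots> < \<infinity>" by simp
  finally have "(\<integral>\<^sup>+x. (\<Sum>n. ennreal \<bar>f (Suc n) x - f n x\<bar>) \<partial>M) \<noteq> \<infinity>" by simp
  then have ae: "AE x in M. (\<Sum>n. ennreal \<bar>f (Suc n) x - f n x\<bar>) \<noteq> \<infinity>"
    by (intro nn_integral_noteq_infinite) measurable
  define g where "g x = lim (\<lambda>n. f n x)" for x
  have conv: "AE x in M. (\<lambda>n. f n x) \<longlonglongrightarrow> g x"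
    using ae
  proof eventually_elim
    fix x assume "(\<Sum>n. ennreal \<bar>f (Suc n) x - f n x\<bar>) \<noteq> \<infinity>"
    then have "summable (\<lambda>n. \<bar>f (Suc n) x - f n x\<bar>)" by (intro summable_suminf_not_top) auto
    then have "summable (\<lambda>n. f (Suc n) x - f n x)" by (rule summable_rabs_cancel)
    then have "(\<lambda>n. \<Sum>i<n. f (Suc i) x - f i x) \<longlonglongrightarrow> (\<Sum>n. f (Suc n) x - f n x)" by (rule summable_LIMSEQ)
    then have "(\<lambda>n. f n x - f 0 x) \<longlonglongrightarrow> (\<Sum>n. f (Suc n) x - f n x)" unfolding sum_lessThan_telescope[of "\<lambda>i. f i x"] .
    from tendsto_add[OF this tendsto_const[of "f 0 x"]]
    have "convergent (\<lambda>n. f n x)" by (auto simp: convergent_def)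
    then show "(\<lambda>n. f n x) \<longlonglongrightarrow> g x" by (simp add: g_def convergent_LIMSEQ_iff)
  qed
  have gm [measurable]: "g \<in> borel_measurable M" unfolding g_def by measurable
  have "(\<integral>\<^sup>+x. ennreal ((g x - f n x)\<^sup>2) \<partial>M) \<le> ennreal (2 * (1/4)^n)" for n
  proof -
    have "(\<integral>\<^sup>+x. ennreal ((g x - f n x)\<^sup>2) \<partial>M) = (\<integral>\<^sup>+x. liminf (\<lambda>m. ennreal ((f m x - f n x)\<^sup>2)) \<partial>M)"
    proof (rule nn_integral_cong_AE)
      show "AE x in M. ennreal ((g x - f n x)\<^sup>2) = liminf (\<lambda>m. ennreal ((f m x - f n x)\<^sup>2))"
        using conv by eventually_elim (intro lim_imp_Liminf[symmetric] tendsto_ennrealI tendsto_intros, auto)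
    qed
    also have "\<dots> \<le> liminf (\<lambda>m. \<integral>\<^sup>+x. ennreal ((f m x - f n x)\<^sup>2) \<partial>M)"
      by (rule nn_integral_liminf) measurable
    also have "\<dots> \<le> liminf (\<lambda>m. ennreal (2 * ((1/4)^m + (1/4)^n)))"
      by (intro Liminf_mono always_eventually allI c)
    also have "\<dots> = ennreal (2 * (0 + (1/4)^n))"
      by (intro lim_imp_Liminf tendsto_ennrealI tendsto_intros LIMSEQ_power_zero) auto
    finally show ?thesis by simp
  qed
  then show thesis using that gm by blast
qed

lemma integrable_product_L2:
  fixes f g :: "'a \<Rightarrow> real"
  assumes [measurable]: "f \<in> borel_measurable M" "g \<in> borel_measurable M"
    and "integrable M (\<lambda>x. (f x)\<^sup>2)" "integrable M (\<lambda>x. (g x)\<^sup>2)"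
  shows "integrable M (\<lambda>x. f x * g x)"
proof (rule Bochner_Integration.integrable_bound)
  show "integrable M (\<lambda>x. (f x)\<^sup>2 + (g x)\<^sup>2)" using assms by auto
  show "AE x in M. norm (f x * g x) \<le> norm ((f x)\<^sup>2 + (g x)\<^sup>2)"
  proof (rule AE_I2)
    fix x
    have "2 * (\<bar>f x\<bar> * \<bar>g x\<bar>) \<le> (f x)\<^sup>2 + (g x)\<^sup>2" using sum_squares_bound[of "\<bar>f x\<bar>" "\<bar>g x\<bar>"] by (simp add: mult.assoc)
    moreover have "0 \<le> \<bar>f x\<bar> * \<bar>g x\<bar>" by simp
    ultimately have "\<bar>f x\<bar> * \<bar>g x\<bar> \<le> (f x)\<^sup>2 + (g x)\<^sup>2" by linarith
    then show "norm (f x * g x) \<le> norm ((f x)\<^sup>2 + (g x)\<^sup>2)" by (simp add: abs_mult)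
  qed
qed measurable

text \<open>On V the functional J(f) = \<parallel>f\<parallel>^2 - 2 L(f) is bounded below by hypothesis.
  The parallelogram identity turns a minimising sequence into a Cauchy sequence; its limit g need not belong
  to V, but the first variation of J along the sequence vanishes in the limit, and this says that L is the
  inner product with g.\<close>

lemma riesz_representation:
  fixes V :: "('a \<Rightarrow> real) set" and L :: "('a \<Rightarrow> real) \<Rightarrow> real"
  assumes M: "finite_measure M" and ne: "f0 \<in> V"
    and lin: "\<And>f g c d. f \<in> V \<Longrightarrow> g \<in> V \<Longrightarrow> (\<lambda>x. c * f x + d * g x) \<in> V"
    and Vm: "\<And>f. f \<in> V \<Longrightarrow> f \<in> borel_measurable M" and Vi: "\<And>f. f \<in> V \<Longrightarrow> integrable M (\<lambda>x. (f x)\<^sup>2)"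
    and L: "\<And>f g c d. f \<in> V \<Longrightarrow> g \<in> V \<Longrightarrow> L (\<lambda>x. c * f x + d * g x) = c * L f + d * L g"
    and bd: "\<And>f. f \<in> V \<Longrightarrow> 2 * L f \<le> C + (\<integral>x. (f x)\<^sup>2 \<partial>M)"
  obtains g where "g \<in> borel_measurable M" "integrable M (\<lambda>x. (g x)\<^sup>2)" "\<And>f. f \<in> V \<Longrightarrow> L f = (\<integral>x. g x * f x \<partial>M)"
proof -
  interpret finite_measure M by fact
  define J where "J f = (\<integral>x. (f x)\<^sup>2 \<partial>M) - 2 * L f" for f
  define m where "m = Inf (J ` V)"
  have bb: "bdd_below (J ` V)" using bd by (intro bdd_belowI[of _ "- C"]) (auto simp: J_def algebra_simps)
  have mJ: "m \<le> J f" if "f \<in> V" for f unfolding m_def using bb that by (intro cInf_lower) auto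
  have "\<exists>f\<in>V. J f < m + (1/4)^n" for n
  proof -
    have "Inf (J ` V) < m + (1/4)^n" by (simp add: m_def)
    then show ?thesis using ne bb by (subst (asm) cInf_less_iff) auto
  qed
  then obtain f where f: "\<And>n. f n \<in> V" "\<And>n. J (f n) < m + (1/4)^n" by metis
  have prod: "integrable M (\<lambda>x. g x * h x)" if "g \<in> V" "h \<in> V" for g h
    using that by (intro integrable_product_L2 Vm Vi)
  have expand: "J (\<lambda>x. c * g x + d * h x) = c\<^sup>2 * (\<integral>x. (g x)\<^sup>2 \<partial>M) + 2 * c * d * (\<integral>x. g x * h x \<partial>M) + d\<^sup>2 * (\<integral>x. (h x)\<^sup>2 \<partial>M) - 2 * (c * L g + d * L h)"
    if "g \<in> V" "h \<in> V" for g h c d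
  proof -
    have "(\<integral>x. (c * g x + d * h x)\<^sup>2 \<partial>M) = (\<integral>x. c\<^sup>2 * (g x)\<^sup>2 + 2 * c * d * (g x * h x) + d\<^sup>2 * (h x)\<^sup>2 \<partial>M)"
      by (intro Bochner_Integration.integral_cong) (auto simp: power2_eq_square algebra_simps)
    also have "\<dots> = c\<^sup>2 * (\<integral>x. (g x)\<^sup>2 \<partial>M) + 2 * c * d * (\<integral>x. g x * h x \<partial>M) + d\<^sup>2 * (\<integral>x. (h x)\<^sup>2 \<partial>M)"
      using Vi[OF that(1)] Vi[OF that(2)] prod[OF that] by simp
    finally show ?thesis by (simp add: J_def L that)
  qed
  have cauchy: "(\<integral>\<^sup>+x. ennreal ((f p x - f n x)\<^sup>2) \<partial>M) \<le> ennreal (2 * ((1/4)^p + (1/4)^n))" for p n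
  proof -
    have mid: "m \<le> J (\<lambda>x. 1/2 * f p x + 1/2 * f n x)" by (intro mJ lin f)
    have "J (\<lambda>x. 1/2 * f p x + 1/2 * f n x) = 1/2 * J (f p) + 1/2 * J (f n) - 1/4 * (\<integral>x. (f p x - f n x)\<^sup>2 \<partial>M)"
    proof -
      have "(\<integral>x. (f p x - f n x)\<^sup>2 \<partial>M) = (\<integral>x. (f p x)\<^sup>2 - 2 * (f p x * f n x) + (f n x)\<^sup>2 \<partial>M)"
        by (intro Bochner_Integration.integral_cong) (auto simp: power2_eq_square algebra_simps)
      also have "\<dots> = (\<integral>x. (f p x)\<^sup>2 \<partial>M) - 2 * (\<integral>x. f p x * f n x \<partial>M) + (\<integral>x. (f n x)\<^sup>2 \<partial>M)"
        using Vi[OF f(1)[of p]] Vi[OF f(1)[of n]] prod[OF f(1)[of p] f(1)[of n]] by simp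
      finally show ?thesis unfolding expand[OF f(1) f(1)] J_def by (simp add: power2_eq_square algebra_simps)
    qed
    moreover have "D \<le> 2 * (a + b)" if "X = 1/2 * P + 1/2 * R - 1/4 * D" "m \<le> X" "P < m + a" "R < m + b" for D a b X P R :: real
      using that by argo
    ultimately have "(\<integral>x. (f p x - f n x)\<^sup>2 \<partial>M) \<le> 2 * ((1/4)^p + (1/4)^n)"
      using mid f(2)[of p] f(2)[of n] by blast
    moreover have "integrable M (\<lambda>x. (f p x - f n x)\<^sup>2)"
      using Vi[OF lin[OF f(1)[of p] f(1)[of n], of 1 "-1"]] by simp
    then have "(\<integral>\<^sup>+x. ennreal ((f p x - f n x)\<^sup>2) \<partial>M) = ennreal (\<integral>x. (f p x - f n x)\<^sup>2 \<partial>M)"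
      by (intro nn_integral_eq_integral) auto
    ultimately show ?thesis by (simp only: ennreal_leI)
  qed
  obtain g where g [measurable]: "g \<in> borel_measurable M" and gn: "\<And>n. (\<integral>\<^sup>+x. ennreal ((g x - f n x)\<^sup>2) \<partial>M) \<le> ennreal (2 * (1/4)^n)"
    using L2_limit[OF M Vm[OF f(1)] cauchy] by blast
  have di: "integrable M (\<lambda>x. (g x - f n x)\<^sup>2)" for n
    using gn[of n] Vm[OF f(1)[of n]] by (intro integrableI_bounded) (auto intro: le_less_trans)
  have dn: "(\<integral>x. (g x - f n x)\<^sup>2 \<partial>M) \<le> 2 * (1/4)^n" for n
    using gn[of n] nn_integral_eq_integral[OF di[of n]] by simp
  have gi: "integrable M (\<lambda>x. (g x)\<^sup>2)"
  proof (rule Bochner_Integration.integrable_bound)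
    show "integrable M (\<lambda>x. 2 * (g x - f 0 x)\<^sup>2 + 2 * (f 0 x)\<^sup>2)" using di[of 0] Vi[OF f(1)[of 0]] by simp
    show "AE x in M. norm ((g x)\<^sup>2) \<le> norm (2 * (g x - f 0 x)\<^sup>2 + 2 * (f 0 x)\<^sup>2)"
    proof (rule AE_I2)
      fix x
      have "(g x)\<^sup>2 \<le> 2 * (g x - f 0 x)\<^sup>2 + 2 * (f 0 x)\<^sup>2"
        using zero_le_power2[of "g x - 2 * f 0 x"] by (simp add: power2_eq_square algebra_simps)
      then show "norm ((g x)\<^sup>2) \<le> norm (2 * (g x - f 0 x)\<^sup>2 + 2 * (f 0 x)\<^sup>2)" by simp
    qed
  qed measurable
  have "L h = (\<integral>x. g x * h x \<partial>M)" if h: "h \<in> V" for h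
  proof -
    note hm [measurable] = Vm[OF h]
    define B where "B = (\<integral>x. (h x)\<^sup>2 \<partial>M)"
    have B0: "B \<ge> 0" unfolding B_def by simp
    have lim: "(\<lambda>n. \<integral>x. f n x * h x \<partial>M) \<longlonglongrightarrow> (\<integral>x. g x * h x \<partial>M)"
    proof (rule Lim_null[THEN iffD2], rule Lim_null_comparison)
      have ghi: "integrable M (\<lambda>x. g x * h x)" by (intro integrable_product_L2 gi Vi h g hm)
      show "\<forall>\<^sub>F n in sequentially. norm ((\<integral>x. f n x * h x \<partial>M) - (\<integral>x. g x * h x \<partial>M)) \<le> (2 + B) * (1/2)^n"
      proof (intro always_eventually allI)
        fix n
        note fm [measurable] = Vm[OF f(1)[of n]]
        have p: "integrable M (\<lambda>x. 2^n * (g x - f n x)\<^sup>2 + (1/2)^n * (h x)\<^sup>2)" using di[of n] Vi[OF h] by simp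
        have "(\<integral>x. f n x * h x \<partial>M) - (\<integral>x. g x * h x \<partial>M) = (\<integral>x. (f n x - g x) * h x \<partial>M)"
          using prod[OF f(1)[of n] h] ghi by (simp add: left_diff_distrib)
        also have "norm \<dots> \<le> (\<integral>x. norm ((f n x - g x) * h x) \<partial>M)" by (rule integral_norm_bound)
        also have "\<dots> \<le> (\<integral>x. 2^n * (g x - f n x)\<^sup>2 + (1/2)^n * (h x)\<^sup>2 \<partial>M)"
        proof (rule integral_mono[OF _ p])
          show "integrable M (\<lambda>x. norm ((f n x - g x) * h x))"
            using prod[OF f(1)[of n] h] ghi by (intro integrable_norm) (simp add: left_diff_distrib)
          fix x
          let ?a = "\<bar>g x - f n x\<bar>" and ?b = "\<bar>h x\<bar>"
          have e: "(2::real)^n * (1/2)^n = 1" by (simp add: power_mult_distrib[symmetric])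
          have "0 \<le> 2^n * (?a - (1/2)^n * ?b)\<^sup>2" by simp
          also have "\<dots> = 2^n * ?a\<^sup>2 - 2 * (2^n * (1/2)^n) * (?a * ?b) + (2^n * (1/2)^n) * (1/2)^n * ?b\<^sup>2"
            by (simp only: power2_eq_square) (simp add: algebra_simps)
          finally have "2 * (?a * ?b) \<le> 2^n * ?a\<^sup>2 + (1/2)^n * ?b\<^sup>2" unfolding e by simp
          moreover have "0 \<le> ?a * ?b" by simp
          ultimately have "?a * ?b \<le> 2^n * ?a\<^sup>2 + (1/2)^n * ?b\<^sup>2" by linarith
          then show "norm ((f n x - g x) * h x) \<le> 2^n * (g x - f n x)\<^sup>2 + (1/2)^n * (h x)\<^sup>2"
            by (simp add: abs_mult abs_minus_commute)
        qed
        also have "\<dots> = 2^n * (\<integral>x. (g x - f n x)\<^sup>2 \<partial>M) + (1/2)^n * B" using di[of n] Vi[OF h] by (simp add: B_def)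
        also have "\<dots> \<le> 2^n * (2 * (1/4)^n) + (1/2)^n * B" using dn[of n] by simp
        also have "(2::real)^n * (2 * (1/4)^n) = 2 * (1/2)^n" by (simp add: power_mult_distrib[symmetric])
        finally show "norm ((\<integral>x. f n x * h x \<partial>M) - (\<integral>x. g x * h x \<partial>M)) \<le> (2 + B) * (1/2)^n" by (simp add: algebra_simps)
      qed
      have "(\<lambda>n. (2 + B) * (1/2)^n) \<longlonglongrightarrow> (2 + B) * 0" by (intro tendsto_intros LIMSEQ_power_zero) simp
      then show "(\<lambda>n. (2 + B) * (1/2)^n) \<longlonglongrightarrow> 0" by simp
    qed
    define b where "b = (\<integral>x. g x * h x \<partial>M) - L h"
    have var: "0 \<le> 2 * t * b + t\<^sup>2 * B" for t
    proof (rule LIMSEQ_le_const)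
      have "(\<lambda>n. (1/4)^n + 2 * t * ((\<integral>x. f n x * h x \<partial>M) - L h) + t\<^sup>2 * B) \<longlonglongrightarrow> 0 + 2 * t * ((\<integral>x. g x * h x \<partial>M) - L h) + t\<^sup>2 * B"
        by (intro tendsto_intros lim LIMSEQ_power_zero) simp
      then show "(\<lambda>n. (1/4)^n + 2 * t * ((\<integral>x. f n x * h x \<partial>M) - L h) + t\<^sup>2 * B) \<longlonglongrightarrow> 2 * t * b + t\<^sup>2 * B"
        by (simp add: b_def)
      have "0 \<le> (1/4)^n + 2 * t * ((\<integral>x. f n x * h x \<partial>M) - L h) + t\<^sup>2 * B" for n
      proof -
        have "m \<le> J (\<lambda>x. 1 * f n x + t * h x)" by (intro mJ lin f h)
        also have "\<dots> = J (f n) + 2 * t * ((\<integral>x. f n x * h x \<partial>M) - L h) + t\<^sup>2 * B"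
          unfolding expand[OF f(1) h] by (simp add: J_def B_def algebra_simps)
        finally show ?thesis using f(2)[of n] by linarith
      qed
      then show "\<exists>N. \<forall>n\<ge>N. 0 \<le> (1/4)^n + 2 * t * ((\<integral>x. f n x * h x \<partial>M) - L h) + t\<^sup>2 * B" by blast
    qed
    have "b = 0"
    proof -
      \<comment> \<open>Minimising 2tb + t^2(B+1) over t leads to this value, which remains meaningful for B
        = 0.\<close>
      have "0 \<le> 2 * (- b / (B + 1)) * b + (- b / (B + 1))\<^sup>2 * B" by (rule var)
      also have "\<dots> \<le> 2 * (- b / (B + 1)) * b + (- b / (B + 1))\<^sup>2 * (B + 1)" by (intro add_left_mono mult_left_mono) auto
      also have "\<dots> = - (b\<^sup>2) / (B + 1)"
      proof -
        have "2 * (- b / c) * b + (- b / c)\<^sup>2 * c = - (b\<^sup>2) / c" if "c > 0" for c :: real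
          using that by (simp add: power2_eq_square field_simps)
        then show ?thesis using B0 by simp
      qed
      finally have "b\<^sup>2 \<le> 0" using B0 by (simp add: divide_le_0_iff zero_le_divide_iff)
      then show ?thesis by simp
    qed
    then show ?thesis by (simp add: b_def)
  qed
  then show thesis using that g gi by blast
qed

section \<open>Integration against increments of a Stieltjes function\<close>

lemma cadlag_continuous_at_right:
  fixes W :: "real \<Rightarrow> real"
  assumes "cadlag_on UNIV euclidean W" shows "continuous (at_right t) W"
  using assms by (auto simp: cadlag_on_def continuous_within)

text \<open>Both measures agree on the half-open intervals, because the increments of W are periodic.\<close>

lemma interval_measure_translate:
  fixes W :: "real \<Rightarrow> real"
  assumes mono: "mono W" and rc: "\<And>t. continuous (at_right t) W" and per: "\<And>u. W (u + 1) - W u = W 1 - W 0"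
  shows "distr (interval_measure W) borel (\<lambda>x. x + 1) = interval_measure W"
proof -
  have Ioc: "emeasure (interval_measure W) {a<..b} = (if a \<le> b then ennreal (W b - W a) else 0)" for a b
    using emeasure_interval_measure_Ioc_eq[of W a b] mono rc by (auto simp: mono_def)
  let ?E = "range (\<lambda>(a, b). {a<..b::real})"
  have m: "(\<lambda>x. x + 1) \<in> interval_measure W \<rightarrow>\<^sub>M borel" by measurable
  have eq: "emeasure (distr (interval_measure W) borel (\<lambda>x. x + 1)) {a<..b} = emeasure (interval_measure W) {a<..b}" for a b
  proof -
    have "(\<lambda>x. x + 1) -` {a<..b} = {a - 1<..b - 1}" by auto
    then have "emeasure (distr (interval_measure W) borel (\<lambda>x. x + 1)) {a<..b} = emeasure (interval_measure W) {a - 1<..b - 1}"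
      by (subst emeasure_distr[OF m]) auto
    also have "\<dots> = emeasure (interval_measure W) {a<..b}"
      using per[of "a - 1"] per[of "b - 1"] unfolding Ioc by (auto intro!: arg_cong[where f = ennreal])
    finally show ?thesis .
  qed
  show ?thesis
  proof (rule measure_eqI_generator_eq[where E = ?E and \<Omega> = UNIV and A = "\<lambda>i. {- real i<..real i}"])
    show "Int_stable ?E" by (auto simp: Int_stable_def intro!: image_eqI)
    show "sets (distr (interval_measure W) borel (\<lambda>x. x + 1)) = sigma_sets UNIV ?E"
      by (simp add: borel_sigma_sets_Ioc)
    show "sets (interval_measure W) = sigma_sets UNIV ?E" by (simp add: borel_sigma_sets_Ioc)
    show "(\<Union>i. {- real i<..real i}) = UNIV"
    proof (intro equalityI subset_UNIV subsetI)
      fix x :: real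
      obtain i :: nat where "\<bar>x\<bar> < real i" using reals_Archimedean2 by blast
      then have "x \<in> {- real i<..real i}" by auto
      then show "x \<in> (\<Union>i. {- real i<..real i})" by blast
    qed
    show "emeasure (distr (interval_measure W) borel (\<lambda>x. x + 1)) {- real i<..real i} \<noteq> \<infinity>" for i
      unfolding eq by (simp add: Ioc)
    fix X assume "X \<in> ?E"
    then show "emeasure (distr (interval_measure W) borel (\<lambda>x. x + 1)) X = emeasure (interval_measure W) X"
      using eq by auto
  qed auto
qed

text \<open>The increment W(t+h) - W(t) is the mass of (t,t+h]; Fubini's theorem exchanges the two
  integrals, and t < v \<le> t+h is the same as v-h \<le> t < v. The outer variable v then ranges over
  [0,2), and its part in [1,2) is moved back by one period, where it supplies the values of t below 0.\<close>

lemma stieltjes_increment_integral: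
  fixes W :: "real \<Rightarrow> real" and f :: "real \<Rightarrow> ennreal"
  assumes mono: "mono W" and rc: "\<And>t. continuous (at_right t) W" and per: "\<And>u. W (u + 1) - W u = W 1 - W 0"
    and f [measurable]: "f \<in> borel_measurable borel" and fper: "\<And>t. f (t + 1) = f t" and h: "0 \<le> h" "h \<le> 1"
  shows "(\<integral>\<^sup>+t. f t * ennreal (W (t + h) - W t) * indicator {0..<1} t \<partial>lborel) =
    (\<integral>\<^sup>+v. (\<integral>\<^sup>+t. f t * indicator {v - h..<v} t \<partial>lborel) * indicator {0..<1} v \<partial>interval_measure W)"
proof -
  let ?\<mu> = "interval_measure W"
  have sf: "sigma_finite_measure ?\<mu>"
    by (rule sigma_finite_interval_measure) (use mono rc in \<open>auto simp: mono_def\<close>)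
  interpret pair_sigma_finite lborel ?\<mu> using sf by (simp add: pair_sigma_finite_def lborel.sigma_finite_measure_axioms)
  have inc: "ennreal (W (t + h) - W t) = (\<integral>\<^sup>+v. indicator {t<..t + h} v \<partial>?\<mu>)" for t
    using emeasure_interval_measure_Ioc_eq[of W t "t + h"] mono rc h by (auto simp: mono_def)
  define A where "A v = (\<integral>\<^sup>+t. f t * indicator {0..<1} t * indicator {v - h..<v} t \<partial>lborel)" for v :: real
  have sw: "indicator {t<..t + h} v = (indicator {v - h..<v} t :: ennreal)" for t v :: real
    by (auto simp: indicator_def)
  have m1: "{p. fst p < snd p \<and> snd p \<le> fst p + h} \<in> sets (lborel \<Otimes>\<^sub>M ?\<mu>)"
  proof -
    have "{p \<in> space (lborel \<Otimes>\<^sub>M ?\<mu>). fst p < snd p \<and> snd p \<le> fst p + h} \<in> sets (lborel \<Otimes>\<^sub>M ?\<mu>)" by measurable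
    then show ?thesis by (simp add: space_pair_measure)
  qed
  have im: "(\<lambda>(t, v). indicator {t<..t + h} v :: ennreal) \<in> borel_measurable (lborel \<Otimes>\<^sub>M ?\<mu>)"
  proof -
    have "(\<lambda>(t, v). indicator {t<..t + h} v :: ennreal) = indicator {p. fst p < snd p \<and> snd p \<le> fst p + h}"
      by (auto simp: indicator_def fun_eq_iff)
    then show ?thesis using m1 by simp
  qed
  have fm: "(\<lambda>(t, v). f t * indicator {0..<1} t * indicator {t<..t + h} v) \<in> borel_measurable (lborel \<Otimes>\<^sub>M ?\<mu>)"
  proof -
    have "(\<lambda>p. (f (fst p) * indicator {0..<1} (fst p)) * (\<lambda>(t, v). indicator {t<..t + h} v) p) \<in> borel_measurable (lborel \<Otimes>\<^sub>M ?\<mu>)"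
      by (intro borel_measurable_times_ennreal im) measurable
    then show ?thesis by (simp add: split_beta')
  qed
  have Am: "A \<in> borel_measurable borel"
  proof -
    have "(\<lambda>(v, t). f t * indicator {0..<1} t * indicator {t<..t + h} v) \<in> borel_measurable (?\<mu> \<Otimes>\<^sub>M lborel)"
      using measurable_compose[OF measurable_pair_swap' fm] by (simp add: split_beta')
    from lborel.borel_measurable_nn_integral[OF this] show ?thesis by (simp add: A_def[abs_def] sw cong: measurable_cong_sets)
  qed
  then have Am': "A \<in> borel_measurable ?\<mu>" by (simp cong: measurable_cong_sets)
  have "(\<integral>\<^sup>+t. f t * ennreal (W (t + h) - W t) * indicator {0..<1} t \<partial>lborel) =
     (\<integral>\<^sup>+t. (\<integral>\<^sup>+v. f t * indicator {0..<1} t * indicator {t<..t + h} v \<partial>?\<mu>) \<partial>lborel)"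
    by (intro nn_integral_cong) (simp add: inc nn_integral_cmult mult_ac)
  also have "\<dots> = (\<integral>\<^sup>+v. (\<integral>\<^sup>+t. f t * indicator {0..<1} t * indicator {t<..t + h} v \<partial>lborel) \<partial>?\<mu>)"
    by (rule Fubini'[OF fm, symmetric])
  also have "\<dots> = (\<integral>\<^sup>+v. A v \<partial>?\<mu>)" by (simp add: A_def sw)
  also have "\<dots> = (\<integral>\<^sup>+v. A v * indicator {0..<1} v + A v * indicator {1..<2} v + A v * indicator {2} v \<partial>?\<mu>)"
  proof (intro nn_integral_cong)
    fix v :: real
    show "A v = A v * indicator {0..<1} v + A v * indicator {1..<2} v + A v * indicator {2} v"
    proof (cases "v \<in> {0..2}")
      case True then show ?thesis by (auto simp: indicator_def)
    next
      case False
      have "A v = (\<integral>\<^sup>+(t::real). 0 \<partial>lborel)" unfolding A_def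
        using False h by (intro nn_integral_cong) (auto simp: indicator_def)
      then show ?thesis by simp
    qed
  qed
  also have "\<dots> = (\<integral>\<^sup>+v. A v * indicator {0..<1} v + A v * indicator {1..<2} v \<partial>?\<mu>)"
  proof (intro nn_integral_cong)
    fix v :: real
    have "A 2 = (\<integral>\<^sup>+(t::real). 0 \<partial>lborel)" unfolding A_def using h by (intro nn_integral_cong) (auto simp: indicator_def)
    then show "A v * indicator {0..<1} v + A v * indicator {1..<2} v + A v * indicator {2} v = A v * indicator {0..<1} v + A v * indicator {1..<2} v"
      by (cases "v = 2") auto
  qed
  also have "\<dots> = (\<integral>\<^sup>+v. A v * indicator {0..<1} v \<partial>?\<mu>) + (\<integral>\<^sup>+v. A v * indicator {1..<2} v \<partial>?\<mu>)"
  proof -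
    show ?thesis by (intro nn_integral_add borel_measurable_times_ennreal Am') auto
  qed
  also have "(\<integral>\<^sup>+v. A v * indicator {1..<2} v \<partial>?\<mu>) = (\<integral>\<^sup>+v. A (v + 1) * indicator {0..<1} v \<partial>?\<mu>)"
  proof -
    have "(\<integral>\<^sup>+v. A v * indicator {1..<2} v \<partial>?\<mu>) = (\<integral>\<^sup>+v. A v * indicator {1..<2} v \<partial>distr ?\<mu> borel (\<lambda>x. x + 1))"
      by (simp add: interval_measure_translate[OF mono rc per])
    also have "\<dots> = (\<integral>\<^sup>+v. A (v + 1) * indicator {1..<2} (v + 1) \<partial>?\<mu>)"
      using Am by (subst nn_integral_distr) auto
    also have "\<dots> = (\<integral>\<^sup>+v. A (v + 1) * indicator {0..<1} v \<partial>?\<mu>)"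
      by (intro nn_integral_cong) (auto simp: indicator_def)
    finally show ?thesis .
  qed
  also have "(\<integral>\<^sup>+v. A v * indicator {0..<1} v \<partial>?\<mu>) + \<dots> = (\<integral>\<^sup>+v. A v * indicator {0..<1} v + A (v + 1) * indicator {0..<1} v \<partial>?\<mu>)"
  proof -
    have "(\<lambda>v. A (v + 1)) \<in> borel_measurable ?\<mu>" using Am by measurable
    then show ?thesis by (intro nn_integral_add[symmetric] borel_measurable_times_ennreal Am') auto
  qed
  also have "\<dots> = (\<integral>\<^sup>+v. (\<integral>\<^sup>+t. f t * indicator {v - h..<v} t \<partial>lborel) * indicator {0..<1} v \<partial>?\<mu>)"
  proof (intro nn_integral_cong)
    fix v :: real
    show "A v * indicator {0..<1} v + A (v + 1) * indicator {0..<1} v = (\<integral>\<^sup>+t. f t * indicator {v - h..<v} t \<partial>lborel) * indicator {0..<1} v"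
    proof (cases "v \<in> {0..<1}")
      case True
      have "A (v + 1) = (\<integral>\<^sup>+t. f (1 + t) * indicator {0..<1} (1 + t) * indicator {v + 1 - h..<v + 1} (1 + t) \<partial>lborel)"
        unfolding A_def by (subst nn_integral_real_affine[where c = 1 and t = 1]) auto
      also have "\<dots> = (\<integral>\<^sup>+t. f t * indicator {-1..<0} t * indicator {v - h..<v} t \<partial>lborel)"
        using fper by (intro nn_integral_cong) (auto simp: indicator_def add.commute)
      finally have "A v + A (v + 1) = (\<integral>\<^sup>+t. f t * indicator {0..<1} t * indicator {v - h..<v} t + f t * indicator {-1..<0} t * indicator {v - h..<v} t \<partial>lborel)"
        unfolding A_def by (subst nn_integral_add) auto
      also have "\<dots> = (\<integral>\<^sup>+t. f t * indicator {v - h..<v} t \<partial>lborel)"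
        using True h by (intro nn_integral_cong) (auto simp: indicator_def)
      finally show ?thesis using True by simp
    qed simp
  qed
  finally show ?thesis .
qed

section \<open>Product structure of the torus measures\<close>

lemma vec_lambda_measurable:
  assumes "\<And>k. (\<lambda>w. f w k) \<in> borel_measurable M"
  shows "(\<lambda>w. (\<chi> k. f w k) :: real^'n::finite) \<in> borel_measurable M"
proof (rule borel_measurable_euclidean_space[THEN iffD2], intro ballI)
  fix b :: "real^'n" assume "b \<in> Basis"
  then obtain k where b: "b = axis k 1" by (auto simp: Basis_vec_def)
  show "(\<lambda>w. ((\<chi> k. f w k) :: real^'n) \<bullet> b) \<in> borel_measurable M"
    using assms[of k] by (simp add: b inner_axis)
qed

text \<open>It makes iterated integrals over single coordinates available on the torus.\<close>

lemma lborel_vec: "distr (\<Pi>\<^sub>M k\<in>UNIV. lborel) borel (\<lambda>w. \<chi> k. w k) = (lborel :: (real^'n::finite) measure)"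
proof (rule lborel_eqI[symmetric])
  interpret product_sigma_finite "\<lambda>_::'n. lborel :: real measure" ..
  interpret finite_product_sigma_finite "\<lambda>_::'n. lborel :: real measure" UNIV by standard simp
  fix l u :: "real^'n" assume le: "\<And>b. b \<in> Basis \<Longrightarrow> l \<bullet> b \<le> u \<bullet> b"
  have le': "l $ k \<le> u $ k" for k using le[of "axis k 1"] by (simp add: inner_axis axis_in_Basis_iff)
  have m: "(\<lambda>w. \<chi> k. w k) \<in> (\<Pi>\<^sub>M k\<in>(UNIV::'n set). (lborel :: real measure)) \<rightarrow>\<^sub>M (borel :: (real^'n) measure)"
    by (rule vec_lambda_measurable) measurable
  have "(\<lambda>w. \<chi> k. w k) -` box l u \<inter> space (\<Pi>\<^sub>M k\<in>(UNIV::'n set). (lborel :: real measure)) = (\<Pi>\<^sub>E k\<in>UNIV. {l $ k<..<u $ k})"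
    by (auto simp: mem_box_cart space_PiM PiE_def Pi_iff)
  then have "emeasure (distr (\<Pi>\<^sub>M k\<in>(UNIV::'n set). lborel) borel (\<lambda>w. \<chi> k. w k)) (box l u) = (\<Prod>k\<in>UNIV. emeasure lborel {l $ k<..<u $ k})"
    using m by (subst emeasure_distr) (auto simp: measure_times)
  also have "\<dots> = ennreal (\<Prod>k\<in>UNIV. u $ k - l $ k)"
    using le' by (simp add: prod_ennreal)
  also have "(\<Prod>k\<in>UNIV. u $ k - l $ k) = (\<Prod>b\<in>Basis. (u - l) \<bullet> b)"
  proof -
    have B: "(Basis :: (real^'n) set) = (\<lambda>k. axis k 1) ` UNIV" by (auto simp: Basis_vec_def)
    have "inj (\<lambda>k::'n. axis k (1::real))" by (auto simp: inj_on_def axis_eq_axis)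
    then show ?thesis unfolding B by (subst prod.reindex) (auto simp: inner_axis)
  qed
  finally show "emeasure (distr (\<Pi>\<^sub>M k\<in>(UNIV::'n set). lborel) borel (\<lambda>w. \<chi> k. w k)) (box l u) = ennreal (\<Prod>b\<in>Basis. (u - l) \<bullet> b)" .
qed simp

abbreviation unit_interval :: "real measure" where "unit_interval \<equiv> restrict_space lborel {0..<1}"

lemma unit_interval_borel: "f \<in> borel_measurable borel \<Longrightarrow> f \<in> borel_measurable unit_interval"
  by (rule measurable_restrict_space1) simp

lemma finite_measure_unit: "finite_measure unit_interval"
proof
  have "emeasure unit_interval {0..<1} = emeasure lborel {0..<1::real}" by (subst emeasure_restrict_space) auto
  then show "emeasure unit_interval (space unit_interval) \<noteq> \<infinity>" by (simp add: space_restrict_space)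
qed

lemma vec_lambda_torus:
  assumes M: "\<And>k. sets (M k) = sets unit_interval"
  shows "(\<lambda>w. \<chi> k. w k) \<in> (\<Pi>\<^sub>M k\<in>UNIV. M k) \<rightarrow>\<^sub>M (torus_borel :: (real^'n::finite) measure)"
  unfolding torus_borel_def
proof (rule measurable_restrict_space2)
  have sp: "space (M k) = {0..<1}" for k using sets_eq_imp_space_eq[OF M[of k]] by (simp add: space_restrict_space)
  show "(\<lambda>w. \<chi> k. w k) \<in> space (\<Pi>\<^sub>M k\<in>UNIV. M k) \<rightarrow> torus"
    by (auto simp: torus_def space_PiM sp PiE_def Pi_def)
  show "(\<lambda>w. \<chi> k. w k) \<in> (\<Pi>\<^sub>M k\<in>UNIV. M k) \<rightarrow>\<^sub>M borel"
  proof (rule vec_lambda_measurable)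
    fix k :: 'n
    have "(\<lambda>x. x) \<in> borel_measurable (M k)"
      using unit_interval_borel[of "\<lambda>x. x"] M[of k] by (simp cong: measurable_cong_sets)
    from measurable_compose[OF measurable_component_singleton[of k UNIV M] this]
    show "(\<lambda>w. w k) \<in> borel_measurable (\<Pi>\<^sub>M k\<in>UNIV. M k)" by simp
  qed
qed

lemma torus_lebesgue_product:
  "distr (\<Pi>\<^sub>M k\<in>UNIV. unit_interval) torus_borel (\<lambda>w. \<chi> k. w k) = (torus_lebesgue :: (real^'n::finite) measure)"
proof -
  interpret U: finite_measure unit_interval by (rule finite_measure_unit)
  interpret PU: product_sigma_finite "\<lambda>_::'n. unit_interval" by standard
  interpret PL: product_sigma_finite "\<lambda>_::'n. lborel :: real measure" ..
  interpret PL: finite_product_sigma_finite "\<lambda>_::'n. lborel :: real measure" UNIV by standard simp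
  let ?P = "\<Pi>\<^sub>M k\<in>(UNIV::'n set). unit_interval"
  have mv: "(\<lambda>w. \<chi> k. w k) \<in> (\<Pi>\<^sub>M k\<in>(UNIV::'n set). (lborel :: real measure)) \<rightarrow>\<^sub>M (borel :: (real^'n) measure)"
    by (rule vec_lambda_measurable) measurable
  have mn: "(\<lambda>x. \<lambda>k\<in>UNIV. x $ k) \<in> (torus_lebesgue :: (real^'n) measure) \<rightarrow>\<^sub>M ?P"
  proof (rule measurable_restrict)
    fix k :: 'n
    show "(\<lambda>x. x $ k) \<in> (torus_lebesgue :: (real^'n) measure) \<rightarrow>\<^sub>M unit_interval"
    proof (rule measurable_restrict_space2)
      show "(\<lambda>x. x $ k) \<in> space (torus_lebesgue :: (real^'n) measure) \<rightarrow> {0..<1}" by (auto simp: torus_def)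
      show "(\<lambda>x. x $ k) \<in> (torus_lebesgue :: (real^'n) measure) \<rightarrow>\<^sub>M lborel"
        using measurable_compose[OF torus_lebesgue_id vec_nth_measurable[of k]] by simp
    qed
  qed
  have eq: "?P = distr torus_lebesgue ?P (\<lambda>x. \<lambda>k\<in>UNIV. x $ k)"
  proof (rule PU.PiM_eqI[symmetric])
    fix A assume A: "\<And>i::'n. i \<in> UNIV \<Longrightarrow> A i \<in> sets unit_interval"
    have Ab: "A i \<in> sets borel" "A i \<subseteq> {0..<1}" for i using A[of i] by (auto simp: sets_restrict_space_iff)
    have PA: "Pi\<^sub>E UNIV A \<in> sets ?P" using A by (intro sets_PiM_I_finite) auto
    have "emeasure (distr torus_lebesgue ?P (\<lambda>x. \<lambda>k\<in>UNIV. x $ k)) (Pi\<^sub>E UNIV A) = emeasure torus_lebesgue ((\<lambda>x. \<lambda>k\<in>UNIV. x $ k) -` Pi\<^sub>E UNIV A \<inter> (torus :: (real^'n) set))"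
      by (subst emeasure_distr[OF mn PA]) simp
    also have "(\<lambda>x. \<lambda>k\<in>UNIV. x $ k) -` Pi\<^sub>E UNIV A \<inter> (torus :: (real^'n) set) = {x. \<forall>k. x $ k \<in> A k}"
    proof -
      have "x \<in> torus" if "\<forall>k. x $ k \<in> A k" for x :: "real^'n" using Ab(2) that by (fastforce simp: torus_def)
      then show ?thesis by (auto simp: PiE_def Pi_def)
    qed
    also have "emeasure torus_lebesgue {x. \<forall>k. x $ k \<in> A k} = emeasure lborel {x::real^'n. \<forall>k. x $ k \<in> A k}"
      unfolding torus_lebesgue_def
    proof (subst emeasure_restrict_space)
      have "x \<in> torus" if "\<forall>k. x $ k \<in> A k" for x :: "real^'n" using Ab(2) that by (fastforce simp: torus_def)
      then show "{x::real^'n. \<forall>k. x $ k \<in> A k} \<subseteq> torus" by auto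
    qed auto
    also have "\<dots> = emeasure (distr (\<Pi>\<^sub>M k\<in>UNIV. lborel) borel (\<lambda>w. \<chi> k. w k)) {x::real^'n. \<forall>k. x $ k \<in> A k}"
      by (simp add: lborel_vec)
    also have "\<dots> = emeasure (\<Pi>\<^sub>M k\<in>UNIV. lborel) (Pi\<^sub>E UNIV A)"
    proof (subst emeasure_distr[OF mv])
      have "{x::real^'n. \<forall>k. x $ k \<in> A k} = (\<Inter>k\<in>UNIV. (\<lambda>x. x $ k) -` A k \<inter> space borel)" by auto
      also have "\<dots> \<in> sets borel" using Ab(1) by (intro sets.finite_INT measurable_sets[OF vec_nth_measurable]) auto
      finally show "{x::real^'n. \<forall>k. x $ k \<in> A k} \<in> sets borel" .
      show "emeasure (\<Pi>\<^sub>M k\<in>UNIV. lborel) ((\<lambda>w. \<chi> k. w k) -` {x::real^'n. \<forall>k. x $ k \<in> A k} \<inter> space (\<Pi>\<^sub>M k\<in>(UNIV::'n set). lborel)) = emeasure (\<Pi>\<^sub>M k\<in>UNIV. lborel) (Pi\<^sub>E UNIV A)"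
        by (intro arg_cong2[where f = emeasure] refl) (auto simp: space_PiM PiE_def Pi_def)
    qed
    also have "\<dots> = (\<Prod>k\<in>UNIV. emeasure lborel (A k))" using Ab by (intro PL.measure_times) auto
    also have "\<dots> = (\<Prod>k\<in>UNIV. emeasure unit_interval (A k))"
      using Ab by (intro prod.cong refl) (auto simp: emeasure_restrict_space)
    finally show "emeasure (distr torus_lebesgue ?P (\<lambda>x. \<lambda>k\<in>UNIV. x $ k)) (Pi\<^sub>E UNIV A) = (\<Prod>k\<in>UNIV. emeasure unit_interval (A k))" .
  qed auto
  have "distr ?P torus_borel (\<lambda>w. \<chi> k. w k) = distr (distr torus_lebesgue ?P (\<lambda>x. \<lambda>k\<in>UNIV. x $ k)) torus_borel (\<lambda>w. \<chi> k. w k)"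
    using eq by simp
  also have "\<dots> = distr torus_lebesgue torus_borel ((\<lambda>w. \<chi> k. w k) \<circ> (\<lambda>x. \<lambda>k\<in>UNIV. x $ k))"
    by (rule distr_distr[OF vec_lambda_torus mn]) simp
  also have "(\<lambda>w. \<chi> k. w k) \<circ> (\<lambda>x. \<lambda>k\<in>UNIV. x $ k) = (\<lambda>x::real^'n. x)" by (auto simp: fun_eq_iff vec_eq_iff)
  also have "distr torus_lebesgue torus_borel (\<lambda>x::real^'n. x) = torus_lebesgue"
    by (rule distr_id2) simp
  finally show ?thesis .
qed

lemma sets_xW [simp, measurable_cong]: "sets (xW_measure W j) = sets torus_borel"
  by (simp add: xW_measure_def)

lemma space_xW [simp]: "space (xW_measure W j) = torus"
  by (simp add: xW_measure_def)

locale stieltjes =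
  fixes W :: "'n::finite \<Rightarrow> real \<Rightarrow> real" and j :: 'n
  assumes W_mono: "strict_mono (W j)" and W_rc: "\<And>t. continuous (at_right t) (W j)"
    and W_per: "\<And>u. W j (u + 1) - W j u = W j 1 - W j 0"
begin

abbreviation stieltjes_unit :: "real measure" where
  "stieltjes_unit \<equiv> restrict_space (interval_measure (W j)) {0..<1}"

lemma mono: "mono (W j)" by (rule strict_mono_mono[OF W_mono])

lemma finite_measure_stieltjes: "finite_measure stieltjes_unit"
proof
  have "emeasure stieltjes_unit {0..<1} = emeasure (interval_measure (W j)) {0..<1}" by (subst emeasure_restrict_space) auto
  also have "\<dots> \<le> emeasure (interval_measure (W j)) {-1<..1}" by (intro emeasure_mono) auto
  also have "\<dots> < \<infinity>" using emeasure_interval_measure_Ioc_eq[of "W j" "-1" 1] mono W_rc by (auto simp: mono_def)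
  finally show "emeasure stieltjes_unit (space stieltjes_unit) \<noteq> \<infinity>" by (simp add: space_restrict_space)
qed

abbreviation (input) coordinate_measure :: "'n \<Rightarrow> real measure" where
  "coordinate_measure k \<equiv> restrict_space (if k = j then interval_measure (W j) else lborel) {0..<1}"

lemma finite_measure_coordinate: "finite_measure (coordinate_measure k)"
  using finite_measure_unit finite_measure_stieltjes by auto

lemma sets_coordinate: "sets (coordinate_measure k) = sets unit_interval"
  by (auto simp: sets_restrict_space)

lemma product_coordinate: "product_sigma_finite coordinate_measure"
  unfolding product_sigma_finite_def using finite_measure_coordinate finite_measure.axioms(1) by blast

lemma product_unit: "product_sigma_finite (\<lambda>_::'n. unit_interval)"
  unfolding product_sigma_finite_def using finite_measure_unit finite_measure.axioms(1) by blast

lemma finite_measure_xW: "finite_measure (xW_measure W j)"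
proof
  interpret product_sigma_finite coordinate_measure by (rule product_coordinate)
  have sp: "space (coordinate_measure k) = {0..<1}" for k by (simp add: space_restrict_space)
  have "emeasure (xW_measure W j) torus = emeasure (\<Pi>\<^sub>M k\<in>UNIV. coordinate_measure k) ((\<lambda>w. \<chi> k. w k) -` torus \<inter> space (\<Pi>\<^sub>M k\<in>UNIV. coordinate_measure k))"
    unfolding xW_measure_def
    by (rule emeasure_distr[OF vec_lambda_torus[OF sets_coordinate]]) (simp add: torus_borel_def sets_restrict_space_iff)
  also have "\<dots> \<le> emeasure (\<Pi>\<^sub>M k\<in>UNIV. coordinate_measure k) (space (\<Pi>\<^sub>M k\<in>UNIV. coordinate_measure k))"
    by (intro emeasure_mono) auto
  also have "space (\<Pi>\<^sub>M k\<in>UNIV. coordinate_measure k) = (\<Pi>\<^sub>E k\<in>UNIV. {0..<1})" by (simp only: space_PiM sp)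
  also have "emeasure (\<Pi>\<^sub>M k\<in>UNIV. coordinate_measure k) (\<Pi>\<^sub>E k\<in>UNIV. {0..<1}) = (\<Prod>k\<in>UNIV. emeasure (coordinate_measure k) {0..<1})"
    by (rule emeasure_PiM) (auto simp: sets_restrict_space_iff)
  also have "\<dots> < \<infinity>"
  proof -
    have "(\<Prod>k\<in>UNIV. emeasure (coordinate_measure k) {0..<1}) = ennreal (\<Prod>k\<in>UNIV. measure (coordinate_measure k) {0..<1})"
      by (simp only: finite_measure.emeasure_eq_measure[OF finite_measure_coordinate] prod_ennreal[OF measure_nonneg])
    then show ?thesis by simp
  qed
  finally show "emeasure (xW_measure W j) (space (xW_measure W j)) \<noteq> \<infinity>" by simp
qed

definition glue :: "('n \<Rightarrow> real) \<Rightarrow> real \<Rightarrow> real^'n" where "glue w y = (\<chi> k. (w(j := y)) k)"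

lemma nn_integral_xW_split:
  assumes F: "F \<in> borel_measurable borel"
  shows "(\<integral>\<^sup>+x. F x \<partial>xW_measure W j) = (\<integral>\<^sup>+w. (\<integral>\<^sup>+y. F (glue w y) \<partial>stieltjes_unit) \<partial>(\<Pi>\<^sub>M k\<in>UNIV - {j}. unit_interval))"
proof -
  interpret product_sigma_finite coordinate_measure by (rule product_coordinate)
  have Fm: "(\<lambda>w. F (\<chi> k. w k)) \<in> borel_measurable (Pi\<^sub>M UNIV coordinate_measure)"
    by (rule measurable_compose[OF vec_lambda_torus[OF sets_coordinate] torus_borel_measurable[OF F]])
  have ins: "insert j (UNIV - {j}) = UNIV" by auto
  have "(\<integral>\<^sup>+x. F x \<partial>xW_measure W j) = (\<integral>\<^sup>+w. F (\<chi> k. w k) \<partial>Pi\<^sub>M UNIV coordinate_measure)"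
    unfolding xW_measure_def by (rule nn_integral_distr) (simp_all add: vec_lambda_torus[OF sets_coordinate] torus_borel_measurable[OF F])
  also have "\<dots> = (\<integral>\<^sup>+w. (\<integral>\<^sup>+y. F (\<chi> k. (w(j := y)) k) \<partial>coordinate_measure j) \<partial>Pi\<^sub>M (UNIV - {j}) coordinate_measure)"
    using product_nn_integral_insert[of "UNIV - {j}" j "\<lambda>w. F (\<chi> k. w k)"] Fm unfolding ins by simp
  also have "Pi\<^sub>M (UNIV - {j}) coordinate_measure = Pi\<^sub>M (UNIV - {j}) (\<lambda>_. unit_interval)"
    by (rule PiM_cong) auto
  finally show ?thesis by (simp add: glue_def)
qed

lemma nn_integral_torus_split:
  assumes F: "F \<in> borel_measurable borel"
  shows "(\<integral>\<^sup>+x. F x \<partial>torus_lebesgue) = (\<integral>\<^sup>+w. (\<integral>\<^sup>+y. F (glue w y) \<partial>unit_interval) \<partial>(\<Pi>\<^sub>M k\<in>UNIV - {j}. unit_interval))"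
proof -
  interpret product_sigma_finite "\<lambda>_::'n. unit_interval" by (rule product_unit)
  have Fm: "(\<lambda>w. F (\<chi> k. w k)) \<in> borel_measurable (Pi\<^sub>M UNIV (\<lambda>_::'n. unit_interval))"
    by (rule measurable_compose[OF vec_lambda_torus torus_borel_measurable[OF F]]) simp
  have ins: "insert j (UNIV - {j}) = UNIV" by auto
  have "(\<integral>\<^sup>+x. F x \<partial>torus_lebesgue) = (\<integral>\<^sup>+x. F x \<partial>distr (\<Pi>\<^sub>M k\<in>UNIV. unit_interval) torus_borel (\<lambda>w. \<chi> k. w k))"
    by (simp add: torus_lebesgue_product)
  also have "\<dots> = (\<integral>\<^sup>+w. F (\<chi> k. w k) \<partial>Pi\<^sub>M UNIV (\<lambda>_::'n. unit_interval))"
    by (rule nn_integral_distr) (simp_all add: vec_lambda_torus torus_borel_measurable[OF F])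
  also have "\<dots> = (\<integral>\<^sup>+w. (\<integral>\<^sup>+y. F (\<chi> k. (w(j := y)) k) \<partial>unit_interval) \<partial>Pi\<^sub>M (UNIV - {j}) (\<lambda>_. unit_interval))"
    using product_nn_integral_insert[of "UNIV - {j}" j "\<lambda>w. F (\<chi> k. w k)"] Fm unfolding ins by simp
  finally show ?thesis by (simp add: glue_def)
qed

text \<open>In the direction j, stieltjes_increment_integral replaces the integral against increments by one
  against dW_j, with f evaluated at points at distance at most h; the other coordinates are not touched.\<close>

lemma weighted_torus_integral_bound:
  fixes f :: "real^'n \<Rightarrow> ennreal"
  assumes f [measurable]: "f \<in> borel_measurable borel" and per: "\<And>x k. f (x + axis k 1) = f x"
    and h: "0 \<le> h" "h \<le> 1" and osc: "\<And>x t. \<bar>t\<bar> \<le> h \<Longrightarrow> f (x + t *\<^sub>R axis j 1) \<le> f x + c"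
  shows "(\<integral>\<^sup>+x. f x * ennreal (W j (x $ j + h) - W j (x $ j)) \<partial>torus_lebesgue)
     \<le> ennreal h * ((\<integral>\<^sup>+x. f x \<partial>xW_measure W j) + c * emeasure (xW_measure W j) torus)"
proof -
  have Wm [measurable]: "W j \<in> borel_measurable borel" by (rule borel_measurable_mono[OF mono])
  have g1: "glue w (y + 1) = glue w y + axis j 1" for w y by (simp add: glue_def vec_eq_iff axis_def)
  have g2: "glue w t = glue w v + (t - v) *\<^sub>R axis j 1" for w t v by (simp add: glue_def vec_eq_iff axis_def)
  have gj: "glue w y $ j = y" for w y by (simp add: glue_def)
  have gm: "(\<lambda>y. glue w y) \<in> borel_measurable borel" for w
    unfolding glue_def by (rule vec_lambda_measurable) (simp add: fun_upd_def if_distrib)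
  have inner: "(\<integral>\<^sup>+y. f (glue w y) * ennreal (W j (y + h) - W j y) \<partial>unit_interval) \<le> (\<integral>\<^sup>+v. ennreal h * (f (glue w v) + c) \<partial>stieltjes_unit)" for w
  proof -
    have fg: "(\<lambda>y. f (glue w y)) \<in> borel_measurable borel" by (rule measurable_compose[OF gm f])
    have "(\<integral>\<^sup>+y. f (glue w y) * ennreal (W j (y + h) - W j y) \<partial>unit_interval) = (\<integral>\<^sup>+y. f (glue w y) * ennreal (W j (y + h) - W j y) * indicator {0..<1} y \<partial>lborel)"
      by (subst nn_integral_restrict_space) auto
    also have "\<dots> = (\<integral>\<^sup>+v. (\<integral>\<^sup>+t. f (glue w t) * indicator {v - h..<v} t \<partial>lborel) * indicator {0..<1} v \<partial>interval_measure (W j))"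
      by (rule stieltjes_increment_integral[OF mono W_rc W_per fg _ h]) (simp add: g1 per)
    also have "\<dots> \<le> (\<integral>\<^sup>+v. (ennreal h * (f (glue w v) + c)) * indicator {0..<1} v \<partial>interval_measure (W j))"
    proof (intro nn_integral_mono mult_right_mono)
      fix v :: real
      have "(\<integral>\<^sup>+t. f (glue w t) * indicator {v - h..<v} t \<partial>lborel) \<le> (\<integral>\<^sup>+t. (f (glue w v) + c) * indicator {v - h..<v} t \<partial>lborel)"
      proof (rule nn_integral_mono)
        fix t :: real
        show "f (glue w t) * indicator {v - h..<v} t \<le> (f (glue w v) + c) * indicator {v - h..<v} t"
          using osc[of "t - v" "glue w v"] g2[of w t v] by (auto simp: indicator_def)
      qed
      also have "\<dots> = (f (glue w v) + c) * ennreal h" using h by (subst nn_integral_cmult_indicator) auto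
      finally show "(\<integral>\<^sup>+t. f (glue w t) * indicator {v - h..<v} t \<partial>lborel) \<le> ennreal h * (f (glue w v) + c)" by (simp add: mult.commute)
    qed simp
    also have "\<dots> = (\<integral>\<^sup>+v. ennreal h * (f (glue w v) + c) \<partial>stieltjes_unit)"
      by (subst nn_integral_restrict_space) auto
    finally show ?thesis .
  qed
  have Fm: "(\<lambda>x::real^'n. f x * ennreal (W j (x $ j + h) - W j (x $ j))) \<in> borel_measurable borel" by measurable
  have Gm: "(\<lambda>x. ennreal h * (f x + c)) \<in> borel_measurable borel" by measurable
  have "(\<integral>\<^sup>+x. f x * ennreal (W j (x $ j + h) - W j (x $ j)) \<partial>torus_lebesgue)
     = (\<integral>\<^sup>+w. (\<integral>\<^sup>+y. f (glue w y) * ennreal (W j (y + h) - W j y) \<partial>unit_interval) \<partial>(\<Pi>\<^sub>M k\<in>UNIV - {j}. unit_interval))"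
    using nn_integral_torus_split[OF Fm] by (simp add: gj)
  also have "\<dots> \<le> (\<integral>\<^sup>+w. (\<integral>\<^sup>+v. ennreal h * (f (glue w v) + c) \<partial>stieltjes_unit) \<partial>(\<Pi>\<^sub>M k\<in>UNIV - {j}. unit_interval))"
    by (intro nn_integral_mono inner)
  also have "\<dots> = (\<integral>\<^sup>+x. ennreal h * (f x + c) \<partial>xW_measure W j)" by (rule nn_integral_xW_split[OF Gm, symmetric])
  also have "\<dots> = ennreal h * ((\<integral>\<^sup>+x. f x \<partial>xW_measure W j) + c * emeasure (xW_measure W j) torus)"
  proof -
    have "f \<in> borel_measurable (xW_measure W j)" using torus_borel_measurable[OF f] by (simp cong: measurable_cong_sets)
    then show ?thesis by (simp add: nn_integral_cmult nn_integral_add)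
  qed
  finally show ?thesis .
qed

end

section \<open>The weak derivative\<close>

text \<open>The integer parts of the coordinates are removed one after the other.\<close>

lemma periodic_reduce:
  fixes f :: "real^'n::finite \<Rightarrow> 'a"
  assumes per: "\<And>x k. f (x + axis k 1) = f x"
  obtains u where "u \<in> torus" "f u = f x"
proof
  define v :: "real^'n" where "v = (\<chi> k. of_int (- \<lfloor>x $ k\<rfloor>))"
  have "f (x + (\<Sum>k\<in>A. (v $ k) *\<^sub>R axis k 1)) = f x" for A
  proof (induction A rule: infinite_finite_induct)
    case (insert i A)
    have "x + (\<Sum>k\<in>insert i A. (v $ k) *\<^sub>R axis k 1) = (x + (\<Sum>k\<in>A. (v $ k) *\<^sub>R axis k 1)) + of_int (- \<lfloor>x $ i\<rfloor>) *\<^sub>R axis i 1"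
      unfolding sum.insert[OF insert(1,2)] by (simp only: v_def vec_lambda_beta add_ac)
    then show ?case using periodic_int_axis[of f "x + (\<Sum>k\<in>A. (v $ k) *\<^sub>R axis k 1)", OF per] insert(3) by (simp only:)
  qed simp_all
  from this[of UNIV] show "f (x + v) = f x" by (simp only: vec_sum_axis)
  have "(x + v) $ k = frac (x $ k)" for k by (simp add: v_def frac_def)
  then show "x + v \<in> torus" by (simp add: torus_def frac_lt_1)
qed

lemma bounded_periodic:
  fixes g :: "real \<Rightarrow> real^'n::finite \<Rightarrow> real"
  assumes c: "continuous_on ({0..T} \<times> UNIV) (\<lambda>(t, x). g t x)" and per: "\<And>t x k. t \<in> {0..T} \<Longrightarrow> g t (x + axis k 1) = g t x"
  obtains B where "B \<ge> 0" "\<And>t x. t \<in> {0..T} \<Longrightarrow> \<bar>g t x\<bar> \<le> B"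
proof -
  have "compact ((\<lambda>(t, x). g t x) ` ({0..T} \<times> cbox 0 One))"
    by (intro compact_continuous_image continuous_on_subset[OF c] compact_Times) auto
  then obtain B where B: "\<And>z. z \<in> (\<lambda>(t, x). g t x) ` ({0..T} \<times> cbox 0 One) \<Longrightarrow> norm z \<le> B"
    using compact_imp_bounded bounded_iff by metis
  have "\<bar>g t x\<bar> \<le> max B 0" if t: "t \<in> {0..T}" for t x
  proof -
    obtain u where u: "u \<in> torus" "g t u = g t x" using periodic_reduce[of "g t" x, OF per[OF t]] by blast
    have "u \<in> cbox 0 One" using u(1) by (auto simp: torus_def mem_box_cart One_vec_nth less_imp_le)
    then have "norm (g t u) \<le> B" using t by (intro B) (auto intro!: image_eqI[where x = "(t, u)"])
    then show ?thesis using u(2) by simp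
  qed
  then show thesis using that[of "max B 0"] by simp
qed

lemma time_space_measurable:
  fixes g :: "real \<Rightarrow> real^'n::finite \<Rightarrow> real"
  assumes c: "continuous_on ({0..T} \<times> UNIV) (\<lambda>(t, x). g t x)"
  shows "(\<lambda>(t, x). g t x) \<in> borel_measurable (restrict_space borel {0..T} \<Otimes>\<^sub>M borel)"
proof -
  have "(\<lambda>z. z) \<in> restrict_space borel {0..T} \<Otimes>\<^sub>M (borel :: (real^'n) measure) \<rightarrow>\<^sub>M restrict_space borel ({0..T} \<times> UNIV)"
  proof (rule measurable_restrict_space2)
    show "(\<lambda>z. z) \<in> space (restrict_space borel {0..T} \<Otimes>\<^sub>M (borel :: (real^'n) measure)) \<rightarrow> {0..T} \<times> UNIV"
      by (auto simp: space_pair_measure space_restrict_space)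
    have 1: "(\<lambda>s. s) \<in> restrict_space borel {0..T} \<rightarrow>\<^sub>M (borel :: real measure)" by (rule measurable_restrict_space1) simp
    have "(\<lambda>z. (fst z, snd z)) \<in> restrict_space borel {0..T} \<Otimes>\<^sub>M (borel :: (real^'n) measure) \<rightarrow>\<^sub>M borel \<Otimes>\<^sub>M borel"
      by (intro measurable_Pair measurable_compose[OF measurable_fst 1] measurable_snd)
    then show "(\<lambda>z. z) \<in> restrict_space borel {0..T} \<Otimes>\<^sub>M (borel :: (real^'n) measure) \<rightarrow>\<^sub>M borel" by (simp add: borel_prod)
  qed
  from measurable_compose[OF this borel_measurable_continuous_on_restrict[OF c]] show ?thesis .
qed

lemma partial_deriv_line:
  assumes d: "\<And>x. (\<lambda>h. f (x + h *\<^sub>R axis j 1)) field_differentiable (at 0)"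
  shows "((\<lambda>h. f (x + h *\<^sub>R axis j 1)) has_real_derivative partial_deriv j f (x + t *\<^sub>R axis j 1)) (at t)"
proof -
  have "((\<lambda>h. f ((x + t *\<^sub>R axis j 1) + h *\<^sub>R axis j 1)) has_real_derivative partial_deriv j f (x + t *\<^sub>R axis j 1)) (at 0)"
    unfolding partial_deriv_def using d[of "x + t *\<^sub>R axis j 1"] by (simp add: field_differentiable_derivI)
  then have "((\<lambda>h. (\<lambda>h. f (x + h *\<^sub>R axis j 1)) (h + t)) has_real_derivative partial_deriv j f (x + t *\<^sub>R axis j 1)) (at 0)"
    by (simp add: algebra_simps)
  then show ?thesis using DERIV_shift[of "\<lambda>h. f (x + h *\<^sub>R axis j 1)" _ 0 t] by simp
qed

lemma partial_deriv_periodic: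
  assumes "\<And>x k. f (x + axis k 1) = f x" shows "partial_deriv j f (x + axis k 1) = partial_deriv j f x"
proof -
  have "f (x + axis k 1 + h *\<^sub>R axis j 1) = f (x + h *\<^sub>R axis j 1)" for h
    using assms[of "x + h *\<^sub>R axis j 1" k] by (simp add: algebra_simps)
  then show ?thesis by (simp add: partial_deriv_def)
qed

text \<open>By periodicity it suffices to bound continuous functions on the compact set [0,T] \<times>
  [0,1]^d; the last bound is the mean value theorem in the direction j.\<close>

lemma C01_bounds:
  assumes H: "H \<in> C01 T j"
  obtains B where "B \<ge> 0" "\<And>t x. t \<in> {0..T} \<Longrightarrow> \<bar>H t x\<bar> \<le> B" "\<And>t x. t \<in> {0..T} \<Longrightarrow> \<bar>partial_deriv j (H t) x\<bar> \<le> B"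
    "\<And>t x h. t \<in> {0..T} \<Longrightarrow> \<bar>H t (x + h *\<^sub>R axis j 1) - H t x\<bar> \<le> B * \<bar>h\<bar>"
proof -
  have per: "\<And>t x k. t \<in> {0..T} \<Longrightarrow> H t (x + axis k 1) = H t x" using H by (auto simp: C01_def periodic_def)
  have d: "(\<lambda>h. H t (x + h *\<^sub>R axis j 1)) field_differentiable (at 0)" if "t \<in> {0..T}" for t x using H that by (auto simp: C01_def)
  obtain B1 where B1: "B1 \<ge> 0" "\<And>t x. t \<in> {0..T} \<Longrightarrow> \<bar>H t x\<bar> \<le> B1"
    using bounded_periodic[of T H] H per by (auto simp: C01_def)
  obtain B2 where B2: "B2 \<ge> 0" "\<And>t x. t \<in> {0..T} \<Longrightarrow> \<bar>partial_deriv j (H t) x\<bar> \<le> B2"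
  proof (rule bounded_periodic[of T "\<lambda>t. partial_deriv j (H t)"])
    show "continuous_on ({0..T} \<times> UNIV) (\<lambda>(t, x). partial_deriv j (H t) x)" using H by (auto simp: C01_def)
  qed (auto intro!: partial_deriv_periodic per)
  have lip: "\<bar>H t (x + h *\<^sub>R axis j 1) - H t x\<bar> \<le> B2 * \<bar>h\<bar>" if t: "t \<in> {0..T}" for t x h
  proof -
    have "norm (H t (x + h *\<^sub>R axis j 1) - H t (x + 0 *\<^sub>R axis j 1)) \<le> B2 * norm (h - 0)"
    proof (rule field_differentiable_bound[where S = UNIV and f = "\<lambda>h. H t (x + h *\<^sub>R axis j 1)" and f' = "\<lambda>s. partial_deriv j (H t) (x + s *\<^sub>R axis j 1)"])
      show "((\<lambda>h. H t (x + h *\<^sub>R axis j 1)) has_field_derivative partial_deriv j (H t) (x + s *\<^sub>R axis j 1)) (at s within UNIV)" for s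
        using partial_deriv_line[of "H t" j x s, OF d[OF t]] by simp
      show "norm (partial_deriv j (H t) (x + s *\<^sub>R axis j 1)) \<le> B2" for s using B2(2)[OF t] by simp
    qed auto
    then show ?thesis by simp
  qed
  show thesis
  proof (rule that[of "B1 + B2"])
    show "\<bar>H t x\<bar> \<le> B1 + B2" if "t \<in> {0..T}" for t x using B1(2)[OF that, of x] B2(1) by linarith
    show "\<bar>partial_deriv j (H t) x\<bar> \<le> B1 + B2" if "t \<in> {0..T}" for t x using B2(2)[OF that, of x] B1(1) by linarith
    show "\<bar>H t (x + h *\<^sub>R axis j 1) - H t x\<bar> \<le> (B1 + B2) * \<bar>h\<bar>" if "t \<in> {0..T}" for t x h
      using lip[OF that, of x h] mult_right_mono[of B2 "B1 + B2" "\<bar>h\<bar>"] B1(1) by linarith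
  qed (use B1(1) B2(1) in simp)
qed

lemma C01_linear:
  assumes H: "H \<in> C01 T j" and K: "K \<in> C01 T j"
  shows "(\<lambda>t x. c * H t x + d * K t x) \<in> C01 T j"
    and "t \<in> {0..T} \<Longrightarrow> partial_deriv j (\<lambda>x. c * H t x + d * K t x) x = c * partial_deriv j (H t) x + d * partial_deriv j (K t) x"
proof -
  have dH: "(\<lambda>h. H t (x + h *\<^sub>R axis j 1)) field_differentiable (at 0)" "(\<lambda>h. K t (x + h *\<^sub>R axis j 1)) field_differentiable (at 0)" if "t \<in> {0..T}" for t x
    using H K that by (auto simp: C01_def)
  have pd: "partial_deriv j (\<lambda>x. c * H t x + d * K t x) x = c * partial_deriv j (H t) x + d * partial_deriv j (K t) x" if t: "t \<in> {0..T}" for t x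
    unfolding partial_deriv_def
    by (rule DERIV_imp_deriv) (intro DERIV_add DERIV_cmult dH[OF t, THEN field_differentiable_derivI])
  then show "t \<in> {0..T} \<Longrightarrow> partial_deriv j (\<lambda>x. c * H t x + d * K t x) x = c * partial_deriv j (H t) x + d * partial_deriv j (K t) x" .
  have cH: "continuous_on ({0..T} \<times> UNIV) (\<lambda>z. H (fst z) (snd z))" "continuous_on ({0..T} \<times> UNIV) (\<lambda>z. K (fst z) (snd z))"
    "continuous_on ({0..T} \<times> UNIV) (\<lambda>z. partial_deriv j (H (fst z)) (snd z))" "continuous_on ({0..T} \<times> UNIV) (\<lambda>z. partial_deriv j (K (fst z)) (snd z))"
    using H K by (auto simp: C01_def split_beta')
  show "(\<lambda>t x. c * H t x + d * K t x) \<in> C01 T j"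
    unfolding C01_def
  proof (intro CollectI conjI ballI allI)
    show "periodic (\<lambda>x. c * H t x + d * K t x)" if "t \<in> {0..T}" for t
      using H K that by (auto simp: C01_def periodic_def)
    show "continuous_on ({0..T} \<times> UNIV) (\<lambda>(t, x). c * H t x + d * K t x)"
      unfolding split_beta' by (intro continuous_intros cH)
    show "(\<lambda>h. c * H t (x + h *\<^sub>R axis j 1) + d * K t (x + h *\<^sub>R axis j 1)) field_differentiable at 0" if "t \<in> {0..T}" for t x
      by (intro field_differentiable_add field_differentiable_mult field_differentiable_const dH[OF that])
    have "continuous_on ({0..T} \<times> UNIV) (\<lambda>z. c * partial_deriv j (H (fst z)) (snd z) + d * partial_deriv j (K (fst z)) (snd z))"
      by (intro continuous_intros cH)
    then show "continuous_on ({0..T} \<times> UNIV) (\<lambda>(t, x). partial_deriv j (\<lambda>x. c * H t x + d * K t x) x)"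
      by (rule continuous_on_cong[THEN iffD1, rotated 2]) (auto simp: pd)
  qed
qed

text \<open>The positive and the negative part of f are both periodic, and nn_integral_torus_translate
  applies to each.\<close>

lemma integral_torus_translate:
  fixes f :: "real^'n::finite \<Rightarrow> real"
  assumes f [measurable]: "f \<in> borel_measurable borel" and per: "\<And>x k. f (x + axis k 1) = f x" and B: "\<And>x. \<bar>f x\<bar> \<le> B"
  shows "(\<integral>x. f (x + v) \<partial>torus_lebesgue) = (\<integral>x. f x \<partial>torus_lebesgue)"
proof -
  interpret finite_measure "torus_lebesgue :: (real^'n) measure" by (rule finite_measure_torus_lebesgue)
  have i: "integrable torus_lebesgue (\<lambda>x. f (x + v))" for v
  proof (rule integrable_const_bound[where B = B])
    have "(\<lambda>x. x + v) \<in> borel_measurable (borel :: (real^'n) measure)" by measurable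
    then have "(\<lambda>x. f (x + v)) \<in> borel_measurable borel" by (rule measurable_compose) (rule f)
    from measurable_compose[OF torus_lebesgue_id this] show "(\<lambda>x. f (x + v)) \<in> borel_measurable torus_lebesgue" .
  qed (use B in auto)
  have i0: "integrable torus_lebesgue f" using i[of 0] by simp
  have "(\<integral>\<^sup>+x. ennreal (f (x + v)) \<partial>torus_lebesgue) = (\<integral>\<^sup>+x. ennreal (f x) \<partial>torus_lebesgue)"
    by (rule nn_integral_torus_translate) (use per in auto)
  moreover have "(\<integral>\<^sup>+x. ennreal (- f (x + v)) \<partial>torus_lebesgue) = (\<integral>\<^sup>+x. ennreal (- f x) \<partial>torus_lebesgue)"
    by (rule nn_integral_torus_translate) (use per in auto)
  ultimately show ?thesis by (simp add: real_lebesgue_integral_def[OF i] real_lebesgue_integral_def[OF i0])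
qed

text \<open>The increment factors as \<Phi>(u) - \<Phi>(v) = (1 + a(u+v)) (u - v).\<close>

lemma Phi_lipschitz:
  assumes "0 \<le> u" "u \<le> 1" "0 \<le> v" "v \<le> 1"
  shows "(\<Phi> a u - \<Phi> a v)\<^sup>2 \<le> (1 + 2 * \<bar>a\<bar>)\<^sup>2 * (u - v)\<^sup>2"
proof -
  have "\<Phi> a u - \<Phi> a v = (1 + a * (u + v)) * (u - v)" by (simp add: \<Phi>_def power2_eq_square algebra_simps)
  moreover have "\<bar>1 + a * (u + v)\<bar> \<le> 1 + 2 * \<bar>a\<bar>"
  proof -
    have "\<bar>a * (u + v)\<bar> \<le> \<bar>a\<bar> * 2" unfolding abs_mult using assms by (intro mult_left_mono) auto
    then show ?thesis by linarith
  qed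
  then have "(1 + a * (u + v))\<^sup>2 \<le> (1 + 2 * \<bar>a\<bar>)\<^sup>2" by (metis abs_ge_zero power2_abs power_mono)
  ultimately show ?thesis by (simp add: power_mult_distrib mult_right_mono)
qed

lemma Phi_bound:
  assumes "0 \<le> u" "u \<le> 1" shows "\<bar>\<Phi> a u\<bar> \<le> 1 + \<bar>a\<bar>"
proof -
  have "u\<^sup>2 \<le> 1" using assms by (simp add: power_le_one)
  then have "\<bar>a * u\<^sup>2\<bar> \<le> \<bar>a\<bar> * 1" unfolding abs_mult by (intro mult_left_mono) auto
  then show ?thesis using assms unfolding \<Phi>_def by linarith
qed

lemma integral_le_nn_integral:
  assumes "integrable M f" shows "ennreal (\<integral>x. f x \<partial>M) \<le> (\<integral>\<^sup>+x. ennreal (f x) \<partial>M)"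
proof -
  have "(\<integral>x. f x \<partial>M) \<le> (\<integral>x. max 0 (f x) \<partial>M)" using assms by (intro integral_mono) auto
  then have "ennreal (\<integral>x. f x \<partial>M) \<le> ennreal (\<integral>x. max 0 (f x) \<partial>M)" by (rule ennreal_leI)
  also have "\<dots> = (\<integral>\<^sup>+x. ennreal (max 0 (f x)) \<partial>M)" using assms by (intro nn_integral_eq_integral[symmetric]) auto
  also have "\<dots> = (\<integral>\<^sup>+x. ennreal (f x) \<partial>M)" by (intro nn_integral_cong) (simp add: max_def ennreal_neg)
  finally show ?thesis .
qed

context stieltjes
begin

abbreviation space_time_xW :: "real \<Rightarrow> (real \<times> (real^'n)) measure" where
  "space_time_xW T \<equiv> restrict_space lborel {0..T} \<Otimes>\<^sub>M xW_measure W j"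

lemma finite_measure_space_time_xW: "finite_measure (space_time_xW T)"
  by (rule finite_measure_pair_measure[OF finite_measure_xW finite_measure_time])

lemma sets_space_time_xW: "sets (space_time_xW T) = sets (space_time T)"
  by (rule sets_pair_measure_cong) auto

lemma space_time_shift:
  "(\<lambda>z. (fst z, snd z + v)) \<in> space_time T \<rightarrow>\<^sub>M restrict_space borel {0..T} \<Otimes>\<^sub>M (borel :: (real^'n) measure)"
proof -
  have "(\<lambda>z. fst z) \<in> space_time T \<rightarrow>\<^sub>M restrict_space borel {0..T}" by (rule measurable_compose[OF measurable_fst time_id])
  moreover have "(\<lambda>z. snd z + v) \<in> space_time T \<rightarrow>\<^sub>M (borel :: (real^'n) measure)"
    by (rule borel_measurable_add[OF torus_lebesgue_measurable[OF measurable_snd] borel_measurable_const])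
  ultimately show ?thesis by (rule measurable_Pair)
qed

definition weak_form :: "real \<Rightarrow> (real \<Rightarrow> real^'n \<Rightarrow> real) \<Rightarrow> (real \<Rightarrow> real^'n \<Rightarrow> real) \<Rightarrow> real" where
  "weak_form T \<phi> H = (\<integral>s. (\<integral>x. partial_deriv j (H s) x * \<phi> s x \<partial>torus_lebesgue) \<partial>restrict_space lborel {0..T})"

text \<open>Translation invariance of the Lebesgue measure on the torus moves the difference quotient from H
  to \<phi>. The quotients of H are bounded by its Lipschitz constant, so they may be replaced by their
  limit under the integral.\<close>

lemma difference_quotient_limit:
  fixes \<phi> :: "real \<Rightarrow> real^'n \<Rightarrow> real"
  assumes H: "H \<in> C01 T j" and \<phi>m: "(\<lambda>(s, x). \<phi> s x) \<in> borel_measurable (restrict_space borel {0..T} \<Otimes>\<^sub>M borel)"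
    and \<phi>b: "\<And>s x. \<bar>\<phi> s x\<bar> \<le> B0" and \<phi>per: "\<And>s x k. \<phi> s (x + axis k 1) = \<phi> s x"
  shows "(\<lambda>k. \<integral>z. H (fst z) (snd z) * (\<phi> (fst z) (snd z) - \<phi> (fst z) (snd z + (1 / real (Suc k)) *\<^sub>R axis j 1)) / (1 / real (Suc k)) \<partial>space_time T)
     \<longlonglongrightarrow> weak_form T \<phi> H"
proof -
  interpret ST: finite_measure "space_time T :: (real \<times> (real^'n)) measure" by (rule finite_measure_space_time)
  interpret TL: finite_measure "torus_lebesgue :: (real^'n) measure" by (rule finite_measure_torus_lebesgue)
  interpret TI: finite_measure "restrict_space lborel {0..T}" by (rule finite_measure_time)
  interpret P: pair_sigma_finite "restrict_space lborel {0..T}" "torus_lebesgue :: (real^'n) measure" ..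
  obtain B where B: "B \<ge> 0" "\<And>t x. t \<in> {0..T} \<Longrightarrow> \<bar>H t x\<bar> \<le> B" "\<And>t x. t \<in> {0..T} \<Longrightarrow> \<bar>partial_deriv j (H t) x\<bar> \<le> B"
    "\<And>t x h. t \<in> {0..T} \<Longrightarrow> \<bar>H t (x + h *\<^sub>R axis j 1) - H t x\<bar> \<le> B * \<bar>h\<bar>"
    using C01_bounds[OF H] by blast
  have B00: "B0 \<ge> 0" using \<phi>b[of 0 0] by linarith
  have Hm: "(\<lambda>(s, x). H s x) \<in> borel_measurable (restrict_space borel {0..T} \<Otimes>\<^sub>M borel)"
    and pm: "(\<lambda>(s, x). partial_deriv j (H s) x) \<in> borel_measurable (restrict_space borel {0..T} \<Otimes>\<^sub>M borel)"
    using H by (auto simp: C01_def intro!: time_space_measurable)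
  have m: "(\<lambda>z. f (fst z) (snd z + v)) \<in> borel_measurable (space_time T)"
    if "(\<lambda>(s, x). f s x) \<in> borel_measurable (restrict_space borel {0..T} \<Otimes>\<^sub>M borel)" for f :: "real \<Rightarrow> real^'n \<Rightarrow> real" and v
    using measurable_compose[OF space_time_shift[of v T] that] by simp
  have m0: "(\<lambda>z. f (fst z) (snd z)) \<in> borel_measurable (space_time T)"
    if "(\<lambda>(s, x). f s x) \<in> borel_measurable (restrict_space borel {0..T} \<Otimes>\<^sub>M borel)" for f :: "real \<Rightarrow> real^'n \<Rightarrow> real"
    using m[OF that, of 0] by simp
  have fs: "fst z \<in> {0..T}" if "z \<in> space (space_time T)" for z :: "real \<times> (real^'n)"
    using that by (auto simp: space_pair_measure space_restrict_space)
  have abs_quotient: "0 < e \<Longrightarrow> \<bar>y\<bar> \<le> B * e \<Longrightarrow> \<bar>y / e\<bar> \<le> B" for e y :: real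
    by (simp add: abs_divide pos_divide_le_eq)
  let ?e = "\<lambda>k. 1 / real (Suc k)"
  let ?Q = "\<lambda>k z. (H (fst z) (snd z) - H (fst z) (snd z + (- ?e k) *\<^sub>R axis j 1)) / ?e k * \<phi> (fst z) (snd z)"
  have lim: "(\<lambda>k. \<integral>z. ?Q k z \<partial>space_time T) \<longlonglongrightarrow> (\<integral>z. partial_deriv j (H (fst z)) (snd z) * \<phi> (fst z) (snd z) \<partial>space_time T)"
  proof (rule integral_dominated_convergence[where w = "\<lambda>_. B * B0"])
    show "(\<lambda>z. partial_deriv j (H (fst z)) (snd z) * \<phi> (fst z) (snd z)) \<in> borel_measurable (space_time T)"
      by (intro borel_measurable_times m0 pm \<phi>m)
    show "?Q k \<in> borel_measurable (space_time T)" for k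
      by (intro borel_measurable_times borel_measurable_divide borel_measurable_diff m m0 Hm \<phi>m borel_measurable_const)
    show "AE z in space_time T. (\<lambda>k. ?Q k z) \<longlonglongrightarrow> partial_deriv j (H (fst z)) (snd z) * \<phi> (fst z) (snd z)"
    proof (rule AE_I2)
      fix z :: "real \<times> (real^'n)" assume "z \<in> space (space_time T)"
      note t = fs[OF this]
      let ?g = "\<lambda>h. H (fst z) (snd z + h *\<^sub>R axis j 1)"
      have "?g field_differentiable (at 0)" using H t by (auto simp: C01_def)
      then have "(?g has_real_derivative partial_deriv j (H (fst z)) (snd z)) (at 0)"
        unfolding partial_deriv_def by (rule field_differentiable_derivI)
      then have "((\<lambda>h. (?g h - ?g 0) / h) \<longlongrightarrow> partial_deriv j (H (fst z)) (snd z)) (at 0)"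
        by (simp add: has_field_derivative_iff)
      moreover have "filterlim (\<lambda>k. - ?e k) (at 0) sequentially"
        unfolding filterlim_at
      proof
        have "(\<lambda>k. - ?e k) \<longlonglongrightarrow> - 0" using LIMSEQ_inverse_real_of_nat by (intro tendsto_minus) (simp add: inverse_eq_divide)
        then show "(\<lambda>k. - ?e k) \<longlonglongrightarrow> 0" by simp
      qed auto
      ultimately have "(\<lambda>k. (?g (- ?e k) - ?g 0) / (- ?e k)) \<longlonglongrightarrow> partial_deriv j (H (fst z)) (snd z)"
        by (rule filterlim_compose)
      moreover have "(?g (- ?e k) - ?g 0) / (- ?e k) = (H (fst z) (snd z) - H (fst z) (snd z + (- ?e k) *\<^sub>R axis j 1)) / ?e k" for k
        using minus_divide_divide[of "?g 0 - ?g (- ?e k)" "?e k"] by (simp del: of_nat_Suc)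
      ultimately have "(\<lambda>k. (H (fst z) (snd z) - H (fst z) (snd z + (- ?e k) *\<^sub>R axis j 1)) / ?e k) \<longlonglongrightarrow> partial_deriv j (H (fst z)) (snd z)"
        by simp
      then show "(\<lambda>k. ?Q k z) \<longlonglongrightarrow> partial_deriv j (H (fst z)) (snd z) * \<phi> (fst z) (snd z)"
        by (intro tendsto_mult tendsto_const)
    qed
    show "AE z in space_time T. norm (?Q k z) \<le> B * B0" for k
    proof (rule AE_I2)
      fix z :: "real \<times> (real^'n)" assume "z \<in> space (space_time T)"
      note t = fs[OF this]
      have "\<bar>H (fst z) (snd z) - H (fst z) (snd z + (- ?e k) *\<^sub>R axis j 1)\<bar> \<le> B * ?e k"
        using B(4)[OF t, of "snd z" "- ?e k"] by (simp add: abs_minus_commute)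
      then have "\<bar>(H (fst z) (snd z) - H (fst z) (snd z + (- ?e k) *\<^sub>R axis j 1)) / ?e k\<bar> \<le> B"
        by (rule abs_quotient[rotated]) simp
      then show "norm (?Q k z) \<le> B * B0" unfolding real_norm_def abs_mult using B(1) by (intro mult_mono \<phi>b) auto
    qed
  qed simp
  have ST: "(\<integral>z. f (fst z) (snd z) \<partial>space_time T) = (\<integral>s. (\<integral>x. f s x \<partial>torus_lebesgue) \<partial>restrict_space lborel {0..T})"
    if fm: "(\<lambda>z. f (fst z) (snd z)) \<in> borel_measurable (space_time T)" and fb: "\<And>s x. s \<in> {0..T} \<Longrightarrow> \<bar>f s x\<bar> \<le> C"
    for f :: "real \<Rightarrow> real^'n \<Rightarrow> real" and C
  proof -
    have "integrable (space_time T) (\<lambda>z. f (fst z) (snd z))"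
    proof (rule ST.integrable_const_bound[OF AE_I2 fm, where B = C])
      show "norm (f (fst z) (snd z)) \<le> C" if "z \<in> space (space_time T)" for z :: "real \<times> (real^'n)"
        unfolding real_norm_def by (rule fb[OF fs[OF that]])
    qed
    from P.integral_fst'[OF this] show ?thesis by simp
  qed
  have r: "(\<integral>z. partial_deriv j (H (fst z)) (snd z) * \<phi> (fst z) (snd z) \<partial>space_time T) = weak_form T \<phi> H"
    unfolding weak_form_def
  proof (rule ST[where f = "\<lambda>s x. partial_deriv j (H s) x * \<phi> s x" and C = "B * B0"])
    show "(\<lambda>z. partial_deriv j (H (fst z)) (snd z) * \<phi> (fst z) (snd z)) \<in> borel_measurable (space_time T)"
      by (rule borel_measurable_times[OF m0[OF pm] m0[OF \<phi>m]])
    show "\<bar>partial_deriv j (H s) x * \<phi> s x\<bar> \<le> B * B0" if "s \<in> {0..T}" for s x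
      unfolding abs_mult by (rule mult_mono[OF B(3)[OF that] \<phi>b B(1)]) simp
  qed
  have l: "(\<integral>z. ?Q k z \<partial>space_time T) = (\<integral>z. H (fst z) (snd z) * (\<phi> (fst z) (snd z) - \<phi> (fst z) (snd z + ?e k *\<^sub>R axis j 1)) / ?e k \<partial>space_time T)" for k
  proof -
    let ?v = "?e k *\<^sub>R axis j 1 :: real^'n"
    have HH: "\<bar>f s x * g s y\<bar> \<le> B * B0" if "\<And>x. \<bar>f s x\<bar> \<le> B" "\<And>x. \<bar>g s x\<bar> \<le> B0" for f g :: "real \<Rightarrow> real^'n \<Rightarrow> real" and s x y
      unfolding abs_mult using that B(1) by (intro mult_mono) auto
    have b1: "\<bar>H s x * \<phi> s y\<bar> \<le> B * B0" if "s \<in> {0..T}" for s x y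
      by (rule HH[of H s \<phi>]) (use B(2)[OF that] \<phi>b in auto)
    have bint: "integrable (space_time T) (\<lambda>z. H (fst z) (p z) * \<phi> (fst z) (q z))"
      if "(\<lambda>z. H (fst z) (p z)) \<in> borel_measurable (space_time T)" "(\<lambda>z. \<phi> (fst z) (q z)) \<in> borel_measurable (space_time T)"
      for p q :: "real \<times> (real^'n) \<Rightarrow> real^'n"
    proof (rule ST.integrable_const_bound[OF AE_I2 borel_measurable_times[OF that], where B = "B * B0"])
      show "norm (H (fst z) (p z) * \<phi> (fst z) (q z)) \<le> B * B0" if "z \<in> space (space_time T)" for z :: "real \<times> (real^'n)"
        unfolding real_norm_def by (rule b1[OF fs[OF that]])
    qed
    have i1: "integrable (space_time T) (\<lambda>z. H (fst z) (snd z) * \<phi> (fst z) (snd z))"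
      by (rule bint[OF m0[OF Hm] m0[OF \<phi>m]])
    have i2: "integrable (space_time T) (\<lambda>z. H (fst z) (snd z) * \<phi> (fst z) (snd z + ?v))"
      by (rule bint[OF m0[OF Hm] m[OF \<phi>m]])
    have tr: "(\<integral>z. H (fst z) (snd z + - ?v) * \<phi> (fst z) (snd z) \<partial>space_time T) = (\<integral>z. H (fst z) (snd z) * \<phi> (fst z) (snd z + ?v) \<partial>space_time T)"
    proof -
      have "(\<integral>z. H (fst z) (snd z + - ?v) * \<phi> (fst z) (snd z) \<partial>space_time T) = (\<integral>s. (\<integral>x. H s (x + - ?v) * \<phi> s x \<partial>torus_lebesgue) \<partial>restrict_space lborel {0..T})"
        by (rule ST[where f = "\<lambda>s x. H s (x + - ?v) * \<phi> s x" and C = "B * B0"]) (fact borel_measurable_times[OF m[OF Hm] m0[OF \<phi>m]], fact b1)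
      also have "\<dots> = (\<integral>s. (\<integral>x. H s x * \<phi> s (x + ?v) \<partial>torus_lebesgue) \<partial>restrict_space lborel {0..T})"
      proof (rule Bochner_Integration.integral_cong[OF refl])
        fix s assume "s \<in> space (restrict_space lborel {0..T})"
        then have s: "s \<in> {0..T}" by (simp add: space_restrict_space)
        have sec: "(\<lambda>x. f s x) \<in> borel_measurable borel" if "(\<lambda>(s, x). f s x) \<in> borel_measurable (restrict_space borel {0..T} \<Otimes>\<^sub>M borel)" for f :: "real \<Rightarrow> real^'n \<Rightarrow> real"
          using measurable_compose[OF measurable_Pair1' that, of s] s by (simp add: space_restrict_space)
        have perH: "H s (x + axis k 1) = H s x" for x k using H s by (auto simp: C01_def periodic_def)
        let ?f = "\<lambda>x. H s x * \<phi> s (x + ?v)"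
        have "(\<lambda>x. x + ?v) \<in> borel_measurable borel" by measurable
        from measurable_compose[OF this sec[OF \<phi>m]] have fm: "?f \<in> borel_measurable borel"
          by (rule borel_measurable_times[OF sec[OF Hm]])
        have fper: "?f (x + axis k 1) = ?f x" for x k
          using perH[of x k] \<phi>per[of s "x + ?v" k] by (simp add: algebra_simps)
        have "(\<integral>x. ?f (x + - ?v) \<partial>torus_lebesgue) = (\<integral>x. ?f x \<partial>torus_lebesgue)"
          by (rule integral_torus_translate[OF fm fper b1[OF s]])
        then show "(\<integral>x. H s (x + - ?v) * \<phi> s x \<partial>torus_lebesgue) = (\<integral>x. ?f x \<partial>torus_lebesgue)" by simp
      qed
      also have "\<dots> = (\<integral>z. H (fst z) (snd z) * \<phi> (fst z) (snd z + ?v) \<partial>space_time T)"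
        by (rule ST[where f = "\<lambda>s x. H s x * \<phi> s (x + ?v)" and C = "B * B0", symmetric]) (fact borel_measurable_times[OF m0[OF Hm] m[OF \<phi>m]], fact b1)
      finally show ?thesis .
    qed
    have "(\<integral>z. ?Q k z \<partial>space_time T) = (\<integral>z. (H (fst z) (snd z) * \<phi> (fst z) (snd z) - H (fst z) (snd z + - ?v) * \<phi> (fst z) (snd z)) / ?e k \<partial>space_time T)"
      by (intro Bochner_Integration.integral_cong refl) (simp only: left_diff_distrib times_divide_eq_left scaleR_minus_left)
    also have "\<dots> = ((\<integral>z. H (fst z) (snd z) * \<phi> (fst z) (snd z) \<partial>space_time T) - (\<integral>z. H (fst z) (snd z + - ?v) * \<phi> (fst z) (snd z) \<partial>space_time T)) / ?e k"
      unfolding Bochner_Integration.integral_divide_zero Bochner_Integration.integral_diff[OF i1 bint[OF m[OF Hm] m0[OF \<phi>m]]] ..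
    also have "\<dots> = (\<integral>z. (H (fst z) (snd z) * \<phi> (fst z) (snd z) - H (fst z) (snd z) * \<phi> (fst z) (snd z + ?v)) / ?e k \<partial>space_time T)"
      unfolding tr Bochner_Integration.integral_divide_zero Bochner_Integration.integral_diff[OF i1 i2] ..
    finally show ?thesis by (simp only: right_diff_distrib)
  qed
  show ?thesis using lim unfolding r l .
qed

text \<open>For each \<epsilon> the difference quotient is estimated by Young's inequality 2hd/\<epsilon>
  \<le> 2d^2/(\<epsilon>w) + h^2w/(2\<epsilon>), where w is the increment of W_j over a length 2\<epsilon>.
  The first term is controlled by the energy, as \<Phi> is Lipschitz; in the second, the factor 1/2 cancels
  the length 2 of the increment, and the Lipschitz continuity of H makes the error of
  weighted_torus_integral_bound of order \<epsilon>. Infinitely many \<epsilon> with bounded energy suffice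
  to conclude.\<close>

lemma weak_form_bound:
  fixes \<rho> :: "real \<Rightarrow> real^'n \<Rightarrow> real"
  assumes T: "T > 0" and H: "H \<in> C01 T j" and \<rho>m: "(\<lambda>(s, x). \<rho> s x) \<in> borel_measurable (restrict_space borel {0..T} \<Otimes>\<^sub>M borel)"
    and \<rho>01: "\<And>s x. 0 \<le> \<rho> s x \<and> \<rho> s x \<le> 1" and \<rho>per: "\<And>s x k. \<rho> s (x + axis k 1) = \<rho> s x"
    and fin: "\<exists>\<^sub>F k in sequentially. (\<integral>\<^sup>+z. ennreal ((\<rho> (fst z) (snd z + (1 / real (Suc k)) *\<^sub>R axis j 1) - \<rho> (fst z) (snd z))\<^sup>2
       / ((1 / real (Suc k)) * (W j (snd z $ j + 2 * (1 / real (Suc k))) - W j (snd z $ j)))) \<partial>space_time T) \<le> ennreal C"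
    and C: "C \<ge> 0"
  shows "2 * weak_form T (\<lambda>s x. \<Phi> a (\<rho> s x)) H \<le> 2 * (1 + 2 * \<bar>a\<bar>)\<^sup>2 * C + (\<integral>z. (H (fst z) (snd z))\<^sup>2 \<partial>space_time_xW T)"
proof (rule ccontr)
  interpret ST: finite_measure "space_time T :: (real \<times> (real^'n)) measure" by (rule finite_measure_space_time)
  interpret SX: finite_measure "space_time_xW T" by (rule finite_measure_space_time_xW)
  interpret X: finite_measure "xW_measure W j" by (rule finite_measure_xW)
  interpret TL: finite_measure "torus_lebesgue :: (real^'n) measure" by (rule finite_measure_torus_lebesgue)
  let ?\<phi> = "\<lambda>s x. \<Phi> a (\<rho> s x)"
  let ?e = "\<lambda>k. 1 / real (Suc k)"
  define K where "K = (1 + 2 * \<bar>a\<bar>)\<^sup>2"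
  have K0: "K \<ge> 0" by (simp add: K_def)
  obtain B where B: "B \<ge> 0" "\<And>t x. t \<in> {0..T} \<Longrightarrow> \<bar>H t x\<bar> \<le> B" "\<And>t x. t \<in> {0..T} \<Longrightarrow> \<bar>partial_deriv j (H t) x\<bar> \<le> B"
    "\<And>t x h. t \<in> {0..T} \<Longrightarrow> \<bar>H t (x + h *\<^sub>R axis j 1) - H t x\<bar> \<le> B * \<bar>h\<bar>"
    using C01_bounds[OF H] by blast
  have Hm: "(\<lambda>(s, x). H s x) \<in> borel_measurable (restrict_space borel {0..T} \<Otimes>\<^sub>M borel)"
    using H by (auto simp: C01_def intro!: time_space_measurable)
  have \<phi>m: "(\<lambda>(s, x). ?\<phi> s x) \<in> borel_measurable (restrict_space borel {0..T} \<Otimes>\<^sub>M borel)"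
  proof -
    have "\<Phi> a \<in> borel_measurable borel" unfolding \<Phi>_def[abs_def] by measurable
    from measurable_compose[OF \<rho>m this] show ?thesis by (simp add: split_beta')
  qed
  have \<phi>b: "\<bar>?\<phi> s x\<bar> \<le> 1 + \<bar>a\<bar>" for s x
    by (rule Phi_bound) (simp_all add: \<rho>01)
  have m: "(\<lambda>z. f (fst z) (snd z + v)) \<in> borel_measurable (space_time T)"
    if "(\<lambda>(s, x). f s x) \<in> borel_measurable (restrict_space borel {0..T} \<Otimes>\<^sub>M borel)" for f :: "real \<Rightarrow> real^'n \<Rightarrow> real" and v
    using measurable_compose[OF space_time_shift[of v T] that] by simp
  have m0: "(\<lambda>z. f (fst z) (snd z)) \<in> borel_measurable (space_time T)"
    if "(\<lambda>(s, x). f s x) \<in> borel_measurable (restrict_space borel {0..T} \<Otimes>\<^sub>M borel)" for f :: "real \<Rightarrow> real^'n \<Rightarrow> real"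
    using m[OF that, of 0] by simp
  have fs: "fst z \<in> {0..T}" if "z \<in> space (space_time T)" for z :: "real \<times> (real^'n)"
    using that by (auto simp: space_pair_measure space_restrict_space)
  let ?L = "weak_form T ?\<phi> H"
  define h2 where "h2 = (\<integral>z. (H (fst z) (snd z))\<^sup>2 \<partial>space_time_xW T)"
  define D where "D k = (\<integral>z. H (fst z) (snd z) * (?\<phi> (fst z) (snd z) - ?\<phi> (fst z) (snd z + ?e k *\<^sub>R axis j 1)) / ?e k \<partial>space_time T)" for k
  have lim: "D \<longlonglongrightarrow> ?L"
    unfolding D_def by (rule difference_quotient_limit[OF H \<phi>m \<phi>b]) (simp add: \<rho>per)
  \<comment> \<open>Over the distance 2e the function H^2 oscillates by at most 4 B^2 e, and Y e is the
    integral of this bound.\<close>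
  define Y where "Y = 4 * B\<^sup>2 * (T * measure (xW_measure W j) torus)"
  have Hx: "(\<lambda>z. (H (fst z) (snd z))\<^sup>2) \<in> borel_measurable (space_time_xW T)"
    using borel_measurable_power[OF m0[OF Hm], of 2] sets_space_time_xW by (simp cong: measurable_cong_sets)
  have hi: "integrable (space_time_xW T) (\<lambda>z. (H (fst z) (snd z))\<^sup>2)"
  proof (rule SX.integrable_const_bound[OF _ Hx, where B = "B\<^sup>2"])
    show "AE z in space_time_xW T. norm ((H (fst z) (snd z))\<^sup>2) \<le> B\<^sup>2"
    proof (rule AE_I2)
      fix z :: "real \<times> (real^'n)" assume "z \<in> space (space_time_xW T)"
      then have "fst z \<in> {0..T}" by (auto simp: space_pair_measure space_restrict_space)
      from power_mono[OF B(2)[OF this, of "snd z"], of 2] show "norm ((H (fst z) (snd z))\<^sup>2) \<le> B\<^sup>2" by simp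
    qed
  qed
  have N: "(\<integral>\<^sup>+z. ennreal ((H (fst z) (snd z))\<^sup>2 * (W j (snd z $ j + 2 * e) - W j (snd z $ j)) / e) \<partial>space_time T) \<le> ennreal (2 * (h2 + Y * e))"
    if e: "0 < e" "e \<le> 1/2" for e
  proof -
    have Wi: "W j (y + 2 * e) - W j y \<ge> 0" for y using mono e by (auto simp: mono_def)
    have Wm [measurable]: "W j \<in> borel_measurable borel" by (rule borel_measurable_mono[OF mono])
    have inner: "(\<integral>\<^sup>+x. ennreal ((H s x)\<^sup>2 * (W j (x $ j + 2 * e) - W j (x $ j)) / e) \<partial>torus_lebesgue)
       \<le> 2 * (\<integral>\<^sup>+x. ennreal ((H s x)\<^sup>2) \<partial>xW_measure W j) + ennreal (8 * B\<^sup>2 * e * measure (xW_measure W j) torus)" if s: "s \<in> {0..T}" for s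
    proof -
      have sec: "H s \<in> borel_measurable borel"
        using measurable_compose[OF measurable_Pair1' Hm, of s] s by (simp add: space_restrict_space)
      have wb: "(\<integral>\<^sup>+x. ennreal ((H s x)\<^sup>2) * ennreal (W j (x $ j + 2 * e) - W j (x $ j)) \<partial>torus_lebesgue)
         \<le> ennreal (2 * e) * ((\<integral>\<^sup>+x. ennreal ((H s x)\<^sup>2) \<partial>xW_measure W j) + ennreal (4 * B\<^sup>2 * e) * emeasure (xW_measure W j) torus)"
      proof (rule weighted_torus_integral_bound)
        show "(\<lambda>x. ennreal ((H s x)\<^sup>2)) \<in> borel_measurable borel" using sec by measurable
        show "ennreal ((H s (x + axis k 1))\<^sup>2) = ennreal ((H s x)\<^sup>2)" for x k using H s by (auto simp: C01_def periodic_def)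
        fix x :: "real^'n" and t :: real assume t: "\<bar>t\<bar> \<le> 2 * e"
        have "(H s (x + t *\<^sub>R axis j 1))\<^sup>2 - (H s x)\<^sup>2 = (H s (x + t *\<^sub>R axis j 1) - H s x) * (H s (x + t *\<^sub>R axis j 1) + H s x)"
          by (simp add: power2_eq_square algebra_simps)
        also have "\<dots> \<le> \<bar>H s (x + t *\<^sub>R axis j 1) - H s x\<bar> * \<bar>H s (x + t *\<^sub>R axis j 1) + H s x\<bar>" by (metis abs_ge_self abs_mult)
        also have "\<dots> \<le> (B * (2 * e)) * (2 * B)"
        proof (intro mult_mono)
          show "\<bar>H s (x + t *\<^sub>R axis j 1) - H s x\<bar> \<le> B * (2 * e)"
            using B(4)[OF s, of x t] mult_left_mono[OF t B(1)] by linarith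
          show "\<bar>H s (x + t *\<^sub>R axis j 1) + H s x\<bar> \<le> 2 * B"
            using B(2)[OF s, of x] B(2)[OF s, of "x + t *\<^sub>R axis j 1"] by linarith
        qed (use B(1) e in auto)
        finally have "(H s (x + t *\<^sub>R axis j 1))\<^sup>2 \<le> (H s x)\<^sup>2 + 4 * B\<^sup>2 * e" by (simp add: power2_eq_square algebra_simps)
        then have "ennreal ((H s (x + t *\<^sub>R axis j 1))\<^sup>2) \<le> ennreal ((H s x)\<^sup>2 + 4 * B\<^sup>2 * e)" by (rule ennreal_leI)
        also have "\<dots> = ennreal ((H s x)\<^sup>2) + ennreal (4 * B\<^sup>2 * e)" using e by (intro ennreal_plus) auto
        finally show "ennreal ((H s (x + t *\<^sub>R axis j 1))\<^sup>2) \<le> ennreal ((H s x)\<^sup>2) + ennreal (4 * B\<^sup>2 * e)" .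
      qed (use e in auto)
      have "(\<integral>\<^sup>+x. ennreal ((H s x)\<^sup>2 * (W j (x $ j + 2 * e) - W j (x $ j)) / e) \<partial>torus_lebesgue)
         = (\<integral>\<^sup>+x. ennreal (1 / e) * (ennreal ((H s x)\<^sup>2) * ennreal (W j (x $ j + 2 * e) - W j (x $ j))) \<partial>torus_lebesgue)"
        using Wi e by (intro nn_integral_cong) (simp add: ennreal_mult[symmetric])
      also have "\<dots> = ennreal (1 / e) * (\<integral>\<^sup>+x. (ennreal ((H s x)\<^sup>2) * ennreal (W j (x $ j + 2 * e) - W j (x $ j))) \<partial>torus_lebesgue)"
      proof (rule nn_integral_cmult)
        have "(\<lambda>x. ennreal ((H s x)\<^sup>2) * ennreal (W j (x $ j + 2 * e) - W j (x $ j))) \<in> borel_measurable borel" using sec by measurable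
        from measurable_compose[OF torus_lebesgue_id this] show "(\<lambda>x. ennreal ((H s x)\<^sup>2) * ennreal (W j (x $ j + 2 * e) - W j (x $ j))) \<in> borel_measurable torus_lebesgue" .
      qed
      also have "\<dots> \<le> ennreal (1 / e) * (ennreal (2 * e) * ((\<integral>\<^sup>+x. ennreal ((H s x)\<^sup>2) \<partial>xW_measure W j) + ennreal (4 * B\<^sup>2 * e) * emeasure (xW_measure W j) torus))"
        by (intro mult_left_mono wb) simp
      also have "\<dots> = 2 * ((\<integral>\<^sup>+x. ennreal ((H s x)\<^sup>2) \<partial>xW_measure W j) + ennreal (4 * B\<^sup>2 * e * measure (xW_measure W j) torus))"
      proof -
        have "ennreal (1 / e) * ennreal (2 * e) = 2" using e by (simp add: ennreal_mult[symmetric])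
        moreover have "ennreal (4 * B\<^sup>2 * e) * emeasure (xW_measure W j) torus = ennreal (4 * B\<^sup>2 * e * measure (xW_measure W j) torus)"
          using e by (simp add: X.emeasure_eq_measure ennreal_mult[symmetric])
        ultimately show ?thesis by (simp add: mult.assoc[symmetric])
      qed
      also have "\<dots> = 2 * (\<integral>\<^sup>+x. ennreal ((H s x)\<^sup>2) \<partial>xW_measure W j) + 2 * ennreal (4 * B\<^sup>2 * e * measure (xW_measure W j) torus)"
        by (simp add: distrib_left)
      also have "2 * ennreal (4 * B\<^sup>2 * e * measure (xW_measure W j) torus) = ennreal (8 * B\<^sup>2 * e * measure (xW_measure W j) torus)"
        using e by (simp add: ennreal_mult'[symmetric] flip: ennreal_numeral)
      finally show ?thesis .
    qed
    have Hx2: "(\<lambda>z. ennreal ((H (fst z) (snd z))\<^sup>2)) \<in> borel_measurable (space_time_xW T)" using Hx by measurable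
    have wm: "(\<lambda>z. W j (snd z $ j + 2 * e) - W j (snd z $ j)) \<in> borel_measurable (space_time T)"
    proof -
      have "(\<lambda>x. W j (x $ j + 2 * e) - W j (x $ j)) \<in> borel_measurable (borel :: (real^'n) measure)" by measurable
      from measurable_compose[OF torus_lebesgue_measurable[OF measurable_snd] this] show ?thesis .
    qed
    have im: "(\<lambda>z. ennreal ((H (fst z) (snd z))\<^sup>2 * (W j (snd z $ j + 2 * e) - W j (snd z $ j)) / e)) \<in> borel_measurable (space_time T)"
      by (intro measurable_compose[OF _ measurable_ennreal] borel_measurable_divide borel_measurable_times borel_measurable_power m0 Hm wm borel_measurable_const)
    have xm: "(\<lambda>s. \<integral>\<^sup>+x. ennreal ((H s x)\<^sup>2) \<partial>xW_measure W j) \<in> borel_measurable (restrict_space lborel {0..T})"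
      using X.borel_measurable_nn_integral_fst[OF Hx2] by simp
    have "(\<integral>\<^sup>+z. ennreal ((H (fst z) (snd z))\<^sup>2 * (W j (snd z $ j + 2 * e) - W j (snd z $ j)) / e) \<partial>space_time T)
       = (\<integral>\<^sup>+s. (\<integral>\<^sup>+x. ennreal ((H s x)\<^sup>2 * (W j (x $ j + 2 * e) - W j (x $ j)) / e) \<partial>torus_lebesgue) \<partial>restrict_space lborel {0..T})"
      using TL.nn_integral_fst[OF im] by simp
    also have "\<dots> \<le> (\<integral>\<^sup>+s. 2 * (\<integral>\<^sup>+x. ennreal ((H s x)\<^sup>2) \<partial>xW_measure W j) + ennreal (8 * B\<^sup>2 * e * measure (xW_measure W j) torus) \<partial>restrict_space lborel {0..T})"
      by (intro nn_integral_mono inner) (simp add: space_restrict_space)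
    also have "\<dots> = 2 * (\<integral>\<^sup>+s. (\<integral>\<^sup>+x. ennreal ((H s x)\<^sup>2) \<partial>xW_measure W j) \<partial>restrict_space lborel {0..T}) + ennreal (8 * B\<^sup>2 * e * measure (xW_measure W j) torus) * ennreal T"
    proof (subst nn_integral_add)
      have "emeasure (restrict_space lborel {0..T}) (space (restrict_space lborel {0..T})) = ennreal T"
        using T by (simp add: space_restrict_space emeasure_restrict_space)
      then show "(\<integral>\<^sup>+s. 2 * (\<integral>\<^sup>+x. ennreal ((H s x)\<^sup>2) \<partial>xW_measure W j) \<partial>restrict_space lborel {0..T}) + (\<integral>\<^sup>+s. ennreal (8 * B\<^sup>2 * e * measure (xW_measure W j) torus) \<partial>restrict_space lborel {0..T})
        = 2 * (\<integral>\<^sup>+s. (\<integral>\<^sup>+x. ennreal ((H s x)\<^sup>2) \<partial>xW_measure W j) \<partial>restrict_space lborel {0..T}) + ennreal (8 * B\<^sup>2 * e * measure (xW_measure W j) torus) * ennreal T"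
        by (simp add: nn_integral_cmult[OF xm])
    qed (use xm in auto)
    also have "(\<integral>\<^sup>+s. (\<integral>\<^sup>+x. ennreal ((H s x)\<^sup>2) \<partial>xW_measure W j) \<partial>restrict_space lborel {0..T}) = ennreal h2"
      using X.nn_integral_fst[OF Hx2] nn_integral_eq_integral[OF hi] by (simp add: h2_def)
    also have "2 * ennreal h2 + ennreal (8 * B\<^sup>2 * e * measure (xW_measure W j) torus) * ennreal T = ennreal (2 * (h2 + Y * e))"
    proof -
      have h0: "h2 \<ge> 0" by (simp add: h2_def)
      have "2 * ennreal h2 = ennreal (2 * h2)" using h0 by (simp add: ennreal_mult' flip: ennreal_numeral)
      moreover have "ennreal (8 * B\<^sup>2 * e * measure (xW_measure W j) torus) * ennreal T = ennreal (2 * (Y * e))"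
        using T e by (subst ennreal_mult[symmetric]) (auto simp: Y_def mult_ac)
      moreover have "Y \<ge> 0" using T by (simp add: Y_def)
      ultimately show ?thesis using h0 e by (simp add: ennreal_plus[symmetric] distrib_left del: ennreal_plus)
    qed
    finally show ?thesis .
  qed
  have bound: "2 * D k \<le> 2 * K * C + h2 + Y * ?e k"
    if k: "k \<ge> 1" and E: "(\<integral>\<^sup>+z. ennreal ((\<rho> (fst z) (snd z + ?e k *\<^sub>R axis j 1) - \<rho> (fst z) (snd z))\<^sup>2
       / (?e k * (W j (snd z $ j + 2 * ?e k) - W j (snd z $ j)))) \<partial>space_time T) \<le> ennreal C" for k
  proof -
    define e where "e = ?e k"
    have e: "0 < e" "e \<le> 1/2" using k by (auto simp: e_def intro!: divide_left_mono)
    let ?S = "\<lambda>z. W j (snd z $ j + 2 * e) - W j (snd z $ j)"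
    let ?r = "\<lambda>z. \<rho> (fst z) (snd z + e *\<^sub>R axis j 1) - \<rho> (fst z) (snd z)"
    let ?P = "\<lambda>z. H (fst z) (snd z) * (?\<phi> (fst z) (snd z) - ?\<phi> (fst z) (snd z + e *\<^sub>R axis j 1)) / e"
    have S0: "?S z > 0" for z using strict_monoD[OF W_mono, of "snd z $ j" "snd z $ j + 2 * e"] e by simp
    have Wm [measurable]: "W j \<in> borel_measurable borel" by (rule borel_measurable_mono[OF mono])
    have wm: "?S \<in> borel_measurable (space_time T)"
    proof -
      have "(\<lambda>x. W j (x $ j + 2 * e) - W j (x $ j)) \<in> borel_measurable (borel :: (real^'n) measure)" by measurable
      from measurable_compose[OF torus_lebesgue_measurable[OF measurable_snd] this] show ?thesis .
    qed
    have Pm: "?P \<in> borel_measurable (space_time T)"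
      by (intro borel_measurable_divide borel_measurable_times borel_measurable_diff m0[OF Hm] m0[OF \<phi>m] m[OF \<phi>m] borel_measurable_const)
    have Pi: "integrable (space_time T) ?P"
    proof (rule ST.integrable_const_bound[OF _ Pm, where B = "B * (2 * (1 + \<bar>a\<bar>)) / e"])
      show "AE z in space_time T. norm (?P z) \<le> B * (2 * (1 + \<bar>a\<bar>)) / e"
      proof (rule AE_I2)
        fix z :: "real \<times> (real^'n)" assume "z \<in> space (space_time T)"
        note t = fs[OF this]
        have "\<bar>?\<phi> (fst z) (snd z) - ?\<phi> (fst z) (snd z + e *\<^sub>R axis j 1)\<bar> \<le> 2 * (1 + \<bar>a\<bar>)"
          unfolding mult_2 by (rule order_trans[OF abs_triangle_ineq4 add_mono[OF \<phi>b \<phi>b]])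
        then show "norm (?P z) \<le> B * (2 * (1 + \<bar>a\<bar>)) / e"
          unfolding real_norm_def abs_divide abs_mult using e B(1) by (intro frac_le mult_mono B(2) t) auto
      qed
    qed
    have m1: "(\<lambda>z. ennreal ((?r z)\<^sup>2 / (e * ?S z))) \<in> borel_measurable (space_time T)"
      by (intro measurable_compose[OF _ measurable_ennreal] borel_measurable_divide borel_measurable_times borel_measurable_power borel_measurable_diff m0[OF \<rho>m] m[OF \<rho>m] wm borel_measurable_const)
    have m2: "(\<lambda>z. ennreal ((H (fst z) (snd z))\<^sup>2 * ?S z / e)) \<in> borel_measurable (space_time T)"
      by (intro measurable_compose[OF _ measurable_ennreal] borel_measurable_divide borel_measurable_times borel_measurable_power m0[OF Hm] wm borel_measurable_const)
    have "ennreal (2 * D k) = ennreal (\<integral>z. 2 * ?P z \<partial>space_time T)" by (simp add: D_def e_def)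
    also have "\<dots> \<le> (\<integral>\<^sup>+z. ennreal (2 * ?P z) \<partial>space_time T)" by (rule integral_le_nn_integral[OF integrable_mult_right[OF Pi]])
    also have "\<dots> \<le> (\<integral>\<^sup>+z. ennreal (2 * K) * ennreal ((?r z)\<^sup>2 / (e * ?S z)) + ennreal (1/2) * ennreal ((H (fst z) (snd z))\<^sup>2 * ?S z / e) \<partial>space_time T)"
    proof (rule nn_integral_mono)
      fix z :: "real \<times> (real^'n)"
      let ?h = "H (fst z) (snd z)" and ?d = "?\<phi> (fst z) (snd z) - ?\<phi> (fst z) (snd z + e *\<^sub>R axis j 1)"
      have young: "2 * (h * d / e) \<le> 2 * (d\<^sup>2 / (e * s)) + 1/2 * (h\<^sup>2 * s / e)" if "s > 0" for h d s :: real
      proof -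
        have "0 \<le> (2 * d - h * s)\<^sup>2 / (2 * e * s)" using that e by simp
        also have "\<dots> = 2 * (d\<^sup>2 / (e * s)) + 1/2 * (h\<^sup>2 * s / e) - 2 * (h * d / e)"
          using that e by (simp add: power2_eq_square field_simps)
        finally show ?thesis by simp
      qed
      have "?d\<^sup>2 \<le> K * (?r z)\<^sup>2"
        using Phi_lipschitz[of "\<rho> (fst z) (snd z)" "\<rho> (fst z) (snd z + e *\<^sub>R axis j 1)" a] \<rho>01 unfolding K_def by (simp add: power2_commute)
      then have "?d\<^sup>2 / (e * ?S z) \<le> K * (?r z)\<^sup>2 / (e * ?S z)" using S0[of z] e by (intro divide_right_mono) auto
      then have "2 * ?P z \<le> 2 * K * ((?r z)\<^sup>2 / (e * ?S z)) + 1/2 * (?h\<^sup>2 * ?S z / e)"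
        using young[OF S0[of z], of ?h ?d] by simp
      then have "ennreal (2 * ?P z) \<le> ennreal (2 * K * ((?r z)\<^sup>2 / (e * ?S z)) + 1/2 * (?h\<^sup>2 * ?S z / e))" by (rule ennreal_leI)
      also have "\<dots> = ennreal (2 * K) * ennreal ((?r z)\<^sup>2 / (e * ?S z)) + ennreal (1/2) * ennreal (?h\<^sup>2 * ?S z / e)"
      proof -
        have "ennreal (2 * K * p + 1/2 * q) = ennreal (2 * K) * ennreal p + ennreal (1/2) * ennreal q" if "p \<ge> 0" "q \<ge> 0" for p q :: real
          using that K0 by (simp only: ennreal_mult[symmetric] ennreal_plus[symmetric] mult_nonneg_nonneg zero_le_numeral zero_le_divide_1_iff)
        then show ?thesis by this (use S0[of z] e in \<open>auto intro!: divide_nonneg_pos mult_nonneg_nonneg\<close>)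
      qed
      finally show "ennreal (2 * ?P z) \<le> ennreal (2 * K) * ennreal ((?r z)\<^sup>2 / (e * ?S z)) + ennreal (1/2) * ennreal (?h\<^sup>2 * ?S z / e)" .
    qed
    also have "\<dots> = ennreal (2 * K) * (\<integral>\<^sup>+z. ennreal ((?r z)\<^sup>2 / (e * ?S z)) \<partial>space_time T) + ennreal (1/2) * (\<integral>\<^sup>+z. ennreal ((H (fst z) (snd z))\<^sup>2 * ?S z / e) \<partial>space_time T)"
      by (simp add: nn_integral_add[OF borel_measurable_times_ennreal[OF borel_measurable_const m1] borel_measurable_times_ennreal[OF borel_measurable_const m2]]
          nn_integral_cmult[OF m1] nn_integral_cmult[OF m2])
    also have "\<dots> \<le> ennreal (2 * K) * ennreal C + ennreal (1/2) * ennreal (2 * (h2 + Y * e))"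
      by (intro add_mono mult_left_mono N e E[folded e_def]) auto
    also have "\<dots> = ennreal (2 * K * C + (h2 + Y * e))"
    proof -
      have "h2 + Y * e \<ge> 0" using e T by (simp add: h2_def Y_def)
      moreover have "ennreal (2 * K) * ennreal C + ennreal (1/2) * ennreal (2 * q) = ennreal (2 * K * C + q)" if "q \<ge> 0" for q :: real
      proof -
        have half: "1/2 * (2 * q) = q" by simp
        show ?thesis
          using that K0 C by (simp only: half ennreal_mult[symmetric] ennreal_plus[symmetric] mult_nonneg_nonneg zero_le_numeral zero_le_divide_1_iff)
      qed
      ultimately show ?thesis by blast
    qed
    finally have "ennreal (2 * D k) \<le> ennreal (2 * K * C + (h2 + Y * e))" .
    moreover have "2 * K * C + (h2 + Y * e) \<ge> 0" using K0 C e T by (simp add: h2_def Y_def)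
    ultimately show ?thesis by (simp add: e_def)
  qed
  assume "\<not> 2 * ?L \<le> 2 * (1 + 2 * \<bar>a\<bar>)\<^sup>2 * C + (\<integral>z. (H (fst z) (snd z))\<^sup>2 \<partial>space_time_xW T)"
  then have gt: "2 * K * C + h2 < 2 * ?L - Y * 0" by (simp add: K_def h2_def)
  have "(\<lambda>k. 2 * D k - Y * ?e k) \<longlonglongrightarrow> 2 * ?L - Y * 0"
    using lim LIMSEQ_inverse_real_of_nat by (intro tendsto_intros) (simp_all add: inverse_eq_divide)
  from order_tendstoD(1)[OF this gt]
  have "\<forall>\<^sub>F k in sequentially. 2 * K * C + h2 < 2 * D k - Y * ?e k" .
  then have "\<forall>\<^sub>F k in sequentially. 2 * K * C + h2 < 2 * D k - Y * ?e k \<and> k \<ge> 1"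
    using eventually_ge_at_top[of 1] by eventually_elim simp
  then have "\<forall>\<^sub>F k in sequentially. \<not> (\<integral>\<^sup>+z. ennreal ((\<rho> (fst z) (snd z + ?e k *\<^sub>R axis j 1) - \<rho> (fst z) (snd z))\<^sup>2
       / (?e k * (W j (snd z $ j + 2 * ?e k) - W j (snd z $ j)))) \<partial>space_time T) \<le> ennreal C"
    by eventually_elim (use bound in fastforce)
  with fin show False by (simp add: frequently_def)
qed

text \<open>The test functions form a vector space on which weak_form_bound is the hypothesis of
  riesz_representation. The derivative is minus the representing function.\<close>

lemma weak_derivative_exists:
  fixes \<rho> :: "real \<Rightarrow> real^'n \<Rightarrow> real"
  assumes T: "T > 0" and \<rho>m: "(\<lambda>(s, x). \<rho> s x) \<in> borel_measurable (restrict_space borel {0..T} \<Otimes>\<^sub>M borel)"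
    and \<rho>01: "\<And>s x. 0 \<le> \<rho> s x \<and> \<rho> s x \<le> 1" and \<rho>per: "\<And>s x k. \<rho> s (x + axis k 1) = \<rho> s x"
    and fin: "liminf (\<lambda>k. \<integral>\<^sup>+z. ennreal ((\<rho> (fst z) (snd z + (1 / real (Suc k)) *\<^sub>R axis j 1) - \<rho> (fst z) (snd z))\<^sup>2
       / ((1 / real (Suc k)) * (W j (snd z $ j + 2 * (1 / real (Suc k))) - W j (snd z $ j)))) \<partial>space_time T) < \<infinity>"
  shows "\<exists>g\<in>L2_xW T W j. \<forall>H\<in>C01 T j. weak_form T (\<lambda>s x. \<Phi> a (\<rho> s x)) H =
      - (\<integral>s. (\<integral>x. g s x * H s x \<partial>xW_measure W j) \<partial>restrict_space lborel {0..T})"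
proof -
  interpret SX: finite_measure "space_time_xW T" by (rule finite_measure_space_time_xW)
  interpret X: finite_measure "xW_measure W j" by (rule finite_measure_xW)
  interpret TI: finite_measure "restrict_space lborel {0..T}" by (rule finite_measure_time)
  interpret P: pair_sigma_finite "restrict_space lborel {0..T}" "xW_measure W j" ..
  interpret TL: finite_measure "torus_lebesgue :: (real^'n) measure" by (rule finite_measure_torus_lebesgue)
  interpret ST: finite_measure "space_time T :: (real \<times> (real^'n)) measure" by (rule finite_measure_space_time)
  interpret PT: pair_sigma_finite "restrict_space lborel {0..T}" "torus_lebesgue :: (real^'n) measure" ..
  let ?E = "\<lambda>k. \<integral>\<^sup>+z. ennreal ((\<rho> (fst z) (snd z + (1 / real (Suc k)) *\<^sub>R axis j 1) - \<rho> (fst z) (snd z))\<^sup>2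
       / ((1 / real (Suc k)) * (W j (snd z $ j + 2 * (1 / real (Suc k))) - W j (snd z $ j)))) \<partial>space_time T"
  let ?\<phi> = "\<lambda>s x. \<Phi> a (\<rho> s x)"
  obtain C where C: "C \<ge> 0" "liminf ?E < ennreal C"
  proof -
    obtain c where c: "liminf ?E = ennreal c" "c \<ge> 0" using fin by (cases "liminf ?E") auto
    have "ennreal c < ennreal (c + 1)" using c(2) by (intro ennreal_lessI) auto
    then show thesis using that[of "c + 1"] c by simp
  qed
  have fr: "\<exists>\<^sub>F k in sequentially. ?E k \<le> ennreal C"
  proof (rule ccontr)
    assume "\<not> ?thesis"
    then have "\<forall>\<^sub>F k in sequentially. ennreal C \<le> ?E k" unfolding not_frequently by (rule eventually_mono) auto
    then have "ennreal C \<le> liminf ?E" by (rule Liminf_bounded)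
    with C(2) show False by simp
  qed
  define V where "V = {f :: real \<times> (real^'n) \<Rightarrow> real. (\<lambda>s x. f (s, x)) \<in> C01 T j}"
  define L where "L f = weak_form T ?\<phi> (\<lambda>s x. f (s, x))" for f
  have Vm: "f \<in> borel_measurable (space_time_xW T)" if "f \<in> V" for f
  proof -
    have "(\<lambda>(s, x). f (s, x)) \<in> borel_measurable (restrict_space borel {0..T} \<Otimes>\<^sub>M borel)"
      using that by (intro time_space_measurable) (auto simp: V_def C01_def)
    from measurable_compose[OF space_time_shift[of 0 T] this]
    have "f \<in> borel_measurable (space_time T)" by simp
    then show ?thesis using sets_space_time_xW by (simp cong: measurable_cong_sets)
  qed
  have Vb: "\<exists>B. \<forall>z\<in>space (space_time_xW T). \<bar>f z\<bar> \<le> B" if "f \<in> V" for f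
  proof -
    have "(\<lambda>s x. f (s, x)) \<in> C01 T j" using that by (simp add: V_def)
    then obtain B where "\<And>t x. t \<in> {0..T} \<Longrightarrow> \<bar>f (t, x)\<bar> \<le> B" by (rule C01_bounds) blast
    then show ?thesis by (intro exI[of _ B]) (auto simp: space_pair_measure space_restrict_space)
  qed
  have Vi: "integrable (space_time_xW T) (\<lambda>z. (f z)\<^sup>2)" if f: "f \<in> V" for f
  proof -
    obtain B where B: "\<And>z. z \<in> space (space_time_xW T) \<Longrightarrow> \<bar>f z\<bar> \<le> B" using Vb[OF f] by blast
    show ?thesis
    proof (rule SX.integrable_const_bound[where B = "B\<^sup>2"])
      show "AE z in space_time_xW T. norm ((f z)\<^sup>2) \<le> B\<^sup>2"
        using power_mono[OF B, of _ 2] by (intro AE_I2) auto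
    qed (use Vm[OF f] in measurable)
  qed
  have \<phi>m: "(\<lambda>(s, x). ?\<phi> s x) \<in> borel_measurable (restrict_space borel {0..T} \<Otimes>\<^sub>M borel)"
  proof -
    have "\<Phi> a \<in> borel_measurable borel" unfolding \<Phi>_def[abs_def] by measurable
    from measurable_compose[OF \<rho>m this] show ?thesis by (simp add: split_beta')
  qed
  have \<phi>b: "\<bar>?\<phi> s x\<bar> \<le> 1 + \<bar>a\<bar>" for s x
    by (rule Phi_bound) (simp_all add: \<rho>01)
  have Lp: "integrable (space_time T) (\<lambda>z. partial_deriv j (H (fst z)) (snd z) * ?\<phi> (fst z) (snd z))"
    "weak_form T ?\<phi> H = (\<integral>z. partial_deriv j (H (fst z)) (snd z) * ?\<phi> (fst z) (snd z) \<partial>space_time T)" if H: "H \<in> C01 T j" for H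
  proof -
    obtain B where B: "B \<ge> 0" "\<And>t x. t \<in> {0..T} \<Longrightarrow> \<bar>partial_deriv j (H t) x\<bar> \<le> B"
      by (rule C01_bounds[OF H], rule that)
    have pm: "(\<lambda>(s, x). partial_deriv j (H s) x) \<in> borel_measurable (restrict_space borel {0..T} \<Otimes>\<^sub>M borel)"
      using H by (auto simp: C01_def intro!: time_space_measurable)
    show i: "integrable (space_time T) (\<lambda>z. partial_deriv j (H (fst z)) (snd z) * ?\<phi> (fst z) (snd z))"
    proof (rule ST.integrable_const_bound[where B = "B * (1 + \<bar>a\<bar>)"])
      show "(\<lambda>z. partial_deriv j (H (fst z)) (snd z) * ?\<phi> (fst z) (snd z)) \<in> borel_measurable (space_time T)"
        using measurable_compose[OF space_time_shift[of 0 T] pm] measurable_compose[OF space_time_shift[of 0 T] \<phi>m]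
        by (intro borel_measurable_times) simp_all
      show "AE z in space_time T. norm (partial_deriv j (H (fst z)) (snd z) * ?\<phi> (fst z) (snd z)) \<le> B * (1 + \<bar>a\<bar>)"
        unfolding real_norm_def abs_mult using B(1)
        by (intro AE_I2 mult_mono B(2) \<phi>b) (auto simp: space_pair_measure space_restrict_space)
    qed
    show "weak_form T ?\<phi> H = (\<integral>z. partial_deriv j (H (fst z)) (snd z) * ?\<phi> (fst z) (snd z) \<partial>space_time T)"
      using PT.integral_fst'[OF i] by (simp add: weak_form_def)
  qed
  have Vlin: "(\<lambda>z. c * f z + d * g z) \<in> V" if "f \<in> V" "g \<in> V" for f g c d
    using C01_linear(1)[of "\<lambda>s x. f (s, x)" T j "\<lambda>s x. g (s, x)" c d] that by (simp add: V_def)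
  have Llin: "L (\<lambda>z. c * f z + d * g z) = c * L f + d * L g" if f: "f \<in> V" and g: "g \<in> V" for f g c d
  proof -
    have fC: "(\<lambda>s x. f (s, x)) \<in> C01 T j" and gC: "(\<lambda>s x. g (s, x)) \<in> C01 T j" using f g by (auto simp: V_def)
    have "L (\<lambda>z. c * f z + d * g z) = (\<integral>z. partial_deriv j (\<lambda>x. c * f (fst z, x) + d * g (fst z, x)) (snd z) * ?\<phi> (fst z) (snd z) \<partial>space_time T)"
      unfolding L_def by (rule Lp(2)[OF C01_linear(1)[OF fC gC]])
    also have "\<dots> = (\<integral>z. c * (partial_deriv j (\<lambda>x. f (fst z, x)) (snd z) * ?\<phi> (fst z) (snd z)) + d * (partial_deriv j (\<lambda>x. g (fst z, x)) (snd z) * ?\<phi> (fst z) (snd z)) \<partial>space_time T)"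
    proof (intro Bochner_Integration.integral_cong refl)
      fix z :: "real \<times> (real^'n)" assume "z \<in> space (space_time T)"
      then have "fst z \<in> {0..T}" by (auto simp: space_pair_measure space_restrict_space)
      from C01_linear(2)[OF fC gC this, of c d "snd z"]
      show "partial_deriv j (\<lambda>x. c * f (fst z, x) + d * g (fst z, x)) (snd z) * ?\<phi> (fst z) (snd z) =
        c * (partial_deriv j (\<lambda>x. f (fst z, x)) (snd z) * ?\<phi> (fst z) (snd z)) + d * (partial_deriv j (\<lambda>x. g (fst z, x)) (snd z) * ?\<phi> (fst z) (snd z))"
        by (simp add: algebra_simps)
    qed
    also have "\<dots> = c * L f + d * L g"
      using Lp(1)[OF fC] Lp(1)[OF gC] unfolding L_def Lp(2)[OF fC] Lp(2)[OF gC] by simp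
    finally show ?thesis .
  qed
  have bd: "2 * L f \<le> 2 * (1 + 2 * \<bar>a\<bar>)\<^sup>2 * C + (\<integral>z. (f z)\<^sup>2 \<partial>space_time_xW T)" if "f \<in> V" for f
    using weak_form_bound[OF T _ \<rho>m \<rho>01 \<rho>per fr C(1), of "\<lambda>s x. f (s, x)" a] that by (simp add: L_def V_def)
  have ne: "(\<lambda>_. 0) \<in> V"
  proof -
    have "partial_deriv j (\<lambda>_::real^'n. 0) x = 0" for x by (simp add: partial_deriv_def)
    then show ?thesis by (simp add: V_def C01_def periodic_def split_beta')
  qed
  obtain g where g: "g \<in> borel_measurable (space_time_xW T)" "integrable (space_time_xW T) (\<lambda>x. (g x)\<^sup>2)"
    "\<And>f. f \<in> V \<Longrightarrow> L f = (\<integral>x. g x * f x \<partial>space_time_xW T)"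
    using riesz_representation[OF finite_measure_space_time_xW ne Vlin Vm Vi Llin bd] by blast
  show ?thesis
  proof (intro bexI[of _ "\<lambda>s x. - g (s, x)"] ballI)
    show "(\<lambda>s x. - g (s, x)) \<in> L2_xW T W j" using g(1,2) by (simp add: L2_xW_def split_beta')
    fix H assume H: "H \<in> C01 T j"
    define f where "f z = H (fst z) (snd z)" for z
    have f: "f \<in> V" using H by (simp add: V_def f_def)
    have i: "integrable (space_time_xW T) (\<lambda>z. g z * f z)"
      by (intro integrable_product_L2 g Vm Vi f)
    have "weak_form T ?\<phi> H = L f" by (simp add: L_def f_def)
    also have "\<dots> = (\<integral>z. g z * f z \<partial>space_time_xW T)" by (rule g(3)[OF f])
    also have "\<dots> = (\<integral>s. (\<integral>x. g (s, x) * f (s, x) \<partial>xW_measure W j) \<partial>restrict_space lborel {0..T})"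
      by (rule P.integral_fst'[OF i, symmetric])
    finally show "weak_form T ?\<phi> H = - (\<integral>s. (\<integral>x. - g (s, x) * H s x \<partial>xW_measure W j) \<partial>restrict_space lborel {0..T})"
      by (simp add: f_def)
  qed
qed

end

theorem proposition6p1:
  fixes W :: "'n::finite \<Rightarrow> real \<Rightarrow> real"
    and a T :: real
    and \<rho>\<^sub>0 :: "real ^ 'n \<Rightarrow> real"
    and \<mu> :: "nat \<Rightarrow> 'n config measure"
    and \<Omega> :: "nat \<Rightarrow> 'w measure"
    and \<eta> :: "nat \<Rightarrow> real \<Rightarrow> 'w \<Rightarrow> 'n config"
    and Q :: "(real \<Rightarrow> (real ^ 'n) measure) measure"
  assumes "CARD('n) > 1"
    and "\<And>k. strict_mono (W k)"
    and "\<And>k. cadlag_on UNIV euclidean (W k)"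
    and "\<And>k. W k 0 = 0"
    and "\<And>k u. W k (u + 1) - W k u = W k 1 - W k 0"
    and "a > - 1 / 2"
    and "T > 0"
    and "\<rho>\<^sub>0 \<in> C_torus"
    and "\<And>u. 0 \<le> \<rho>\<^sub>0 u \<and> \<rho>\<^sub>0 u \<le> 1"
    and "\<And>N. N \<ge> 1 \<Longrightarrow> prob_space (\<mu> N) \<and> sets (\<mu> N) = Pow (configs N)"
    and "associated_to \<mu> \<rho>\<^sub>0"
    and "\<And>N. N \<ge> 1 \<Longrightarrow>
           markov_process (configs N) (\<lambda>f \<zeta>. (real N)\<^sup>2 * generator W a N f \<zeta>) (\<mu> N) (\<Omega> N) (\<eta> N)"
    and "limit_point T (\<lambda>N. empirical_law T N (\<Omega> N) (\<eta> N)) Q"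
  shows "AE \<pi> in Q. \<exists>\<rho>.
           (\<lambda>(s, x). \<rho> s x) \<in> borel_measurable (restrict_space borel {0..T} \<Otimes>\<^sub>M torus_borel) \<and>
           (\<forall>s\<in>{0..T}. \<forall>x\<in>torus. 0 \<le> \<rho> s x \<and> \<rho> s x \<le> 1) \<and>
           (\<forall>s\<in>{0..T}. \<pi> s = density torus_lebesgue (\<lambda>x. ennreal (\<rho> s x))) \<and>
           (\<forall>j. \<exists>d\<Phi>\<in>L2_xW T W j. \<forall>H\<in>C01 T j.
              (\<integral>s. (\<integral>x. partial_deriv j (H s) x * \<Phi> a (\<rho> s x) \<partial>torus_lebesgue) \<partial>restrict_space lborel {0..T})
              = - (\<integral>s. (\<integral>x. d\<Phi> s x * H s x \<partial>xW_measure W j) \<partial>restrict_space lborel {0..T}))"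
proof -
  interpret hydrodynamic_limit W a T \<mu> \<Omega> \<eta> Q
    by (rule hydrodynamic_limit.intro) (fact assms)+
  from limit_density_energy AE_space show ?thesis
  proof eventually_elim
    fix \<pi> assume \<pi>: "\<pi> \<in> space Q"
      and E: "(\<forall>s\<in>{0..T}. box_bounded (\<pi> s)) \<and> (\<forall>j. liminf (\<lambda>k. density_energy j (1 / real (Suc k)) \<pi>) < \<infinity>)"
    have \<pi>D: "\<pi> \<in> D_space T" using \<pi> by (simp add: space_Q)
    define \<rho> where "\<rho> s x = box_density (\<pi> s) x" for s x
    have m: "(\<lambda>(s, x). \<rho> s x) \<in> borel_measurable (restrict_space borel {0..T} \<Otimes>\<^sub>M borel)"
    proof -
      have "(\<lambda>z. box_average n (\<pi> (fst z)) (snd z)) \<in> borel_measurable (restrict_space borel {0..T} \<Otimes>\<^sub>M borel)" for n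
      proof -
        have "(\<lambda>z. (z, \<pi>)) \<in> restrict_space borel {0..T} \<Otimes>\<^sub>M borel \<rightarrow>\<^sub>M (restrict_space borel {0..T} \<Otimes>\<^sub>M (borel :: (real^'n) measure)) \<Otimes>\<^sub>M path_space T"
          by (rule measurable_Pair2') (simp add: space_path_space \<pi>D)
        from measurable_compose[OF this box_average_measurable[of T n]] T0 show ?thesis by (simp add: split_beta')
      qed
      then show ?thesis unfolding \<rho>_def box_density_def split_beta' by measurable
    qed
    show "\<exists>\<rho>. (\<lambda>(s, x). \<rho> s x) \<in> borel_measurable (restrict_space borel {0..T} \<Otimes>\<^sub>M torus_borel) \<and>
           (\<forall>s\<in>{0..T}. \<forall>x\<in>torus. 0 \<le> \<rho> s x \<and> \<rho> s x \<le> 1) \<and>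
           (\<forall>s\<in>{0..T}. \<pi> s = density torus_lebesgue (\<lambda>x. ennreal (\<rho> s x))) \<and>
           (\<forall>j. \<exists>d\<Phi>\<in>L2_xW T W j. \<forall>H\<in>C01 T j.
              (\<integral>s. (\<integral>x. partial_deriv j (H s) x * \<Phi> a (\<rho> s x) \<partial>torus_lebesgue) \<partial>restrict_space lborel {0..T})
              = - (\<integral>s. (\<integral>x. d\<Phi> s x * H s x \<partial>xW_measure W j) \<partial>restrict_space lborel {0..T}))"
    proof (intro exI[of _ \<rho>] conjI ballI allI)
      have "(\<lambda>z. (fst z, snd z)) \<in> restrict_space borel {0..T} \<Otimes>\<^sub>M torus_borel \<rightarrow>\<^sub>M restrict_space borel {0..T} \<Otimes>\<^sub>M (borel :: (real^'n) measure)"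
      proof (rule measurable_Pair)
        have "(\<lambda>x. x) \<in> torus_borel \<rightarrow>\<^sub>M (borel :: (real^'n) measure)" unfolding torus_borel_def by (rule measurable_restrict_space1) simp
        from measurable_compose[OF measurable_snd this] show "(\<lambda>z. snd z) \<in> restrict_space borel {0..T} \<Otimes>\<^sub>M torus_borel \<rightarrow>\<^sub>M (borel :: (real^'n) measure)" .
      qed simp
      from measurable_compose[OF this m] show "(\<lambda>(s, x). \<rho> s x) \<in> borel_measurable (restrict_space borel {0..T} \<Otimes>\<^sub>M torus_borel)" by simp
      show "0 \<le> \<rho> s x" "\<rho> s x \<le> 1" for s x by (simp_all add: \<rho>_def box_density_range)
      show "\<pi> s = density torus_lebesgue (\<lambda>x. ennreal (\<rho> s x))" if s: "s \<in> {0..T}" for s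
        unfolding \<rho>_def by (rule box_bounded_density(2)[OF D_space_value[OF \<pi>D s]]) (use E s in blast)
      fix j
      interpret stieltjes W j
        by (rule stieltjes.intro) (use assms(2,3,5) in \<open>auto intro: cadlag_continuous_at_right\<close>)
      interpret TL: finite_measure "torus_lebesgue :: (real^'n) measure" by (rule finite_measure_torus_lebesgue)
      have de: "density_energy j \<epsilon> \<pi> = (\<integral>\<^sup>+z. ennreal ((\<rho> (fst z) (snd z + \<epsilon> *\<^sub>R axis j 1) - \<rho> (fst z) (snd z))\<^sup>2
          / (\<epsilon> * (W j (snd z $ j + 2 * \<epsilon>) - W j (snd z $ j)))) \<partial>space_time T)" for \<epsilon>
      proof -
        have "(\<lambda>z. ennreal ((\<rho> (fst z) (snd z + \<epsilon> *\<^sub>R axis j 1) - \<rho> (fst z) (snd z))\<^sup>2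
          / (\<epsilon> * (W j (snd z $ j + 2 * \<epsilon>) - W j (snd z $ j))))) \<in> borel_measurable (space_time T)"
          using measurable_compose[OF space_time_shift[of "\<epsilon> *\<^sub>R axis j 1" T] m] measurable_compose[OF space_time_shift[of 0 T] m]
          by (intro measurable_compose[OF _ measurable_ennreal] borel_measurable_divide borel_measurable_power borel_measurable_diff space_time_weight_measurable) simp_all
        from TL.nn_integral_fst[OF this] show ?thesis by (simp add: density_energy_def \<rho>_def)
      qed
      have "\<exists>g\<in>L2_xW T W j. \<forall>H\<in>C01 T j. weak_form T (\<lambda>s x. \<Phi> a (\<rho> s x)) H =
        - (\<integral>s. (\<integral>x. g s x * H s x \<partial>xW_measure W j) \<partial>restrict_space lborel {0..T})"
      proof (rule weak_derivative_exists[OF assms(7) m])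
        show "0 \<le> \<rho> s x \<and> \<rho> s x \<le> 1" for s x by (simp add: \<rho>_def box_density_range)
        show "\<rho> s (x + axis k 1) = \<rho> s x" for s x k by (simp add: \<rho>_def box_density_periodic)
        show "liminf (\<lambda>k. \<integral>\<^sup>+z. ennreal ((\<rho> (fst z) (snd z + (1 / real (Suc k)) *\<^sub>R axis j 1) - \<rho> (fst z) (snd z))\<^sup>2
          / ((1 / real (Suc k)) * (W j (snd z $ j + 2 * (1 / real (Suc k))) - W j (snd z $ j)))) \<partial>space_time T) < \<infinity>"
          unfolding de[symmetric] using E by blast
      qed
      then show "\<exists>d\<Phi>\<in>L2_xW T W j. \<forall>H\<in>C01 T j.
              (\<integral>s. (\<integral>x. partial_deriv j (H s) x * \<Phi> a (\<rho> s x) \<partial>torus_lebesgue) \<partial>restrict_space lborel {0..T})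
              = - (\<integral>s. (\<integral>x. d\<Phi> s x * H s x \<partial>xW_measure W j) \<partial>restrict_space lborel {0..T})"
        unfolding weak_form_def .
    qed
  qed
qed

end
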